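(* Let $\omega:=e^{2\pi i/3}$, $\Lambda:=\omega\mathbb Z\oplus\mathbb Z\subset\mathbb C$, and let $V\in C^\infty(\mathbb C)$ (complex-valued) satisfy $V(z+\gamma)=V(z)$ for all $\gamma\in\Lambda$ and $V(\omega z)=\bar\omega V(z)$. For $\alpha,k\in\mathbb C$ let $$Q(\alpha,k):=(2D_{\bar z}+k)^2-\alpha^2V(z):H^2(\mathbb C/\Lambda;\mathbb C)\to L^2(\mathbb C/\Lambda;\mathbb C),$$ and let $m(\alpha,k)$ be the associated multiplicity defined in the context. Then there exists a discrete set $\mathcal A_{\rm sc}\subset\mathbb C$ such that $$\ker_{H^2(\mathbb C/\Lambda;\mathbb C)}Q(\alpha,k)\neq\{0\}\quad\text{for all }\alpha\in\mathcal A_{\rm sc},\ k\in\mathbb C,$$ and $$m(\alpha,k)=2\cdot\mathbf 1_{\Lambda^*}(k)\quad\text{for all }\alpha\in\mathbb C\setminus\mathcal A_{\rm sc},\ k\in\mathbb C,$$ where $\mathbf 1_{\Lambda^*}$ is the indicator function of $\Lambda^*$.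
   Context: Notation: $z=x_1+ix_2\in\mathbb C$, $2D_{\bar z}=\tfrac1i(\partial_{x_1}+i\partial_{x_2})$, $\langle z,w\rangle:=\operatorname{Re}(z\bar w)$. The dual lattice is $\Lambda^*:=\frac{4\pi i}{\sqrt3}\Lambda$, i.e. the set of $p\in\mathbb C$ with $\langle p,\gamma\rangle\in2\pi\mathbb Z$ for all $\gamma\in\Lambda$. $L^2(\mathbb C/\Lambda)$ and $H^2(\mathbb C/\Lambda)$ are the Lebesgue and Sobolev spaces of $\Lambda$-periodic functions. The operators $Q(\alpha,k)$ form a holomorphic family, in $(\alpha,k)\in\mathbb C^2$, of Fredholm operators of index $0$ from $X=H^2(\mathbb C/\Lambda)$ to $Y=L^2(\mathbb C/\Lambda)$. Multiplicity. Let $\alpha\in\mathbb C$. If there is $k_0\in\mathbb C$ with $\ker Q(\alpha,k_0)=\{0\}$, then $\zeta\mapsto Q(\alpha,\zeta)^{-1}$ is a meromorphic family of operators on $\mathbb C$, and for $k\in\mathbb C$ $$m(\alpha,k):=\frac1{2\pi i}\operatorname{tr}\oint_{\partial D}Q(\alpha,\zeta)^{-1}\,\partial_\zeta Q(\alpha,\zeta)\,d\zeta ,$$ where the integral is over the positively oriented boundary of a disc $D$ containing $k$ such that $k$ is the only possible pole of $\zeta\mapsto Q(\alpha,\zeta)^{-1}$ in (the closure of) $D$. Otherwise $m(\alpha,k):=\infty$ for all $k\in\mathbb C$. *)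

theory Defs
  imports "HOL-Analysis.Analysis"
begin

section \<open>Complex normed spaces, operators and multiplicity\<close>

class complex_normed_vector = real_normed_vector +
  fixes scaleC :: "complex \<Rightarrow> 'a \<Rightarrow> 'a" (infixr "*\<^sub>C" 75)
  assumes scaleC_add_right: "a *\<^sub>C (x + y) = a *\<^sub>C x + a *\<^sub>C y"
    and scaleC_add_left: "(a + b) *\<^sub>C x = a *\<^sub>C x + b *\<^sub>C x"
    and scaleC_scaleC: "a *\<^sub>C b *\<^sub>C x = (a * b) *\<^sub>C x"
    and scaleR_scaleC: "r *\<^sub>R x = complex_of_real r *\<^sub>C x"
    and norm_scaleC: "norm (a *\<^sub>C x) = cmod a * norm x"

lemma scaleC_one: "1 *\<^sub>C (x::'a::complex_normed_vector) = x"
  using scaleR_scaleC[of 1 x] by simp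

global_interpretation cvec: vector_space "scaleC :: complex \<Rightarrow> 'a \<Rightarrow> 'a::complex_normed_vector"
  by unfold_locales
    (simp_all add: scaleC_add_right scaleC_add_left scaleC_scaleC scaleC_one)

lemma bounded_linear_scaleC:
  "bounded_linear (\<lambda>x. c *\<^sub>C (x::'a::complex_normed_vector))"
proof
  show "\<exists>K. \<forall>x::'a. norm (c *\<^sub>C x) \<le> norm x * K"
    by (rule exI[of _ "cmod c"]) (simp add: norm_scaleC mult.commute)
qed (simp_all add: scaleC_add_right scaleR_scaleC scaleC_scaleC mult.commute)

instantiation blinfun :: (real_normed_vector, complex_normed_vector) complex_normed_vector
begin

lift_definition scaleC_blinfun :: "complex \<Rightarrow> ('a \<Rightarrow>\<^sub>L 'b) \<Rightarrow> ('a \<Rightarrow>\<^sub>L 'b)"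
  is "\<lambda>c A x. c *\<^sub>C A x"
  by (rule bounded_linear_compose[OF bounded_linear_scaleC])

instance
proof
  fix a b :: complex and r :: real and A B :: "'a \<Rightarrow>\<^sub>L 'b"
  show "a *\<^sub>C (A + B) = a *\<^sub>C A + a *\<^sub>C B"
    by transfer (simp add: scaleC_add_right)
  show "(a + b) *\<^sub>C A = a *\<^sub>C A + b *\<^sub>C A"
    by transfer (simp add: scaleC_add_left)
  show "a *\<^sub>C b *\<^sub>C A = (a * b) *\<^sub>C A"
    by transfer (simp add: scaleC_scaleC)
  show "r *\<^sub>R A = complex_of_real r *\<^sub>C A"
    by transfer (simp add: scaleR_scaleC)
  have le: "norm (c *\<^sub>C C) \<le> cmod c * norm C" for c and C :: "'a \<Rightarrow>\<^sub>L 'b"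
  proof (rule norm_blinfun_bound)
    show "norm (blinfun_apply (c *\<^sub>C C) x) \<le> cmod c * norm C * norm x" for x
      by (simp add: scaleC_blinfun.rep_eq norm_scaleC mult.assoc mult_left_mono norm_blinfun)
  qed simp
  show "norm (a *\<^sub>C A) = cmod a * norm A"
  proof (cases "a = 0")
    case True
    then show ?thesis using le[of a A] by simp
  next
    case False
    have "inverse a *\<^sub>C a *\<^sub>C A = A"
      using False by transfer (simp add: scaleC_scaleC scaleC_one)
    then have "norm A \<le> inverse (cmod a) * norm (a *\<^sub>C A)"
      using le[of "inverse a" "a *\<^sub>C A"] by (simp add: norm_inverse)
    then have "cmod a * norm A \<le> norm (a *\<^sub>C A)"
      using False by (simp add: field_simps)
    then show ?thesis using le[of a A] by simp
  qed
qed

end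

definition op_invertible ::
    "('a::real_normed_vector \<Rightarrow>\<^sub>L 'b::real_normed_vector) \<Rightarrow> bool" where
  "op_invertible A \<longleftrightarrow> (\<exists>B. B o\<^sub>L A = id_blinfun \<and> A o\<^sub>L B = id_blinfun)"

definition op_inverse ::
    "('a::real_normed_vector \<Rightarrow>\<^sub>L 'b::real_normed_vector) \<Rightarrow> ('b \<Rightarrow>\<^sub>L 'a)" where
  "op_inverse A = (THE B. B o\<^sub>L A = id_blinfun \<and> A o\<^sub>L B = id_blinfun)"

definition op_ker :: "('a::real_normed_vector \<Rightarrow>\<^sub>L 'b::real_normed_vector) \<Rightarrow> 'a set" where
  "op_ker A = {u. blinfun_apply A u = 0}"

text \<open>The trace of a finite-rank complex-linear operator is the trace of its restriction to its
  range, computed in an arbitrary basis of the range.\<close>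

definition op_trace :: "('a::complex_normed_vector \<Rightarrow>\<^sub>L 'a) \<Rightarrow> complex" where
  "op_trace A =
     (let B = (SOME B. cvec.independent B \<and> cvec.span B = range (blinfun_apply A))
      in \<Sum>b\<in>B. cvec.representation B (blinfun_apply A b) b)"

definition complex_deriv :: "(complex \<Rightarrow> 'a::complex_normed_vector) \<Rightarrow> complex \<Rightarrow> 'a" where
  "complex_deriv F z = Lim (at 0) (\<lambda>h. (1 / h) *\<^sub>C (F (z + h) - F z))"

text \<open>The contour integral over the positively oriented circle \<open>t \<mapsto> c + r e\<^sup>i\<^sup>t\<close>.\<close>

definition circle_integral ::
    "(complex \<Rightarrow> 'a::complex_normed_vector) \<Rightarrow> complex \<Rightarrow> real \<Rightarrow> 'a" where
  "circle_integral F c r =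
     integral {0..2*pi} (\<lambda>t. (\<i> * of_real r * cis t) *\<^sub>C F (c + of_real r * cis t))"

text \<open>Multiplicity of an operator family \<open>F\<close> at \<open>k\<close>. The poles of the pointwise inverse of a holomorphic
  family of Fredholm operators of index 0 are exactly the points where the family is not invertible,
  so \<open>k\<close> is the only possible pole in a closed disc iff the family is invertible on the rest of it.
  The value does not depend on the choice of the disc (homotopy invariance) or, in the trace, of
  the basis.\<close>

datatype multiplicity = Fin complex | Infinite

definition admissible_disc ::
    "(complex \<Rightarrow> ('a::real_normed_vector \<Rightarrow>\<^sub>L 'b::real_normed_vector)) \<Rightarrow> complex \<Rightarrow>
     complex \<Rightarrow> real \<Rightarrow> bool" where
  "admissible_disc F k c r \<longleftrightarrow>
     k \<in> ball c r \<and> (\<forall>\<zeta>\<in>cball c r - {k}. op_invertible (F \<zeta>))"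

definition op_multiplicity ::
    "(complex \<Rightarrow> ('a::complex_normed_vector \<Rightarrow>\<^sub>L 'b::complex_normed_vector)) \<Rightarrow>
     complex \<Rightarrow> multiplicity" where
  "op_multiplicity F k =
     (if \<exists>k0. op_ker (F k0) = {0} then
        (let (c, r) = (SOME (c, r). admissible_disc F k c r)
         in Fin (1 / (2 * pi * \<i>) *
              op_trace (circle_integral (\<lambda>\<zeta>. op_inverse (F \<zeta>) o\<^sub>L complex_deriv F \<zeta>) c r)))
      else Infinite)"

section \<open>The lattice and \<open>L\<^sup>2(\<complex>/\<Lambda>)\<close>\<close>

definition omega :: complex where
  "omega = exp (2 * pi * \<i> / 3)"

definition Lambda :: "complex set" where
  "Lambda = {omega * of_int m + of_int n | m n. True}"

definition Lambda_dual :: "complex set" where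
  "Lambda_dual = (\<lambda>\<gamma>. (4 * pi * \<i> / sqrt 3) * \<gamma>) ` Lambda"

definition periodic :: "(complex \<Rightarrow> 'a) \<Rightarrow> bool" where
  "periodic f \<longleftrightarrow> (\<forall>z. \<forall>\<gamma>\<in>Lambda. f (z + \<gamma>) = f z)"

definition cell :: "complex set" where
  "cell = {omega * of_real s + of_real t | s t. s \<in> {0..<1} \<and> t \<in> {0..<1}}"

text \<open>Lebesgue measure on a fundamental domain; integrals over \<open>\<complex>/\<Lambda>\<close> of periodic functions are
  integrals against it.\<close>

definition cell_measure :: "complex measure" where
  "cell_measure = restrict_space lborel cell"

text \<open>Real coordinates with respect to the lattice basis: \<open>z = omega * s + t\<close>.\<close>

definition crd_s :: "complex \<Rightarrow> real" where "crd_s z = 2 / sqrt 3 * Im z"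
definition crd_t :: "complex \<Rightarrow> real" where "crd_t z = Re z + Im z / sqrt 3"

lemma omega_eq: "omega = Complex (- 1 / 2) (sqrt 3 / 2)"
proof -
  have "omega = cis (2 * pi / 3)"
    by (simp add: omega_def cis_conv_exp mult_ac)
  moreover have "cos (2 * pi / 3) = - 1 / 2" "sin (2 * pi / 3) = sqrt 3 / 2"
    using cos_120 sin_120 by simp_all
  ultimately show ?thesis by (simp add: complex_eq_iff)
qed

lemma crd_add:
  "crd_s (z + w) = crd_s z + crd_s w" "crd_t (z + w) = crd_t z + crd_t w"
  by (simp_all add: crd_s_def crd_t_def algebra_simps add_divide_distrib)

lemma crd_omega [simp]:
  "crd_s (omega * of_real s + of_real t) = s" "crd_t (omega * of_real s + of_real t) = t"
  by (simp_all add: crd_s_def crd_t_def omega_eq)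

lemma crd_decomp: "z = omega * of_real (crd_s z) + of_real (crd_t z)"
  by (simp add: crd_s_def crd_t_def omega_eq complex_eq_iff)

lemma cell_eq: "cell = {z. crd_s z \<in> {0..<1} \<and> crd_t z \<in> {0..<1}}"
proof (intro equalityI subsetI)
  fix z assume "z \<in> cell"
  then show "z \<in> {z. crd_s z \<in> {0..<1} \<and> crd_t z \<in> {0..<1}}"
    by (auto simp: cell_def)
next
  fix z assume "z \<in> {z. crd_s z \<in> {0..<1} \<and> crd_t z \<in> {0..<1}}"
  then show "z \<in> cell"
    unfolding cell_def mem_Collect_eq using crd_decomp[of z] by blast
qed

lemma crd_Lambda:
  assumes "\<gamma> \<in> Lambda"
  obtains m n :: int where "crd_s \<gamma> = of_int m" "crd_t \<gamma> = of_int n"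
proof -
  obtain m n :: int where "\<gamma> = omega * of_int m + of_int n"
    using assms by (auto simp: Lambda_def)
  then have "\<gamma> = omega * of_real (of_int m) + of_real (of_int n)" by simp
  then show thesis using that[of m n] crd_omega[of "of_int m" "of_int n"] by simp
qed

lemma continuous_crd [continuous_intros]:
  "continuous_on A f \<Longrightarrow> continuous_on A (\<lambda>x. crd_s (f x))"
  "continuous_on A f \<Longrightarrow> continuous_on A (\<lambda>x. crd_t (f x))"
  unfolding crd_s_def crd_t_def by (auto intro!: continuous_intros)

lemma crd_measurable [measurable]:
  "crd_s \<in> borel_measurable borel" "crd_t \<in> borel_measurable borel"
  by (intro borel_measurable_continuous_onI continuous_intros)+

lemma cell_sets [measurable]: "cell \<in> sets borel"
proof -
  have "{z \<in> space borel. crd_s z \<in> {0..<1} \<and> crd_t z \<in> {0..<1}} \<in> sets borel"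
    by measurable
  then show ?thesis by (simp add: cell_eq)
qed

lemma cell_bounded: "bounded cell"
proof (rule boundedI[of _ "cmod omega + 1"])
  fix z assume "z \<in> cell"
  then obtain s t where z: "z = omega * of_real s + of_real t" and st: "s \<in> {0..<1}" "t \<in> {0..<1}"
    by (auto simp: cell_def)
  have "cmod z \<le> cmod omega * \<bar>s\<bar> + \<bar>t\<bar>"
    unfolding z by (rule order_trans[OF norm_triangle_ineq]) (simp add: norm_mult)
  also have "\<dots> \<le> cmod omega * 1 + 1"
    using st by (intro add_mono mult_left_mono) auto
  finally show "cmod z \<le> cmod omega + 1" by simp
qed

lemma space_cell_measure [simp]: "space cell_measure = cell"
  by (simp add: cell_measure_def space_restrict_space)

lemma measurable_cell:
  "f \<in> borel_measurable borel \<Longrightarrow> f \<in> borel_measurable cell_measure"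
  unfolding cell_measure_def by (intro measurable_restrict_space1) simp

interpretation cell: finite_measure cell_measure
proof
  have "emeasure lborel cell < \<infinity>"
    using cell_bounded by (rule emeasure_bounded_finite)
  then show "emeasure cell_measure (space cell_measure) \<noteq> \<infinity>"
    by (simp add: cell_measure_def emeasure_restrict_space space_restrict_space)
qed

definition l2_fun :: "(complex \<Rightarrow> complex) \<Rightarrow> bool" where
  "l2_fun f \<longleftrightarrow> periodic f \<and> f \<in> borel_measurable borel
     \<and> integrable cell_measure (\<lambda>z. (cmod (f z))\<^sup>2)"

definition l2_rel :: "(complex \<Rightarrow> complex) \<Rightarrow> (complex \<Rightarrow> complex) \<Rightarrow> bool" where
  "l2_rel f g \<longleftrightarrow> l2_fun f \<and> l2_fun g \<and> (AE z in cell_measure. f z = g z)"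

lemma l2_fun_measurable [measurable_dest]:
  "l2_fun f \<Longrightarrow> f \<in> borel_measurable cell_measure"
  by (auto simp: l2_fun_def measurable_cell)

lemma l2_fun_zero: "l2_fun (\<lambda>_. 0)"
  by (simp add: l2_fun_def periodic_def)

lemma l2_fun_mult_bounded:
  assumes "l2_fun f" "periodic g" "g \<in> borel_measurable borel" "\<And>z. cmod (g z) \<le> C"
  shows "l2_fun (\<lambda>z. g z * f z)"
  unfolding l2_fun_def
proof (intro conjI)
  have [measurable]: "f \<in> borel_measurable borel" "g \<in> borel_measurable borel"
    using assms by (auto simp: l2_fun_def)
  show "(\<lambda>z. g z * f z) \<in> borel_measurable borel" by measurable
  then have [measurable]: "(\<lambda>z. g z * f z) \<in> borel_measurable cell_measure"
    by (rule measurable_cell)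
  show "periodic (\<lambda>z. g z * f z)"
    using assms by (auto simp: l2_fun_def periodic_def)
  show "integrable cell_measure (\<lambda>z. (cmod (g z * f z))\<^sup>2)"
  proof (rule Bochner_Integration.integrable_bound)
    show "integrable cell_measure (\<lambda>z. C\<^sup>2 * (cmod (f z))\<^sup>2)"
      using assms by (auto simp: l2_fun_def)
    have "(cmod (g z))\<^sup>2 * (cmod (f z))\<^sup>2 \<le> C\<^sup>2 * (cmod (f z))\<^sup>2" for z
      using assms(4)[of z] by (intro mult_right_mono power_mono) auto
    then show "AE z in cell_measure. norm ((cmod (g z * f z))\<^sup>2) \<le> norm (C\<^sup>2 * (cmod (f z))\<^sup>2)"
      by (simp add: norm_mult power_mult_distrib)
  qed measurable
qed

lemma l2_fun_scale: "l2_fun f \<Longrightarrow> l2_fun (\<lambda>z. c * f z)"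
  by (rule l2_fun_mult_bounded[where C = "cmod c"]) (auto simp: periodic_def)

lemma l2_fun_add:
  assumes "l2_fun f" "l2_fun g"
  shows "l2_fun (\<lambda>z. f z + g z)"
  unfolding l2_fun_def
proof (intro conjI)
  have [measurable]: "f \<in> borel_measurable borel" "g \<in> borel_measurable borel"
    using assms by (auto simp: l2_fun_def)
  show "(\<lambda>z. f z + g z) \<in> borel_measurable borel" by measurable
  then have [measurable]: "(\<lambda>z. f z + g z) \<in> borel_measurable cell_measure"
    by (rule measurable_cell)
  show "periodic (\<lambda>z. f z + g z)"
    using assms by (auto simp: l2_fun_def periodic_def)
  show "integrable cell_measure (\<lambda>z. (cmod (f z + g z))\<^sup>2)"
  proof (rule Bochner_Integration.integrable_bound)
    show "integrable cell_measure (\<lambda>z. 2 * (cmod (f z))\<^sup>2 + 2 * (cmod (g z))\<^sup>2)"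
      using assms by (auto simp: l2_fun_def)
    have "(cmod (f z + g z))\<^sup>2 \<le> 2 * (cmod (f z))\<^sup>2 + 2 * (cmod (g z))\<^sup>2" for z
    proof -
      have "(cmod (f z + g z))\<^sup>2 \<le> (cmod (f z) + cmod (g z))\<^sup>2"
        by (intro power_mono norm_triangle_ineq) simp
      also have "\<dots> \<le> 2 * (cmod (f z))\<^sup>2 + 2 * (cmod (g z))\<^sup>2"
        using sum_squares_bound[of "cmod (f z)" "cmod (g z)"] by (simp add: power2_sum)
      finally show ?thesis .
    qed
    then show "AE z in cell_measure.
        norm ((cmod (f z + g z))\<^sup>2) \<le> norm (2 * (cmod (f z))\<^sup>2 + 2 * (cmod (g z))\<^sup>2)"
      by simp
  qed measurable
qed

lemma l2_prod_integrable:
  assumes "l2_fun f" "l2_fun g"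
  shows "integrable cell_measure (\<lambda>z. f z * g z)"
proof (rule Bochner_Integration.integrable_bound)
  have [measurable]: "f \<in> borel_measurable cell_measure" "g \<in> borel_measurable cell_measure"
    using assms by (auto intro: l2_fun_measurable)
  show "(\<lambda>z. f z * g z) \<in> borel_measurable cell_measure" by measurable
  show "integrable cell_measure (\<lambda>z. (cmod (f z))\<^sup>2 + (cmod (g z))\<^sup>2)"
    using assms by (auto simp: l2_fun_def)
  have "cmod (f z) * cmod (g z) \<le> (cmod (f z))\<^sup>2 + (cmod (g z))\<^sup>2" for z
    using sum_squares_bound[of "cmod (f z)" "cmod (g z)"]
      mult_nonneg_nonneg[of "cmod (f z)" "cmod (g z)"] norm_ge_zero[of "f z"] norm_ge_zero[of "g z"]
    by linarith
  then show "AE z in cell_measure. norm (f z * g z) \<le> norm ((cmod (f z))\<^sup>2 + (cmod (g z))\<^sup>2)"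
    by (simp add: norm_mult)
qed

lemma l2_fun_cnj: "l2_fun f \<Longrightarrow> l2_fun (\<lambda>z. cnj (f z))"
  by (auto simp: l2_fun_def periodic_def
      intro!: borel_measurable_continuous_on[where f = cnj] continuous_intros)

lemma l2_inner_integrable:
  assumes "l2_fun f" "l2_fun g"
  shows "integrable cell_measure (\<lambda>z. Re (f z * cnj (g z)))"
  by (intro integrable_Re l2_prod_integrable l2_fun_cnj assms)

lemma l2_rel_refl_iff: "l2_rel f f \<longleftrightarrow> l2_fun f"
  by (simp add: l2_rel_def)

quotient_type l2 = "complex \<Rightarrow> complex" / partial: l2_rel
proof (rule part_equivpI)
  show "\<exists>f. l2_rel f f" using l2_fun_zero by (auto simp: l2_rel_refl_iff)
  show "symp l2_rel" by (auto simp: symp_def l2_rel_def)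
  show "transp l2_rel"
    unfolding transp_def l2_rel_def by (auto elim: AE_mp)
qed

instantiation l2 :: real_inner
begin

lift_definition zero_l2 :: l2 is "\<lambda>_. 0"
  by (simp add: l2_rel_refl_iff l2_fun_zero)

lift_definition plus_l2 :: "l2 \<Rightarrow> l2 \<Rightarrow> l2" is "\<lambda>f g z. f z + g z"
  by (auto simp: l2_rel_def l2_fun_add)

lift_definition uminus_l2 :: "l2 \<Rightarrow> l2" is "\<lambda>f z. - f z"
  using l2_fun_scale[of _ "-1"] by (auto simp: l2_rel_def)

definition minus_l2 :: "l2 \<Rightarrow> l2 \<Rightarrow> l2" where "minus_l2 u v = u + - v"

lift_definition scaleR_l2 :: "real \<Rightarrow> l2 \<Rightarrow> l2" is "\<lambda>r f z. complex_of_real r * f z"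
  by (auto simp: l2_rel_def l2_fun_scale)

lift_definition inner_l2 :: "l2 \<Rightarrow> l2 \<Rightarrow> real"
  is "\<lambda>f g. LINT z|cell_measure. Re (f z * cnj (g z))"
proof -
  fix f f' g g' assume "l2_rel f f'" "l2_rel g g'"
  then have r: "l2_fun f" "l2_fun f'" "l2_fun g" "l2_fun g'"
    "AE z in cell_measure. f z = f' z" "AE z in cell_measure. g z = g' z"
    by (auto simp: l2_rel_def)
  show "(LINT z|cell_measure. Re (f z * cnj (g z))) = (LINT z|cell_measure. Re (f' z * cnj (g' z)))"
  proof (rule integral_cong_AE)
    show "AE z in cell_measure. Re (f z * cnj (g z)) = Re (f' z * cnj (g' z))"
      using r(5,6) by eventually_elim simp
  qed (use r in \<open>auto intro: borel_measurable_integrable l2_inner_integrable\<close>)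
qed

definition norm_l2 :: "l2 \<Rightarrow> real" where "norm_l2 u = sqrt (inner u u)"
definition sgn_l2 :: "l2 \<Rightarrow> l2" where "sgn_l2 u = inverse (norm u) *\<^sub>R u"
definition dist_l2 :: "l2 \<Rightarrow> l2 \<Rightarrow> real" where "dist_l2 u v = norm (u - v)"
definition uniformity_l2 :: "(l2 \<times> l2) filter" where
  "uniformity_l2 = (INF e\<in>{0 <..}. principal {(u, v). dist u v < e})"
definition open_l2 :: "l2 set \<Rightarrow> bool" where
  "open_l2 S \<longleftrightarrow> (\<forall>u\<in>S. \<forall>\<^sub>F (u', v) in uniformity. u' = u \<longrightarrow> v \<in> S)"

instance
proof
  fix u v w :: l2 and r s :: real
  show "u + v + w = u + (v + w)"
    by transfer (simp add: l2_rel_def l2_fun_add add.assoc)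
  show "u + v = v + u"
    by transfer (simp add: l2_rel_def l2_fun_add add.commute)
  show "0 + u = u"
    by transfer (simp add: l2_rel_def)
  show "- u + u = 0"
    by transfer (simp add: l2_rel_def l2_fun_zero)
  show "u - v = u + - v" by (rule minus_l2_def)
  show "r *\<^sub>R (u + v) = r *\<^sub>R u + r *\<^sub>R v"
    by transfer (simp add: l2_rel_def l2_fun_add l2_fun_scale distrib_left)
  show "(r + s) *\<^sub>R u = r *\<^sub>R u + s *\<^sub>R u"
    by transfer (simp add: l2_rel_def l2_fun_add l2_fun_scale distrib_right)
  show "r *\<^sub>R s *\<^sub>R u = (r * s) *\<^sub>R u"
    by transfer (simp add: l2_rel_def mult.assoc l2_fun_scale[OF l2_fun_scale])
  show "1 *\<^sub>R u = u"
    by transfer (simp add: l2_rel_def)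
  show "sgn u = inverse (norm u) *\<^sub>R u" by (rule sgn_l2_def)
  show "dist u v = norm (u - v)" by (rule dist_l2_def)
  show "(uniformity :: (l2 \<times> l2) filter) = (INF e\<in>{0 <..}. principal {(u, v). dist u v < e})"
    by (rule uniformity_l2_def)
  show "open S \<longleftrightarrow> (\<forall>u\<in>S. \<forall>\<^sub>F (u', v) in uniformity. u' = u \<longrightarrow> v \<in> S)" for S :: "l2 set"
    by (rule open_l2_def)
  show "inner u v = inner v u"
    by transfer (simp add: mult.commute add.commute)
  show "inner (u + v) w = inner u w + inner v w"
  proof transfer
    fix f g h assume "l2_rel f f" "l2_rel g g" "l2_rel h h"
    then have fgh: "l2_fun f" "l2_fun g" "l2_fun h" by (simp_all add: l2_rel_refl_iff)
    have "Re ((f z + g z) * cnj (h z)) = Re (f z * cnj (h z)) + Re (g z * cnj (h z))" for z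
      by (simp add: algebra_simps)
    then show "(LINT z|cell_measure. Re ((f z + g z) * cnj (h z))) =
      (LINT z|cell_measure. Re (f z * cnj (h z))) + (LINT z|cell_measure. Re (g z * cnj (h z)))"
      by (simp only: Bochner_Integration.integral_add l2_inner_integrable fgh)
  qed
  show "inner (r *\<^sub>R u) v = r * inner u v"
    by transfer (simp add: mult.assoc distrib_left[symmetric] del: integral_mult_right_zero
        flip: integral_mult_right_zero)
  show "0 \<le> inner u u"
    by transfer (simp add: integral_nonneg_AE)
  show "inner u u = 0 \<longleftrightarrow> u = 0"
  proof transfer
    fix f assume "l2_rel f f"
    then have f: "l2_fun f" by (simp add: l2_rel_refl_iff)
    have eq: "(\<lambda>z. Re (f z * cnj (f z))) = (\<lambda>z. (cmod (f z))\<^sup>2)"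
      by (simp add: complex_mult_cnj cmod_power2 fun_eq_iff flip: power2_eq_square)
    have "(LINT z|cell_measure. (cmod (f z))\<^sup>2) = 0 \<longleftrightarrow> (AE z in cell_measure. (cmod (f z))\<^sup>2 = 0)"
      using f by (intro integral_nonneg_eq_0_iff_AE) (auto simp: l2_fun_def)
    then show "(LINT z|cell_measure. Re (f z * cnj (f z))) = 0 \<longleftrightarrow> l2_rel f (\<lambda>_. 0)"
      using f by (simp only: eq) (simp add: l2_rel_def l2_fun_zero)
  qed
  show "norm u = sqrt (inner u u)" by (rule norm_l2_def)
qed

end

instantiation l2 :: complex_normed_vector
begin

lift_definition scaleC_l2 :: "complex \<Rightarrow> l2 \<Rightarrow> l2" is "\<lambda>c f z. c * f z"
  by (auto simp: l2_rel_def l2_fun_scale)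

instance
proof
  fix a b :: complex and r :: real and u v :: l2
  show "a *\<^sub>C (u + v) = a *\<^sub>C u + a *\<^sub>C v"
    by transfer (simp add: l2_rel_def l2_fun_add l2_fun_scale distrib_left)
  show "(a + b) *\<^sub>C u = a *\<^sub>C u + b *\<^sub>C u"
    by transfer (simp add: l2_rel_def l2_fun_add l2_fun_scale distrib_right)
  show "a *\<^sub>C b *\<^sub>C u = (a * b) *\<^sub>C u"
    by transfer (simp add: l2_rel_def mult.assoc l2_fun_scale[OF l2_fun_scale])
  show "r *\<^sub>R u = complex_of_real r *\<^sub>C u"
    by transfer (simp add: l2_rel_def l2_fun_scale)
  have "inner (a *\<^sub>C u) (a *\<^sub>C u) = (cmod a)\<^sup>2 * inner u u"
  proof transfer
    fix a :: complex and f :: "complex \<Rightarrow> complex"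
    have "Re (a * f z * cnj (a * f z)) = (cmod a)\<^sup>2 * Re (f z * cnj (f z))" for z
      by (simp add: complex_mult_cnj cmod_power2) algebra
    then show "(LINT z|cell_measure. Re (a * f z * cnj (a * f z))) =
        (cmod a)\<^sup>2 * (LINT z|cell_measure. Re (f z * cnj (f z)))"
      by (simp only: integral_mult_right_zero)
  qed
  then show "norm (a *\<^sub>C u) = cmod a * norm u"
    by (simp add: norm_eq_sqrt_inner real_sqrt_mult)
qed

end

section \<open>Smooth functions and weak derivatives\<close>

text \<open>\<open>C\<^sup>n\<close> in the real sense on \<open>\<complex> = \<real>\<^sup>2\<close>; the directions \<open>1\<close> and \<open>\<i>\<close> give the two partial
  derivatives.\<close>

primrec Ck :: "nat \<Rightarrow> (complex \<Rightarrow> complex) \<Rightarrow> bool" where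
  "Ck 0 f \<longleftrightarrow> continuous_on UNIV f"
| "Ck (Suc n) f \<longleftrightarrow> f differentiable_on UNIV
     \<and> (\<forall>v\<in>{1, \<i>}. Ck n (\<lambda>z. frechet_derivative f (at z) v))"

definition smooth :: "(complex \<Rightarrow> complex) \<Rightarrow> bool" where
  "smooth f \<longleftrightarrow> (\<forall>n. Ck n f)"

lemma Ck_Suc_imp: "Ck (Suc n) f \<Longrightarrow> Ck n f"
proof (induction n arbitrary: f)
  case 0
  then show ?case by (auto intro: differentiable_imp_continuous_on)
next
  case (Suc n)
  show ?case unfolding Ck.simps
  proof (intro conjI ballI)
    show "f differentiable_on UNIV" using Suc.prems by simp
    fix v :: complex assume "v \<in> {1, \<i>}"
    then have "Ck (Suc n) (\<lambda>z. frechet_derivative f (at z) v)"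
      using Suc.prems unfolding Ck.simps(2)[of "Suc n"] by blast
    then show "Ck n (\<lambda>z. frechet_derivative f (at z) v)" by (rule Suc.IH)
  qed
qed

lemma Ck_imp_continuous: "Ck n f \<Longrightarrow> continuous_on UNIV f"
  by (cases n) (auto intro: differentiable_imp_continuous_on)

lemma Ck_SucI:
  assumes "\<And>z. (f has_derivative f' z) (at z)" "\<And>v. v \<in> {1, \<i>} \<Longrightarrow> Ck n (\<lambda>z. f' z v)"
  shows "Ck (Suc n) f"
proof -
  have "frechet_derivative f (at z) = f' z" for z
    using frechet_derivative_at[OF assms(1)] by simp
  moreover have "f differentiable_on UNIV"
    using assms(1) by (auto simp: differentiable_on_def differentiable_def)
  ultimately show ?thesis using assms(2) by simp
qed

lemma Ck_SucD:
  assumes "Ck (Suc n) f"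
  shows "(f has_derivative frechet_derivative f (at z)) (at z)"
    and "v \<in> {1, \<i>} \<Longrightarrow> Ck n (\<lambda>z. frechet_derivative f (at z) v)"
  using assms by (auto simp: differentiable_on_def frechet_derivative_works)

lemma Ck_const: "Ck n (\<lambda>_. c)"
proof (induction n arbitrary: c)
  case (Suc n)
  show ?case by (rule Ck_SucI[where f' = "\<lambda>_ _. 0"]) (use Suc in auto)
qed simp

lemma Ck_add: "Ck n f \<Longrightarrow> Ck n g \<Longrightarrow> Ck n (\<lambda>z. f z + g z)"
proof (induction n arbitrary: f g)
  case (Suc n)
  show ?case
    by (rule Ck_SucI, rule has_derivative_add[OF Ck_SucD(1)[OF Suc.prems(1)] Ck_SucD(1)[OF Suc.prems(2)]])
      (rule Suc.IH[OF Ck_SucD(2)[OF Suc.prems(1)] Ck_SucD(2)[OF Suc.prems(2)]])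
qed (auto intro: continuous_intros)

lemma Ck_mult: "Ck n f \<Longrightarrow> Ck n g \<Longrightarrow> Ck n (\<lambda>z. f z * g z)"
proof (induction n arbitrary: f g)
  case (Suc n)
  show ?case
  proof (rule Ck_SucI)
    fix z
    show "((\<lambda>z. f z * g z) has_derivative
        (\<lambda>v. f z * frechet_derivative g (at z) v + frechet_derivative f (at z) v * g z)) (at z)"
      by (rule has_derivative_mult[OF Ck_SucD(1)[OF Suc.prems(1)] Ck_SucD(1)[OF Suc.prems(2)]])
  next
    fix v :: complex assume v: "v \<in> {1, \<i>}"
    note Ck_Suc_imp[OF Suc.prems(1)] Ck_Suc_imp[OF Suc.prems(2)]
      Ck_SucD(2)[OF Suc.prems(1) v] Ck_SucD(2)[OF Suc.prems(2) v]
    then show "Ck n (\<lambda>z. f z * frechet_derivative g (at z) v + frechet_derivative f (at z) v * g z)"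
      by (intro Ck_add Suc.IH)
  qed
qed (auto intro: continuous_intros)

lemma Ck_cis: "Ck n (\<lambda>z. c * cis (a * crd_s z + b * crd_t z))"
proof (induction n arbitrary: c)
  case 0
  then show ?case by (auto intro!: continuous_intros simp: cis_conv_exp)
next
  case (Suc n)
  define L where "L = (\<lambda>z. a * crd_s z + b * crd_t z)"
  have L: "bounded_linear L"
    unfolding L_def crd_s_def crd_t_def
    by (intro bounded_linear_add bounded_linear_const_mult bounded_linear_Re bounded_linear_Im
        bounded_linear_divide[THEN bounded_linear_compose])
  have "((\<lambda>z. c * exp (\<i> * of_real (L z))) has_derivative
      (\<lambda>v. (c * \<i> * of_real (L v)) * exp (\<i> * of_real (L z)))) (at z)" for z
  proof -
    have "bounded_linear (\<lambda>z. \<i> * complex_of_real (L z))"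
      by (intro bounded_linear_const_mult bounded_linear_compose[OF bounded_linear_of_real L])
    then have "((\<lambda>z. \<i> * complex_of_real (L z)) has_derivative (\<lambda>v. \<i> * of_real (L v))) (at z)"
      by (rule bounded_linear_imp_has_derivative)
    from has_derivative_compose[OF this DERIV_exp[unfolded has_field_derivative_def]]
    have "((\<lambda>z. exp (\<i> * of_real (L z))) has_derivative
        (\<lambda>v. exp (\<i> * of_real (L z)) * (\<i> * of_real (L v)))) (at z)" .
    from has_derivative_mult_right[OF this, of c] show ?thesis
      by (simp add: mult_ac)
  qed
  then have "((\<lambda>z. c * cis (L z)) has_derivative (\<lambda>v. (c * \<i> * of_real (L v)) * cis (L z))) (at z)" for z
    by (simp add: cis_conv_exp)
  then have "Ck (Suc n) (\<lambda>z. c * cis (L z))"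
    by (rule Ck_SucI) (use Suc in \<open>simp add: L_def\<close>)
  then show ?case by (simp only: L_def)
qed

lemma smooth_const: "smooth (\<lambda>_. c)"
  and smooth_add: "smooth f \<Longrightarrow> smooth g \<Longrightarrow> smooth (\<lambda>z. f z + g z)"
  and smooth_mult: "smooth f \<Longrightarrow> smooth g \<Longrightarrow> smooth (\<lambda>z. f z * g z)"
  and smooth_cis: "smooth (\<lambda>z. cis (a * crd_s z + b * crd_t z))"
  using Ck_cis[of _ 1 a b] by (simp_all add: smooth_def Ck_const Ck_add Ck_mult)

lemma smooth_continuous: "smooth f \<Longrightarrow> continuous_on A f"
  using Ck_imp_continuous continuous_on_subset unfolding smooth_def by blast

lemma smooth_frechet:
  assumes "smooth f" "v \<in> {1, \<i>}"
  shows "smooth (\<lambda>z. frechet_derivative f (at z) v)"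
  using assms Ck_SucD(2)[of _ f v] by (auto simp: smooth_def simp del: Ck.simps)

lemma cell_closed_compact: "compact {z. crd_s z \<in> {0..1} \<and> crd_t z \<in> {0..1}}"
proof -
  have "bounded {z. crd_s z \<in> {0..1} \<and> crd_t z \<in> {0..1}}"
  proof (rule boundedI[of _ "cmod omega + 1"], clarsimp)
    fix z assume z: "0 \<le> crd_s z" "crd_s z \<le> 1" "0 \<le> crd_t z" "crd_t z \<le> 1"
    have "cmod z = cmod (omega * of_real (crd_s z) + of_real (crd_t z))"
      using crd_decomp[of z] by simp
    also have "\<dots> \<le> cmod omega * \<bar>crd_s z\<bar> + \<bar>crd_t z\<bar>"
      by (rule order_trans[OF norm_triangle_ineq]) (simp add: norm_mult)
    also have "\<dots> \<le> cmod omega * 1 + 1"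
      using z by (intro add_mono mult_left_mono) auto
    finally show "cmod z \<le> cmod omega + 1" by simp
  qed
  moreover have "closed {z. crd_s z \<in> {0..1} \<and> crd_t z \<in> {0..1}}"
    unfolding atLeastAtMost_iff
    by (intro closed_Collect_conj closed_Collect_le continuous_intros)
  ultimately show ?thesis by (simp add: compact_eq_bounded_closed)
qed

lemma cell_reduce: "\<exists>\<gamma>\<in>Lambda. z + \<gamma> \<in> cell"
proof -
  define m n where "m = - \<lfloor>crd_s z\<rfloor>" "n = - \<lfloor>crd_t z\<rfloor>"
  define \<gamma> where "\<gamma> = omega * of_int m + of_int n"
  have "\<gamma> = omega * of_real (of_int m) + of_real (of_int n)" by (simp add: \<gamma>_def)
  then have "crd_s \<gamma> = of_int m" "crd_t \<gamma> = of_int n"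
    using crd_omega[of "of_int m" "of_int n"] by simp_all
  then have "z + \<gamma> \<in> cell"
    unfolding cell_eq by (auto simp: crd_add m_n_def) linarith+
  moreover have "\<gamma> \<in> Lambda" by (auto simp: Lambda_def \<gamma>_def)
  ultimately show ?thesis by blast
qed

lemma periodic_continuous_bounded:
  assumes "periodic f" "continuous_on UNIV (f :: complex \<Rightarrow> complex)"
  obtains C where "\<And>z. cmod (f z) \<le> C"
proof -
  have "compact (f ` {z. crd_s z \<in> {0..1} \<and> crd_t z \<in> {0..1}})"
    by (intro compact_continuous_image cell_closed_compact continuous_on_subset[OF assms(2)]) simp
  then obtain C where C: "\<And>z. crd_s z \<in> {0..1} \<Longrightarrow> crd_t z \<in> {0..1} \<Longrightarrow> cmod (f z) \<le> C"
    unfolding compact_eq_bounded_closed bounded_iff by auto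
  have "cmod (f z) \<le> C" for z
  proof -
    obtain \<gamma> where g: "\<gamma> \<in> Lambda" "z + \<gamma> \<in> cell" using cell_reduce by blast
    then have "f z = f (z + \<gamma>)" using assms(1) by (simp add: periodic_def)
    then show ?thesis using C[of "z + \<gamma>"] g by (auto simp: cell_eq)
  qed
  then show thesis by (rule that)
qed

lemma l2_fun_mult_smooth:
  assumes "l2_fun f" "periodic g" "smooth g"
  shows "l2_fun (\<lambda>z. g z * f z)"
  using periodic_continuous_bounded[OF assms(2) smooth_continuous[OF assms(3)]]
    l2_fun_mult_bounded[OF assms(1,2)]
    borel_measurable_continuous_onI[OF smooth_continuous[OF assms(3)]] by metis

lemma l2_fun_smooth: "periodic g \<Longrightarrow> smooth g \<Longrightarrow> l2_fun g"
proof -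
  assume g: "periodic g" "smooth g"
  have "l2_fun (\<lambda>_. 1)" by (simp add: l2_fun_def periodic_def)
  from l2_fun_mult_smooth[OF this g] show ?thesis by simp
qed

lemma periodic_frechet:
  assumes "periodic f" "smooth f"
  shows "periodic (\<lambda>z. frechet_derivative f (at z) v)"
  unfolding periodic_def
proof (intro allI ballI)
  fix z \<gamma> assume g: "\<gamma> \<in> Lambda"
  have "Ck (Suc 0) f" using assms by (simp add: smooth_def del: Ck.simps)
  then have "(f has_derivative frechet_derivative f (at (z + \<gamma>))) (at (z + \<gamma>))"
    by (rule Ck_SucD)
  moreover have "((\<lambda>z. z + \<gamma>) has_derivative (\<lambda>v. v)) (at z)"
    by (auto intro!: derivative_eq_intros)
  ultimately have "((\<lambda>z. f (z + \<gamma>)) has_derivative frechet_derivative f (at (z + \<gamma>))) (at z)"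
    using has_derivative_compose[of "\<lambda>z. z + \<gamma>" "\<lambda>v. v" z UNIV f] by auto
  moreover have "(\<lambda>z. f (z + \<gamma>)) = f" using assms g by (auto simp: periodic_def)
  ultimately have "(f has_derivative frechet_derivative f (at (z + \<gamma>))) (at z)" by simp
  then show "frechet_derivative f (at (z + \<gamma>)) v = frechet_derivative f (at z) v"
    using frechet_derivative_at by metis
qed

subsection \<open>Density of the test functions\<close>

definition torus_emb :: "complex \<Rightarrow> complex \<times> complex" where
  "torus_emb z = (cis (2 * pi * crd_s z), cis (2 * pi * crd_t z))"

lemma periodic_torus_emb: "periodic torus_emb"
  unfolding periodic_def
proof (intro allI ballI)
  fix z \<gamma> assume "\<gamma> \<in> Lambda"
  then obtain m n :: int where "crd_s \<gamma> = of_int m" "crd_t \<gamma> = of_int n" by (rule crd_Lambda)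
  moreover have "cis (2 * pi * of_int k) = 1" for k :: int
    using cis_multiple_2pi[of "of_int k"] by (simp add: mult_ac)
  ultimately show "torus_emb (z + \<gamma>) = torus_emb z"
    by (simp add: torus_emb_def crd_add distrib_left flip: cis_mult)
qed

lemma continuous_torus_emb: "continuous_on A torus_emb"
  unfolding torus_emb_def cis_conv_exp by (intro continuous_intros)

lemma torus_emb_inj: "inj_on torus_emb cell"
proof (rule inj_onI)
  fix z w assume z: "z \<in> cell" "w \<in> cell" "torus_emb z = torus_emb w"
  have aux: "x = y" if "cis (2 * pi * x) = cis (2 * pi * y)" "x \<in> {0..<1}" "y \<in> {0..<1}" for x y :: real
  proof -
    have "cos (2 * pi * x) = cos (2 * pi * y)" "sin (2 * pi * x) = sin (2 * pi * y)"
      using that(1) by (auto simp: complex_eq_iff)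
    then obtain n :: int where "2 * pi * x = 2 * pi * y + 2 * pi * of_int n"
      using sin_cos_eq_iff[of "2 * pi * x" "2 * pi * y"] by (auto simp: mult_ac)
    then have "2 * pi * x = 2 * pi * (y + of_int n)" by (simp add: distrib_left)
    then have "x = y + of_int n" by simp
    moreover have "of_int n < (1::real)" "(- 1::real) < of_int n"
      using that calculation by auto
    then have "n = 0" by linarith
    ultimately show ?thesis by simp
  qed
  have "crd_s z = crd_s w" "crd_t z = crd_t w"
    using z by (auto simp: torus_emb_def cell_eq intro!: aux)
  then show "z = w" using crd_decomp[of z] crd_decomp[of w] by simp
qed

lemma smooth_poly_torus_emb:
  assumes "real_polynomial_function g"
  shows "smooth (\<lambda>z. of_real (g (torus_emb z)))"
  using assms
proof induction
  case (linear f)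
  interpret bounded_linear f by fact
  have [intro]: "smooth (\<lambda>z. cis (2 * pi * crd_s z))" "smooth (\<lambda>z. cis (- (2 * pi * crd_s z)))"
    "smooth (\<lambda>z. cis (2 * pi * crd_t z))" "smooth (\<lambda>z. cis (- (2 * pi * crd_t z)))"
    using smooth_cis[of "2 * pi" 0] smooth_cis[of "- 2 * pi" 0]
      smooth_cis[of 0 "2 * pi"] smooth_cis[of 0 "- 2 * pi"] by simp_all
  have cs: "complex_of_real (cos x) = 1 / 2 * (cis x + cis (- x))"
    "complex_of_real (sin x) = (- \<i> / 2) * (cis x + (- 1) * cis (- x))" for x
    by (simp_all add: complex_eq_iff)
  have dec: "f (a, b) = Re a * f (1, 0) + Im a * f (\<i>, 0) + Re b * f (0, 1) + Im b * f (0, \<i>)" for a b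
  proof -
    have "(a, b) = Re a *\<^sub>R (1, 0) + Im a *\<^sub>R (\<i>, 0) + Re b *\<^sub>R (0, 1) + Im b *\<^sub>R (0, \<i>)"
      by (simp add: complex_eq_iff)
    then show ?thesis by (metis add scaleR real_scaleR_def)
  qed
  have "of_real (f (torus_emb z)) =
      of_real (f (1, 0)) * (1 / 2 * (cis (2 * pi * crd_s z) + cis (- (2 * pi * crd_s z))))
    + of_real (f (\<i>, 0)) * ((- \<i> / 2) * (cis (2 * pi * crd_s z) + (- 1) * cis (- (2 * pi * crd_s z))))
    + of_real (f (0, 1)) * (1 / 2 * (cis (2 * pi * crd_t z) + cis (- (2 * pi * crd_t z))))
    + of_real (f (0, \<i>)) * ((- \<i> / 2) * (cis (2 * pi * crd_t z) + (- 1) * cis (- (2 * pi * crd_t z))))" for z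
    unfolding torus_emb_def cs[symmetric]
    using dec[of "cis (2 * pi * crd_s z)" "cis (2 * pi * crd_t z)"] by (simp add: mult_ac)
  then show ?case
    by (simp only:) (intro smooth_add smooth_mult smooth_const; auto)
next
  case (const c)
  show ?case by (rule smooth_const)
next
  case (add f g)
  then show ?case using smooth_add by simp
next
  case (mult f g)
  then show ?case using smooth_mult by simp
qed

lemma integrable_mult_bounded_cont:
  assumes "integrable cell_measure w" "h \<in> borel_measurable cell_measure" "\<And>z. \<bar>h z :: real\<bar> \<le> C"
  shows "integrable cell_measure (\<lambda>z. w z * complex_of_real (h z))"
proof (rule Bochner_Integration.integrable_bound)
  show "integrable cell_measure (\<lambda>z. C * cmod (w z))" using assms(1) by auto
  have [measurable]: "w \<in> borel_measurable cell_measure" "h \<in> borel_measurable cell_measure"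
    using assms by auto
  show "(\<lambda>z. w z * complex_of_real (h z)) \<in> borel_measurable cell_measure" by measurable
  have "cmod (w z) * \<bar>h z\<bar> \<le> \<bar>C\<bar> * cmod (w z)" for z
    using mult_left_mono[OF order_trans[OF assms(3)[of z] abs_ge_self[of C]], of "cmod (w z)"]
    by (simp add: mult.commute)
  then show "AE z in cell_measure. norm (w z * complex_of_real (h z)) \<le> norm (C * cmod (w z))"
    by (simp add: norm_mult abs_mult)
qed

lemma test_functions_dense:
  assumes w: "l2_fun w"
    and test: "\<And>\<phi>. smooth \<phi> \<Longrightarrow> periodic \<phi> \<Longrightarrow> (LINT z|cell_measure. w z * \<phi> z) = 0"
  shows "AE z in cell_measure. w z = 0"
proof -
  have wint: "integrable cell_measure w"
    using l2_prod_integrable[OF w l2_fun_smooth[of "\<lambda>_. 1"]] by (simp add: periodic_def smooth_const)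
  define T :: "(complex \<times> complex) set" where "T = sphere 0 1 \<times> sphere 0 1"
  have T: "compact T" "torus_emb z \<in> T" for z
    by (auto simp: T_def torus_emb_def intro: compact_Times)
  have meas: "(\<lambda>z. G (torus_emb z)) \<in> borel_measurable cell_measure"
    if "continuous_on UNIV G" for G :: "complex \<times> complex \<Rightarrow> real"
    by (intro measurable_cell borel_measurable_continuous_onI
        continuous_on_compose2[OF that continuous_torus_emb]) simp
  have bdd: "\<exists>C. \<forall>z. \<bar>G (torus_emb z)\<bar> \<le> C" if "continuous_on UNIV G" for G :: "complex \<times> complex \<Rightarrow> real"
  proof -
    have "compact (G ` T)"
      by (intro compact_continuous_image T continuous_on_subset[OF that]) simp
    then show ?thesis
      using T(2) by (auto simp: compact_eq_bounded_closed bounded_iff)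
  qed
  have poly: "(LINT z|cell_measure. w z * of_real (g (torus_emb z))) = 0"
    if "real_polynomial_function g" for g
    using periodic_torus_emb by (intro test smooth_poly_torus_emb that) (simp add: periodic_def)
  have cont: "(LINT z|cell_measure. w z * of_real (G (torus_emb z))) = 0"
    if G: "continuous_on UNIV G" for G :: "complex \<times> complex \<Rightarrow> real"
  proof -
    define I where "I = (LINT z|cell_measure. w z * of_real (G (torus_emb z)))"
    define J where "J = (LINT z|cell_measure. cmod (w z))"
    have J: "J \<ge> 0" by (simp add: J_def)
    have "cmod I \<le> e * J" if e: "e > 0" for e
    proof -
      obtain g where g: "real_polynomial_function g" "\<And>x. x \<in> T \<Longrightarrow> \<bar>G x - g x\<bar> < e"
        using Stone_Weierstrass_real_polynomial_function[OF T(1) continuous_on_subset[OF G] e] by auto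
      have gc: "continuous_on UNIV g"
        using g(1) by (intro continuous_on_polymonial_function) (simp add: real_polynomial_function_eq)
      obtain C1 C2 where C: "\<And>z. \<bar>G (torus_emb z)\<bar> \<le> C1" "\<And>z. \<bar>g (torus_emb z)\<bar> \<le> C2"
        using bdd[OF G] bdd[OF gc] by blast
      have i1: "integrable cell_measure (\<lambda>z. w z * of_real (G (torus_emb z)))"
        and i2: "integrable cell_measure (\<lambda>z. w z * of_real (g (torus_emb z)))"
        using C by (auto intro!: integrable_mult_bounded_cont wint meas G gc)
      have "I = (LINT z|cell_measure. w z * of_real (G (torus_emb z)) - w z * of_real (g (torus_emb z)))"
        unfolding I_def by (simp add: Bochner_Integration.integral_diff[OF i1 i2] poly[OF g(1)])
      also have "cmod \<dots> \<le> (LINT z|cell_measure. e * cmod (w z))"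
      proof (rule Bochner_Integration.integral_norm_bound_integral)
        show "integrable cell_measure (\<lambda>z. w z * of_real (G (torus_emb z)) - w z * of_real (g (torus_emb z)))"
          using i1 i2 by auto
        show "integrable cell_measure (\<lambda>z. e * cmod (w z))" using wint by auto
        fix z
        have "w z * of_real (G (torus_emb z)) - w z * of_real (g (torus_emb z)) =
            w z * of_real (G (torus_emb z) - g (torus_emb z))" by (simp add: algebra_simps)
        then have "cmod (w z * of_real (G (torus_emb z)) - w z * of_real (g (torus_emb z))) =
            cmod (w z) * \<bar>G (torus_emb z) - g (torus_emb z)\<bar>"
          by (simp only: norm_mult norm_of_real)
        also have "\<dots> \<le> cmod (w z) * e"
          using g(2)[OF T(2)[of z]] by (intro mult_left_mono) auto
        finally show "norm (w z * of_real (G (torus_emb z)) - w z * of_real (g (torus_emb z)))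
            \<le> e * cmod (w z)" by (simp add: mult.commute)
      qed
      also have "\<dots> = e * J" by (simp add: J_def)
      finally show ?thesis .
    qed
    note le = this
    have "cmod I \<le> 0"
    proof (rule field_le_epsilon)
      fix e :: real assume "e > 0"
      then have "cmod I \<le> e / (J + 1) * J" using J by (intro le) simp
      also have "\<dots> \<le> e" using J \<open>e > 0\<close> by (simp add: field_simps)
      finally show "cmod I \<le> 0 + e" by simp
    qed
    then show ?thesis by (simp add: I_def)
  qed
  have comp: "(LINT z|cell_measure. w z * of_real (indicat_real K z)) = 0"
    if K: "compact K" "K \<subseteq> cell" for K
  proof (cases "K = {}")
    case False
    define B where "B = torus_emb ` K"
    have B: "closed B" "B \<noteq> {}"
      using False unfolding B_def
      by (auto intro!: compact_imp_closed compact_continuous_image continuous_torus_emb K)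
    define h where "h = (\<lambda>n x. max 0 (1 - real n * infdist x B))"
    have hc: "continuous_on UNIV (h n)" for n
      unfolding h_def by (intro continuous_intros)
    have h01: "0 \<le> h n x" "h n x \<le> 1" for n x
      using infdist_nonneg[of x B] by (auto simp: h_def)
    have lim: "(\<lambda>n. h n (torus_emb z)) \<longlonglongrightarrow> indicat_real K z" if z: "z \<in> cell" for z
    proof (cases "z \<in> K")
      case True
      then have "infdist (torus_emb z) B = 0" by (simp add: B_def)
      then show ?thesis using True by (simp add: h_def)
    next
      case False
      then have "torus_emb z \<notin> B"
        using z K(2) torus_emb_inj by (auto simp: B_def inj_on_def)
      then have pos: "infdist (torus_emb z) B > 0"
        using B in_closed_iff_infdist_zero[of B "torus_emb z"] infdist_nonneg[of "torus_emb z" B]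
        by (simp add: order_less_le)
      obtain N where N: "real N * infdist (torus_emb z) B > 1"
        using reals_Archimedean3[OF pos] by blast
      have "h n (torus_emb z) = 0" if "n \<ge> N" for n
      proof -
        have "real N * infdist (torus_emb z) B \<le> real n * infdist (torus_emb z) B"
          using that pos by (intro mult_right_mono) auto
        then show ?thesis using N by (simp add: h_def)
      qed
      then show ?thesis
        using False by (intro tendsto_eventually) (auto simp: eventually_sequentially)
    qed
    have [measurable]: "w \<in> borel_measurable cell_measure" using wint by auto
    have [measurable]: "(\<lambda>z. h n (torus_emb z)) \<in> borel_measurable cell_measure" for n
      by (intro meas hc)
    have [measurable]: "indicat_real K \<in> borel_measurable cell_measure"
      using K by (intro measurable_cell borel_measurable_indicator borel_compact)
    have "(\<lambda>n. LINT z|cell_measure. w z * of_real (h n (torus_emb z))) \<longlonglongrightarrow>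
        (LINT z|cell_measure. w z * of_real (indicat_real K z))"
    proof (rule integral_dominated_convergence[where w = "\<lambda>z. cmod (w z)"])
      show "integrable cell_measure (\<lambda>z. cmod (w z))" using wint by auto
      show "AE z in cell_measure. (\<lambda>n. w z * of_real (h n (torus_emb z))) \<longlonglongrightarrow>
          w z * of_real (indicat_real K z)"
        using lim by (intro AE_I2) (auto intro!: tendsto_intros)
      show "AE z in cell_measure. norm (w z * of_real (h n (torus_emb z))) \<le> cmod (w z)" for n
        using h01 by (intro AE_I2) (auto simp: norm_mult mult_left_le)
    qed measurable
    then show ?thesis using LIMSEQ_unique[OF _ tendsto_const[of 0]] by (simp add: cont[OF hc])
  qed simp
  have wb [measurable]: "w \<in> borel_measurable borel" using w by (simp add: l2_fun_def)
  have key: "AE z in cell_measure. \<not> 0 < F (w z)"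
    if F: "bounded_linear F" for F :: "complex \<Rightarrow> real"
  proof -
    have [measurable]: "F \<in> borel_measurable borel"
      using F by (intro borel_measurable_continuous_onI linear_continuous_on)
    define P where "P = {z. 0 < F (w z)} \<inter> cell"
    have "{z \<in> space borel. 0 < F (w z)} \<in> sets borel" by measurable
    then have P: "P \<in> sets borel"
      using cell_sets by (simp add: P_def sets.Int)
    have nullK: "emeasure lborel K = 0" if K: "compact K" "K \<subseteq> P" for K
    proof -
      have Kc: "K \<subseteq> cell" using K by (auto simp: P_def)
      have [measurable]: "K \<in> sets borel" using K by (simp add: borel_compact)
      have KM: "K \<in> sets cell_measure"
        using Kc cell_sets by (auto simp: cell_measure_def sets_restrict_space_iff)
      have mK: "indicat_real K \<in> borel_measurable cell_measure"
        by (intro measurable_cell) measurable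
      have int: "integrable cell_measure (\<lambda>z. w z * of_real (indicat_real K z))"
        by (rule integrable_mult_bounded_cont[OF wint mK, of 1]) (simp add: indicator_def)
      have "F (w z * of_real (indicat_real K z)) = indicat_real K z * F (w z)" for z
        using F by (auto simp: indicator_def linear_0 bounded_linear.linear)
      then have eq: "(\<lambda>z. F (w z * of_real (indicat_real K z))) = (\<lambda>z. indicat_real K z * F (w z))"
        by blast
      have "(LINT z|cell_measure. indicat_real K z * F (w z)) = 0"
        using integral_bounded_linear[OF F int] comp[OF K(1) Kc] eq
        by (simp add: linear_0 bounded_linear.linear F)
      moreover have "integrable cell_measure (\<lambda>z. indicat_real K z * F (w z))"
        using integrable_bounded_linear[OF F int] eq by simp
      ultimately have "AE z in cell_measure. indicat_real K z * F (w z) = 0"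
      proof (subst integral_nonneg_eq_0_iff_AE[symmetric])
        have "0 \<le> indicat_real K z * F (w z)" for z
          using K by (auto simp: P_def indicator_def intro: less_imp_le)
        then show "AE z in cell_measure. 0 \<le> indicat_real K z * F (w z)" by simp
      qed
      then have "AE z in cell_measure. z \<notin> K"
        using K by (auto simp: P_def indicator_def split: if_splits elim!: eventually_mono)
      then have "emeasure cell_measure K = 0"
        using KM Kc by (subst (asm) AE_iff_measurable[of K]) auto
      then show ?thesis
        using Kc cell_sets by (simp add: cell_measure_def emeasure_restrict_space)
    qed
    define M where "M = density lborel (indicator cell)"
    have M: "sets M = sets borel" by (simp add: M_def)
    have Me: "emeasure M A = emeasure lborel (A \<inter> cell)" if "A \<in> sets borel" for A
    proof -
      have "emeasure M A = (\<integral>\<^sup>+ x. indicator cell x * indicator A x \<partial>lborel)"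
        unfolding M_def using that cell_sets by (intro emeasure_density) auto
      also have "\<dots> = (\<integral>\<^sup>+ x. indicator (A \<inter> cell) x \<partial>lborel)"
        by (intro nn_integral_cong) (auto simp: indicator_def)
      finally show ?thesis using that cell_sets by simp
    qed
    have "emeasure M (space M) \<noteq> \<infinity>"
      using emeasure_bounded_finite[OF cell_bounded] Me[of UNIV] by (simp add: M_def)
    then have "emeasure M P = (SUP K\<in>{K. K \<subseteq> P \<and> compact K}. emeasure M K)"
      by (intro inner_regular M P)
    also have "\<dots> = 0"
    proof -
      have "emeasure M K = 0" if "K \<subseteq> P" "compact K" for K
      proof -
        have "K \<inter> cell = K" using that by (auto simp: P_def)
        then show ?thesis using Me[of K] nullK[of K] that by (simp add: borel_compact)
      qed
      then show ?thesis by (intro SUP_eqI) auto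
    qed
    finally have "emeasure lborel P = 0"
      using Me[OF P] by (simp add: P_def Int_assoc)
    then have "emeasure cell_measure P = 0"
      using cell_sets by (simp add: cell_measure_def emeasure_restrict_space P_def)
    moreover have "P \<in> sets cell_measure"
      using P cell_sets by (auto simp: cell_measure_def sets_restrict_space_iff P_def)
    ultimately show ?thesis
      by (intro AE_I[of _ _ P]) (auto simp: P_def)
  qed
  have "AE z in cell_measure. \<not> 0 < Re (w z)" "AE z in cell_measure. \<not> 0 < - Re (w z)"
    "AE z in cell_measure. \<not> 0 < Im (w z)" "AE z in cell_measure. \<not> 0 < - Im (w z)"
    by (intro key bounded_linear_Re bounded_linear_Im bounded_linear_minus)+
  then show ?thesis
    by eventually_elim (simp add: complex_eq_iff)
qed

subsection \<open>Sobolev spaces\<close>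

text \<open>\<open>weak_deriv v u w\<close>: \<open>w\<close> is the derivative of \<open>u\<close> in direction \<open>v\<close> in the sense of distributions
  on \<open>\<complex>/\<Lambda>\<close>, the test functions being the smooth periodic functions.\<close>

definition weak_deriv :: "complex \<Rightarrow> l2 \<Rightarrow> l2 \<Rightarrow> bool" where
  "weak_deriv v u w \<longleftrightarrow> (\<forall>\<phi>. smooth \<phi> \<and> periodic \<phi> \<longrightarrow>
     (LINT z|cell_measure. rep_l2 u z * frechet_derivative \<phi> (at z) v) =
     - (LINT z|cell_measure. rep_l2 w z * \<phi> z))"

primrec sobolev :: "nat \<Rightarrow> l2 set" where
  "sobolev 0 = UNIV"
| "sobolev (Suc n) = {u. \<forall>v\<in>{1, \<i>}. \<exists>w\<in>sobolev n. weak_deriv v u w}"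

definition wderiv :: "complex \<Rightarrow> l2 \<Rightarrow> l2" where
  "wderiv v u = (THE w. weak_deriv v u w)"

lemma l2_fun_rep: "l2_fun (rep_l2 u)"
  using Quotient3_rep_reflp[OF Quotient3_l2, of u] by (simp add: l2_rel_refl_iff)

lemma abs_rep_l2 [simp]: "abs_l2 (rep_l2 u) = u"
  by (rule Quotient3_abs_rep[OF Quotient3_l2])

lemma rep_abs_l2_AE: "l2_fun f \<Longrightarrow> AE z in cell_measure. rep_l2 (abs_l2 f) z = f z"
  using rep_abs_rsp_left[OF Quotient3_l2, of f f] by (simp add: l2_rel_def)

lemma l2_eqI: "AE z in cell_measure. rep_l2 u z = rep_l2 v z \<Longrightarrow> u = v"
  using Quotient3_rel_rep[OF Quotient3_l2, of u v] l2_fun_rep by (simp add: l2_rel_def)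

lemma rep_add_AE: "AE z in cell_measure. rep_l2 (u + v) z = rep_l2 u z + rep_l2 v z"
proof -
  have "abs_l2 (rep_l2 u) + abs_l2 (rep_l2 v) = abs_l2 (\<lambda>z. rep_l2 u z + rep_l2 v z)"
    by (rule plus_l2.abs_eq) (simp_all add: l2_rel_refl_iff l2_fun_rep)
  then show ?thesis
    using rep_abs_l2_AE[OF l2_fun_add[OF l2_fun_rep l2_fun_rep, of u v]] by simp
qed

lemma rep_scaleC_AE: "AE z in cell_measure. rep_l2 (c *\<^sub>C u) z = c * rep_l2 u z"
proof -
  have "c *\<^sub>C abs_l2 (rep_l2 u) = abs_l2 (\<lambda>z. c * rep_l2 u z)"
    by (rule scaleC_l2.abs_eq) (simp add: l2_rel_refl_iff l2_fun_rep)
  then show ?thesis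
    using rep_abs_l2_AE[OF l2_fun_scale[OF l2_fun_rep, of c u]] by simp
qed

lemma pair_integrable:
  "smooth \<phi> \<Longrightarrow> periodic \<phi> \<Longrightarrow> integrable cell_measure (\<lambda>z. rep_l2 u z * \<phi> z)"
  by (intro l2_prod_integrable l2_fun_rep l2_fun_smooth)

lemma pair_add:
  assumes "smooth \<phi>" "periodic \<phi>"
  shows "(LINT z|cell_measure. rep_l2 (u + v) z * \<phi> z) =
    (LINT z|cell_measure. rep_l2 u z * \<phi> z) + (LINT z|cell_measure. rep_l2 v z * \<phi> z)"
proof -
  note i = pair_integrable[OF assms]
  have "(LINT z|cell_measure. rep_l2 (u + v) z * \<phi> z) =
      (LINT z|cell_measure. rep_l2 u z * \<phi> z + rep_l2 v z * \<phi> z)"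
  proof (rule integral_cong_AE)
    show "AE z in cell_measure. rep_l2 (u + v) z * \<phi> z = rep_l2 u z * \<phi> z + rep_l2 v z * \<phi> z"
      using rep_add_AE[of u v] by eventually_elim (simp add: distrib_right)
  qed (use i in \<open>auto intro: borel_measurable_integrable Bochner_Integration.integrable_add\<close>)
  then show ?thesis by (simp add: Bochner_Integration.integral_add i)
qed

lemma pair_scaleC:
  assumes "smooth \<phi>" "periodic \<phi>"
  shows "(LINT z|cell_measure. rep_l2 (c *\<^sub>C u) z * \<phi> z) =
    c * (LINT z|cell_measure. rep_l2 u z * \<phi> z)"
proof -
  note i = pair_integrable[OF assms]
  have "(LINT z|cell_measure. rep_l2 (c *\<^sub>C u) z * \<phi> z) =
      (LINT z|cell_measure. c * (rep_l2 u z * \<phi> z))"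
  proof (rule integral_cong_AE)
    show "AE z in cell_measure. rep_l2 (c *\<^sub>C u) z * \<phi> z = c * (rep_l2 u z * \<phi> z)"
      using rep_scaleC_AE[of c u] by eventually_elim (simp add: mult.assoc)
    show "(\<lambda>z. c * (rep_l2 u z * \<phi> z)) \<in> borel_measurable cell_measure"
      by (intro borel_measurable_integrable integrable_mult_right i)
  qed (use i in \<open>auto intro: borel_measurable_integrable\<close>)
  then show ?thesis by simp
qed

lemma pair_zero_imp_zero:
  assumes "\<And>\<phi>. smooth \<phi> \<Longrightarrow> periodic \<phi> \<Longrightarrow> (LINT z|cell_measure. rep_l2 u z * \<phi> z) = 0"
  shows "u = 0"
proof -
  have "AE z in cell_measure. rep_l2 u z = 0"
    by (rule test_functions_dense[OF l2_fun_rep assms])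
  moreover have "AE z in cell_measure. rep_l2 0 z = 0"
    using rep_abs_l2_AE[OF l2_fun_zero] by (simp add: zero_l2_def)
  ultimately have "AE z in cell_measure. rep_l2 u z = rep_l2 0 z" by eventually_elim simp
  then show ?thesis by (rule l2_eqI)
qed

lemma weak_deriv_add:
  assumes "v \<in> {1, \<i>}" "weak_deriv v u w" "weak_deriv v u' w'"
  shows "weak_deriv v (u + u') (w + w')"
  using assms(2,3)
  by (simp add: weak_deriv_def pair_add smooth_frechet[OF _ assms(1)] periodic_frechet)

lemma weak_deriv_scaleC:
  assumes "v \<in> {1, \<i>}" "weak_deriv v u w"
  shows "weak_deriv v (c *\<^sub>C u) (c *\<^sub>C w)"
  using assms(2)
  by (simp add: weak_deriv_def pair_scaleC smooth_frechet[OF _ assms(1)] periodic_frechet)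

lemma l2_uminus: "- u = (- 1) *\<^sub>C (u :: l2)"
  using cvec.scale_minus_left[of 1 u] by (simp add: scaleC_one)

lemma weak_deriv_unique:
  assumes "v \<in> {1, \<i>}" "weak_deriv v u w" "weak_deriv v u w'"
  shows "w = w'"
proof -
  have "weak_deriv v (u + (- 1) *\<^sub>C u) (w + (- 1) *\<^sub>C w')"
    by (intro weak_deriv_add weak_deriv_scaleC assms)
  then have wd: "weak_deriv v 0 (w - w')"
    by (simp flip: l2_uminus)
  have "(LINT z|cell_measure. rep_l2 0 z * \<psi> z) = 0" if "smooth \<psi>" "periodic \<psi>" for \<psi>
    using pair_scaleC[OF that, of 0 0] by simp
  then have "w - w' = 0"
    using wd assms(1)
    by (intro pair_zero_imp_zero) (simp add: weak_deriv_def smooth_frechet periodic_frechet)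
  then show ?thesis by simp
qed

lemma wderiv_eq: "v \<in> {1, \<i>} \<Longrightarrow> weak_deriv v u w \<Longrightarrow> wderiv v u = w"
  unfolding wderiv_def using weak_deriv_unique by blast

lemma sobolev_wderiv:
  assumes "u \<in> sobolev (Suc n)" "v \<in> {1, \<i>}"
  shows "weak_deriv v u (wderiv v u)" "wderiv v u \<in> sobolev n"
proof -
  obtain w where "w \<in> sobolev n" "weak_deriv v u w" using assms by auto
  with wderiv_eq[OF assms(2) this(2)]
  show "weak_deriv v u (wderiv v u)" "wderiv v u \<in> sobolev n" by simp_all
qed

lemma sobolev_Suc_subset: "sobolev (Suc n) \<subseteq> sobolev n"
  by (induction n) auto

lemma sobolev_add: "u \<in> sobolev n \<Longrightarrow> u' \<in> sobolev n \<Longrightarrow> u + u' \<in> sobolev n"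
proof (induction n arbitrary: u u')
  case (Suc n)
  show ?case unfolding sobolev.simps mem_Collect_eq
  proof
    fix v :: complex assume v: "v \<in> {1, \<i>}"
    show "\<exists>w\<in>sobolev n. weak_deriv v (u + u') w"
      by (intro bexI[of _ "wderiv v u + wderiv v u'"] weak_deriv_add v Suc.IH
          sobolev_wderiv[OF Suc.prems(1) v] sobolev_wderiv[OF Suc.prems(2) v])
  qed
qed simp

lemma sobolev_scaleC: "u \<in> sobolev n \<Longrightarrow> c *\<^sub>C u \<in> sobolev n"
proof (induction n arbitrary: u)
  case (Suc n)
  show ?case unfolding sobolev.simps mem_Collect_eq
  proof
    fix v :: complex assume v: "v \<in> {1, \<i>}"
    show "\<exists>w\<in>sobolev n. weak_deriv v (c *\<^sub>C u) w"
      by (intro bexI[of _ "c *\<^sub>C wderiv v u"] weak_deriv_scaleC v Suc.IH sobolev_wderiv[OF Suc.prems v])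
  qed
qed simp

lemma sobolev_zero: "0 \<in> sobolev n"
proof (induction n)
  case (Suc n)
  have "weak_deriv v 0 0" if "v \<in> {1, \<i>}" for v
    using pair_scaleC[of _ 0 0] that by (simp add: weak_deriv_def smooth_frechet periodic_frechet)
  then show ?case using Suc by auto
qed simp

lemma wderiv_add:
  assumes "u \<in> sobolev (Suc n)" "u' \<in> sobolev (Suc n)" "v \<in> {1, \<i>}"
  shows "wderiv v (u + u') = wderiv v u + wderiv v u'"
  by (intro wderiv_eq weak_deriv_add assms sobolev_wderiv[OF assms(1)] sobolev_wderiv[OF assms(2)])

lemma wderiv_scaleC:
  assumes "u \<in> sobolev (Suc n)" "v \<in> {1, \<i>}"
  shows "wderiv v (c *\<^sub>C u) = c *\<^sub>C wderiv v u"
  by (intro wderiv_eq weak_deriv_scaleC assms sobolev_wderiv[OF assms(1)])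

text \<open>\<open>H\<^sup>2(\<complex>/\<Lambda>)\<close> with the norm given by the sum of the squared \<open>L\<^sup>2\<close> norms of \<open>u\<close>, its gradient and
  its Hessian.\<close>

typedef h2 = "sobolev 2"
  using sobolev_zero by blast

setup_lifting type_definition_h2

lemma wderiv2_add:
  assumes "u \<in> sobolev 2" "u' \<in> sobolev 2" "v \<in> {1, \<i>}"
  shows "wderiv v (u + u') = wderiv v u + wderiv v u'"
    and "v' \<in> {1, \<i>} \<Longrightarrow>
      wderiv v' (wderiv v u + wderiv v u') = wderiv v' (wderiv v u) + wderiv v' (wderiv v u')"
proof -
  have u: "u \<in> sobolev (Suc (Suc 0))" "u' \<in> sobolev (Suc (Suc 0))"
    using assms(1,2) by (simp_all only: numeral_2_eq_2)
  show "wderiv v (u + u') = wderiv v u + wderiv v u'"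
    by (rule wderiv_add[OF u assms(3)])
  show "wderiv v' (wderiv v u + wderiv v u') = wderiv v' (wderiv v u) + wderiv v' (wderiv v u')"
    if "v' \<in> {1, \<i>}"
    by (rule wderiv_add[OF sobolev_wderiv(2)[OF u(1) assms(3)]
          sobolev_wderiv(2)[OF u(2) assms(3)] that])
qed

lemma wderiv2_scaleC:
  assumes "u \<in> sobolev 2" "v \<in> {1, \<i>}"
  shows "wderiv v (c *\<^sub>C u) = c *\<^sub>C wderiv v u"
    and "v' \<in> {1, \<i>} \<Longrightarrow> wderiv v' (c *\<^sub>C wderiv v u) = c *\<^sub>C wderiv v' (wderiv v u)"
proof -
  have u: "u \<in> sobolev (Suc (Suc 0))"
    using assms(1) by (simp only: numeral_2_eq_2)
  show "wderiv v (c *\<^sub>C u) = c *\<^sub>C wderiv v u"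
    by (rule wderiv_scaleC[OF u assms(2)])
  show "wderiv v' (c *\<^sub>C wderiv v u) = c *\<^sub>C wderiv v' (wderiv v u)"
    if "v' \<in> {1, \<i>}"
    by (rule wderiv_scaleC[OF sobolev_wderiv(2)[OF u assms(2)] that])
qed

lemmas wderiv2_scaleR = wderiv2_scaleC[where c = "of_real r" for r, folded scaleR_scaleC]

lemma sum_directions: "(\<Sum>v\<in>{1, \<i>}. f v) = f 1 + f \<i>" for f :: "complex \<Rightarrow> real"
  by (simp add: complex_eq_iff)

lemma directions: "(1::complex) \<in> {1, \<i>}" "\<i> \<in> {1, \<i>}"
  by simp_all

lemma inner_scaleC_same: "inner (c *\<^sub>C u) (c *\<^sub>C u) = (cmod c)\<^sup>2 * inner u (u :: l2)"
  using norm_scaleC[of c u] by (simp add: power_mult_distrib flip: power2_norm_eq_inner)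

instantiation h2 :: real_inner
begin

lift_definition zero_h2 :: h2 is 0 by (rule sobolev_zero)
lift_definition plus_h2 :: "h2 \<Rightarrow> h2 \<Rightarrow> h2" is "(+)" by (rule sobolev_add)
lift_definition uminus_h2 :: "h2 \<Rightarrow> h2" is uminus
  unfolding l2_uminus by (rule sobolev_scaleC)
definition minus_h2 :: "h2 \<Rightarrow> h2 \<Rightarrow> h2" where "minus_h2 u v = u + - v"
lift_definition scaleR_h2 :: "real \<Rightarrow> h2 \<Rightarrow> h2" is scaleR
  unfolding scaleR_scaleC by (rule sobolev_scaleC)

lift_definition inner_h2 :: "h2 \<Rightarrow> h2 \<Rightarrow> real" is
  "\<lambda>u w. inner u w + (\<Sum>v\<in>{1, \<i>}. inner (wderiv v u) (wderiv v w))
     + (\<Sum>v\<in>{1, \<i>}. \<Sum>v'\<in>{1, \<i>}. inner (wderiv v' (wderiv v u)) (wderiv v' (wderiv v w)))" .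

definition norm_h2 :: "h2 \<Rightarrow> real" where "norm_h2 u = sqrt (inner u u)"
definition sgn_h2 :: "h2 \<Rightarrow> h2" where "sgn_h2 u = inverse (norm u) *\<^sub>R u"
definition dist_h2 :: "h2 \<Rightarrow> h2 \<Rightarrow> real" where "dist_h2 u v = norm (u - v)"
definition uniformity_h2 :: "(h2 \<times> h2) filter" where
  "uniformity_h2 = (INF e\<in>{0 <..}. principal {(u, v). dist u v < e})"
definition open_h2 :: "h2 set \<Rightarrow> bool" where
  "open_h2 S \<longleftrightarrow> (\<forall>u\<in>S. \<forall>\<^sub>F (u', v) in uniformity. u' = u \<longrightarrow> v \<in> S)"

instance
proof
  fix u v w :: h2 and r s :: real
  show "u + v + w = u + (v + w)" by transfer (rule add.assoc)
  show "u + v = v + u" by transfer (rule add.commute)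
  show "0 + u = u" by transfer simp
  show "- u + u = 0" by transfer simp
  show "u - v = u + - v" by (rule minus_h2_def)
  show "r *\<^sub>R (u + v) = r *\<^sub>R u + r *\<^sub>R v" by transfer (rule scaleR_add_right)
  show "(r + s) *\<^sub>R u = r *\<^sub>R u + s *\<^sub>R u" by transfer (rule scaleR_add_left)
  show "r *\<^sub>R s *\<^sub>R u = (r * s) *\<^sub>R u" by transfer simp
  show "1 *\<^sub>R u = u" by transfer simp
  show "sgn u = inverse (norm u) *\<^sub>R u" by (rule sgn_h2_def)
  show "dist u v = norm (u - v)" by (rule dist_h2_def)
  show "(uniformity :: (h2 \<times> h2) filter) = (INF e\<in>{0 <..}. principal {(u, v). dist u v < e})"
    by (rule uniformity_h2_def)
  show "open S \<longleftrightarrow> (\<forall>u\<in>S. \<forall>\<^sub>F (u', v) in uniformity. u' = u \<longrightarrow> v \<in> S)" for S :: "h2 set"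
    by (rule open_h2_def)
  show "inner u v = inner v u" by transfer (simp add: inner_commute)
  show "inner (u + v) w = inner u w + inner v w"
    by transfer (simp only: sum_directions wderiv2_add directions inner_add_left)
  show "inner (r *\<^sub>R u) v = r * inner u v"
    by transfer (simp only: sum_directions wderiv2_scaleR directions inner_scaleR_left inner_scaleR_right distrib_left)
  show "0 \<le> inner u u" by transfer (intro add_nonneg_nonneg sum_nonneg inner_ge_zero)
  show "inner u u = 0 \<longleftrightarrow> u = 0"
  proof
    assume "inner u u = 0"
    then show "u = 0"
    proof transfer
      fix u :: l2
      have "0 \<le> (\<Sum>v\<in>{1, \<i>}. inner (wderiv v u) (wderiv v u))"
        "0 \<le> (\<Sum>v\<in>{1, \<i>}. \<Sum>v'\<in>{1, \<i>}. inner (wderiv v' (wderiv v u)) (wderiv v' (wderiv v u)))"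
        by (intro sum_nonneg inner_ge_zero)+
      moreover assume "inner u u + (\<Sum>v\<in>{1, \<i>}. inner (wderiv v u) (wderiv v u))
        + (\<Sum>v\<in>{1, \<i>}. \<Sum>v'\<in>{1, \<i>}. inner (wderiv v' (wderiv v u)) (wderiv v' (wderiv v u))) = 0"
      ultimately have "inner u u = 0" using inner_ge_zero[of u] by linarith
      then show "u = 0" by simp
    qed
  next
    assume "u = 0"
    have "inner (0 *\<^sub>R u) u = 0 * inner u u" for u :: h2
      by transfer (simp only: sum_directions wderiv2_scaleR directions inner_scaleR_left mult_zero_left add_0)
    moreover have "0 *\<^sub>R (0 :: h2) = 0" by transfer simp
    ultimately show "inner u u = 0" using \<open>u = 0\<close> by (metis mult_zero_left)
  qed
  show "norm u = sqrt (inner u u)" by (rule norm_h2_def)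
qed

end

instantiation h2 :: complex_normed_vector
begin

lift_definition scaleC_h2 :: "complex \<Rightarrow> h2 \<Rightarrow> h2" is scaleC by (rule sobolev_scaleC)

instance
proof
  fix a b :: complex and r :: real and u v :: h2
  show "a *\<^sub>C (u + v) = a *\<^sub>C u + a *\<^sub>C v" by transfer (rule scaleC_add_right)
  show "(a + b) *\<^sub>C u = a *\<^sub>C u + b *\<^sub>C u" by transfer (rule scaleC_add_left)
  show "a *\<^sub>C b *\<^sub>C u = (a * b) *\<^sub>C u" by transfer (rule scaleC_scaleC)
  show "r *\<^sub>R u = complex_of_real r *\<^sub>C u" by transfer (rule scaleR_scaleC)
  have "inner (a *\<^sub>C u) (a *\<^sub>C u) = (cmod a)\<^sup>2 * inner u u"
    by transfer (simp only: sum_directions wderiv2_scaleC directions inner_scaleC_same distrib_left)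
  then show "norm (a *\<^sub>C u) = cmod a * norm u"
    by (simp add: norm_eq_sqrt_inner real_sqrt_mult)
qed

end

section \<open>The operators \<open>Q(\<alpha>,k)\<close>\<close>

text \<open>\<open>2 D\<^bsub>zbar\<^esub> = (1/\<i>)(\<partial>\<^sub>1 + \<i> \<partial>\<^sub>2)\<close>, meaningful on \<open>H\<^sup>1\<close>, which contains \<open>(2 D\<^bsub>zbar\<^esub> + k) u\<close> for
  \<open>u\<close> in \<open>H\<^sup>2\<close>.\<close>

definition two_Dbar :: "l2 \<Rightarrow> l2" where
  "two_Dbar u = (1 / \<i>) *\<^sub>C (wderiv 1 u + \<i> *\<^sub>C wderiv \<i> u)"

definition l2_mult :: "(complex \<Rightarrow> complex) \<Rightarrow> l2 \<Rightarrow> l2" where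
  "l2_mult V u = abs_l2 (\<lambda>z. V z * rep_l2 u z)"

definition Q_map :: "(complex \<Rightarrow> complex) \<Rightarrow> complex \<Rightarrow> complex \<Rightarrow> h2 \<Rightarrow> l2" where
  "Q_map V \<alpha> k u =
     (let P = (\<lambda>w. two_Dbar w + k *\<^sub>C w)
      in P (P (Rep_h2 u)) - \<alpha>\<^sup>2 *\<^sub>C l2_mult V (Rep_h2 u))"

definition Q_op :: "(complex \<Rightarrow> complex) \<Rightarrow> complex \<Rightarrow> complex \<Rightarrow> (h2 \<Rightarrow>\<^sub>L l2)" where
  "Q_op V \<alpha> k = Blinfun (Q_map V \<alpha> k)"

lemma norm_h2_bounds:
  assumes "v \<in> {1, \<i>}" "v' \<in> {1, \<i>}"
  shows "norm (Rep_h2 u) \<le> norm u" "norm (wderiv v (Rep_h2 u)) \<le> norm u"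
    "norm (wderiv v' (wderiv v (Rep_h2 u))) \<le> norm u"
proof -
  have "v = 1 \<or> v = \<i>" "v' = 1 \<or> v' = \<i>" using assms by auto
  then have "inner (Rep_h2 u) (Rep_h2 u) \<le> inner u u
    \<and> inner (wderiv v (Rep_h2 u)) (wderiv v (Rep_h2 u)) \<le> inner u u
    \<and> inner (wderiv v' (wderiv v (Rep_h2 u))) (wderiv v' (wderiv v (Rep_h2 u))) \<le> inner u u"
    using inner_ge_zero[of "Rep_h2 u"] inner_ge_zero[of "wderiv 1 (Rep_h2 u)"]
      inner_ge_zero[of "wderiv \<i> (Rep_h2 u)"]
      inner_ge_zero[of "wderiv 1 (wderiv 1 (Rep_h2 u))"] inner_ge_zero[of "wderiv \<i> (wderiv 1 (Rep_h2 u))"]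
      inner_ge_zero[of "wderiv 1 (wderiv \<i> (Rep_h2 u))"] inner_ge_zero[of "wderiv \<i> (wderiv \<i> (Rep_h2 u))"]
    by (elim disjE; simp only: inner_h2.rep_eq sum_directions; intro conjI; linarith)
  then show "norm (Rep_h2 u) \<le> norm u" "norm (wderiv v (Rep_h2 u)) \<le> norm u"
    "norm (wderiv v' (wderiv v (Rep_h2 u))) \<le> norm u"
    by (simp_all add: norm_eq_sqrt_inner)
qed

lemma bounded_linear_h2:
  assumes "v \<in> {1, \<i>}" "v' \<in> {1, \<i>}"
  shows "bounded_linear Rep_h2" "bounded_linear (\<lambda>u. wderiv v (Rep_h2 u))"
    "bounded_linear (\<lambda>u. wderiv v' (wderiv v (Rep_h2 u)))"
  by (intro bounded_linear_intro[where K = 1];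
      simp add: plus_h2.rep_eq scaleR_h2.rep_eq wderiv2_add assms[simplified] norm_h2_bounds[OF assms]
        wderiv2_scaleR Rep_h2)+

lemma rep_l2_mult_AE:
  assumes "periodic V" "smooth V"
  shows "AE z in cell_measure. rep_l2 (l2_mult V u) z = V z * rep_l2 u z"
  unfolding l2_mult_def by (intro rep_abs_l2_AE l2_fun_mult_smooth l2_fun_rep assms)

lemma bounded_linear_l2_mult:
  assumes "periodic V" "smooth V"
  shows "bounded_linear (l2_mult V)"
proof -
  note m = rep_l2_mult_AE[OF assms]
  obtain C where C: "\<And>z. cmod (V z) \<le> C"
    using periodic_continuous_bounded[OF assms(1) smooth_continuous[OF assms(2)]] by blast
  have C0: "0 \<le> C" using C[of 0] norm_ge_zero[of "V 0"] by linarith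
  have inner_eq: "inner u u = (LINT z|cell_measure. (cmod (rep_l2 u z))\<^sup>2)" for u
  proof -
    have "inner (abs_l2 (rep_l2 u)) (abs_l2 (rep_l2 u)) =
        (LINT z|cell_measure. Re (rep_l2 u z * cnj (rep_l2 u z)))"
      by (rule inner_l2.abs_eq) (simp_all add: l2_rel_refl_iff l2_fun_rep)
    then show ?thesis
      by (simp add: complex_mult_cnj cmod_power2 flip: power2_eq_square)
  qed
  show ?thesis
  proof (rule bounded_linear_intro[where K = C])
    fix u v :: l2 and r :: real
    show "l2_mult V (u + v) = l2_mult V u + l2_mult V v"
    proof (rule l2_eqI)
      show "AE z in cell_measure. rep_l2 (l2_mult V (u + v)) z = rep_l2 (l2_mult V u + l2_mult V v) z"
        using m[of "u + v"] m[of u] m[of v] rep_add_AE[of u v]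
          rep_add_AE[of "l2_mult V u" "l2_mult V v"]
        by eventually_elim (simp add: distrib_left)
    qed
    show "l2_mult V (r *\<^sub>R u) = r *\<^sub>R l2_mult V u"
      unfolding scaleR_scaleC
    proof (rule l2_eqI)
      show "AE z in cell_measure.
          rep_l2 (l2_mult V (of_real r *\<^sub>C u)) z = rep_l2 (of_real r *\<^sub>C l2_mult V u) z"
        using m[of "of_real r *\<^sub>C u"] m[of u] rep_scaleC_AE[of "of_real r" u]
          rep_scaleC_AE[of "of_real r" "l2_mult V u"]
        by eventually_elim simp
    qed
    have "inner (l2_mult V u) (l2_mult V u) \<le> (LINT z|cell_measure. C\<^sup>2 * (cmod (rep_l2 u z))\<^sup>2)"
      unfolding inner_eq
    proof (rule integral_mono_AE)
      show "integrable cell_measure (\<lambda>z. (cmod (rep_l2 (l2_mult V u) z))\<^sup>2)"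
        "integrable cell_measure (\<lambda>z. C\<^sup>2 * (cmod (rep_l2 u z))\<^sup>2)"
        using l2_fun_rep by (auto simp: l2_fun_def)
      show "AE z in cell_measure. (cmod (rep_l2 (l2_mult V u) z))\<^sup>2 \<le> C\<^sup>2 * (cmod (rep_l2 u z))\<^sup>2"
        using m[of u]
        by eventually_elim (use C in \<open>auto simp: norm_mult power_mult_distrib intro!: mult_right_mono power_mono\<close>)
    qed
    also have "\<dots> = C\<^sup>2 * inner u u" by (simp add: inner_eq)
    finally show "norm (l2_mult V u) \<le> norm u * C"
      using real_sqrt_le_mono[of "inner (l2_mult V u) (l2_mult V u)" "C\<^sup>2 * inner u u"] C0
      by (simp add: norm_eq_sqrt_inner real_sqrt_mult mult.commute)
  qed
qed

lemma bounded_linear_Q_map: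
  assumes "periodic V" "smooth V"
  shows "bounded_linear (Q_map V \<alpha> k)"
proof -
  let ?R = Rep_h2
  have R: "?R u \<in> sobolev (Suc (Suc 0))" for u
    using Rep_h2[of u] by (simp only: numeral_2_eq_2)
  have i: "(1::complex) \<in> {1, \<i>}" "\<i> \<in> {1, \<i>}" by auto
  have d: "wderiv v (?R u) \<in> sobolev (Suc 0)" if "v \<in> {1, \<i>}" for u v
    by (rule sobolev_wderiv(2)[OF R that])
  have R1: "?R u \<in> sobolev (Suc 0)" for u using R sobolev_Suc_subset by blast
  have wd: "wderiv v ((1 / \<i>) *\<^sub>C (wderiv 1 (?R u) + \<i> *\<^sub>C wderiv \<i> (?R u)) + k *\<^sub>C ?R u) =
      (1 / \<i>) *\<^sub>C (wderiv v (wderiv 1 (?R u)) + \<i> *\<^sub>C wderiv v (wderiv \<i> (?R u)))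
      + k *\<^sub>C wderiv v (?R u)" if v: "v \<in> {1, \<i>}" for u v
    by (simp only: wderiv_add[where n = 0, OF _ _ v] wderiv_scaleC[where n = 0, OF _ v] d i R1 sobolev_add sobolev_scaleC)
  have eq: "Q_map V \<alpha> k = (\<lambda>u.
      (1 / \<i>) *\<^sub>C ((1 / \<i>) *\<^sub>C (wderiv 1 (wderiv 1 (?R u)) + \<i> *\<^sub>C wderiv 1 (wderiv \<i> (?R u)))
      + k *\<^sub>C wderiv 1 (?R u) + \<i> *\<^sub>C ((1 / \<i>) *\<^sub>C (wderiv \<i> (wderiv 1 (?R u)) +
         \<i> *\<^sub>C wderiv \<i> (wderiv \<i> (?R u))) + k *\<^sub>C wderiv \<i> (?R u)))
      + k *\<^sub>C ((1 / \<i>) *\<^sub>C (wderiv 1 (?R u) + \<i> *\<^sub>C wderiv \<i> (?R u)) + k *\<^sub>C ?R u)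
      - \<alpha>\<^sup>2 *\<^sub>C l2_mult V (?R u))"
    unfolding Q_map_def Let_def two_Dbar_def by (simp only: wd[OF i(1)] wd[OF i(2)])
  note bl = bounded_linear_h2[OF i(1) i(1)] bounded_linear_h2[OF i(1) i(2)]
    bounded_linear_h2[OF i(2) i(1)] bounded_linear_h2[OF i(2) i(2)]
  show ?thesis
    unfolding eq
    by (intro bounded_linear_sub bounded_linear_add bounded_linear_compose[OF bounded_linear_scaleC]
        bl bounded_linear_compose[OF bounded_linear_l2_mult[OF assms]])
qed

lemma Q_op_apply:
  assumes "periodic V" "smooth V"
  shows "blinfun_apply (Q_op V \<alpha> k) u = Q_map V \<alpha> k u"
  unfolding Q_op_def by (simp add: bounded_linear_Blinfun_apply bounded_linear_Q_map assms)

end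

theory Submission
  imports Defs "HOL-Complex_Analysis.Complex_Analysis" "Jordan_Normal_Form.Determinant"
begin

text \<open>
  In the Fourier basis, division by \<open>p\<^sup>2\<close> (by \<open>1\<close> for \<open>p = 0\<close>) turns \<open>Q(\<alpha>, k)\<close> into a quadratic polynomial in
  \<open>k\<close> and \<open>\<alpha>\<close> of the form identity plus compact.  Locally uniformly in
  \<open>(\<alpha>, k)\<close> a Schur complement with respect to finitely many Fourier modes reduces invertibility to the
  nonvanishing of a holomorphic determinant \<open>f(\<alpha>, k)\<close>, and the trace defining the multiplicity equals
  \<open>\<ointegral> f'/f\<close>, so that \<open>m(\<alpha>, k)\<close> is the order of vanishing of \<open>f(\<alpha>, \<cdot>)\<close> at \<open>k\<close>.

  At \<open>\<alpha> = 0\<close> the operator is diagonal with entries \<open>(p + k)\<^sup>2\<close>, hence \<open>f\<close> has double zeros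
  exactly on \<open>\<Lambda>\<^sup>*\<close>.  The exceptional set consists of the \<open>\<alpha>\<close> with \<open>f(\<alpha>, \<cdot>) = 0\<close>; it is discrete,
  so its complement is connected.  Zeros are invariant under translation by \<open>\<Lambda>\<^sup>*\<close> and under rotation by
  \<open>2\<pi>/3\<close>; a zero that leaves a dual lattice point is therefore accompanied by its two rotated
  copies, which is one zero too many for Rouche's theorem.  The double zeros stay on \<open>\<Lambda>\<^sup>*\<close>.
\<close>

text \<open>The symbol \<open>2 / p\<close> of the term linear in \<open>k\<close> is not
  Hilbert-Schmidt, because the sum of |p|^(-2) over a planar lattice diverges; neither the Fredholm
  nor the Carleman determinant applies directly. The Schur complement asks only that truncated tails
  tend to 0 in norm. The price is a determinant that depends on a radius and on a number of modes.
  Its zero set does not depend on them: it consists of the parameters with a nontrivial kernel.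
  Symmetries are therefore proved for kernels, and the rotation argument counts points, each of
  order at least 1, without comparing orders at different points.

  The exceptional set is discrete because it lies in the zero set of the holomorphic function
  \<alpha> \<mapsto> f(\<alpha>, 1/2), which is nonzero at \<alpha> = 0. The rotation stems from
  \<open>V (omega * z) = cnj omega * V z\<close>: pulling back along z \<mapsto> omega z gives the
  potential and the squared first-order part the same factor once \<open>k\<close> is replaced by
  \<open>cnj omega * k\<close>. Conjugated by translations, it becomes a rotation of the kernel set
  about every point of the dual lattice.\<close>

section \<open>Complex Hilbert spaces\<close>

text \<open>The Hermitian product, linear in the first argument, whose real part is the given real
  inner product; this forces Im <x, y> = Re <x, i y>.\<close>

definition cip :: "'a::{complex_normed_vector,real_inner} \<Rightarrow> 'a \<Rightarrow> complex" where
  "cip x y = Complex (inner x y) (inner x (\<i> *\<^sub>C y))"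

lemma bounded_bilinear_scaleC:
  "bounded_bilinear (scaleC :: complex \<Rightarrow> 'a::complex_normed_vector \<Rightarrow> 'a)"
proof
  show "(r *\<^sub>R a) *\<^sub>C b = r *\<^sub>R a *\<^sub>C b" for r a and b :: 'a
    by (simp add: scaleR_scaleC scaleC_scaleC scaleR_conv_of_real)
  show "a *\<^sub>C r *\<^sub>R b = r *\<^sub>R a *\<^sub>C b" for r a and b :: 'a
    by (simp add: scaleR_scaleC scaleC_scaleC mult.commute)
  show "\<exists>K. \<forall>a (b::'a). norm (a *\<^sub>C b) \<le> norm a * norm b * K"
    by (rule exI[of _ 1]) (simp add: norm_scaleC)
qed (simp_all add: scaleC_add_left scaleC_add_right)

lemmas tendsto_scaleC = bounded_bilinear.tendsto[OF bounded_bilinear_scaleC]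
lemmas continuous_on_scaleC [continuous_intros] =
  bounded_bilinear.continuous_on[OF bounded_bilinear_scaleC]

lemma scaleC_minus_one: "(-1) *\<^sub>C x = - (x :: 'a::complex_normed_vector)"
  using cvec.scale_minus_left[of 1 x] by (simp add: scaleC_one)

text \<open>Complex scaling and the real inner product are linked only through the norm, so
  polarisation is what makes multiplication by \<open>\<i>\<close> orthogonal.\<close>

lemma inner_ii: "inner (\<i> *\<^sub>C x) (\<i> *\<^sub>C y) = inner x (y :: 'a::{complex_normed_vector,real_inner})"
proof -
  have "norm (\<i> *\<^sub>C x + \<i> *\<^sub>C y) = norm (x + y)"
    by (simp add: norm_scaleC flip: scaleC_add_right)
  then show ?thesis by (simp add: dot_norm norm_scaleC)
qed

lemma inner_i_left: "inner (\<i> *\<^sub>C x) y = - inner x (\<i> *\<^sub>C y :: 'a::{complex_normed_vector,real_inner})"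
  using inner_ii[of "\<i> *\<^sub>C x" y] by (simp add: scaleC_scaleC scaleC_minus_one)

lemma cip_add_left: "cip (x + y) z = cip x z + cip y z"
  by (simp add: cip_def inner_add_left complex_eq_iff)

lemma scaleC_Complex: "c *\<^sub>C x = Re c *\<^sub>R x + Im c *\<^sub>R (\<i> *\<^sub>C x)"
proof -
  have "c = of_real (Re c) + of_real (Im c) * \<i>" by (simp add: complex_eq_iff)
  then have "c *\<^sub>C x = (of_real (Re c) + of_real (Im c) * \<i>) *\<^sub>C x" by simp
  then show ?thesis by (simp only: scaleC_add_left scaleR_scaleC scaleC_scaleC)
qed

lemma cip_scaleC_left: "cip (c *\<^sub>C x) y = c * cip x y"
  by (simp add: cip_def scaleC_Complex[of c] inner_add_left inner_i_left complex_eq_iff inner_ii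
      scaleC_scaleC scaleC_minus_one)

lemma cip_commute: "cip y x = cnj (cip x y)"
  by (simp add: cip_def complex_eq_iff inner_commute[of y] inner_i_left)

lemma cip_self: "cip x x = of_real ((norm x)\<^sup>2)"
proof -
  have "inner x (\<i> *\<^sub>C x) = 0"
    using inner_i_left[of x x] by (simp add: inner_commute)
  then show ?thesis by (simp add: cip_def complex_eq_iff power2_norm_eq_inner)
qed

lemma cip_zero_left [simp]: "cip 0 y = 0"
  by (simp add: cip_def complex_eq_iff)

lemma cip_minus_left: "cip (- x) y = - cip x y"
  using cip_scaleC_left[of "-1" x y] by (simp add: scaleC_minus_one)

lemma cip_diff_left: "cip (x - y) z = cip x z - cip y z"
  by (simp only: diff_conv_add_uminus cip_add_left cip_minus_left)

lemma cip_sum_left: "cip (\<Sum>i\<in>I. f i) y = (\<Sum>i\<in>I. cip (f i) y)"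
  by (induction I rule: infinite_finite_induct) (simp_all add: cip_add_left)

lemma cip_bound: "cmod (cip x y) \<le> norm x * norm y"
proof (cases "cip x y = 0")
  case False
  \<comment> \<open>A unimodular factor that turns \<open>cip x y\<close> into its modulus, so that
    the real Cauchy-Schwarz inequality suffices.\<close>
  define c where "c = cnj (cip x y) / cmod (cip x y)"
  have c: "cmod c = 1" using False by (simp add: c_def norm_divide)
  have "c * cip x y = of_real (cmod (cip x y))"
    using False by (simp add: c_def complex_norm_square power2_eq_square mult.commute[of "cnj _"]
        flip: complex_norm_square)
  then have "cmod (cip x y) = Re (cip (c *\<^sub>C x) y)" by (simp add: cip_scaleC_left)
  also have "\<dots> = inner (c *\<^sub>C x) y" by (simp add: cip_def)
  also have "\<dots> \<le> norm (c *\<^sub>C x) * norm y" by (rule norm_cauchy_schwarz)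
  finally show ?thesis by (simp add: norm_scaleC c)
qed simp

lemma bounded_linear_cip_left: "bounded_linear (\<lambda>x. cip x y)"
  by (rule bounded_linear_intro[where K = "norm y"])
    (simp_all add: cip_add_left scaleR_scaleC cip_scaleC_left cip_bound scaleR_conv_of_real)

lemma cip_eqI: "(\<And>y. cip x y = cip x' y) \<Longrightarrow> x = x'"
  using cip_self[of "x - x'"] by (simp add: cip_diff_left)

text \<open>Testing with \<open>y = v\<close> turns scalar bounds into a norm bound; this is how
  scalar Cauchy estimates reach vector-valued functions.\<close>

lemma norm_le_cip:
  assumes "\<And>y. cmod (cip v y) \<le> K * norm y" "0 \<le> K"
  shows "norm v \<le> K"
proof (cases "norm v = 0")
  case False
  then have "norm v * norm v \<le> K * norm v"
    using assms(1)[of v] by (simp add: cip_self power2_eq_square norm_mult)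
  then show ?thesis using False by simp
qed (use assms in simp)

text \<open>The operator type records real linearity only, so complex linearity travels as a
  separate predicate.\<close>

definition clin :: "('a::complex_normed_vector \<Rightarrow>\<^sub>L 'b::complex_normed_vector) \<Rightarrow> bool" where
  "clin A \<longleftrightarrow> (\<forall>c x. blinfun_apply A (c *\<^sub>C x) = c *\<^sub>C blinfun_apply A x)"

lemma clinD: "clin A \<Longrightarrow> blinfun_apply A (c *\<^sub>C x) = c *\<^sub>C blinfun_apply A x"
  by (simp add: clin_def)

lemma clin_id [simp]: "clin id_blinfun"
  and clin_add: "clin A \<Longrightarrow> clin B \<Longrightarrow> clin (A + B)"
  and clin_diff: "clin A \<Longrightarrow> clin B \<Longrightarrow> clin (A - B)"
  and clin_scaleC: "clin A \<Longrightarrow> clin (c *\<^sub>C A)"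
  and clin_compose: "clin C \<Longrightarrow> clin D \<Longrightarrow> clin (C o\<^sub>L D)"
  by (simp_all add: clin_def blinfun.bilinear_simps scaleC_add_right cvec.scale_right_diff_distrib
      scaleC_blinfun.rep_eq scaleC_scaleC mult.commute)

section \<open>Orthonormal bases and diagonal operators\<close>

locale orthonormal_basis =
  fixes e :: "nat \<Rightarrow> 'a::{complex_normed_vector,real_inner,banach}"
  assumes orth: "cip (e i) (e j) = (if i = j then 1 else 0)"
    and total: "(\<And>i. cip x (e i) = 0) \<Longrightarrow> x = 0"
begin

lemma coeff_eqI: "(\<And>i. cip x (e i) = cip y (e i)) \<Longrightarrow> x = y"
  using total[of "x - y"] by (simp add: cip_diff_left)

lemma norm_lincomb:
  assumes "finite I"
  shows "(norm (\<Sum>i\<in>I. c i *\<^sub>C e i))\<^sup>2 = (\<Sum>i\<in>I. (cmod (c i))\<^sup>2)"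
proof -
  have "complex_of_real ((norm (\<Sum>i\<in>I. c i *\<^sub>C e i))\<^sup>2) =
      (\<Sum>i\<in>I. c i * cip (e i) (\<Sum>i\<in>I. c i *\<^sub>C e i))"
    by (simp only: cip_self[symmetric] cip_sum_left cip_scaleC_left)
  also have "\<dots> = (\<Sum>i\<in>I. c i * cnj (c i))"
  proof (rule sum.cong)
    fix i assume "i \<in> I"
    have "cip (\<Sum>i\<in>I. c i *\<^sub>C e i) (e i) = (\<Sum>j\<in>I. if j = i then c j else 0)"
      by (simp add: cip_sum_left cip_scaleC_left orth if_distrib cong: if_cong)
    also have "\<dots> = c i" using assms \<open>i \<in> I\<close> by simp
    finally show "c i * cip (e i) (\<Sum>i\<in>I. c i *\<^sub>C e i) = c i * cnj (c i)"
      by (metis cip_commute)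
  qed simp
  also have "\<dots> = of_real (\<Sum>i\<in>I. (cmod (c i))\<^sup>2)"
    by (simp flip: complex_norm_square)
  finally show ?thesis using of_real_eq_iff by blast
qed

lemma lincomb_summable:
  assumes "summable (\<lambda>i. (cmod (c i))\<^sup>2)"
  shows "summable (\<lambda>i. c i *\<^sub>C e i)"
  unfolding summable_Cauchy
proof (intro allI impI)
  fix \<epsilon> :: real assume "\<epsilon> > 0"
  then obtain N where N: "\<And>m n. m \<ge> N \<Longrightarrow> norm (\<Sum>i\<in>{m..<n}. (cmod (c i))\<^sup>2) < \<epsilon>\<^sup>2"
    using assms unfolding summable_Cauchy by (meson zero_less_power)
  have "norm (\<Sum>i\<in>{m..<n}. c i *\<^sub>C e i) < \<epsilon>" if "m \<ge> N" for m n
  proof -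
    have "(norm (\<Sum>i\<in>{m..<n}. c i *\<^sub>C e i))\<^sup>2 < \<epsilon>\<^sup>2"
      using N[OF that, of n] by (simp add: norm_lincomb)
    then show ?thesis using \<open>\<epsilon> > 0\<close> by (meson less_eq_real_def power_less_imp_less_base)
  qed
  then show "\<exists>N. \<forall>m\<ge>N. \<forall>n. norm (\<Sum>i\<in>{m..<n}. c i *\<^sub>C e i) < \<epsilon>" by blast
qed

lemma coeff_suminf:
  assumes "summable (\<lambda>i. (cmod (c i))\<^sup>2)"
  shows "cip (\<Sum>i. c i *\<^sub>C e i) (e j) = c j"
proof -
  have "(\<lambda>i. cip (c i *\<^sub>C e i) (e j)) sums cip (\<Sum>i. c i *\<^sub>C e i) (e j)"
    by (rule bounded_linear.sums[OF bounded_linear_cip_left summable_sums[OF lincomb_summable[OF assms]]])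
  moreover have "(\<lambda>i. cip (c i *\<^sub>C e i) (e j)) = (\<lambda>i. if i = j then c i else 0)"
    by (auto simp: cip_scaleC_left orth)
  ultimately show ?thesis using sums_unique2[OF _ sums_single[of j c]] by simp
qed

text \<open>For the partial sum \<open>p\<close>, both \<open>cip p x\<close> and
  \<open>cip p p\<close> equal the sum of squares, so Cauchy-Schwarz gives |p|^2 \<le> |p|
  |x|.\<close>

lemma bessel: "(\<Sum>i<n. (cmod (cip x (e i)))\<^sup>2) \<le> (norm x)\<^sup>2"
proof -
  define p where "p = (\<Sum>i<n. cip x (e i) *\<^sub>C e i)"
  have "cip p x = (\<Sum>i<n. cip x (e i) * cnj (cip x (e i)))"
    unfolding p_def cip_sum_left cip_scaleC_left by (metis (no_types, lifting) cip_commute sum.cong)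
  also have "\<dots> = of_real (\<Sum>i<n. (cmod (cip x (e i)))\<^sup>2)"
    by (simp flip: complex_norm_square)
  also have "\<dots> = of_real ((norm p)\<^sup>2)"
    by (simp only: p_def norm_lincomb[OF finite_lessThan])
  finally have px: "cip p x = of_real ((norm p)\<^sup>2)" .
  then have "(norm p)\<^sup>2 \<le> norm p * norm x"
    using cip_bound[of p x] by (simp add: norm_power)
  then have "norm p \<le> norm x" by (cases "norm p = 0") (simp_all add: power2_eq_square)
  then have "(norm p)\<^sup>2 \<le> (norm x)\<^sup>2" by (simp add: power_mono)
  then show ?thesis by (simp add: p_def norm_lincomb)
qed

lemma coeff_summable: "summable (\<lambda>i. (cmod (cip x (e i)))\<^sup>2)"
proof (rule bounded_imp_summable)
  show "(\<Sum>i\<le>n. (cmod (cip x (e i)))\<^sup>2) \<le> (norm x)\<^sup>2" for n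
    using bessel[of x "Suc n"] by (simp only: lessThan_Suc_atMost)
qed simp

lemma expansion: "(\<lambda>i. cip x (e i) *\<^sub>C e i) sums x"
proof -
  have "(\<Sum>i. cip x (e i) *\<^sub>C e i) = x"
    by (rule coeff_eqI) (simp add: coeff_suminf coeff_summable)
  then show ?thesis using summable_sums[OF lincomb_summable[OF coeff_summable[of x]]] by simp
qed

lemma parseval: "(\<lambda>i. (cmod (cip x (e i)))\<^sup>2) sums (norm x)\<^sup>2"
proof -
  have "(\<lambda>n. (norm (\<Sum>i<n. cip x (e i) *\<^sub>C e i))\<^sup>2) \<longlonglongrightarrow> (norm x)\<^sup>2"
    by (rule tendsto_power[OF tendsto_norm[OF expansion[of x, unfolded sums_def]]])
  then show ?thesis by (simp add: sums_def norm_lincomb)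
qed

lemma cip_sums: "(\<lambda>i. cip x (e i) * cnj (cip y (e i))) sums cip x y"
proof -
  have "cip (e i) y = cnj (cip y (e i))" for i by (rule cip_commute)
  then show ?thesis
    using bounded_linear.sums[OF bounded_linear_cip_left[of y] expansion[of x]]
    by (simp add: cip_scaleC_left)
qed

lemma norm_le_coeff:
  assumes "\<And>i. cmod (cip x (e i)) \<le> K * cmod (cip y (e i))" "0 \<le> K"
  shows "norm x \<le> K * norm y"
proof -
  have "(norm x)\<^sup>2 \<le> K\<^sup>2 * (norm y)\<^sup>2"
  proof (rule sums_le[OF _ parseval sums_mult[OF parseval]])
    show "(cmod (cip x (e i)))\<^sup>2 \<le> K\<^sup>2 * (cmod (cip y (e i)))\<^sup>2" for i
      using power_mono[OF assms(1)[of i], of 2] by (simp add: power_mult_distrib)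
  qed
  then have "(norm x)\<^sup>2 \<le> (K * norm y)\<^sup>2" by (simp only: power_mult_distrib)
  then show ?thesis by (rule power2_le_imp_le) (use assms(2) in simp)
qed

text \<open>The diagonal operator with entries \<open>\<sigma> i\<close>; the series is meaningful
  once \<open>\<sigma>\<close> is bounded, which the facts about it assume.\<close>

definition multiplier :: "(nat \<Rightarrow> complex) \<Rightarrow> 'a \<Rightarrow>\<^sub>L 'a" where
  "multiplier \<sigma> = Blinfun (\<lambda>x. \<Sum>i. (\<sigma> i * cip x (e i)) *\<^sub>C e i)"

lemma
  assumes "\<And>i. cmod (\<sigma> i) \<le> K"
  shows coeff_multiplier: "cip (multiplier \<sigma> x) (e i) = \<sigma> i * cip x (e i)"
    and clin_multiplier: "clin (multiplier \<sigma>)"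
    and norm_multiplier: "norm (multiplier \<sigma>) \<le> K"
proof -
  have K: "0 \<le> K" by (rule order_trans[OF norm_ge_zero assms[of 0]])
  define M where "M = (\<lambda>x. \<Sum>i. (\<sigma> i * cip x (e i)) *\<^sub>C e i)"
  have M: "cip (M x) (e i) = \<sigma> i * cip x (e i)" for x i
    unfolding M_def
  proof (rule coeff_suminf, rule summable_comparison_test')
    show "summable (\<lambda>i. K\<^sup>2 * (cmod (cip x (e i)))\<^sup>2)"
      by (intro summable_mult coeff_summable)
    show "norm ((cmod (\<sigma> i * cip x (e i)))\<^sup>2) \<le> K\<^sup>2 * (cmod (cip x (e i)))\<^sup>2" for i
      using power_mono[OF assms[of i] norm_ge_zero, of 2]
      by (simp add: norm_mult power_mult_distrib mult_right_mono)
  qed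
  have le: "norm (M x) \<le> K * norm x" for x
  proof (rule norm_le_coeff[OF _ K])
    show "cmod (cip (M x) (e i)) \<le> K * cmod (cip x (e i))" for i
      unfolding M norm_mult by (rule mult_right_mono[OF assms norm_ge_zero])
  qed
  have "bounded_linear M"
  proof (rule bounded_linear_intro[where K = K])
    show "norm (M x) \<le> norm x * K" for x using le[of x] by (simp add: mult.commute)
    show "M (x + y) = M x + M y" for x y
      by (rule coeff_eqI) (simp add: M cip_add_left distrib_left)
    show "M (r *\<^sub>R x) = r *\<^sub>R M x" for r x
      by (rule coeff_eqI) (simp add: M scaleR_scaleC cip_scaleC_left)
  qed
  then have eq: "blinfun_apply (multiplier \<sigma>) = M"
    unfolding multiplier_def M_def by (rule bounded_linear_Blinfun_apply)
  show "cip (multiplier \<sigma> x) (e i) = \<sigma> i * cip x (e i)" by (simp add: eq M)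
  show "clin (multiplier \<sigma>)"
    unfolding clin_def eq by (intro allI coeff_eqI) (simp add: M cip_scaleC_left)
  show "norm (multiplier \<sigma>) \<le> K"
    by (rule norm_blinfun_bound[OF K]) (simp add: eq le)
qed

definition proj :: "nat \<Rightarrow> 'a \<Rightarrow>\<^sub>L 'a" where
  "proj n = multiplier (\<lambda>i. if i < n then 1 else 0)"

lemma coeff_proj: "cip (proj n x) (e i) = (if i < n then cip x (e i) else 0)"
  unfolding proj_def by (subst coeff_multiplier[where K = 1]) auto

lemma clin_proj: "clin (proj n)"
  unfolding proj_def by (rule clin_multiplier[where K = 1]) auto

lemma proj_eq: "proj n x = (\<Sum>i<n. cip x (e i) *\<^sub>C e i)"
proof (rule coeff_eqI)
  fix j
  have "cip (\<Sum>i<n. cip x (e i) *\<^sub>C e i) (e j) = (\<Sum>i<n. if i = j then cip x (e i) else 0)"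
    by (simp add: cip_sum_left cip_scaleC_left orth if_distrib cong: if_cong)
  then show "cip (proj n x) (e j) = cip (\<Sum>i<n. cip x (e i) *\<^sub>C e i) (e j)"
    by (simp add: coeff_proj)
qed

lemma proj_e: "i < n \<Longrightarrow> proj n (e i) = e i"
  by (rule coeff_eqI) (auto simp: coeff_proj orth)

lemma proj_idem: "proj n (proj n x) = proj n x"
  by (rule coeff_eqI) (auto simp: coeff_proj)

text \<open>Compactness of a diagonal operator with decaying symbol, in the form used later: it is
  small once the first \<open>n\<close> basis vectors are removed.\<close>

lemma norm_multiplier_tail:
  assumes "\<And>i. cmod (\<sigma> i) \<le> K" "\<And>i. i \<ge> n \<Longrightarrow> cmod (\<sigma> i) \<le> \<delta>" "0 \<le> \<delta>"
  shows "norm (multiplier \<sigma> o\<^sub>L (id_blinfun - proj n)) \<le> \<delta>"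
proof (rule norm_blinfun_bound[OF assms(3)])
  fix x
  show "norm (blinfun_apply (multiplier \<sigma> o\<^sub>L (id_blinfun - proj n)) x) \<le> \<delta> * norm x"
  proof (rule norm_le_coeff[OF _ assms(3)])
    fix i
    have "cip ((multiplier \<sigma> o\<^sub>L (id_blinfun - proj n)) x) (e i) = (if i < n then 0 else \<sigma> i * cip x (e i))"
      by (simp add: coeff_multiplier[OF assms(1)] coeff_proj blinfun.diff_left cip_diff_left)
    then show "cmod (cip ((multiplier \<sigma> o\<^sub>L (id_blinfun - proj n)) x) (e i)) \<le> \<delta> * cmod (cip x (e i))"
      using assms(2)[of i] assms(3) by (auto simp: norm_mult intro: mult_right_mono)
  qed
qed

end

section \<open>Operator-valued holomorphic functions\<close>

definition has_cderiv :: "(complex \<Rightarrow> 'a::complex_normed_vector) \<Rightarrow> 'a \<Rightarrow> complex \<Rightarrow> bool" where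
  "has_cderiv F D z \<longleftrightarrow> ((\<lambda>h. (1 / h) *\<^sub>C (F (z + h) - F z)) \<longlongrightarrow> D) (at 0)"

lemma complex_deriv_eq: "has_cderiv F D z \<Longrightarrow> complex_deriv F z = D"
  unfolding has_cderiv_def complex_deriv_def by (rule tendsto_Lim) auto

lemma has_cderiv_isCont:
  assumes "has_cderiv F D z"
  shows "isCont F z"
proof -
  have "((\<lambda>h. h *\<^sub>C ((1 / h) *\<^sub>C (F (z + h) - F z))) \<longlongrightarrow> 0 *\<^sub>C D) (at 0)"
    using assms unfolding has_cderiv_def by (intro tendsto_scaleC tendsto_ident_at)
  moreover have "\<forall>\<^sub>F h in at 0. h *\<^sub>C ((1 / h) *\<^sub>C (F (z + h) - F z)) = F (z + h) - F z"
    by (auto simp: eventually_at_filter scaleC_scaleC scaleC_one)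
  ultimately have "((\<lambda>h. F (z + h) - F z) \<longlongrightarrow> 0) (at 0)"
    using tendsto_cong by fastforce
  then have "((\<lambda>h. F (z + h)) \<longlongrightarrow> F z) (at 0)"
    using Lim_null by blast
  then show ?thesis by (simp add: isCont_iff)
qed

lemma has_cderiv_const: "has_cderiv (\<lambda>_. A) 0 z"
  by (simp add: has_cderiv_def)

lemma has_cderiv_add:
  "has_cderiv F D z \<Longrightarrow> has_cderiv G E z \<Longrightarrow> has_cderiv (\<lambda>w. F w + G w) (D + E) z"
  unfolding has_cderiv_def
  by (drule (1) tendsto_add) (simp add: scaleC_add_right cvec.scale_right_diff_distrib algebra_simps)

lemma has_cderiv_diff:
  "has_cderiv F D z \<Longrightarrow> has_cderiv G E z \<Longrightarrow> has_cderiv (\<lambda>w. F w - G w) (D - E) z"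
  unfolding has_cderiv_def
  by (drule (1) tendsto_diff) (simp add: scaleC_add_right cvec.scale_right_diff_distrib algebra_simps)

lemma has_cderiv_scaleC:
  assumes "(c has_field_derivative c') (at z)"
  shows "has_cderiv (\<lambda>w. c w *\<^sub>C A) (c' *\<^sub>C A) z"
proof -
  have "((\<lambda>h. ((c (z + h) - c z) / h) *\<^sub>C A) \<longlongrightarrow> c' *\<^sub>C A) (at 0)"
    using assms unfolding DERIV_def by (intro tendsto_scaleC tendsto_const)
  then show ?thesis
    unfolding has_cderiv_def by (simp add: scaleC_scaleC flip: cvec.scale_left_diff_distrib)
qed

lemma has_cderiv_functional:
  assumes "has_cderiv F D z" "bounded_linear \<psi>" "\<And>c x. \<psi> (c *\<^sub>C x) = c * \<psi> x"
  shows "((\<lambda>w. \<psi> (F w)) has_field_derivative \<psi> D) (at z)"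
proof -
  interpret bounded_linear \<psi> by fact
  have "((\<lambda>h. \<psi> ((1 / h) *\<^sub>C (F (z + h) - F z))) \<longlongrightarrow> \<psi> D) (at 0)"
    using assms(1) unfolding has_cderiv_def by (rule tendsto)
  then show ?thesis by (simp add: DERIV_def assms(3) diff)
qed

lemma blinfun_compose_scaleC_left: "(c *\<^sub>C A) o\<^sub>L B = c *\<^sub>C (A o\<^sub>L B)"
  by (rule blinfun_eqI) (simp add: scaleC_blinfun.rep_eq)

lemma blinfun_compose_scaleC_right: "clin A \<Longrightarrow> A o\<^sub>L (c *\<^sub>C B) = c *\<^sub>C (A o\<^sub>L B)"
  by (rule blinfun_eqI) (simp add: scaleC_blinfun.rep_eq clinD)

lemmas compose_simps = bounded_bilinear.add_left[OF bounded_bilinear_blinfun_compose]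
  bounded_bilinear.add_right[OF bounded_bilinear_blinfun_compose]
  bounded_bilinear.diff_left[OF bounded_bilinear_blinfun_compose]
  bounded_bilinear.diff_right[OF bounded_bilinear_blinfun_compose]
  bounded_bilinear.minus_left[OF bounded_bilinear_blinfun_compose]
  bounded_bilinear.minus_right[OF bounded_bilinear_blinfun_compose]

text \<open>The product rule. The quotient splits as F(z+h) (G(z+h) - G(z))/h + (F(z+h) - F(z))/h
  G(z); pulling 1/h through the left factor is where complex linearity near \<open>z\<close>
  enters.\<close>

lemma has_cderiv_compose:
  fixes F :: "complex \<Rightarrow> 'b::complex_normed_vector \<Rightarrow>\<^sub>L 'c::complex_normed_vector"
    and G :: "complex \<Rightarrow> 'a::real_normed_vector \<Rightarrow>\<^sub>L 'b"
  assumes F: "has_cderiv F D z" and G: "has_cderiv G E z"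
    and U: "open U" "z \<in> U" "\<And>w. w \<in> U \<Longrightarrow> clin (F w)"
  shows "has_cderiv (\<lambda>w. F w o\<^sub>L G w) ((F z o\<^sub>L E) + (D o\<^sub>L G z)) z"
proof -
  have cont: "((\<lambda>h. F (z + h)) \<longlongrightarrow> F z) (at 0)"
    using has_cderiv_isCont[OF F] by (simp add: isCont_iff)
  have "((\<lambda>h. (F (z + h) o\<^sub>L ((1 / h) *\<^sub>C (G (z + h) - G z)))
      + (((1 / h) *\<^sub>C (F (z + h) - F z)) o\<^sub>L G z)) \<longlongrightarrow> (F z o\<^sub>L E) + (D o\<^sub>L G z)) (at 0)"
    using F G cont unfolding has_cderiv_def
    by (intro tendsto_add bounded_bilinear.tendsto[OF bounded_bilinear_blinfun_compose] tendsto_const)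
  moreover have "\<forall>\<^sub>F h in at 0. (F (z + h) o\<^sub>L ((1 / h) *\<^sub>C (G (z + h) - G z)))
      + (((1 / h) *\<^sub>C (F (z + h) - F z)) o\<^sub>L G z) =
      (1 / h) *\<^sub>C ((F (z + h) o\<^sub>L G (z + h)) - (F z o\<^sub>L G z))"
  proof -
    have "\<forall>\<^sub>F h in at 0. z + h \<in> U"
      using U by (intro topological_tendstoD[where l = z]) (auto intro!: tendsto_eq_intros)
    then show ?thesis
      by eventually_elim (simp add: blinfun_compose_scaleC_right U blinfun_compose_scaleC_left
          compose_simps flip: scaleC_add_right)
  qed
  ultimately show ?thesis unfolding has_cderiv_def using tendsto_cong by fastforce
qed

lemma blinfun_compose_assoc: "(A o\<^sub>L B) o\<^sub>L C = A o\<^sub>L (B o\<^sub>L C)"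
  by (rule blinfun_eqI) simp

lemma blinfun_compose_id [simp]: "A o\<^sub>L id_blinfun = A" "id_blinfun o\<^sub>L A = A"
  by (rule blinfun_eqI, simp)+

text \<open>The resolvent identity. Continuity and differentiability of operator inverses both come
  from it.\<close>

lemma inverse_diff_eq:
  assumes "G1 o\<^sub>L N1 = id_blinfun" "N2 o\<^sub>L G2 = id_blinfun"
  shows "G1 - G2 = G1 o\<^sub>L (N2 - N1) o\<^sub>L G2"
proof -
  have "G1 o\<^sub>L (N2 - N1) o\<^sub>L G2 = (G1 o\<^sub>L (N2 o\<^sub>L G2)) - ((G1 o\<^sub>L N1) o\<^sub>L G2)"
    by (simp only: compose_simps blinfun_compose_assoc)
  also have "\<dots> = G1 - G2" by (simp only: assms blinfun_compose_id)
  finally show ?thesis by simp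
qed

lemma clin_inverse:
  assumes "clin N" "G o\<^sub>L N = id_blinfun" "N o\<^sub>L G = id_blinfun"
  shows "clin G"
  unfolding clin_def
proof (intro allI)
  fix c x
  have GN: "G (N y) = y" and NG: "N (G z) = z" for y z
    using assms(2,3) by (metis blinfun_apply_blinfun_compose blinfun_apply_id_blinfun)+
  have "G (c *\<^sub>C x) = G (N (c *\<^sub>C G x))" using assms(1) by (simp add: clinD NG)
  then show "G (c *\<^sub>C x) = c *\<^sub>C G x" by (simp add: GN)
qed

lemma has_cderiv_inverse:
  assumes N: "has_cderiv N D z" and U: "open U" "z \<in> U"
    and inv: "\<And>w. w \<in> U \<Longrightarrow> clin (N w) \<and> G w o\<^sub>L N w = id_blinfun \<and> N w o\<^sub>L G w = id_blinfun"
    and cont: "isCont G z"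
  shows "has_cderiv G (- (G z o\<^sub>L D o\<^sub>L G z)) z"
proof -
  have "((\<lambda>h. - (G (z + h) o\<^sub>L ((1 / h) *\<^sub>C (N (z + h) - N z)) o\<^sub>L G z)) \<longlongrightarrow> - (G z o\<^sub>L D o\<^sub>L G z)) (at 0)"
    using N cont unfolding has_cderiv_def isCont_iff
    by (intro tendsto_minus bounded_bilinear.tendsto[OF bounded_bilinear_blinfun_compose] tendsto_const)
  moreover have "\<forall>\<^sub>F h in at 0. - (G (z + h) o\<^sub>L ((1 / h) *\<^sub>C (N (z + h) - N z)) o\<^sub>L G z)
      = (1 / h) *\<^sub>C (G (z + h) - G z)"
  proof -
    have "\<forall>\<^sub>F h in at 0. z + h \<in> U"
      using U by (intro topological_tendstoD[where l = z]) (auto intro!: tendsto_eq_intros)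
    then show ?thesis
    proof eventually_elim
      case (elim h)
      have cG: "clin (G (z + h))" using inv[OF elim] clin_inverse by blast
      have "G (z + h) - G z = G (z + h) o\<^sub>L (N z - N (z + h)) o\<^sub>L G z"
        by (rule inverse_diff_eq) (use inv elim U in auto)
      also have "\<dots> = - (G (z + h) o\<^sub>L (N (z + h) - N z) o\<^sub>L G z)"
        by (simp add: compose_simps)
      finally show ?case
        by (simp add: blinfun_compose_scaleC_right[OF cG] blinfun_compose_scaleC_left)
    qed
  qed
  ultimately show ?thesis unfolding has_cderiv_def using tendsto_cong by fastforce
qed

text \<open>For each \<open>y\<close>, the equation x = y + B x is solved by Banach's fixed point
  theorem instead of a series; the contraction constant 1/2 gives the bound 1 / (1 - 1/2) = 2 on the
  inverse.\<close>

lemma neumann: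
  fixes B :: "'a::banach \<Rightarrow>\<^sub>L 'a"
  assumes B: "norm B \<le> 1 / 2"
  obtains G where "G o\<^sub>L (id_blinfun - B) = id_blinfun" "(id_blinfun - B) o\<^sub>L G = id_blinfun" "norm G \<le> 2"
proof -
  have le: "norm x \<le> 2 * norm (x - B x)" for x
  proof -
    have "norm (B x) \<le> 1 / 2 * norm x"
      using norm_blinfun[of B x] B mult_right_mono[OF B norm_ge_zero[of x]] by linarith
    then show ?thesis using norm_triangle_sub[of x "B x"] by linarith
  qed
  have ex: "\<exists>x. x - B x = y" for y
  proof -
    have "\<exists>!x. x \<in> UNIV \<and> y + B x = x"
    proof (rule Banach_fix[where c = "1 / 2"])
      show "complete (UNIV :: 'a set)" by (rule complete_UNIV)
      fix x x' :: 'a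
      have "norm (B (x - x')) \<le> 1 / 2 * norm (x - x')"
        using norm_blinfun[of B "x - x'"] mult_right_mono[OF B norm_ge_zero[of "x - x'"]] by linarith
      then show "dist (y + B x) (y + B x') \<le> 1 / 2 * dist x x'"
        by (simp add: dist_norm blinfun.diff_right)
    qed auto
    then show ?thesis by (metis add_diff_cancel_right')
  qed
  define g where "g = (\<lambda>y. SOME x. x - B x = y)"
  have g: "g y - B (g y) = y" for y unfolding g_def using ex by (rule someI_ex)
  have uniq: "x = x'" if "x - B x = x' - B x'" for x x'
  proof -
    have "(x - x') - B (x - x') = 0" using that by (simp add: blinfun.diff_right algebra_simps)
    then show ?thesis using le[of "x - x'"] by simp
  qed
  have bl: "bounded_linear g"
  proof (rule bounded_linear_intro[where K = 2])
    show "g (x + y) = g x + g y" for x y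
      by (rule uniq) (simp only: g blinfun.add_right add_diff_add)
    show "g (r *\<^sub>R x) = r *\<^sub>R g x" for r x
      by (rule uniq) (metis g blinfun.scaleR_right scaleR_diff_right)
    show "norm (g x) \<le> norm x * 2" for x using le[of "g x"] by (simp add: g)
  qed
  have ap: "blinfun_apply (Blinfun g) = g" by (rule bounded_linear_Blinfun_apply[OF bl])
  show thesis
  proof (rule that[of "Blinfun g"])
    show "Blinfun g o\<^sub>L (id_blinfun - B) = id_blinfun"
      by (rule blinfun_eqI) (auto simp: ap blinfun.diff_left intro: uniq g)
    show "(id_blinfun - B) o\<^sub>L Blinfun g = id_blinfun"
      by (rule blinfun_eqI) (simp add: ap blinfun.diff_left g)
    show "norm (Blinfun g) \<le> 2"
      by (rule norm_blinfun_bound) (use le[of "g _"] in \<open>simp_all add: ap g\<close>)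
  qed
qed

section \<open>The trace of a finite-rank operator\<close>

text \<open>\<open>op_trace\<close> uses an arbitrarily chosen basis \<open>B\<close> of the range.
  Extended to a basis \<open>C\<close> of the whole space, it turns both sides into the same double
  sum of coordinates, even if the \<open>u i\<close> are linearly dependent.\<close>

lemma op_trace_finite_rank:
  fixes A :: "'a::complex_normed_vector \<Rightarrow>\<^sub>L 'a"
  assumes I: "finite I" and A: "\<And>x. A x = (\<Sum>i\<in>I. \<phi> i x *\<^sub>C u i)"
    and add: "\<And>i x y. i \<in> I \<Longrightarrow> \<phi> i (x + y) = \<phi> i x + \<phi> i y"
    and scale: "\<And>i c x. i \<in> I \<Longrightarrow> \<phi> i (c *\<^sub>C x) = c * \<phi> i x"
  shows "op_trace A = (\<Sum>i\<in>I. \<phi> i (u i))"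
proof -
  have sub: "cvec.subspace (range (blinfun_apply A))"
  proof (rule cvec.subspaceI)
    show "0 \<in> range (blinfun_apply A)" by (metis blinfun.zero_right rangeI)
    show "x + y \<in> range (blinfun_apply A)"
      if "x \<in> range (blinfun_apply A)" "y \<in> range (blinfun_apply A)" for x y
    proof -
      from that obtain v w where "x = A v" "y = A w" by auto
      then have "x + y = A (v + w)" by (simp only: blinfun.add_right)
      then show ?thesis by (simp only: rangeI)
    qed
    show "c *\<^sub>C x \<in> range (blinfun_apply A)" if x: "x \<in> range (blinfun_apply A)" for c x
    proof -
      obtain w where "x = A w" using x by auto
      then have "c *\<^sub>C x = A (c *\<^sub>C w)"
        by (simp add: A cvec.scale_sum_right scaleC_scaleC scale cong: sum.cong)
      then show ?thesis by blast
    qed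
  qed
  define B where "B = (SOME B. cvec.independent B \<and> cvec.span B = range (blinfun_apply A))"
  have "\<exists>B. cvec.independent B \<and> cvec.span B = range (blinfun_apply A)"
    using cvec.basis_exists[of "range (blinfun_apply A)"] cvec.span_subspace[OF _ _ sub] by metis
  then have B: "cvec.independent B" "cvec.span B = range (blinfun_apply A)"
    unfolding B_def by (metis (mono_tags, lifting) someI_ex)+
  have "B \<subseteq> cvec.span (u ` I)"
  proof
    fix b assume "b \<in> B"
    then have "b \<in> range (blinfun_apply A)" using B(2) cvec.span_base by blast
    then obtain x where "b = (\<Sum>i\<in>I. \<phi> i x *\<^sub>C u i)" using A by auto
    moreover have "(\<Sum>i\<in>I. \<phi> i x *\<^sub>C u i) \<in> cvec.span (u ` I)"
      by (intro cvec.span_sum cvec.span_scale cvec.span_base imageI)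
    ultimately show "b \<in> cvec.span (u ` I)" by simp
  qed
  then have finB: "finite B"
    using cvec.independent_span_bound[of "u ` I" B] I B(1) by simp
  define C where "C = cvec.extend_basis B"
  have C: "cvec.independent C" "cvec.span C = UNIV" "B \<subseteq> C"
    using cvec.independent_extend_basis[OF B(1)] cvec.span_extend_basis[OF B(1)]
      cvec.extend_basis_superset[OF B(1)] by (simp_all add: C_def)
  define r where "r = (\<lambda>v c. cvec.representation C v c)"
  \<comment> \<open>Finitely many members of \<open>C\<close> that contain \<open>B\<close> and
    carry all coordinates of the vectors \<open>u i\<close>, so that the sums may be
    exchanged.\<close>
  define S where "S = B \<union> (\<Union>i\<in>I. {c. r (u i) c \<noteq> 0})"
  have S: "finite S"
    unfolding S_def r_def using finB I cvec.finite_representation by auto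
  have dec: "(\<Sum>c\<in>S. r (u i) c *\<^sub>C c) = u i" if "i \<in> I" for i
  proof -
    have "(\<Sum>c\<in>S. r (u i) c *\<^sub>C c) = (\<Sum>c\<in>{c. r (u i) c \<noteq> 0}. r (u i) c *\<^sub>C c)"
      by (rule sum.mono_neutral_right) (use S that in \<open>auto simp: S_def\<close>)
    also have "\<dots> = u i"
      unfolding r_def using cvec.sum_nonzero_representation_eq[OF C(1), of "u i"] C(2) by simp
    finally show ?thesis .
  qed
  have \<phi>sum: "\<phi> i (\<Sum>c\<in>T. a c *\<^sub>C c) = (\<Sum>c\<in>T. a c * \<phi> i c)" if "i \<in> I" "finite T" for i a T
    using that(2)
  proof induction
    case empty
    show ?case using scale[OF that(1), of 0 0] by simp
  qed (simp add: add scale that(1))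
  have rA: "(\<Sum>i\<in>I. \<phi> i c * r (u i) c) = r (A c) c" for c
    unfolding r_def A
    by (simp add: cvec.representation_sum[OF C(1)] cvec.representation_scale[OF C(1)] C(2))
  have rB: "r (A x) b = cvec.representation B (A x) b" for x b
    unfolding r_def using cvec.representation_extend[OF C(1) _ C(3), of "A x"] B(2) by simp
  have "(\<Sum>i\<in>I. \<phi> i (u i)) = (\<Sum>i\<in>I. \<Sum>c\<in>S. r (u i) c * \<phi> i c)"
  proof (rule sum.cong)
    fix i assume i: "i \<in> I"
    have "\<phi> i (u i) = \<phi> i (\<Sum>c\<in>S. r (u i) c *\<^sub>C c)" by (simp only: dec[OF i])
    also have "\<dots> = (\<Sum>c\<in>S. r (u i) c * \<phi> i c)" by (rule \<phi>sum[OF i S])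
    finally show "\<phi> i (u i) = (\<Sum>c\<in>S. r (u i) c * \<phi> i c)" .
  qed simp
  also have "\<dots> = (\<Sum>c\<in>S. r (A c) c)"
    by (subst sum.swap) (simp add: mult.commute flip: rA)
  \<comment> \<open>Every \<open>A c\<close> lies in the span of \<open>B\<close>, so its
    coordinates along the rest of \<open>C\<close> vanish.\<close>
  also have "\<dots> = (\<Sum>c\<in>B. r (A c) c)"
    using cvec.representation_ne_zero[of B] by (intro sum.mono_neutral_right S) (auto simp: S_def rB)
  also have "\<dots> = op_trace A"
    unfolding op_trace_def B_def[symmetric] by (simp add: rB)
  finally show ?thesis by simp
qed

section \<open>Determinants of matrices of functions\<close>

text \<open>Plain functions of two indices stand for matrices, so that the size stays a parameter
  and holomorphy can be stated entry by entry.\<close>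

definition mdet :: "nat \<Rightarrow> (nat \<Rightarrow> nat \<Rightarrow> complex) \<Rightarrow> complex" where
  "mdet n a = Determinant.det (Matrix.mat n n (\<lambda>(i, j). a i j))"

text \<open>Entry (i, j) of the adjugate, hence the transposed index pair in the cofactor.\<close>

definition madj :: "nat \<Rightarrow> (nat \<Rightarrow> nat \<Rightarrow> complex) \<Rightarrow> nat \<Rightarrow> nat \<Rightarrow> complex" where
  "madj n a i j = cofactor (Matrix.mat n n (\<lambda>(i, j). a i j)) j i"

lemma mdet_Leibniz:
  "mdet n a = (\<Sum>p | p permutes {0..<n}. signof p * (\<Prod>i\<in>{0..<n}. a i (p i)))"
  unfolding mdet_def
proof (subst det_def'[where n = n], simp, rule sum.cong)
  fix p assume p: "p \<in> {p. p permutes {0..<n}}"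
  have "(\<Prod>i\<in>{0..<n}. Matrix.mat n n (\<lambda>(i, j). a i j) $$ (i, p i)) = (\<Prod>i\<in>{0..<n}. a i (p i))"
    by (rule prod.cong) (use p permutes_in_image[of p "{0..<n}"] in auto)
  then show "signof p * (\<Prod>i\<in>{0..<n}. Matrix.mat n n (\<lambda>(i, j). a i j) $$ (i, p i))
      = signof p * (\<Prod>i\<in>{0..<n}. a i (p i))" by (simp only:)
qed simp

lemma mdet_row_expansion:
  assumes "i < n"
  shows "mdet n a = (\<Sum>j<n. a i j * madj n a j i)"
  unfolding mdet_def madj_def
  by (subst laplace_expansion_row[where n = n and i = i]) (use assms in auto)

lemma madj_row_cong:
  assumes "\<And>k l. k \<noteq> i \<Longrightarrow> a k l = b k l" "i < n" "j < n"
  shows "madj n a j i = madj n b j i"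
proof -
  have "mat_delete (Matrix.mat n n (\<lambda>(i, j). a i j)) i j = mat_delete (Matrix.mat n n (\<lambda>(i, j). b i j)) i j"
    unfolding mat_delete_def by (rule eq_matI) (use assms in auto)
  then show ?thesis by (simp add: madj_def cofactor_def)
qed

lemma
  assumes "i < n" "j < n"
  shows mult_madj: "(\<Sum>k<n. a i k * madj n a k j) = (if i = j then mdet n a else 0)"
    and madj_mult: "(\<Sum>k<n. madj n a i k * a k j) = (if i = j then mdet n a else 0)"
proof -
  define A where "A = Matrix.mat n n (\<lambda>(i, j). a i j)"
  have A: "A \<in> carrier_mat n n" by (simp add: A_def)
  have adj: "adj_mat A \<in> carrier_mat n n" "k < n \<Longrightarrow> l < n \<Longrightarrow> adj_mat A $$ (k, l) = madj n a k l" for k l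
    using A by (simp_all add: adj_mat_def madj_def A_def)
  have "(A * adj_mat A) $$ (i, j) = (\<Sum>k = 0..<n. A $$ (i, k) * adj_mat A $$ (k, j))"
    using A adj(1) assms by (simp add: scalar_prod_def)
  also have "\<dots> = (\<Sum>k<n. a i k * madj n a k j)"
    using assms adj(2) by (intro sum.cong) (auto simp: A_def)
  finally show "(\<Sum>k<n. a i k * madj n a k j) = (if i = j then mdet n a else 0)"
    using adj_mat(2)[OF A] assms by (auto simp: mdet_def A_def split: if_splits)
  have "(adj_mat A * A) $$ (i, j) = (\<Sum>k = 0..<n. adj_mat A $$ (i, k) * A $$ (k, j))"
    using A adj(1) assms by (simp add: scalar_prod_def)
  also have "\<dots> = (\<Sum>k<n. madj n a i k * a k j)"
    using assms adj(2) by (intro sum.cong) (auto simp: A_def)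
  finally show "(\<Sum>k<n. madj n a i k * a k j) = (if i = j then mdet n a else 0)"
    using adj_mat(3)[OF A] assms by (auto simp: mdet_def A_def split: if_splits)
qed

lemma mdet_zero_kernel:
  assumes "mdet n a = 0"
  obtains v i where "i < n" "v i \<noteq> (0::complex)" "\<And>i. i < n \<Longrightarrow> (\<Sum>k<n. a i k * v k) = 0"
proof -
  define A where "A = Matrix.mat n n (\<lambda>(i, j). a i j)"
  have A: "A \<in> carrier_mat n n" by (simp add: A_def)
  have "Determinant.det A = 0" using assms by (simp add: mdet_def A_def)
  then obtain v where v: "v \<in> carrier_vec n" "v \<noteq> 0\<^sub>v n" "A *\<^sub>v v = 0\<^sub>v n"
    using det_0_iff_vec_prod_zero_field[OF A] by blast
  define w where "w = vec_index v"
  have "\<exists>i<n. w i \<noteq> 0"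
  proof (rule ccontr)
    assume "\<not> (\<exists>i<n. w i \<noteq> 0)"
    then have "v = 0\<^sub>v n" using v(1) by (intro eq_vecI) (auto simp: w_def)
    then show False using v(2) by contradiction
  qed
  then obtain i where i: "i < n" "w i \<noteq> 0" by blast
  have "(\<Sum>k<n. a i k * w k) = 0" if "i < n" for i
  proof -
    have "vec_index (A *\<^sub>v v) i = (\<Sum>k = 0..<n. A $$ (i, k) * vec_index v k)"
      using A v(1) that by (simp add: scalar_prod_def)
    also have "\<dots> = (\<Sum>k<n. a i k * w k)"
      using that by (intro sum.cong) (auto simp: A_def w_def)
    finally show ?thesis using v(3) that by simp
  qed
  then show thesis using that[of i w] i by blast
qed

lemma mdet_holomorphic:
  assumes "\<And>i j. i < n \<Longrightarrow> j < n \<Longrightarrow> (\<lambda>z. a z i j) holomorphic_on U"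
  shows "(\<lambda>z. mdet n (a z)) holomorphic_on U"
  unfolding mdet_Leibniz
proof (intro holomorphic_on_sum holomorphic_on_mult holomorphic_on_const holomorphic_on_prod assms)
  fix p i assume "p \<in> {p. p permutes {0..<n}}" "i \<in> {0..<n}"
  then show "i < n" "p i < n" using permutes_in_image[of p "{0..<n}" i] by auto
qed

lemma mdet_continuous:
  fixes a :: "'a::topological_space \<Rightarrow> nat \<Rightarrow> nat \<Rightarrow> complex"
  assumes "\<And>i j. i < n \<Longrightarrow> j < n \<Longrightarrow> continuous_on U (\<lambda>z. a z i j)"
  shows "continuous_on U (\<lambda>z. mdet n (a z))"
  unfolding mdet_Leibniz
proof (intro continuous_on_sum continuous_on_mult continuous_on_const continuous_on_prod assms)
  fix p i assume "p \<in> {p. p permutes {0..<n}}" "i \<in> {0..<n}"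
  then show "i < n" "p i < n" using permutes_in_image[of p "{0..<n}" i] by auto
qed

lemma madj_holomorphic:
  assumes "\<And>i j. i < n \<Longrightarrow> j < n \<Longrightarrow> (\<lambda>z. a z i j) holomorphic_on U" and ij: "i < n" "j < n"
  shows "(\<lambda>z. madj n (a z) i j) holomorphic_on U"
proof -
  define s where "s = (\<lambda>l m :: nat. if m < l then m else Suc m)"
  have "madj n (a z) i j = (-1) ^ (j + i) * mdet (n - 1) (\<lambda>k l. a z (s j k) (s i l))" for z
  proof -
    have "mat_delete (Matrix.mat n n (\<lambda>(i, j). a z i j)) j i =
        Matrix.mat (n - 1) (n - 1) (\<lambda>(k, l). a z (s j k) (s i l))"
      unfolding mat_delete_def s_def by (rule eq_matI) (use ij in auto)
    then show ?thesis by (simp add: madj_def cofactor_def mdet_def)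
  qed
  moreover have "(\<lambda>z. mdet (n - 1) (\<lambda>k l. a z (s j k) (s i l))) holomorphic_on U"
    by (intro mdet_holomorphic assms(1)) (auto simp: s_def)
  ultimately show ?thesis by (simp add: holomorphic_intros)
qed

text \<open>Jacobi's formula. The product rule replaces one row at a time by its derivative, and
  expansion along that row leaves cofactors that do not see it.\<close>

lemma mdet_derivative:
  assumes "\<And>i j. i < n \<Longrightarrow> j < n \<Longrightarrow> ((\<lambda>z. a z i j) has_field_derivative a' i j) (at z)"
  shows "((\<lambda>z. mdet n (a z)) has_field_derivative (\<Sum>i<n. \<Sum>j<n. a' i j * madj n (a z) j i)) (at z)"
proof -
  define R where "R = (\<lambda>i k l. if k = i then a' i l else a z k l)"
  have pn: "p i < n" if "p permutes {0..<n}" "i < n" for p i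
    using that permutes_in_image[of p "{0..<n}" i] by auto
  have "((\<lambda>z. mdet n (a z)) has_field_derivative (\<Sum>p | p permutes {0..<n}. signof p *
      (\<Sum>i\<in>{0..<n}. a' i (p i) * (\<Prod>j\<in>{0..<n} - {i}. a z j (p j))))) (at z)"
    unfolding mdet_Leibniz
    by (intro DERIV_sum DERIV_cmult has_field_derivative_prod assms) (auto simp: pn)
  also have "(\<Sum>p | p permutes {0..<n}. signof p *
      (\<Sum>i\<in>{0..<n}. a' i (p i) * (\<Prod>j\<in>{0..<n} - {i}. a z j (p j)))) =
      (\<Sum>i\<in>{0..<n}. \<Sum>p | p permutes {0..<n}. signof p * (\<Prod>j\<in>{0..<n}. R i j (p j)))"
  proof (subst sum.swap, rule sum.cong, simp)
    fix p assume "p \<in> {p. p permutes {0..<n}}"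
    have "a' i (p i) * (\<Prod>j\<in>{0..<n} - {i}. a z j (p j)) = (\<Prod>j\<in>{0..<n}. R i j (p j))"
      if "i \<in> {0..<n}" for i
    proof -
      have "(\<Prod>j\<in>{0..<n}. R i j (p j)) = R i i (p i) * (\<Prod>j\<in>{0..<n} - {i}. R i j (p j))"
        using that by (intro prod.remove) auto
      also have "(\<Prod>j\<in>{0..<n} - {i}. R i j (p j)) = (\<Prod>j\<in>{0..<n} - {i}. a z j (p j))"
        by (rule prod.cong) (auto simp: R_def)
      finally show ?thesis by (simp add: R_def)
    qed
    then show "signof p * (\<Sum>i\<in>{0..<n}. a' i (p i) * (\<Prod>j\<in>{0..<n} - {i}. a z j (p j))) =
        (\<Sum>i\<in>{0..<n}. signof p * (\<Prod>j\<in>{0..<n}. R i j (p j)))"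
      by (simp add: sum_distrib_left)
  qed
  also have "\<dots> = (\<Sum>i<n. mdet n (R i))" by (simp add: mdet_Leibniz lessThan_atLeast0)
  also have "\<dots> = (\<Sum>i<n. \<Sum>j<n. a' i j * madj n (a z) j i)"
  proof (rule sum.cong)
    fix i assume i: "i \<in> {..<n}"
    have "mdet n (R i) = (\<Sum>j<n. R i i j * madj n (R i) j i)"
      using i by (intro mdet_row_expansion) simp
    also have "\<dots> = (\<Sum>j<n. a' i j * madj n (a z) j i)"
    proof (rule sum.cong)
      fix j assume "j \<in> {..<n}"
      then have "madj n (R i) j i = madj n (a z) j i"
        using i by (intro madj_row_cong) (auto simp: R_def)
      then show "R i i j * madj n (R i) j i = a' i j * madj n (a z) j i" by (simp add: R_def)
    qed simp
    finally show "mdet n (R i) = (\<Sum>j<n. a' i j * madj n (a z) j i)" .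
  qed simp
  finally show ?thesis .
qed

section \<open>Schur complements\<close>

lemma op_inverse_eq:
  assumes "B o\<^sub>L A = id_blinfun" "A o\<^sub>L B = id_blinfun"
  shows "op_inverse A = B"
  unfolding op_inverse_def
proof (rule the_equality)
  fix C assume C: "C o\<^sub>L A = id_blinfun \<and> A o\<^sub>L C = id_blinfun"
  have "C = C o\<^sub>L (A o\<^sub>L B)" by (simp add: assms)
  also have "\<dots> = B" using C by (simp flip: blinfun_compose_assoc)
  finally show "C = B" .
qed (use assms in simp)

context orthonormal_basis
begin

text \<open>For T = 1 + K this is 1 + K (1 - P) with P = \<open>proj n\<close>: only the tail of K
  is left, so the operator is close to 1 when that tail is small. If G is its inverse, S = G T is
  the identity on the range of 1 - P, and invertibility of T is decided by an n by n matrix.\<close>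

definition schur_op :: "nat \<Rightarrow> ('a \<Rightarrow>\<^sub>L 'a) \<Rightarrow> 'a \<Rightarrow>\<^sub>L 'a" where
  "schur_op n T = (T o\<^sub>L (id_blinfun - proj n)) + proj n"

definition schur_matrix :: "('a \<Rightarrow>\<^sub>L 'a) \<Rightarrow> nat \<Rightarrow> nat \<Rightarrow> complex" where
  "schur_matrix S i j = cip (S (e j)) (e i)"

text \<open>\<open>e i\<close> corrected within the range of 1 - P so that S maps it into the span
  of the first \<open>n\<close> basis vectors, where the matrix alone acts.\<close>

definition schur_vec :: "nat \<Rightarrow> ('a \<Rightarrow>\<^sub>L 'a) \<Rightarrow> nat \<Rightarrow> 'a" where
  "schur_vec n S i = e i - (S (e i) - proj n (S (e i)))"

text \<open>The inverse of a block triangular operator: the part of \<open>y\<close> beyond the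
  first \<open>n\<close> modes is kept, and the remaining block is inverted by Cramer's rule along
  the vectors \<open>schur_vec\<close>.\<close>

definition schur_inverse :: "nat \<Rightarrow> ('a \<Rightarrow>\<^sub>L 'a) \<Rightarrow> 'a \<Rightarrow> 'a" where
  "schur_inverse n S y = (y - proj n y) +
     (\<Sum>i<n. \<Sum>j<n. (madj n (schur_matrix S) i j / mdet n (schur_matrix S) * cip y (e j)) *\<^sub>C schur_vec n S i)"

text \<open>On the range of 1 - P the operators \<open>schur_op n T\<close> and \<open>T\<close>
  agree, so \<open>G\<close> undoes \<open>T\<close> there.\<close>

lemma
  assumes G: "G o\<^sub>L schur_op n T = id_blinfun" "schur_op n T o\<^sub>L G = id_blinfun" and T: "clin T"
  defines "S \<equiv> G o\<^sub>L T"
  shows schur_complement: "S (x - proj n x) = x - proj n x"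
    and schur_clin: "clin S"
    and schur_factor: "schur_op n T o\<^sub>L S = T"
proof -
  have "schur_op n T (x - proj n x) = T (x - proj n x)"
    by (simp add: schur_op_def blinfun.bilinear_simps proj_idem)
  then have "S (x - proj n x) = (G o\<^sub>L schur_op n T) (x - proj n x)"
    by (simp add: S_def)
  then show "S (x - proj n x) = x - proj n x" by (simp add: G)
  have "clin (schur_op n T)"
    unfolding schur_op_def by (intro clin_add clin_compose clin_diff T clin_id clin_proj)
  then show "clin S"
    unfolding S_def by (intro clin_compose T clin_inverse[OF _ G])
  show "schur_op n T o\<^sub>L S = T"
    unfolding S_def by (simp add: G flip: blinfun_compose_assoc)
qed

context
  fixes n and S :: "'a \<Rightarrow>\<^sub>L 'a"
  assumes S: "\<And>x. S (x - proj n x) = x - proj n x" "clin S"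
begin

lemma S_schur_vec: "S (schur_vec n S i) = (\<Sum>l<n. schur_matrix S l i *\<^sub>C e l)"
proof -
  have "S (schur_vec n S i) = S (e i) - S (S (e i) - proj n (S (e i)))"
    by (simp only: schur_vec_def blinfun.diff_right)
  also have "\<dots> = proj n (S (e i))" by (simp only: S(1)) simp
  finally show ?thesis by (simp add: proj_eq schur_matrix_def)
qed

lemma S_sum: "S (\<Sum>i\<in>I. c i *\<^sub>C v i) = (\<Sum>i\<in>I. c i *\<^sub>C S (v i))"
  by (simp add: blinfun.sum_right clinD[OF S(2)])

lemma S_schur_inverse:
  assumes "mdet n (schur_matrix S) \<noteq> 0"
  shows "S (schur_inverse n S y) = y"
proof -
  define E where "E = schur_matrix S"
  define d where "d = mdet n E"
  have "(\<Sum>i<n. \<Sum>j<n. (madj n E i j / d * cip y (e j)) *\<^sub>C S (schur_vec n S i)) =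
      (\<Sum>i<n. \<Sum>j<n. \<Sum>l<n. (madj n E i j / d * cip y (e j) * E l i) *\<^sub>C e l)"
    by (simp add: S_schur_vec cvec.scale_sum_right scaleC_scaleC E_def)
  also have "\<dots> = (\<Sum>j<n. \<Sum>l<n. \<Sum>i<n. (madj n E i j / d * cip y (e j) * E l i) *\<^sub>C e l)"
    by (subst sum.swap, rule sum.cong, simp, rule sum.swap)
  also have "\<dots> = (\<Sum>j<n. \<Sum>l<n. (if l = j then cip y (e j) else 0) *\<^sub>C e l)"
  proof (intro sum.cong refl)
    fix j l assume jl: "j \<in> {..<n}" "l \<in> {..<n}"
    have "(\<Sum>i<n. (madj n E i j / d * cip y (e j) * E l i) *\<^sub>C e l) =
        ((\<Sum>i<n. E l i * madj n E i j) * (cip y (e j) / d)) *\<^sub>C e l"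
    proof -
      have "(\<Sum>i<n. madj n E i j / d * cip y (e j) * E l i) =
          (\<Sum>i<n. E l i * madj n E i j) * (cip y (e j) / d)"
        unfolding sum_distrib_right by (rule sum.cong) (simp_all add: mult_ac)
      then show ?thesis by (simp only: cvec.scale_sum_left[symmetric])
    qed
    also have "\<dots> = (if l = j then cip y (e j) else 0) *\<^sub>C e l"
      using jl assms by (simp add: mult_madj d_def E_def)
    finally show "(\<Sum>i<n. (madj n E i j / d * cip y (e j) * E l i) *\<^sub>C e l) =
        (if l = j then cip y (e j) else 0) *\<^sub>C e l" .
  qed
  also have "\<dots> = proj n y"
    unfolding proj_eq by (rule sum.cong) (simp_all add: if_distrib[where f = "\<lambda>c. c *\<^sub>C _"] cong: if_cong)
  finally have eq: "(\<Sum>i<n. \<Sum>j<n. (madj n E i j / d * cip y (e j)) *\<^sub>C S (schur_vec n S i)) = proj n y" .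
  have "S (schur_inverse n S y) = S (y - proj n y) +
      (\<Sum>i<n. \<Sum>j<n. (madj n E i j / d * cip y (e j)) *\<^sub>C S (schur_vec n S i))"
    unfolding schur_inverse_def E_def d_def by (simp only: blinfun.add_right blinfun.sum_right clinD[OF S(2)])
  then show ?thesis by (simp only: eq S(1) diff_add_cancel)
qed

text \<open>A right inverse alone does not invert an operator in infinite dimension; multiplying by
  the adjugate from the other side supplies injectivity.\<close>

lemma S_inj:
  assumes "mdet n (schur_matrix S) \<noteq> 0" "S x = 0"
  shows "x = 0"
proof -
  define E where "E = schur_matrix S"
  have "S x = S (x - proj n x) + S (proj n x)" by (simp add: blinfun.diff_right)
  also have "S (proj n x) = (\<Sum>j<n. cip x (e j) *\<^sub>C S (e j))" by (simp only: proj_eq S_sum)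
  finally have Sx: "S x = (x - proj n x) + (\<Sum>j<n. cip x (e j) *\<^sub>C S (e j))"
    by (simp only: S(1))
  have z: "(\<Sum>j<n. E l j * cip x (e j)) = 0" if "l < n" for l
  proof -
    have "cip (S x) (e l) = (\<Sum>j<n. E l j * cip x (e j))"
      unfolding Sx using that
      by (simp add: cip_add_left cip_diff_left coeff_proj cip_sum_left cip_scaleC_left E_def
          schur_matrix_def mult.commute)
    then show ?thesis using assms(2) by simp
  qed
  have "cip x (e i) = 0" if i: "i < n" for i
  proof -
    have "0 = (\<Sum>l<n. madj n E i l * (\<Sum>j<n. E l j * cip x (e j)))" by (simp add: z)
    also have "\<dots> = (\<Sum>j<n. (\<Sum>l<n. madj n E i l * E l j) * cip x (e j))"
      unfolding sum_distrib_left sum_distrib_right mult.assoc by (rule sum.swap)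
    also have "\<dots> = (\<Sum>j<n. (if i = j then mdet n E else 0) * cip x (e j))"
      using i by (intro sum.cong) (auto simp: madj_mult)
    also have "\<dots> = mdet n E * cip x (e i)"
      using i by (simp add: if_distrib[where f = "\<lambda>c. c * _"] cong: if_cong)
    finally show ?thesis using assms(1) by (simp add: E_def)
  qed
  then have "proj n x = 0" "(\<Sum>j<n. cip x (e j) *\<^sub>C S (e j)) = 0" by (simp_all add: proj_eq)
  then show ?thesis using Sx assms(2) by simp
qed

lemma schur_singular:
  assumes "mdet n (schur_matrix S) = 0"
  obtains x where "x \<noteq> 0" "S x = 0"
proof -
  obtain v i where v: "i < n" "v i \<noteq> 0"
    "\<And>i. i < n \<Longrightarrow> (\<Sum>k<n. schur_matrix S i k * v k) = 0"
    using mdet_zero_kernel[OF assms] by metis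
  \<comment> \<open>A null vector of the matrix, lifted along \<open>schur_vec\<close>. Coordinate
    \<open>i\<close> of the lift is still \<open>v i\<close>, which makes it nonzero.\<close>
  define x where "x = (\<Sum>k<n. v k *\<^sub>C schur_vec n S k)"
  have "S x = (\<Sum>k<n. \<Sum>l<n. (schur_matrix S l k * v k) *\<^sub>C e l)"
    unfolding x_def S_sum by (simp add: S_schur_vec cvec.scale_sum_right scaleC_scaleC mult.commute)
  also have "\<dots> = (\<Sum>l<n. (\<Sum>k<n. schur_matrix S l k * v k) *\<^sub>C e l)"
    by (subst sum.swap) (simp add: cvec.scale_sum_left)
  finally have "S x = 0" by (simp add: v(3))
  moreover
  have "cip x (e i) = v i"
  proof -
    have "cip (schur_vec n S k) (e i) = (if k = i then 1 else 0)" for k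
      using v(1) by (simp add: schur_vec_def cip_diff_left coeff_proj orth)
    then have "cip x (e i) = (\<Sum>k<n. v k * (if k = i then 1 else 0))"
      unfolding x_def cip_sum_left cip_scaleC_left by (simp only:)
    then show ?thesis using v(1) by (simp add: if_distrib cong: if_cong)
  qed
  then have "x \<noteq> 0" using v(2) by auto
  ultimately show thesis using that by blast
qed

lemma bounded_linear_schur_inverse: "bounded_linear (schur_inverse n S)"
  unfolding schur_inverse_def
  by (intro bounded_linear_add bounded_linear_sub bounded_linear_ident blinfun.bounded_linear_right
      bounded_linear_sum
      bounded_linear_compose[OF bounded_bilinear.bounded_linear_left[OF bounded_bilinear_scaleC]]
      bounded_linear_const_mult bounded_linear_cip_left)

end

text \<open>From T = N S with N = \<open>schur_op n T\<close> invertible, the inverse is S^(-1)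
  N^(-1). The explicit form is kept because it shows the singular part of the inverse as a
  finite-rank operator divided by the determinant.\<close>

lemma schur_inverse_op:
  assumes G: "G o\<^sub>L schur_op n T = id_blinfun" "schur_op n T o\<^sub>L G = id_blinfun" and T: "clin T"
    and d: "mdet n (schur_matrix (G o\<^sub>L T)) \<noteq> 0"
  obtains R where "R o\<^sub>L T = id_blinfun" "T o\<^sub>L R = id_blinfun"
    "\<And>y. blinfun_apply R y = schur_inverse n (G o\<^sub>L T) (G y)"
proof -
  define S where "S = G o\<^sub>L T"
  have S: "\<And>x. S (x - proj n x) = x - proj n x" "clin S" and fac: "schur_op n T o\<^sub>L S = T"
    using schur_complement[OF G T] schur_clin[OF G T] schur_factor[OF G T] by (simp_all add: S_def)
  have d': "mdet n (schur_matrix S) \<noteq> 0" using d by (simp add: S_def)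
  define R where "R = Blinfun (schur_inverse n S) o\<^sub>L G"
  have R: "blinfun_apply R y = schur_inverse n S (G y)" for y
    by (simp add: R_def bounded_linear_Blinfun_apply bounded_linear_schur_inverse[OF S])
  have GT: "G (T x) = S x" and NG: "schur_op n T (G y) = y" and NS: "T x = schur_op n T (S x)" for x y
    using fac G(2) by (metis S_def blinfun_apply_blinfun_compose blinfun_apply_id_blinfun)+
  show thesis
  proof (rule that[of R])
    show "T o\<^sub>L R = id_blinfun"
      by (rule blinfun_eqI) (simp add: NS R S_schur_inverse[OF S d'] NG)
    show "R o\<^sub>L T = id_blinfun"
    proof (rule blinfun_eqI)
      fix x
      have "S (schur_inverse n S (S x) - x) = 0"
        by (simp add: blinfun.diff_right S_schur_inverse[OF S d'])
      then have "schur_inverse n S (S x) - x = 0" by (rule S_inj[OF S d'])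
      then show "blinfun_apply (R o\<^sub>L T) x = blinfun_apply id_blinfun x" by (simp add: R GT)
    qed
    show "blinfun_apply R y = schur_inverse n (G o\<^sub>L T) (G y)" for y by (simp add: R S_def)
  qed
qed

lemma schur_kernel:
  assumes G: "G o\<^sub>L schur_op n T = id_blinfun" "schur_op n T o\<^sub>L G = id_blinfun" and T: "clin T"
    and d: "mdet n (schur_matrix (G o\<^sub>L T)) = 0"
  obtains x where "x \<noteq> 0" "T x = 0"
proof -
  obtain x where x: "x \<noteq> 0" "(G o\<^sub>L T) x = 0"
    using schur_singular[OF schur_complement[OF G T] schur_clin[OF G T] d] by metis
  have "T x = (schur_op n T o\<^sub>L (G o\<^sub>L T)) x" by (simp only: schur_factor[OF G T])
  also have "\<dots> = 0" using x(2) by simp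
  finally show thesis using x(1) that by blast
qed

end

section \<open>The trace of a contour integral\<close>

lemma has_integral_circle_integral:
  fixes F :: "complex \<Rightarrow> 'b::{complex_normed_vector,banach}"
  assumes F: "continuous_on (sphere c r) F" and r: "0 \<le> r"
  shows "((\<lambda>t. (\<i> * of_real r * cis t) *\<^sub>C F (c + of_real r * cis t)) has_integral circle_integral F c r) {0..2*pi}"
proof -
  have c: "continuous_on {0..2*pi} (\<lambda>t. c + of_real r * cis t)"
    unfolding cis_conv_exp by (intro continuous_intros)
  have "(\<lambda>t. c + of_real r * cis t) ` {0..2*pi} \<subseteq> sphere c r"
    using r by (auto simp: dist_norm norm_mult)
  then have "continuous_on {0..2*pi} (\<lambda>t. F (c + of_real r * cis t))"
    using continuous_on_compose2[OF F c] by blast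
  moreover have "continuous_on {0..2*pi} (\<lambda>t. \<i> * of_real r * cis t)"
    unfolding cis_conv_exp by (intro continuous_intros)
  ultimately have "continuous_on {0..2*pi} (\<lambda>t. (\<i> * of_real r * cis t) *\<^sub>C F (c + of_real r * cis t))"
    by (intro continuous_on_scaleC)
  then show ?thesis
    unfolding circle_integral_def by (intro integrable_integral integrable_continuous_real)
qed

text \<open>Complex-linear functionals turn the vector-valued integral into scalar contour
  integrals, to which Cauchy theory applies; identities between operators are then tested functional
  by functional.\<close>

lemma contour_integral_functional:
  fixes F :: "complex \<Rightarrow> 'b::{complex_normed_vector,banach}"
  assumes F: "continuous_on (sphere c r) F" and r: "0 \<le> r"
    and \<psi>: "bounded_linear \<psi>" "\<And>a x. \<psi> (a *\<^sub>C x) = a * \<psi> x"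
  shows "((\<lambda>\<zeta>. \<psi> (F \<zeta>)) has_contour_integral \<psi> (circle_integral F c r)) (circlepath c r)"
proof -
  from has_integral_linear[OF has_integral_circle_integral[OF F r] \<psi>(1)]
  have "((\<lambda>t. \<psi> (F (c + of_real r * cis t)) * of_real r * \<i> * cis t) has_integral
      \<psi> (circle_integral F c r)) {0..2*pi}"
    by (simp add: o_def \<psi>(2) mult_ac)
  then show ?thesis
    unfolding circlepath_def by (subst has_contour_integral_part_circlepath_iff) auto
qed

lemma circle_integral_compose:
  fixes F :: "complex \<Rightarrow> 'a::{complex_normed_vector,banach} \<Rightarrow>\<^sub>L 'a" and L :: "'a \<Rightarrow>\<^sub>L 'b::complex_normed_vector"
  assumes F: "continuous_on (sphere c r) F" and r: "0 \<le> r" and L: "clin L"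
    and G: "\<And>\<zeta>. \<zeta> \<in> sphere c r \<Longrightarrow> G \<zeta> = L o\<^sub>L F \<zeta> o\<^sub>L M"
  shows "circle_integral G c r = L o\<^sub>L circle_integral F c r o\<^sub>L M"
proof -
  have "bounded_linear (\<lambda>X. L o\<^sub>L X o\<^sub>L M)"
    by (intro bounded_linear_compose[OF bounded_bilinear.bounded_linear_left[OF bounded_bilinear_blinfun_compose]
        bounded_bilinear.bounded_linear_right[OF bounded_bilinear_blinfun_compose]])
  from has_integral_linear[OF has_integral_circle_integral[OF F r] this]
  have "((\<lambda>t. L o\<^sub>L (\<i> * of_real r * cis t) *\<^sub>C F (c + of_real r * cis t) o\<^sub>L M) has_integral
      L o\<^sub>L circle_integral F c r o\<^sub>L M) {0..2*pi}" by (simp add: o_def)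
  moreover have "L o\<^sub>L (\<i> * of_real r * cis t) *\<^sub>C F (c + of_real r * cis t) o\<^sub>L M =
      (\<i> * of_real r * cis t) *\<^sub>C G (c + of_real r * cis t)" for t
  proof -
    have "c + of_real r * cis t \<in> sphere c r" using r by (auto simp: dist_norm norm_mult)
    from G[OF this] show ?thesis
      by (intro blinfun_eqI) (simp add: scaleC_blinfun.rep_eq clinD[OF L])
  qed
  ultimately show ?thesis unfolding circle_integral_def by (intro integral_unique) simp
qed

text \<open>Riemann's removable singularity theorem followed by Cauchy's theorem. All terms that the
  trace computation discards are discarded by this fact.\<close>

lemma has_contour_integral_removable:
  assumes U: "open U" "convex U" "cball c r \<subseteq> U" "k \<in> ball c r"
    and F: "F holomorphic_on U - {k}" and bd: "\<exists>B. \<forall>\<^sub>F \<zeta> in at k. cmod (F \<zeta>) \<le> B"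
  shows "(F has_contour_integral 0) (circlepath c r)"
proof -
  have kU: "k \<in> interior U" using U by (auto simp: interior_open)
  obtain g where g: "g holomorphic_on U" "\<And>z. z \<in> U - {k} \<Longrightarrow> g z = F z"
    using holomorphic_on_extend_bounded[OF F kU] bd by blast
  have r: "0 < r" using U(4) by (metis ball_eq_empty empty_iff not_less)
  have im: "path_image (circlepath c r) = sphere c r" using r by simp
  have "(g has_contour_integral 0) (circlepath c r)"
    by (rule Cauchy_theorem_convex_simple[OF g(1) U(2)]) (use U(3) im in auto)
  then show ?thesis
  proof (rule has_contour_integral_eq)
    fix z assume "z \<in> path_image (circlepath c r)"
    then have "z \<in> sphere c r" by (simp only: im)
    then have "z \<in> U - {k}" using U(3,4) by auto
    then show "g z = F z" by (rule g(2))
  qed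
qed

text \<open>Cauchy's inequality bounds coefficient \<open>m\<close> by M / \<rho>^m; within distance
  \<rho>/2 the tail is dominated by a geometric series of ratio 1/2, whose sum is the factor
  2.\<close>

lemma taylor_remainder_bound:
  assumes u: "u holomorphic_on ball k (2 * \<rho>)" and \<rho>: "0 < \<rho>"
    and M: "\<And>\<zeta>. \<zeta> \<in> sphere k \<rho> \<Longrightarrow> cmod (u \<zeta>) \<le> M"
    and \<zeta>: "cmod (\<zeta> - k) \<le> \<rho> / 2"
  shows "cmod (u \<zeta> - (\<Sum>m<n. (deriv ^^ m) u k / fact m * (\<zeta> - k) ^ m)) \<le> 2 * M / \<rho> ^ n * cmod (\<zeta> - k) ^ n"
proof -
  define t where "t = cmod (\<zeta> - k)"
  define co where "co = (\<lambda>m. (deriv ^^ m) u k / fact m)"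
  have "continuous_on (cball k \<rho>) u"
    by (rule holomorphic_on_imp_continuous_on[OF holomorphic_on_subset[OF u]]) (use \<rho> in auto)
  moreover have "u holomorphic_on ball k \<rho>"
    by (rule holomorphic_on_subset[OF u]) (use \<rho> in auto)
  ultimately have co: "cmod (co m) \<le> M / \<rho> ^ m" for m
    using Cauchy_inequality[of u k \<rho> M m] M \<rho>
    by (simp add: co_def norm_divide field_simps dist_norm)
  have M0: "0 \<le> M" using order_trans[OF norm_ge_zero co[of 0]] by simp
  have "(\<lambda>m. co m * (\<zeta> - k) ^ m) sums u \<zeta>"
    unfolding co_def by (rule holomorphic_power_series[OF u]) (use \<zeta> \<rho> in \<open>auto simp: dist_norm norm_minus_commute\<close>)
  then have s: "(\<lambda>m. co (m + n) * (\<zeta> - k) ^ (m + n)) sums (u \<zeta> - (\<Sum>m<n. co m * (\<zeta> - k) ^ m))"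
    by (subst sums_iff_shift) simp
  have "(\<lambda>m. (M * (t / \<rho>) ^ n) * (1 / 2) ^ m) sums ((M * (t / \<rho>) ^ n) * 2)"
    using geometric_sums[of "1 / 2 :: real"] by (intro sums_mult) simp
  moreover have "cmod (co (m + n) * (\<zeta> - k) ^ (m + n)) \<le> (M * (t / \<rho>) ^ n) * (1 / 2) ^ m" for m
  proof -
    have "cmod (co (m + n) * (\<zeta> - k) ^ (m + n)) \<le> M / \<rho> ^ (m + n) * t ^ (m + n)"
      unfolding norm_mult norm_power t_def by (intro mult_right_mono co) simp
    also have "\<dots> = M * (t / \<rho>) ^ n * (t / \<rho>) ^ m"
      by (simp add: power_add power_divide field_simps)
    also have "\<dots> \<le> M * (t / \<rho>) ^ n * (1 / 2) ^ m"
      using \<zeta> \<rho> M0 by (intro mult_left_mono power_mono) (auto simp: t_def field_simps)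
    finally show ?thesis .
  qed
  ultimately have "cmod (u \<zeta> - (\<Sum>m<n. co m * (\<zeta> - k) ^ m)) \<le> M * (t / \<rho>) ^ n * 2"
    using norm_sums_le[OF s] by blast
  then show ?thesis by (simp add: t_def co_def power_divide mult_ac)
qed

lemma holomorphic_bounded_near:
  assumes "f holomorphic_on U" "open U" "k \<in> U"
  shows "\<exists>B. \<forall>\<^sub>F \<zeta> in at k. cmod (f \<zeta>) \<le> B"
proof -
  have "isCont f k"
    using assms holomorphic_on_imp_continuous_on continuous_on_eq_continuous_at by blast
  then have "((\<lambda>\<zeta>. cmod (f \<zeta>)) \<longlongrightarrow> cmod (f k)) (at k)"
    by (intro tendsto_norm) (simp add: isCont_def)
  then have "\<forall>\<^sub>F \<zeta> in at k. cmod (f \<zeta>) < cmod (f k) + 1"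
    by (rule order_tendstoD) simp
  then show ?thesis by (auto elim!: eventually_mono intro!: exI[of _ "cmod (f k) + 1"])
qed

text \<open>Tested against \<open>x\<close> and \<open>y\<close>, the integrand is a holomorphic
  part plus a finite sum of rank-one operators with scalar coefficients \<open>h i j\<close>. The
  holomorphic part integrates to 0. As \<open>h i j\<close> has a pole of order at most
  \<open>n\<close>, replacing \<open>a i\<close> by its Taylor polynomial of degree below
  \<open>n\<close> at \<open>k\<close> changes the integral by removable singularities only; what
  remains has finite rank and an explicit trace. Putting the remainders back under the trace
  produces the scalar integral. \<open>Li\<close> and \<open>Lo\<close> carry the operator to
  another space; since \<open>Lo\<close> undoes \<open>Li\<close>, the trace is unaffected.\<close>

lemma op_trace_circle_integral:
  fixes g :: "complex \<Rightarrow> 'a::{complex_normed_vector,real_inner,banach} \<Rightarrow>\<^sub>L 'a"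
    and a :: "nat \<Rightarrow> complex \<Rightarrow> 'a" and \<phi> :: "nat \<Rightarrow> complex \<Rightarrow> 'a \<Rightarrow> complex"
    and Li :: "'a \<Rightarrow>\<^sub>L 'c::complex_normed_vector"
  assumes U: "open U" "convex U" "cball c r \<subseteq> U" "k \<in> ball c r"
    and g: "continuous_on (sphere c r) g"
    and dec: "\<And>\<zeta> x y. \<zeta> \<in> sphere c r \<Longrightarrow> cip (g \<zeta> x) y =
      b x y \<zeta> + (\<Sum>i<N. \<Sum>j<N. h i j \<zeta> * \<phi> j \<zeta> x * cip (a i \<zeta>) y)"
    and b: "\<And>x y. b x y holomorphic_on U"
    and h: "\<And>i j. i < N \<Longrightarrow> j < N \<Longrightarrow> h i j holomorphic_on U - {k}"
    and h_pole: "\<And>i j. i < N \<Longrightarrow> j < N \<Longrightarrow> \<exists>B. \<forall>\<^sub>F \<zeta> in at k. cmod (h i j \<zeta> * (\<zeta> - k) ^ n) \<le> B"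
    and \<phi>: "\<And>j x. j < N \<Longrightarrow> (\<lambda>\<zeta>. \<phi> j \<zeta> x) holomorphic_on U"
    and \<phi>_bound: "\<And>j. j < N \<Longrightarrow> \<exists>B. \<forall>\<^sub>F \<zeta> in at k. \<forall>x. cmod (\<phi> j \<zeta> x) \<le> B * norm x"
    and \<phi>_add: "\<And>j \<zeta> x y. j < N \<Longrightarrow> \<zeta> \<in> U \<Longrightarrow> \<phi> j \<zeta> (x + y) = \<phi> j \<zeta> x + \<phi> j \<zeta> y"
    and \<phi>_scale: "\<And>j \<zeta> s x. j < N \<Longrightarrow> \<zeta> \<in> U \<Longrightarrow> \<phi> j \<zeta> (s *\<^sub>C x) = s * \<phi> j \<zeta> x"
    and a_cont: "\<And>i. i < N \<Longrightarrow> continuous_on U (a i)"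
    and a: "\<And>i y. i < N \<Longrightarrow> (\<lambda>\<zeta>. cip (a i \<zeta>) y) holomorphic_on U"
    and \<phi>a: "\<And>i j. i < N \<Longrightarrow> j < N \<Longrightarrow> (\<lambda>\<zeta>. \<phi> j \<zeta> (a i \<zeta>)) holomorphic_on U"
    and Li: "clin Li" and Lo: "clin Lo" "\<And>x. blinfun_apply Lo (blinfun_apply Li x) = x"
  shows "op_trace (Li o\<^sub>L circle_integral g c r o\<^sub>L Lo) =
    contour_integral (circlepath c r) (\<lambda>\<zeta>. \<Sum>i<N. \<Sum>j<N. h i j \<zeta> * \<phi> j \<zeta> (a i \<zeta>))"
proof -
  define Y where "Y = circle_integral g c r"
  have r: "0 < r" using U(4) by (metis ball_eq_empty empty_iff not_less)
  have im: "path_image (circlepath c r) = sphere c r" using r by simp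
  have kU: "k \<in> U" using U by auto
  have SU: "sphere c r \<subseteq> U - {k}" using U by (auto simp: dist_commute)
  have removable: "(F has_contour_integral 0) (circlepath c r)"
    if "F holomorphic_on U - {k}" "\<exists>B. \<forall>\<^sub>F \<zeta> in at k. cmod (F \<zeta>) \<le> B" for F
    by (rule has_contour_integral_removable[OF U that])
  have integrable: "F contour_integrable_on circlepath c r" if "F holomorphic_on U - {k}" for F
    by (rule contour_integrable_continuous_circlepath, simp only: im)
      (rule continuous_on_subset[OF holomorphic_on_imp_continuous_on[OF that] SU])
  obtain \<rho>' where \<rho>': "0 < \<rho>'" "ball k \<rho>' \<subseteq> U" using U(1) kU openE by blast
  define \<rho> where "\<rho> = \<rho>' / 2"
  have \<rho>: "0 < \<rho>" "ball k (2 * \<rho>) \<subseteq> U" "cball k \<rho> \<subseteq> U" "ball k \<rho> \<subseteq> U"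
    using \<rho>' by (auto simp: \<rho>_def)
  \<comment> \<open>Vector-valued Taylor coefficients of \<open>a i\<close> at \<open>k\<close>,
    produced by Cauchy's integral formula; the next fact identifies them through
    \<open>cip\<close>.\<close>
  define A where "A = (\<lambda>i m. (1 / (2 * pi * \<i>)) *\<^sub>C circle_integral (\<lambda>\<zeta>. (1 / (\<zeta> - k) ^ Suc m) *\<^sub>C a i \<zeta>) k \<rho>)"
  have A: "cip (A i m) y = (deriv ^^ m) (\<lambda>\<zeta>. cip (a i \<zeta>) y) k / fact m" if "i < N" for i m y
  proof -
    have "continuous_on (sphere k \<rho>) (\<lambda>\<zeta>. (1 / (\<zeta> - k) ^ Suc m) *\<^sub>C a i \<zeta>)"
      using \<rho> by (intro continuous_on_scaleC continuous_on_subset[OF a_cont[OF that]] continuous_intros) auto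
    from contour_integral_functional[OF this _ bounded_linear_cip_left cip_scaleC_left, of y] \<rho>
    have "((\<lambda>\<zeta>. cip (a i \<zeta>) y / (\<zeta> - k) ^ Suc m) has_contour_integral
        cip (circle_integral (\<lambda>\<zeta>. (1 / (\<zeta> - k) ^ Suc m) *\<^sub>C a i \<zeta>) k \<rho>) y) (circlepath k \<rho>)"
      by (simp add: cip_scaleC_left)
    moreover have "((\<lambda>\<zeta>. cip (a i \<zeta>) y / (\<zeta> - k) ^ Suc m) has_contour_integral
        (2 * pi * \<i>) / fact m * (deriv ^^ m) (\<lambda>\<zeta>. cip (a i \<zeta>) y) k) (circlepath k \<rho>)"
      using holomorphic_on_subset[OF a[OF that]] holomorphic_on_imp_continuous_on \<rho>
      by (intro Cauchy_has_contour_integral_higher_derivative_circlepath) auto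
    ultimately have "cip (circle_integral (\<lambda>\<zeta>. (1 / (\<zeta> - k) ^ Suc m) *\<^sub>C a i \<zeta>) k \<rho>) y =
        (2 * pi * \<i>) / fact m * (deriv ^^ m) (\<lambda>\<zeta>. cip (a i \<zeta>) y) k"
      by (rule has_contour_integral_unique)
    then show ?thesis by (simp add: A_def cip_scaleC_left)
  qed
  define rem where "rem = (\<lambda>i \<zeta>. a i \<zeta> - (\<Sum>m<n. ((\<zeta> - k) ^ m) *\<^sub>C A i m))"
  have cip_rem: "cip (rem i \<zeta>) y = cip (a i \<zeta>) y - (\<Sum>m<n. (\<zeta> - k) ^ m * cip (A i m) y)" for i \<zeta> y
    by (simp add: rem_def cip_diff_left cip_sum_left cip_scaleC_left)
  have a_eq: "a i \<zeta> = rem i \<zeta> + (\<Sum>m<n. ((\<zeta> - k) ^ m) *\<^sub>C A i m)" for i \<zeta>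
    by (simp add: rem_def)
  have rem_bound: "\<exists>C. \<forall>\<^sub>F \<zeta> in at k. norm (rem i \<zeta>) \<le> C * cmod (\<zeta> - k) ^ n" if i: "i < N" for i
  proof -
    have "compact (a i ` sphere k \<rho>)"
      using \<rho> by (intro compact_continuous_image continuous_on_subset[OF a_cont[OF i]]) auto
    from compact_imp_bounded[OF this]
    obtain M where M: "\<And>\<zeta>. \<zeta> \<in> sphere k \<rho> \<Longrightarrow> norm (a i \<zeta>) \<le> M" "0 < M"
      unfolding bounded_pos by blast
    have le: "norm (rem i \<zeta>) \<le> 2 * M / \<rho> ^ n * cmod (\<zeta> - k) ^ n" if \<zeta>: "cmod (\<zeta> - k) \<le> \<rho> / 2" for \<zeta>
    proof (rule norm_le_cip)
      fix y
      have "cmod (cip (a i \<zeta>) y - (\<Sum>m<n. (deriv ^^ m) (\<lambda>\<zeta>. cip (a i \<zeta>) y) k / fact m * (\<zeta> - k) ^ m))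
          \<le> 2 * (M * norm y) / \<rho> ^ n * cmod (\<zeta> - k) ^ n"
      proof (rule taylor_remainder_bound[OF holomorphic_on_subset[OF a[OF i] \<rho>(2)] \<rho>(1) _ \<zeta>])
        fix \<zeta> assume "\<zeta> \<in> sphere k \<rho>"
        then have "norm (a i \<zeta>) * norm y \<le> M * norm y" by (intro mult_right_mono M) auto
        then show "cmod (cip (a i \<zeta>) y) \<le> M * norm y" using cip_bound order_trans by blast
      qed
      then show "cmod (cip (rem i \<zeta>) y) \<le> 2 * M / \<rho> ^ n * cmod (\<zeta> - k) ^ n * norm y"
        by (simp add: cip_rem A[OF i] mult_ac)
    qed (use M \<rho> in simp)
    have "\<forall>\<^sub>F \<zeta> in at k. cmod (\<zeta> - k) \<le> \<rho> / 2"
      using \<rho>(1) by (auto simp: eventually_at dist_norm intro!: exI[of _ "\<rho> / 2"])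
    then have "\<forall>\<^sub>F \<zeta> in at k. norm (rem i \<zeta>) \<le> 2 * M / \<rho> ^ n * cmod (\<zeta> - k) ^ n"
      by (rule eventually_mono) (rule le)
    then show ?thesis by blast
  qed
  define H where "H = (\<lambda>i x \<zeta>. \<Sum>j<N. h i j \<zeta> * \<phi> j \<zeta> x)"
  have H: "H i x holomorphic_on U - {k}" if "i < N" for i x
    unfolding H_def using that holomorphic_on_subset[OF \<phi>]
    by (intro holomorphic_on_sum holomorphic_on_mult h) auto
  \<comment> \<open>Moments of \<open>H i x\<close> against powers of \<zeta> - k: the linear
    functionals of \<open>x\<close> that go with the fixed vectors \<open>A i m\<close>.\<close>
  define \<Phi> where "\<Phi> = (\<lambda>i m x. contour_integral (circlepath c r) (\<lambda>\<zeta>. H i x \<zeta> * (\<zeta> - k) ^ m))"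
  have \<Phi>: "((\<lambda>\<zeta>. H i x \<zeta> * (\<zeta> - k) ^ m) has_contour_integral \<Phi> i m x) (circlepath c r)" if "i < N" for i m x
    unfolding \<Phi>_def
    by (intro has_contour_integral_integral integrable holomorphic_intros H that)
  have \<Phi>_add: "\<Phi> i m (x + y) = \<Phi> i m x + \<Phi> i m y" if i: "i < N" for i m x y
  proof -
    have "((\<lambda>\<zeta>. H i (x + y) \<zeta> * (\<zeta> - k) ^ m) has_contour_integral \<Phi> i m x + \<Phi> i m y) (circlepath c r)"
    proof (rule has_contour_integral_eq[OF has_contour_integral_add[OF \<Phi>[OF i] \<Phi>[OF i]]])
      fix \<zeta> assume "\<zeta> \<in> path_image (circlepath c r)"
      then have "\<zeta> \<in> U" using im SU by auto
      then show "H i x \<zeta> * (\<zeta> - k) ^ m + H i y \<zeta> * (\<zeta> - k) ^ m = H i (x + y) \<zeta> * (\<zeta> - k) ^ m"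
        by (simp add: H_def \<phi>_add distrib_left distrib_right sum.distrib)
    qed
    then show ?thesis using \<Phi>[OF i] has_contour_integral_unique by blast
  qed
  have \<Phi>_scale: "\<Phi> i m (s *\<^sub>C x) = s * \<Phi> i m x" if i: "i < N" for i m s x
  proof -
    have "((\<lambda>\<zeta>. H i (s *\<^sub>C x) \<zeta> * (\<zeta> - k) ^ m) has_contour_integral s * \<Phi> i m x) (circlepath c r)"
    proof (rule has_contour_integral_eq[OF has_contour_integral_lmul[OF \<Phi>[OF i]]])
      fix \<zeta> assume "\<zeta> \<in> path_image (circlepath c r)"
      then have "\<zeta> \<in> U" using im SU by auto
      then show "s * (H i x \<zeta> * (\<zeta> - k) ^ m) = H i (s *\<^sub>C x) \<zeta> * (\<zeta> - k) ^ m"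
        by (simp add: H_def \<phi>_scale sum_distrib_left sum_distrib_right mult_ac)
    qed
    then show ?thesis using \<Phi>[OF i] has_contour_integral_unique by blast
  qed
  \<comment> \<open>The remainder vanishes to order \<open>n\<close> at \<open>k\<close> and so
    cancels the pole of \<open>h i j\<close>.\<close>
  have zero1: "((\<lambda>\<zeta>. h i j \<zeta> * \<phi> j \<zeta> x * cip (rem i \<zeta>) y) has_contour_integral 0) (circlepath c r)"
    if ij: "i < N" "j < N" for i j x y
  proof (rule removable)
    show "(\<lambda>\<zeta>. h i j \<zeta> * \<phi> j \<zeta> x * cip (rem i \<zeta>) y) holomorphic_on U - {k}"
      unfolding cip_rem
      using holomorphic_on_subset[OF \<phi>[OF ij(2)]] holomorphic_on_subset[OF a[OF ij(1)]]
      by (intro holomorphic_intros h ij) auto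
    obtain B1 where B1: "\<forall>\<^sub>F \<zeta> in at k. cmod (h i j \<zeta> * (\<zeta> - k) ^ n) \<le> B1" using h_pole[OF ij] by blast
    obtain B2 where B2: "\<forall>\<^sub>F \<zeta> in at k. cmod (\<phi> j \<zeta> x) \<le> B2"
      using holomorphic_bounded_near[OF \<phi>[OF ij(2)] U(1) kU] by blast
    obtain C where C: "\<forall>\<^sub>F \<zeta> in at k. norm (rem i \<zeta>) \<le> C * cmod (\<zeta> - k) ^ n"
      using rem_bound[OF ij(1)] by blast
    have "\<forall>\<^sub>F \<zeta> in at k. cmod (h i j \<zeta> * \<phi> j \<zeta> x * cip (rem i \<zeta>) y) \<le> \<bar>B1\<bar> * \<bar>B2\<bar> * (\<bar>C\<bar> * norm y)"
      using B1 B2 C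
    proof eventually_elim
      case (elim \<zeta>)
      have "cmod (cip (rem i \<zeta>) y) \<le> (\<bar>C\<bar> * cmod (\<zeta> - k) ^ n) * norm y"
        by (rule order_trans[OF cip_bound mult_right_mono[OF order_trans[OF elim(3)]]])
          (simp_all add: mult_right_mono)
      then have "cmod (h i j \<zeta>) * cmod (\<phi> j \<zeta> x) * cmod (cip (rem i \<zeta>) y) \<le>
          cmod (h i j \<zeta>) * \<bar>B2\<bar> * ((\<bar>C\<bar> * cmod (\<zeta> - k) ^ n) * norm y)"
        using elim(2) by (intro mult_mono mult_left_mono) auto
      also have "\<dots> = cmod (h i j \<zeta> * (\<zeta> - k) ^ n) * (\<bar>B2\<bar> * (\<bar>C\<bar> * norm y))"
        by (simp add: norm_mult norm_power mult_ac)
      also have "\<dots> \<le> \<bar>B1\<bar> * (\<bar>B2\<bar> * (\<bar>C\<bar> * norm y))"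
        using elim(1) by (intro mult_right_mono) auto
      finally show ?case by (simp add: norm_mult mult_ac)
    qed
    then show "\<exists>B. \<forall>\<^sub>F \<zeta> in at k. cmod (h i j \<zeta> * \<phi> j \<zeta> x * cip (rem i \<zeta>) y) \<le> B" by blast
  qed
  have \<phi>_sum: "\<phi> j \<zeta> (\<Sum>m\<in>I. s m *\<^sub>C v m) = (\<Sum>m\<in>I. s m * \<phi> j \<zeta> (v m))"
    if "j < N" "\<zeta> \<in> U" "finite I" for j \<zeta> I s and v :: "nat \<Rightarrow> 'a"
    using that(3)
  proof induction
    case empty
    show ?case using \<phi>_scale[OF that(1,2), of 0 0] by simp
  qed (simp add: \<phi>_add \<phi>_scale that)
  \<comment> \<open>Here functional and argument both move with \<zeta>, so the bound on
    \<open>\<phi> j\<close> has to be uniform in \<open>x\<close> near \<open>k\<close>.\<close>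
  have zero2: "((\<lambda>\<zeta>. h i j \<zeta> * \<phi> j \<zeta> (rem i \<zeta>)) has_contour_integral 0) (circlepath c r)"
    if ij: "i < N" "j < N" for i j
  proof (rule removable)
    have eq: "\<phi> j \<zeta> (rem i \<zeta>) = \<phi> j \<zeta> (a i \<zeta>) - (\<Sum>m<n. (\<zeta> - k) ^ m * \<phi> j \<zeta> (A i m))" if "\<zeta> \<in> U" for \<zeta>
      using arg_cong[OF a_eq[of i \<zeta>], of "\<phi> j \<zeta>"] by (simp add: \<phi>_add[OF ij(2) that] \<phi>_sum[OF ij(2) that])
    have "(\<lambda>\<zeta>. h i j \<zeta> * (\<phi> j \<zeta> (a i \<zeta>) - (\<Sum>m<n. (\<zeta> - k) ^ m * \<phi> j \<zeta> (A i m)))) holomorphic_on U - {k}"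
      using holomorphic_on_subset[OF \<phi>[OF ij(2)]] holomorphic_on_subset[OF \<phi>a[OF ij]]
      by (intro holomorphic_intros h ij) auto
    then show "(\<lambda>\<zeta>. h i j \<zeta> * \<phi> j \<zeta> (rem i \<zeta>)) holomorphic_on U - {k}"
      by (rule holomorphic_transform) (simp add: eq)
    obtain B1 where B1: "\<forall>\<^sub>F \<zeta> in at k. cmod (h i j \<zeta> * (\<zeta> - k) ^ n) \<le> B1" using h_pole[OF ij] by blast
    obtain B2 where B2: "\<forall>\<^sub>F \<zeta> in at k. \<forall>x. cmod (\<phi> j \<zeta> x) \<le> B2 * norm x" using \<phi>_bound[OF ij(2)] by blast
    obtain C where C: "\<forall>\<^sub>F \<zeta> in at k. norm (rem i \<zeta>) \<le> C * cmod (\<zeta> - k) ^ n"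
      using rem_bound[OF ij(1)] by blast
    have "\<forall>\<^sub>F \<zeta> in at k. cmod (h i j \<zeta> * \<phi> j \<zeta> (rem i \<zeta>)) \<le> \<bar>B1\<bar> * (\<bar>B2\<bar> * \<bar>C\<bar>)"
      using B1 B2 C
    proof eventually_elim
      case (elim \<zeta>)
      have "cmod (\<phi> j \<zeta> (rem i \<zeta>)) \<le> B2 * norm (rem i \<zeta>)" using elim(2) by blast
      also have "\<dots> \<le> \<bar>B2\<bar> * norm (rem i \<zeta>)" by (intro mult_right_mono) auto
      also have "\<dots> \<le> \<bar>B2\<bar> * (C * cmod (\<zeta> - k) ^ n)" by (intro mult_left_mono elim(3)) auto
      also have "\<dots> \<le> \<bar>B2\<bar> * (\<bar>C\<bar> * cmod (\<zeta> - k) ^ n)" by (intro mult_left_mono mult_right_mono) auto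
      finally have "cmod (h i j \<zeta>) * cmod (\<phi> j \<zeta> (rem i \<zeta>)) \<le> cmod (h i j \<zeta>) * (\<bar>B2\<bar> * (\<bar>C\<bar> * cmod (\<zeta> - k) ^ n))"
        by (intro mult_left_mono) auto
      also have "\<dots> = cmod (h i j \<zeta> * (\<zeta> - k) ^ n) * (\<bar>B2\<bar> * \<bar>C\<bar>)"
        by (simp add: norm_mult norm_power mult_ac)
      also have "\<dots> \<le> \<bar>B1\<bar> * (\<bar>B2\<bar> * \<bar>C\<bar>)"
        using elim(1) by (intro mult_right_mono) auto
      finally show ?case by (simp add: norm_mult)
    qed
    then show "\<exists>B. \<forall>\<^sub>F \<zeta> in at k. cmod (h i j \<zeta> * \<phi> j \<zeta> (rem i \<zeta>)) \<le> B" by blast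
  qed
  \<comment> \<open>Holomorphic part and remainders drop out, leaving a sum of N n operators of rank
    at most one.\<close>
  have Y: "Y x = (\<Sum>i<N. \<Sum>m<n. \<Phi> i m x *\<^sub>C A i m)" for x
  proof (rule cip_eqI)
    fix y
    have "((\<lambda>\<zeta>. cip (g \<zeta> x) y) has_contour_integral cip (Y x) y) (circlepath c r)"
      unfolding Y_def
      by (rule contour_integral_functional[OF g _ bounded_linear_compose[OF bounded_linear_cip_left
              blinfun.bounded_linear_left]])
        (use r in \<open>simp_all add: scaleC_blinfun.rep_eq cip_scaleC_left\<close>)
    moreover have "((\<lambda>\<zeta>. cip (g \<zeta> x) y) has_contour_integral
        (0 + ((\<Sum>i<N. \<Sum>m<n. \<Phi> i m x * cip (A i m) y) + (\<Sum>i<N. \<Sum>j<N. 0)))) (circlepath c r)"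
    proof (rule has_contour_integral_eq)
      show "((\<lambda>\<zeta>. b x y \<zeta> + ((\<Sum>i<N. \<Sum>m<n. (H i x \<zeta> * (\<zeta> - k) ^ m) * cip (A i m) y) +
            (\<Sum>i<N. \<Sum>j<N. h i j \<zeta> * \<phi> j \<zeta> x * cip (rem i \<zeta>) y))) has_contour_integral
          (0 + ((\<Sum>i<N. \<Sum>m<n. \<Phi> i m x * cip (A i m) y) + (\<Sum>i<N. \<Sum>j<N. 0)))) (circlepath c r)"
        using removable[OF holomorphic_on_subset[OF b] holomorphic_bounded_near[OF b U(1) kU], of x y]
        by (intro has_contour_integral_add has_contour_integral_sum has_contour_integral_rmul \<Phi> zero1) auto
      fix \<zeta> assume "\<zeta> \<in> path_image (circlepath c r)"
      then have "\<zeta> \<in> sphere c r" by (simp only: im)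
      have "(\<Sum>i<N. \<Sum>j<N. h i j \<zeta> * \<phi> j \<zeta> x * cip (a i \<zeta>) y) =
          (\<Sum>i<N. H i x \<zeta> * (\<Sum>m<n. (\<zeta> - k) ^ m * cip (A i m) y)) +
          (\<Sum>i<N. \<Sum>j<N. h i j \<zeta> * \<phi> j \<zeta> x * cip (rem i \<zeta>) y)"
        unfolding sum.distrib[symmetric]
      proof (rule sum.cong)
        fix i
        have "(\<Sum>j<N. h i j \<zeta> * \<phi> j \<zeta> x * cip (a i \<zeta>) y) = H i x \<zeta> * cip (a i \<zeta>) y"
          "(\<Sum>j<N. h i j \<zeta> * \<phi> j \<zeta> x * cip (rem i \<zeta>) y) = H i x \<zeta> * cip (rem i \<zeta>) y"
          by (simp_all add: H_def sum_distrib_right)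
        then show "(\<Sum>j<N. h i j \<zeta> * \<phi> j \<zeta> x * cip (a i \<zeta>) y) =
            H i x \<zeta> * (\<Sum>m<n. (\<zeta> - k) ^ m * cip (A i m) y) +
            (\<Sum>j<N. h i j \<zeta> * \<phi> j \<zeta> x * cip (rem i \<zeta>) y)"
          by (simp add: cip_rem right_diff_distrib)
      qed simp
      then show "b x y \<zeta> + ((\<Sum>i<N. \<Sum>m<n. (H i x \<zeta> * (\<zeta> - k) ^ m) * cip (A i m) y) +
            (\<Sum>i<N. \<Sum>j<N. h i j \<zeta> * \<phi> j \<zeta> x * cip (rem i \<zeta>) y)) = cip (g \<zeta> x) y"
        by (simp add: dec[OF \<open>\<zeta> \<in> sphere c r\<close>] sum_distrib_left mult.assoc)
    qed
    ultimately have "cip (Y x) y = (\<Sum>i<N. \<Sum>m<n. \<Phi> i m x * cip (A i m) y)"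
      using has_contour_integral_unique by fastforce
    then show "cip (Y x) y = cip (\<Sum>i<N. \<Sum>m<n. \<Phi> i m x *\<^sub>C A i m) y"
      by (simp add: cip_sum_left cip_scaleC_left)
  qed
  have "op_trace (Li o\<^sub>L Y o\<^sub>L Lo) =
      (\<Sum>p\<in>{..<N} \<times> {..<n}. \<Phi> (fst p) (snd p) (Lo (Li (A (fst p) (snd p)))))"
  proof (rule op_trace_finite_rank)
    fix x
    show "(Li o\<^sub>L Y o\<^sub>L Lo) x = (\<Sum>p\<in>{..<N} \<times> {..<n}. \<Phi> (fst p) (snd p) (Lo x) *\<^sub>C Li (A (fst p) (snd p)))"
      by (simp add: Y blinfun.sum_right clinD[OF Li] sum.cartesian_product split_def)
  qed (auto simp: blinfun.add_right clinD[OF Lo(1)] \<Phi>_add \<Phi>_scale)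
  also have "\<dots> = (\<Sum>i<N. \<Sum>m<n. \<Phi> i m (A i m))"
    by (simp add: Lo(2) sum.cartesian_product split_def)
  also have "\<dots> = contour_integral (circlepath c r) (\<lambda>\<zeta>. \<Sum>i<N. \<Sum>j<N. h i j \<zeta> * \<phi> j \<zeta> (a i \<zeta>))"
  proof (rule contour_integral_unique[symmetric])
    have "((\<lambda>\<zeta>. \<Sum>i<N. (\<Sum>m<n. H i (A i m) \<zeta> * (\<zeta> - k) ^ m) + (\<Sum>j<N. h i j \<zeta> * \<phi> j \<zeta> (rem i \<zeta>)))
        has_contour_integral (\<Sum>i<N. (\<Sum>m<n. \<Phi> i m (A i m)) + (\<Sum>j<N. 0))) (circlepath c r)"
      by (intro has_contour_integral_add has_contour_integral_sum \<Phi> zero2) auto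
    then have *: "((\<lambda>\<zeta>. \<Sum>i<N. (\<Sum>m<n. H i (A i m) \<zeta> * (\<zeta> - k) ^ m) + (\<Sum>j<N. h i j \<zeta> * \<phi> j \<zeta> (rem i \<zeta>)))
        has_contour_integral (\<Sum>i<N. \<Sum>m<n. \<Phi> i m (A i m))) (circlepath c r)"
      by simp
    show "((\<lambda>\<zeta>. \<Sum>i<N. \<Sum>j<N. h i j \<zeta> * \<phi> j \<zeta> (a i \<zeta>)) has_contour_integral
        (\<Sum>i<N. \<Sum>m<n. \<Phi> i m (A i m))) (circlepath c r)"
    proof (rule has_contour_integral_eq[OF *], rule sum.cong)
      fix \<zeta> i assume "\<zeta> \<in> path_image (circlepath c r)" and i: "i \<in> {..<N}"
      then have \<zeta>: "\<zeta> \<in> U" using im SU by auto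
      have "(\<Sum>j<N. h i j \<zeta> * \<phi> j \<zeta> (a i \<zeta>)) =
          (\<Sum>j<N. h i j \<zeta> * \<phi> j \<zeta> (rem i \<zeta>)) + (\<Sum>j<N. \<Sum>m<n. h i j \<zeta> * ((\<zeta> - k) ^ m * \<phi> j \<zeta> (A i m)))"
        unfolding sum.distrib[symmetric]
        by (rule sum.cong, simp, subst a_eq) (simp add: \<phi>_add \<phi>_sum \<zeta> distrib_left sum_distrib_left)
      also have "(\<Sum>j<N. \<Sum>m<n. h i j \<zeta> * ((\<zeta> - k) ^ m * \<phi> j \<zeta> (A i m))) =
          (\<Sum>m<n. H i (A i m) \<zeta> * (\<zeta> - k) ^ m)"
        unfolding H_def sum_distrib_right by (subst sum.swap) (simp add: mult_ac)
      finally show "(\<Sum>m<n. H i (A i m) \<zeta> * (\<zeta> - k) ^ m) + (\<Sum>j<N. h i j \<zeta> * \<phi> j \<zeta> (rem i \<zeta>)) =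
          (\<Sum>j<N. h i j \<zeta> * \<phi> j \<zeta> (a i \<zeta>))" by simp
    qed simp
  qed
  finally show ?thesis by (simp add: Y_def)
qed

section \<open>Quadratic families of compact perturbations of the identity\<close>

lemma mdet_diagonal: "(\<And>i j. i < n \<Longrightarrow> j < n \<Longrightarrow> i \<noteq> j \<Longrightarrow> a i j = 0) \<Longrightarrow> mdet n a = (\<Prod>i<n. a i i)"
  unfolding mdet_def
  by (subst det_upper_triangular[where n = n])
    (auto simp: prod_list_diag_prod lessThan_atLeast0 intro!: upper_triangularI prod.cong)

text \<open>A bound on \<open>G w\<close> near \<open>z\<close> has to be earned: the resolvent
  identity gives |G w| \<le> M + |G w| / 2, hence |G w| \<le> 2 M, and with this bound the same
  identity gives continuity.\<close>

lemma continuous_on_inverse_op: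
  fixes N :: "'x::topological_space \<Rightarrow> 'a::real_normed_vector \<Rightarrow>\<^sub>L 'a"
  assumes N: "continuous_on U N"
    and inv: "\<And>w. w \<in> U \<Longrightarrow> G w o\<^sub>L N w = id_blinfun \<and> N w o\<^sub>L G w = id_blinfun"
  shows "continuous_on U G"
  unfolding continuous_on
proof
  fix z assume z: "z \<in> U"
  define M where "M = norm (G z)"
  have lim: "((\<lambda>w. norm (N z - N w)) \<longlongrightarrow> 0) (at z within U)"
  proof -
    have "((\<lambda>w. N z - N w) \<longlongrightarrow> N z - N z) (at z within U)"
      using N z by (intro tendsto_diff tendsto_const) (simp add: continuous_on)
    from tendsto_norm[OF this] show ?thesis by simp
  qed
  have ev: "\<forall>\<^sub>F w in at z within U. w \<in> U" by (simp add: eventually_at_filter)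
  have "((\<lambda>w. norm (N z - N w) * M) \<longlongrightarrow> 0 * M) (at z within U)"
    by (intro tendsto_intros lim)
  then have "\<forall>\<^sub>F w in at z within U. norm (N z - N w) * M < 1 / 2"
    by (rule order_tendstoD) simp
  with ev have bound: "\<forall>\<^sub>F w in at z within U. norm (G w - G z) \<le> 2 * M * (norm (N z - N w) * M)"
  proof eventually_elim
    case (elim w)
    have h1: "norm (G w - G z) \<le> norm (G w) * (norm (N z - N w) * M)"
      using inverse_diff_eq[of "G w" "N w" "N z" "G z"] inv[OF elim(1)] inv[OF z]
        norm_blinfun_compose[of "G w o\<^sub>L (N z - N w)" "G z"] norm_blinfun_compose[of "G w" "N z - N w"]
        mult_right_mono[of "norm (G w o\<^sub>L (N z - N w))" "norm (G w) * norm (N z - N w)" M]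
      by (simp add: M_def mult.assoc)
    have "norm (G w) \<le> 2 * M"
    proof -
      have "norm (G w) \<le> M + norm (G w - G z)"
        using norm_triangle_sub[of "G w" "G z"] by (simp add: M_def)
      also have "norm (G w - G z) \<le> norm (G w) * (1 / 2)"
        using h1 by (rule order_trans) (intro mult_left_mono less_imp_le[OF elim(2)] norm_ge_zero)
      finally show ?thesis by simp
    qed
    then have "norm (G w) * (norm (N z - N w) * M) \<le> 2 * M * (norm (N z - N w) * M)"
      by (intro mult_right_mono) (auto simp: M_def)
    with h1 show ?case by linarith
  qed
  have "((\<lambda>w. 2 * M * (norm (N z - N w) * M)) \<longlongrightarrow> 2 * M * (0 * M)) (at z within U)"
    by (intro tendsto_intros lim)
  then have "((\<lambda>w. G w - G z) \<longlongrightarrow> 0) (at z within U)"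
    using Lim_null_comparison[OF bound] by simp
  then show "(G \<longlongrightarrow> G z) (at z within U)" using Lim_null by blast
qed

lemma cball_subset_open:
  assumes "cball c r \<subseteq> V" "open V" "0 < (r::real)"
  obtains r' where "r < r'" "ball (c::complex) r' \<subseteq> V"
proof -
  obtain \<epsilon> where e: "\<epsilon> > 0" "{x. infdist x (cball c r) \<le> \<epsilon>} \<subseteq> V"
    using compact_in_open_separated[of "cball c r" V] assms by auto
  have "ball c (r + \<epsilon>) \<subseteq> V"
  proof
    fix x assume x: "x \<in> ball c (r + \<epsilon>)"
    show "x \<in> V"
    proof (cases "x \<in> cball c r")
      case False
      \<comment> \<open>The radial projection of \<open>x\<close> to the boundary circle, at
        distance \<open>dist c x - r\<close> from \<open>x\<close>.\<close>
      define y where "y = c + of_real (r / dist c x) * (x - c)"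
      have d: "dist c x > r" "dist c x > 0" using False assms(3) by auto
      have "y \<in> cball c r" using assms(3) d by (simp add: y_def dist_norm norm_mult norm_divide norm_minus_commute)
      then have "infdist x (cball c r) \<le> dist x y" by (rule infdist_le)
      also have "dist x y = dist c x - r"
      proof -
        have "x - y = of_real (1 - r / dist c x) * (x - c)" by (simp add: y_def algebra_simps)
        then have "dist x y = \<bar>1 - r / dist c x\<bar> * dist c x"
          by (simp only: dist_norm norm_mult norm_of_real norm_minus_commute[of c])
        moreover have "0 \<le> 1 - r / dist c x" using d by simp
        ultimately show ?thesis using d by (simp add: abs_of_nonneg left_diff_distrib)
      qed
      also have "\<dots> \<le> \<epsilon>" using x by simp
      finally show ?thesis using e(2) by blast
    qed (use assms in auto)
  qed
  then show thesis using that[of "r + \<epsilon>"] e(1) by simp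
qed

text \<open>The tail conditions express compactness of the coefficients: each is a norm limit of its
  truncations to finitely many modes.\<close>

locale quadratic_family = orthonormal_basis e
  for e :: "nat \<Rightarrow> 'a::{complex_normed_vector,real_inner,banach}" +
  fixes A0 A1 A2 W :: "'a \<Rightarrow>\<^sub>L 'a"
  assumes clin: "clin A0" "clin A1" "clin A2" "clin W"
    and tail: "(\<lambda>n. norm (A0 o\<^sub>L (id_blinfun - proj n))) \<longlonglongrightarrow> 0"
      "(\<lambda>n. norm (A1 o\<^sub>L (id_blinfun - proj n))) \<longlonglongrightarrow> 0"
      "(\<lambda>n. norm (A2 o\<^sub>L (id_blinfun - proj n))) \<longlonglongrightarrow> 0"
      "(\<lambda>n. norm (W o\<^sub>L (id_blinfun - proj n))) \<longlonglongrightarrow> 0"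
begin

definition T :: "complex \<Rightarrow> complex \<Rightarrow> 'a \<Rightarrow>\<^sub>L 'a" where
  "T \<alpha> k = id_blinfun + A0 + k *\<^sub>C A1 + k\<^sup>2 *\<^sub>C A2 - \<alpha>\<^sup>2 *\<^sub>C W"

definition T' :: "complex \<Rightarrow> 'a \<Rightarrow>\<^sub>L 'a" where
  "T' k = A1 + (2 * k) *\<^sub>C A2"

lemma clin_T: "clin (T \<alpha> k)" and clin_T': "clin (T' k)"
  unfolding T_def T'_def by (intro clin_add clin_diff clin_scaleC clin clin_id)+

lemma T_deriv: "has_cderiv (T \<alpha>) (T' k) k"
proof -
  have "has_cderiv (T \<alpha>) (0 + 0 + 1 *\<^sub>C A1 + (2 * k) *\<^sub>C A2 - 0) k"
    unfolding T_def
    by (intro has_cderiv_add has_cderiv_diff has_cderiv_const has_cderiv_scaleC)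
      (auto intro!: derivative_eq_intros)
  then show ?thesis by (simp add: T'_def scaleC_one)
qed

lemma T_deriv_param: "has_cderiv (\<lambda>\<alpha>. T \<alpha> k) (- ((2 * \<alpha>) *\<^sub>C W)) \<alpha>"
proof -
  have "has_cderiv (\<lambda>\<alpha>. T \<alpha> k) (0 + 0 + 0 + 0 - (2 * \<alpha>) *\<^sub>C W) \<alpha>"
    unfolding T_def
    by (intro has_cderiv_add has_cderiv_diff has_cderiv_const has_cderiv_scaleC)
      (auto intro!: derivative_eq_intros)
  then show ?thesis by simp
qed

lemma T'_deriv: "has_cderiv T' (2 *\<^sub>C A2) k"
proof -
  have "has_cderiv T' (0 + 2 *\<^sub>C A2) k"
    unfolding T'_def by (intro has_cderiv_add has_cderiv_const has_cderiv_scaleC)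
      (auto intro!: derivative_eq_intros)
  then show ?thesis by simp
qed

lemma T_continuous: "continuous_on U (\<lambda>p. T (fst p) (snd p))"
  unfolding T_def by (intro continuous_intros)

lemma schur_op_near_id:
  "id_blinfun - schur_op n (T \<alpha> k) = \<alpha>\<^sup>2 *\<^sub>C (W o\<^sub>L (id_blinfun - proj n)) - (A0 o\<^sub>L (id_blinfun - proj n))
    - k *\<^sub>C (A1 o\<^sub>L (id_blinfun - proj n)) - k\<^sup>2 *\<^sub>C (A2 o\<^sub>L (id_blinfun - proj n))"
  by (rule blinfun_eqI)
    (simp add: schur_op_def T_def blinfun.bilinear_simps scaleC_blinfun.rep_eq algebra_simps
      proj_idem)

text \<open>The threshold 1/2 is what \<open>neumann\<close> asks for. One \<open>n\<close> has to
  serve a whole product of balls, so that the determinant is a single function there.\<close>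

definition schur_bound :: "nat \<Rightarrow> real \<Rightarrow> bool" where
  "schur_bound n R \<longleftrightarrow> (\<forall>\<alpha>\<in>ball 0 R. \<forall>k\<in>ball 0 R. norm (id_blinfun - schur_op n (T \<alpha> k)) \<le> 1 / 2)"

lemma schur_bound_exists:
  obtains n where "schur_bound n R"
proof -
  let ?P = "\<lambda>n. id_blinfun - proj n"
  define \<delta> where "\<delta> = (\<lambda>n. R\<^sup>2 * norm (W o\<^sub>L ?P n) + norm (A0 o\<^sub>L ?P n)
    + \<bar>R\<bar> * norm (A1 o\<^sub>L ?P n) + R\<^sup>2 * norm (A2 o\<^sub>L ?P n))"
  have "\<delta> \<longlonglongrightarrow> R\<^sup>2 * 0 + 0 + \<bar>R\<bar> * 0 + R\<^sup>2 * 0"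
    unfolding \<delta>_def by (intro tendsto_add tendsto_mult tendsto_const tail)
  then have "\<forall>\<^sub>F n in sequentially. \<delta> n < 1 / 2" by (rule order_tendstoD) simp
  then obtain n where n: "\<delta> n < 1 / 2" by (auto simp: eventually_sequentially)
  have "norm (id_blinfun - schur_op n (T \<alpha> k)) \<le> 1 / 2" if "\<alpha> \<in> ball 0 R" "k \<in> ball 0 R" for \<alpha> k
  proof -
    have ak: "cmod \<alpha> \<le> \<bar>R\<bar>" "cmod k \<le> \<bar>R\<bar>" "(cmod \<alpha>)\<^sup>2 \<le> R\<^sup>2" "(cmod k)\<^sup>2 \<le> R\<^sup>2"
      using that by (auto intro: power_mono)
    have "norm (id_blinfun - schur_op n (T \<alpha> k)) \<le> norm (\<alpha>\<^sup>2 *\<^sub>C (W o\<^sub>L ?P n)) + norm (A0 o\<^sub>L ?P n)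
        + norm (k *\<^sub>C (A1 o\<^sub>L ?P n)) + norm (k\<^sup>2 *\<^sub>C (A2 o\<^sub>L ?P n))"
      unfolding schur_op_near_id
      by (intro order_trans[OF norm_triangle_ineq4] add_mono order_refl)
    also have "\<dots> \<le> \<delta> n"
      unfolding \<delta>_def norm_scaleC norm_power using ak
      by (intro add_mono mult_right_mono order_refl) auto
    finally show ?thesis using n by simp
  qed
  then show thesis using that unfolding schur_bound_def by blast
qed

definition G :: "nat \<Rightarrow> complex \<Rightarrow> complex \<Rightarrow> 'a \<Rightarrow>\<^sub>L 'a" where
  "G n \<alpha> k = op_inverse (schur_op n (T \<alpha> k))"

definition S :: "nat \<Rightarrow> complex \<Rightarrow> complex \<Rightarrow> 'a \<Rightarrow>\<^sub>L 'a" where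
  "S n \<alpha> k = G n \<alpha> k o\<^sub>L T \<alpha> k"

text \<open>The function f of the overview. Under \<open>schur_bound n R\<close>, its zeros with
  both parameters in \<open>ball 0 R\<close> are the parameters at which \<open>T\<close> has a
  nontrivial kernel, whatever \<open>n\<close> is.\<close>

definition char_det :: "nat \<Rightarrow> complex \<Rightarrow> complex \<Rightarrow> complex" where
  "char_det n \<alpha> k = mdet n (schur_matrix (S n \<alpha> k))"

context
  fixes R :: real and n :: nat
  assumes rank: "schur_bound n R"
begin

lemma G_inverse:
  assumes "\<alpha> \<in> ball 0 R" "k \<in> ball 0 R"
  shows "G n \<alpha> k o\<^sub>L schur_op n (T \<alpha> k) = id_blinfun" "schur_op n (T \<alpha> k) o\<^sub>L G n \<alpha> k = id_blinfun"
proof -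
  have "norm (id_blinfun - schur_op n (T \<alpha> k)) \<le> 1 / 2"
    using rank assms unfolding schur_bound_def by blast
  then obtain B where "B o\<^sub>L schur_op n (T \<alpha> k) = id_blinfun" "schur_op n (T \<alpha> k) o\<^sub>L B = id_blinfun"
    using neumann[of "id_blinfun - schur_op n (T \<alpha> k)"] by auto
  then show "G n \<alpha> k o\<^sub>L schur_op n (T \<alpha> k) = id_blinfun" "schur_op n (T \<alpha> k) o\<^sub>L G n \<alpha> k = id_blinfun"
    unfolding G_def using op_inverse_eq by auto
qed

lemma clin_schur_op: "clin (schur_op n (T \<alpha> k))"
  unfolding schur_op_def by (intro clin_add clin_compose clin_diff clin_T clin_id clin_proj)

lemma clin_G: "\<alpha> \<in> ball 0 R \<Longrightarrow> k \<in> ball 0 R \<Longrightarrow> clin (G n \<alpha> k)"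
  by (rule clin_inverse[OF clin_schur_op G_inverse])

lemma G_continuous: "continuous_on (ball 0 R \<times> ball 0 R) (\<lambda>p. G n (fst p) (snd p))"
proof (rule continuous_on_inverse_op)
  show "continuous_on (ball 0 R \<times> ball 0 R) (\<lambda>p. schur_op n (T (fst p) (snd p)))"
    unfolding schur_op_def
    by (intro continuous_on_add continuous_on_const T_continuous
        bounded_bilinear.continuous_on[OF bounded_bilinear_blinfun_compose])
qed (use G_inverse in auto)

lemma S_continuous: "continuous_on (ball 0 R \<times> ball 0 R) (\<lambda>p. S n (fst p) (snd p))"
  unfolding S_def
  by (intro bounded_bilinear.continuous_on[OF bounded_bilinear_blinfun_compose] G_continuous T_continuous)

lemma schur_op_deriv:
  assumes "has_cderiv F D z" "\<And>w. clin (F w)"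
  shows "has_cderiv (\<lambda>w. schur_op n (F w)) (D o\<^sub>L (id_blinfun - proj n)) z"
proof -
  have "has_cderiv (\<lambda>w. (F w o\<^sub>L (id_blinfun - proj n)) + proj n)
      (((F z o\<^sub>L 0) + (D o\<^sub>L (id_blinfun - proj n))) + 0) z"
    by (intro has_cderiv_add has_cderiv_const has_cderiv_compose[where U = UNIV] assms) auto
  moreover have "F z o\<^sub>L 0 = 0" by (rule blinfun_eqI) simp
  ultimately show ?thesis by (simp add: schur_op_def)
qed

text \<open>Differentiation of \<open>S = G T\<close> along a curve of operators; the formula for the derivative
  shows that the cross terms in the trace recombine to \<open>S'\<close>.\<close>

lemma S_deriv_aux:
  assumes F: "\<And>w. w \<in> ball 0 R \<Longrightarrow> has_cderiv F (D w) w" "\<And>w. clin (F w)"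
    and H: "\<And>w. w \<in> ball 0 R \<Longrightarrow> H w o\<^sub>L schur_op n (F w) = id_blinfun \<and> schur_op n (F w) o\<^sub>L H w = id_blinfun"
    and z: "z \<in> ball 0 R"
  shows "has_cderiv H (- (H z o\<^sub>L (D z o\<^sub>L (id_blinfun - proj n)) o\<^sub>L H z)) z"
    and "has_cderiv (\<lambda>w. H w o\<^sub>L F w)
      ((H z o\<^sub>L D z) - (H z o\<^sub>L D z o\<^sub>L (id_blinfun - proj n) o\<^sub>L (H z o\<^sub>L F z))) z"
proof -
  have cl: "clin (schur_op n (F w))" for w
    unfolding schur_op_def by (intro clin_add clin_compose clin_diff F clin_id clin_proj)
  have N: "has_cderiv (\<lambda>w. schur_op n (F w)) (D w o\<^sub>L (id_blinfun - proj n)) w" if "w \<in> ball 0 R" for w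
    by (intro schur_op_deriv F that)
  have "continuous_on (ball 0 R) (\<lambda>w. schur_op n (F w))"
    using has_cderiv_isCont[OF N] by (simp add: continuous_on_eq_continuous_at)
  then have "continuous_on (ball 0 R) H" by (rule continuous_on_inverse_op) (use H in blast)
  then have cont: "isCont H z" using z by (simp add: continuous_on_eq_continuous_at)
  show 1: "has_cderiv H (- (H z o\<^sub>L (D z o\<^sub>L (id_blinfun - proj n)) o\<^sub>L H z)) z"
    by (rule has_cderiv_inverse[OF N[OF z] open_ball z _ cont]) (use H cl in blast)
  have "has_cderiv (\<lambda>w. H w o\<^sub>L F w)
      ((H z o\<^sub>L D z) + (- (H z o\<^sub>L (D z o\<^sub>L (id_blinfun - proj n)) o\<^sub>L H z) o\<^sub>L F z)) z"
    by (rule has_cderiv_compose[OF 1 F(1)[OF z] open_ball z]) (use H cl clin_inverse in blast)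
  then show "has_cderiv (\<lambda>w. H w o\<^sub>L F w)
      ((H z o\<^sub>L D z) - (H z o\<^sub>L D z o\<^sub>L (id_blinfun - proj n) o\<^sub>L (H z o\<^sub>L F z))) z"
    by (simp add: compose_simps blinfun_compose_assoc algebra_simps)
qed

text \<open>With P = \<open>proj n\<close>, the map 1 - (1 - P) S sends \<open>e j\<close> to the
  vector \<open>schur_vec n S j\<close>, so \<open>S'\<close> applied to \<open>e j\<close> is G T'
  applied to that vector. The entries of the differentiated matrix are thus exactly the pairings
  that occur in the trace.\<close>

definition S' :: "complex \<Rightarrow> complex \<Rightarrow> 'a \<Rightarrow>\<^sub>L 'a" where
  "S' \<alpha> k = (G n \<alpha> k o\<^sub>L T' k) - (G n \<alpha> k o\<^sub>L T' k o\<^sub>L (id_blinfun - proj n) o\<^sub>L S n \<alpha> k)"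

lemma
  assumes "\<alpha> \<in> ball 0 R" "k \<in> ball 0 R"
  shows G_deriv: "has_cderiv (G n \<alpha>) (- (G n \<alpha> k o\<^sub>L (T' k o\<^sub>L (id_blinfun - proj n)) o\<^sub>L G n \<alpha> k)) k"
    and S_deriv: "has_cderiv (S n \<alpha>) (S' \<alpha> k) k"
    and S_deriv_param: "\<exists>D. has_cderiv (\<lambda>\<alpha>. S n \<alpha> k) D \<alpha>"
proof -
  have inv: "\<And>w. w \<in> ball 0 R \<Longrightarrow> G n \<alpha> w o\<^sub>L schur_op n (T \<alpha> w) = id_blinfun \<and>
      schur_op n (T \<alpha> w) o\<^sub>L G n \<alpha> w = id_blinfun"
    using G_inverse assms by blast
  show "has_cderiv (G n \<alpha>) (- (G n \<alpha> k o\<^sub>L (T' k o\<^sub>L (id_blinfun - proj n)) o\<^sub>L G n \<alpha> k)) k"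
    by (rule S_deriv_aux(1)[OF T_deriv clin_T inv assms(2)])
  show "has_cderiv (S n \<alpha>) (S' \<alpha> k) k"
    using S_deriv_aux(2)[OF T_deriv clin_T inv assms(2)] unfolding S_def[abs_def] S'_def by simp
  have inv': "\<And>w. w \<in> ball 0 R \<Longrightarrow> G n w k o\<^sub>L schur_op n (T w k) = id_blinfun \<and>
      schur_op n (T w k) o\<^sub>L G n w k = id_blinfun"
    using G_inverse assms by blast
  show "\<exists>D. has_cderiv (\<lambda>\<alpha>. S n \<alpha> k) D \<alpha>"
    using S_deriv_aux(2)[OF T_deriv_param clin_T inv' assms(1)] unfolding S_def by blast
qed

lemma functional_deriv:
  "has_cderiv F D z \<Longrightarrow> ((\<lambda>w. cip (blinfun_apply (F w) x) y) has_field_derivative cip (D x) y) (at z)"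
  by (rule has_cderiv_functional[OF _ bounded_linear_compose[OF bounded_linear_cip_left
          blinfun.bounded_linear_left]])
    (simp_all add: scaleC_blinfun.rep_eq cip_scaleC_left)

lemma functional_holomorphic:
  "(\<And>z. z \<in> U \<Longrightarrow> \<exists>D. has_cderiv F D z) \<Longrightarrow> open U \<Longrightarrow> (\<lambda>w. cip (blinfun_apply (F w) x) y) holomorphic_on U"
  using functional_deriv by (fastforce simp: holomorphic_on_open)

lemma char_det_continuous: "continuous_on (ball 0 R \<times> ball 0 R) (\<lambda>p. char_det n (fst p) (snd p))"
  unfolding char_det_def
proof (rule mdet_continuous)
  fix i j
  show "continuous_on (ball 0 R \<times> ball 0 R) (\<lambda>p. schur_matrix (S n (fst p) (snd p)) i j)"
    unfolding schur_matrix_def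
    by (rule bounded_linear.continuous_on[OF bounded_linear_cip_left])
      (intro bounded_linear.continuous_on[OF blinfun.bounded_linear_left] S_continuous)
qed

lemma schur_matrix_holomorphic:
  "\<alpha> \<in> ball 0 R \<Longrightarrow> (\<lambda>k. schur_matrix (S n \<alpha> k) i j) holomorphic_on ball 0 R"
  unfolding schur_matrix_def by (rule functional_holomorphic[OF _ open_ball]) (use S_deriv in blast)

lemma char_det_holomorphic: "\<alpha> \<in> ball 0 R \<Longrightarrow> char_det n \<alpha> holomorphic_on ball 0 R"
  unfolding char_det_def[abs_def] by (intro mdet_holomorphic schur_matrix_holomorphic)

lemma char_det_holomorphic_param: "k \<in> ball 0 R \<Longrightarrow> (\<lambda>\<alpha>. char_det n \<alpha> k) holomorphic_on ball 0 R"
  unfolding char_det_def schur_matrix_def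
  by (intro mdet_holomorphic functional_holomorphic) (auto intro: S_deriv_param)

lemma char_det_zero:
  assumes "\<alpha> \<in> ball 0 R" "k \<in> ball 0 R" "char_det n \<alpha> k = 0"
  obtains x where "x \<noteq> 0" "T \<alpha> k x = 0"
  using schur_kernel[OF G_inverse[OF assms(1,2)] clin_T] assms(3) unfolding char_det_def S_def by blast

lemma char_det_nonzero:
  assumes "\<alpha> \<in> ball 0 R" "k \<in> ball 0 R" "char_det n \<alpha> k \<noteq> 0"
  shows "op_inverse (T \<alpha> k) o\<^sub>L T \<alpha> k = id_blinfun" "T \<alpha> k o\<^sub>L op_inverse (T \<alpha> k) = id_blinfun"
    "op_inverse (T \<alpha> k) y = schur_inverse n (S n \<alpha> k) (G n \<alpha> k y)"
proof -
  obtain B where B: "B o\<^sub>L T \<alpha> k = id_blinfun" "T \<alpha> k o\<^sub>L B = id_blinfun"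
    "\<And>y. blinfun_apply B y = schur_inverse n (S n \<alpha> k) (G n \<alpha> k y)"
    using schur_inverse_op[OF G_inverse[OF assms(1,2)] clin_T] assms(3) unfolding char_det_def S_def by metis
  with op_inverse_eq[OF B(1,2)]
  show "op_inverse (T \<alpha> k) o\<^sub>L T \<alpha> k = id_blinfun" "T \<alpha> k o\<^sub>L op_inverse (T \<alpha> k) = id_blinfun"
    "op_inverse (T \<alpha> k) y = schur_inverse n (S n \<alpha> k) (G n \<alpha> k y)" by simp_all
qed

lemma char_det_diagonal:
  assumes "\<alpha> \<in> ball 0 R" "k \<in> ball 0 R" and \<tau>: "\<And>j. j < n \<Longrightarrow> T \<alpha> k (e j) = \<tau> j *\<^sub>C e j"
  shows "char_det n \<alpha> k = (\<Prod>j<n. \<tau> j)"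
proof -
  have "S n \<alpha> k (e j) = \<tau> j *\<^sub>C e j" if "j < n" for j
  proof -
    have "schur_op n (T \<alpha> k) (e j) = e j"
      using that by (simp add: schur_op_def blinfun.bilinear_simps proj_e)
    then have "G n \<alpha> k (e j) = (G n \<alpha> k o\<^sub>L schur_op n (T \<alpha> k)) (e j)" by simp
    also have "\<dots> = e j" by (simp only: G_inverse[OF assms(1,2)] blinfun_apply_id_blinfun)
    finally show ?thesis by (simp add: S_def \<tau> that clinD[OF clin_G[OF assms(1,2)]])
  qed
  then show ?thesis
    unfolding char_det_def by (subst mdet_diagonal) (auto simp: schur_matrix_def cip_scaleC_left orth)
qed

section \<open>The trace as the integral of a logarithmic derivative\<close>

text \<open>By the explicit inverse, T^(-1) T' is the holomorphic operator (1 - P) G T' plus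
  rank-one operators with coefficients adjugate / f. The general trace formula then yields the
  integral of the sum of adj_ij S'_ji / f, and this sum is f' / f by Jacobi's formula.\<close>

theorem char_det_trace:
  fixes Li :: "'a \<Rightarrow>\<^sub>L 'c::complex_normed_vector"
  assumes \<alpha>: "\<alpha> \<in> ball 0 R" and disc: "cball c r \<subseteq> ball 0 R" "\<kappa> \<in> ball c r"
    and nz: "\<And>\<zeta>. \<zeta> \<in> cball c r - {\<kappa>} \<Longrightarrow> char_det n \<alpha> \<zeta> \<noteq> 0"
    and Li: "clin Li" and Lo: "clin Lo" "\<And>x. blinfun_apply Lo (blinfun_apply Li x) = x"
  shows "continuous_on (sphere c r) (\<lambda>\<zeta>. op_inverse (T \<alpha> \<zeta>) o\<^sub>L T' \<zeta>)"
    and "op_trace (Li o\<^sub>L circle_integral (\<lambda>\<zeta>. op_inverse (T \<alpha> \<zeta>) o\<^sub>L T' \<zeta>) c r o\<^sub>L Lo) =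
      contour_integral (circlepath c r) (\<lambda>\<zeta>. deriv (char_det n \<alpha>) \<zeta> / char_det n \<alpha> \<zeta>)"
proof -
  define f where "f = char_det n \<alpha>"
  define E where "E = (\<lambda>\<zeta>. schur_matrix (S n \<alpha> \<zeta>))"
  define E' where "E' = (\<lambda>\<zeta> i j. cip (S' \<alpha> \<zeta> (e j)) (e i))"
  define Q where "Q = id_blinfun - proj n"
  have r: "0 < r" using disc(2) by (metis ball_eq_empty empty_iff not_less)
  have f_hol: "f holomorphic_on ball 0 R" unfolding f_def by (rule char_det_holomorphic[OF \<alpha>])
  \<comment> \<open>The points where \<open>f\<close> is nonzero together with the disc: an open
    neighbourhood of the closed disc, into which a slightly larger concentric disc \<open>U\<close>
    fits. On \<open>U\<close>, only \<kappa> can be a zero.\<close>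
  define V where "V = (ball 0 R \<inter> f -` (- {0})) \<union> ball c r"
  have "open V"
    unfolding V_def using holomorphic_on_imp_continuous_on[OF f_hol]
    by (intro open_Un continuous_open_preimage) auto
  moreover have "cball c r \<subseteq> V" using nz disc by (force simp: V_def f_def)
  ultimately obtain r' where r': "r < r'" "ball c r' \<subseteq> V" using cball_subset_open r by blast
  define U where "U = ball c r'"
  have VR: "V \<subseteq> ball 0 R" using disc by (auto simp: V_def)
  have UR: "U \<subseteq> ball 0 R" using r'(2) VR by (auto simp: U_def)
  have U: "open U" "convex U" "cball c r \<subseteq> U" "\<kappa> \<in> ball c r" "\<kappa> \<in> U"
    using r' disc(2) by (auto simp: U_def)
  have f_nz: "f \<zeta> \<noteq> 0" if "\<zeta> \<in> U - {\<kappa>}" for \<zeta>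
    using that r'(2) nz by (force simp: U_def V_def f_def)
  have SU: "sphere c r \<subseteq> U - {\<kappa>}" using U by auto
  have T_cont: "continuous_on (sphere c r) (T \<alpha>)" "continuous_on (sphere c r) T'"
    using has_cderiv_isCont[OF T_deriv] has_cderiv_isCont[OF T'_deriv]
    by (simp_all add: continuous_at_imp_continuous_on)
  have inv_cont: "continuous_on (sphere c r) (\<lambda>\<zeta>. op_inverse (T \<alpha> \<zeta>))"
    by (rule continuous_on_inverse_op[OF T_cont(1)])
      (use SU UR f_nz \<alpha> char_det_nonzero in \<open>unfold f_def, blast\<close>)
  show g_cont: "continuous_on (sphere c r) (\<lambda>\<zeta>. op_inverse (T \<alpha> \<zeta>) o\<^sub>L T' \<zeta>)"
    by (intro bounded_bilinear.continuous_on[OF bounded_bilinear_blinfun_compose] inv_cont T_cont)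
  have GT': "\<exists>D. has_cderiv (\<lambda>\<zeta>. G n \<alpha> \<zeta> o\<^sub>L T' \<zeta>) D \<zeta>" if "\<zeta> \<in> U" for \<zeta>
    using has_cderiv_compose[OF G_deriv[OF \<alpha>] T'_deriv U(1) that] clin_G[OF \<alpha>] that UR by blast
  have const: "\<exists>D. has_cderiv (\<lambda>\<zeta>. Q o\<^sub>L F \<zeta>) D \<zeta>" if "\<exists>D. has_cderiv F D \<zeta>"
    for F :: "complex \<Rightarrow> 'a \<Rightarrow>\<^sub>L 'a" and \<zeta>
    using that has_cderiv_compose[OF has_cderiv_const, of F _ \<zeta> UNIV Q]
    by (auto simp: Q_def clin_diff clin_proj)
  have E_hol: "(\<lambda>\<zeta>. E \<zeta> i j) holomorphic_on U" for i j
    unfolding E_def using schur_matrix_holomorphic[OF \<alpha>] UR holomorphic_on_subset by blast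
  have E_deriv: "((\<lambda>\<zeta>. E \<zeta> i j) has_field_derivative E' \<zeta> i j) (at \<zeta>)" if "\<zeta> \<in> U" for i j \<zeta>
    unfolding E_def E'_def schur_matrix_def
    by (rule functional_deriv[OF S_deriv[OF \<alpha>]]) (use that UR in auto)
  have E'_hol: "(\<lambda>\<zeta>. E' \<zeta> i j) holomorphic_on U" for i j
  proof (rule holomorphic_transform)
    show "deriv (\<lambda>\<zeta>. E \<zeta> i j) holomorphic_on U" by (intro holomorphic_deriv E_hol U(1))
  qed (use DERIV_imp_deriv[OF E_deriv] in auto)
  have f_E: "f \<zeta> = mdet n (E \<zeta>)" for \<zeta> by (simp add: f_def char_det_def E_def)
  have f_deriv: "deriv f \<zeta> = (\<Sum>i<n. \<Sum>j<n. E' \<zeta> i j * madj n (E \<zeta>) j i)" if "\<zeta> \<in> U" for \<zeta>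
    unfolding f_E[abs_def] by (intro DERIV_imp_deriv mdet_derivative E_deriv that)
  define h where "h = (\<lambda>i j \<zeta>. madj n (E \<zeta>) i j / f \<zeta>)"
  define \<phi> where "\<phi> = (\<lambda>j \<zeta> x. cip ((G n \<alpha> \<zeta> o\<^sub>L T' \<zeta>) x) (e j))"
  define a where "a = (\<lambda>i \<zeta>. schur_vec n (S n \<alpha> \<zeta>) i)"
  have a_eq: "a i \<zeta> = e i - (Q o\<^sub>L S n \<alpha> \<zeta>) (e i)" for i \<zeta>
    by (simp add: a_def schur_vec_def Q_def blinfun.bilinear_simps)
  have \<phi>a: "\<phi> j \<zeta> (a i \<zeta>) = E' \<zeta> j i" for i j \<zeta>
    by (simp add: \<phi>_def a_eq E'_def S'_def Q_def blinfun.bilinear_simps)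
  obtain w where w: "w \<in> sphere c r"
    using r by (metis ex_in_conv sphere_eq_empty not_less_iff_gr_or_eq)
  have ex: "\<exists>w\<in>U. f w \<noteq> 0" using w SU f_nz by blast
  \<comment> \<open>The order of vanishing of \<open>f\<close> at \<kappa> bounds the pole order of
    every \<open>h i j\<close>; it is 0 if \<open>f\<close> does not vanish there.\<close>
  define m where "m = nat (zorder f \<kappa>)"
  have "f holomorphic_on U" using f_hol UR holomorphic_on_subset by blast
  from zorder_exist_zero[OF this U(1) convex_connected[OF U(2)] U(5) ex]
  obtain \<rho> where \<rho>: "0 < \<rho>" "cball \<kappa> \<rho> \<subseteq> U" "zor_poly f \<kappa> holomorphic_on cball \<kappa> \<rho>"
    "\<And>w. w \<in> cball \<kappa> \<rho> \<Longrightarrow> f w = zor_poly f \<kappa> w * (w - \<kappa>) ^ m \<and> zor_poly f \<kappa> w \<noteq> 0"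
    unfolding m_def by blast
  have h_pole: "\<exists>B. \<forall>\<^sub>F \<zeta> in at \<kappa>. cmod (h i j \<zeta> * (\<zeta> - \<kappa>) ^ m) \<le> B" if "i < n" "j < n" for i j
  proof -
    have "(\<lambda>\<zeta>. madj n (E \<zeta>) i j / zor_poly f \<kappa> \<zeta>) holomorphic_on ball \<kappa> \<rho>"
    proof (rule holomorphic_on_divide)
      show "(\<lambda>\<zeta>. madj n (E \<zeta>) i j) holomorphic_on ball \<kappa> \<rho>"
        using \<rho>(2) by (intro holomorphic_on_subset[OF madj_holomorphic[OF E_hol]] that) auto
      show "zor_poly f \<kappa> holomorphic_on ball \<kappa> \<rho>" using \<rho>(3) holomorphic_on_subset ball_subset_cball by blast
    qed (use \<rho>(4) in auto)
    from holomorphic_bounded_near[OF this open_ball, of \<kappa>] \<rho>(1)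
    obtain B where "\<forall>\<^sub>F \<zeta> in at \<kappa>. cmod (madj n (E \<zeta>) i j / zor_poly f \<kappa> \<zeta>) \<le> B" by auto
    moreover have "\<forall>\<^sub>F \<zeta> in at \<kappa>. \<zeta> \<in> ball \<kappa> \<rho> \<and> \<zeta> \<noteq> \<kappa>"
      using \<rho>(1) by (auto simp: eventually_at dist_commute)
    ultimately have "\<forall>\<^sub>F \<zeta> in at \<kappa>. cmod (h i j \<zeta> * (\<zeta> - \<kappa>) ^ m) \<le> B"
    proof eventually_elim
      case (elim \<zeta>)
      have "\<zeta> \<in> cball \<kappa> \<rho>" using elim by auto
      with \<rho>(4)[OF this] elim show ?case by (simp add: h_def)
    qed
    then show ?thesis by blast
  qed
  have \<phi>_bound: "\<exists>B. \<forall>\<^sub>F \<zeta> in at \<kappa>. \<forall>x. cmod (\<phi> j \<zeta> x) \<le> B * norm x" for j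
  proof -
    obtain D where "has_cderiv (\<lambda>\<zeta>. G n \<alpha> \<zeta> o\<^sub>L T' \<zeta>) D \<kappa>" using GT' U(5) by blast
    then have "((\<lambda>\<zeta>. norm (G n \<alpha> \<zeta> o\<^sub>L T' \<zeta>)) \<longlongrightarrow> norm (G n \<alpha> \<kappa> o\<^sub>L T' \<kappa>)) (at \<kappa>)"
      by (intro tendsto_norm) (use has_cderiv_isCont in \<open>simp add: isCont_def\<close>)
    then have "\<forall>\<^sub>F \<zeta> in at \<kappa>. norm (G n \<alpha> \<zeta> o\<^sub>L T' \<zeta>) < norm (G n \<alpha> \<kappa> o\<^sub>L T' \<kappa>) + 1"
      by (rule order_tendstoD) simp
    then have "\<forall>\<^sub>F \<zeta> in at \<kappa>. \<forall>x. cmod (\<phi> j \<zeta> x) \<le> ((norm (G n \<alpha> \<kappa> o\<^sub>L T' \<kappa>) + 1) * norm (e j)) * norm x"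
    proof eventually_elim
      case (elim \<zeta>)
      show ?case
      proof
        fix x
        have "cmod (\<phi> j \<zeta> x) \<le> norm ((G n \<alpha> \<zeta> o\<^sub>L T' \<zeta>) x) * norm (e j)"
          unfolding \<phi>_def by (rule cip_bound)
        also have "\<dots> \<le> ((norm (G n \<alpha> \<kappa> o\<^sub>L T' \<kappa>) + 1) * norm x) * norm (e j)"
          by (rule mult_right_mono[OF order_trans[OF norm_blinfun mult_right_mono]])
            (use elim in auto)
        finally show "cmod (\<phi> j \<zeta> x) \<le> ((norm (G n \<alpha> \<kappa> o\<^sub>L T' \<kappa>) + 1) * norm (e j)) * norm x"
          by (simp add: mult_ac)
      qed
    qed
    then show ?thesis by blast
  qed
  have "op_trace (Li o\<^sub>L circle_integral (\<lambda>\<zeta>. op_inverse (T \<alpha> \<zeta>) o\<^sub>L T' \<zeta>) c r o\<^sub>L Lo) =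
      contour_integral (circlepath c r) (\<lambda>\<zeta>. \<Sum>i<n. \<Sum>j<n. h i j \<zeta> * \<phi> j \<zeta> (a i \<zeta>))"
  proof (rule op_trace_circle_integral[OF U(1-4) g_cont _ _ _ h_pole _ \<phi>_bound _ _ _ _ _ Li Lo])
    show "cip ((op_inverse (T \<alpha> \<zeta>) o\<^sub>L T' \<zeta>) x) y = cip ((Q o\<^sub>L (G n \<alpha> \<zeta> o\<^sub>L T' \<zeta>)) x) y +
        (\<Sum>i<n. \<Sum>j<n. h i j \<zeta> * \<phi> j \<zeta> x * cip (a i \<zeta>) y)" if "\<zeta> \<in> sphere c r" for \<zeta> x y
    proof -
      have "\<zeta> \<in> U - {\<kappa>}" using SU that by (rule subsetD)
      then have "\<zeta> \<in> ball 0 R" "char_det n \<alpha> \<zeta> \<noteq> 0" using UR f_nz by (auto simp: f_def)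
      from char_det_nonzero(3)[OF \<alpha> this] show ?thesis
        by (simp add: schur_inverse_def cip_add_left cip_diff_left cip_sum_left cip_scaleC_left
            Q_def blinfun.bilinear_simps h_def \<phi>_def a_def f_def char_det_def E_def)
    qed
    show "(\<lambda>\<zeta>. cip ((Q o\<^sub>L (G n \<alpha> \<zeta> o\<^sub>L T' \<zeta>)) x) y) holomorphic_on U" for x y
      by (intro functional_holomorphic const GT' U)
    show "h i j holomorphic_on U - {\<kappa>}" if "i < n" "j < n" for i j
      unfolding h_def using UR f_nz
      by (intro holomorphic_on_divide holomorphic_on_subset[OF madj_holomorphic[OF E_hol]] that
          holomorphic_on_subset[OF f_hol]) auto
    show "(\<lambda>\<zeta>. \<phi> j \<zeta> x) holomorphic_on U" for j x
      unfolding \<phi>_def by (intro functional_holomorphic GT' U)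
    show "\<phi> j \<zeta> (x + y) = \<phi> j \<zeta> x + \<phi> j \<zeta> y" for j \<zeta> x y
      by (simp add: \<phi>_def blinfun.add_right cip_add_left)
    show "\<phi> j \<zeta> (s *\<^sub>C x) = s * \<phi> j \<zeta> x" if "\<zeta> \<in> U" for j \<zeta> s x
      using that UR clin_G[OF \<alpha>, of \<zeta>] by (auto simp: \<phi>_def clinD clin_T' cip_scaleC_left)
    have S_cont: "continuous_on U (\<lambda>\<zeta>. S n \<alpha> \<zeta>)"
      using has_cderiv_isCont[OF S_deriv[OF \<alpha>]] UR by (auto intro!: continuous_at_imp_continuous_on)
    show "continuous_on U (a i)" for i
      unfolding a_eq[abs_def]
      by (intro continuous_on_diff continuous_on_const
          bounded_linear.continuous_on[OF blinfun.bounded_linear_left]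
          bounded_bilinear.continuous_on[OF bounded_bilinear_blinfun_compose] S_cont)
    show "(\<lambda>\<zeta>. cip (a i \<zeta>) y) holomorphic_on U" for i y
      unfolding a_eq cip_diff_left using S_deriv[OF \<alpha>] UR
      by (intro holomorphic_on_diff holomorphic_on_const functional_holomorphic const U) blast
    show "(\<lambda>\<zeta>. \<phi> j \<zeta> (a i \<zeta>)) holomorphic_on U" for i j
      unfolding \<phi>a by (rule E'_hol)
  qed
  also have "\<dots> = contour_integral (circlepath c r) (\<lambda>\<zeta>. deriv f \<zeta> / f \<zeta>)"
  proof (rule contour_integral_eq)
    fix \<zeta> assume "\<zeta> \<in> path_image (circlepath c r)"
    then have "\<zeta> \<in> U" using SU r by auto
    have "(\<Sum>i<n. \<Sum>j<n. h i j \<zeta> * \<phi> j \<zeta> (a i \<zeta>)) = (\<Sum>j<n. \<Sum>i<n. h i j \<zeta> * \<phi> j \<zeta> (a i \<zeta>))"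
      by (rule sum.swap)
    also have "\<dots> = deriv f \<zeta> / f \<zeta>"
      by (simp add: h_def \<phi>a f_deriv[OF \<open>\<zeta> \<in> U\<close>] sum_divide_distrib mult.commute)
    finally show "(\<Sum>i<n. \<Sum>j<n. h i j \<zeta> * \<phi> j \<zeta> (a i \<zeta>)) = deriv f \<zeta> / f \<zeta>" .
  qed
  finally show "op_trace (Li o\<^sub>L circle_integral (\<lambda>\<zeta>. op_inverse (T \<alpha> \<zeta>) o\<^sub>L T' \<zeta>) c r o\<^sub>L Lo) =
      contour_integral (circlepath c r) (\<lambda>\<zeta>. deriv (char_det n \<alpha>) \<zeta> / char_det n \<alpha> \<zeta>)"
    by (simp add: f_def)
qed

end

end

section \<open>Integration over a fundamental domain\<close>

definition lat :: "real \<times> real \<Rightarrow> complex" where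
  "lat p = omega * of_real (fst p) + of_real (snd p)"

lemma lat_measurable [measurable]: "lat \<in> borel_measurable borel"
  unfolding lat_def by (intro borel_measurable_continuous_onI continuous_intros)

lemma lat_Re_Im: "Re (lat p) = snd p - fst p / 2" "Im (lat p) = sqrt 3 / 2 * fst p"
  by (simp_all add: lat_def omega_eq)

text \<open>Change of variables for a linear map of determinant sqrt 3 / 2, verified on boxes. The
  imaginary part depends on the first coordinate alone, so the slices of a preimage are intervals of
  constant length.\<close>

lemma lborel_lat: "lborel = density (distr (lborel \<Otimes>\<^sub>M lborel) borel lat) (\<lambda>_. ennreal (sqrt 3 / 2))"
proof (rule lborel_eqI)
  fix l u :: complex
  assume lu: "\<And>b. b \<in> Basis \<Longrightarrow> l \<bullet> b \<le> u \<bullet> b"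
  have le: "Re l \<le> Re u" "Im l \<le> Im u"
    using lu[of 1] lu[of \<i>] by (simp_all add: Basis_complex_def inner_complex_def)
  have m: "lat \<in> measurable (lborel \<Otimes>\<^sub>M lborel) borel"
    using lat_measurable by (simp add: lborel_prod)
  define B where "B = lat -` box l u \<inter> space (lborel \<Otimes>\<^sub>M lborel)"
  have B: "B \<in> sets (lborel \<Otimes>\<^sub>M lborel)" unfolding B_def by (rule measurable_sets[OF m]) simp
  have s3: "sqrt 3 > 0" by simp
  have sec: "emeasure lborel (Pair s -` B) =
      ennreal (Re u - Re l) * indicator {2 / sqrt 3 * Im l <..< 2 / sqrt 3 * Im u} s" for s :: real
  proof -
    have "Pair s -` B = (if s \<in> {2 / sqrt 3 * Im l <..< 2 / sqrt 3 * Im u}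
        then {Re l + s / 2 <..< Re u + s / 2} else {})"
      using s3 by (auto simp: B_def in_box_complex_iff lat_Re_Im space_pair_measure field_simps)
    then show ?thesis using le by (auto simp: indicator_def)
  qed
  have "emeasure (lborel \<Otimes>\<^sub>M lborel) B = (\<integral>\<^sup>+ s. emeasure lborel (Pair s -` B) \<partial>lborel)"
    by (rule lborel.emeasure_pair_measure_alt[OF B])
  also have "\<dots> = ennreal (Re u - Re l) * ennreal (2 / sqrt 3 * Im u - 2 / sqrt 3 * Im l)"
    unfolding sec using le by (subst nn_integral_cmult_indicator) (auto simp: divide_right_mono)
  finally have e: "emeasure (lborel \<Otimes>\<^sub>M lborel) B =
      ennreal ((Re u - Re l) * (2 / sqrt 3 * Im u - 2 / sqrt 3 * Im l))"
    by (subst ennreal_mult) (use le in \<open>auto simp: divide_right_mono\<close>)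
  have "emeasure (density (distr (lborel \<Otimes>\<^sub>M lborel) borel lat) (\<lambda>_. ennreal (sqrt 3 / 2))) (box l u)
      = ennreal (sqrt 3 / 2) * emeasure (lborel \<Otimes>\<^sub>M lborel) B"
    unfolding B_def by (subst emeasure_density_const) (auto simp: emeasure_distr[OF m])
  also have "\<dots> = ennreal (sqrt 3 / 2 * ((Re u - Re l) * (2 / sqrt 3 * Im u - 2 / sqrt 3 * Im l)))"
    unfolding e using le by (subst ennreal_mult) (auto simp: divide_right_mono)
  also have "sqrt 3 / 2 * ((Re u - Re l) * (2 / sqrt 3 * Im u - 2 / sqrt 3 * Im l)) =
      (Re u - Re l) * (Im u - Im l)"
    using s3 by (simp add: field_simps)
  also have "(Re u - Re l) * (Im u - Im l) = (\<Prod>b\<in>Basis. (u - l) \<bullet> b)"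
    by (simp add: Basis_complex_def inner_complex_def complex_eq_iff)
  finally show "emeasure (density (distr (lborel \<Otimes>\<^sub>M lborel) borel lat) (\<lambda>_. ennreal (sqrt 3 / 2))) (box l u)
      = (\<Prod>b\<in>Basis. (u - l) \<bullet> b)" .
qed simp

lemma cell_integral:
  fixes F :: "complex \<Rightarrow> complex"
  assumes [measurable]: "F \<in> borel_measurable borel"
  shows "(LINT z|cell_measure. F z) = of_real (sqrt 3 / 2) *
    (LINT p|(lborel \<Otimes>\<^sub>M lborel). indicator ({0..<1} \<times> {0..<1}) p *\<^sub>R F (lat p))"
proof -
  have m: "lat \<in> measurable (lborel \<Otimes>\<^sub>M lborel) borel"
    using lat_measurable by (simp add: lborel_prod)
  define H where "H = (\<lambda>z. indicator cell z *\<^sub>R F z)"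
  have Hm: "H \<in> borel_measurable borel" unfolding H_def using cell_sets by measurable
  have "(LINT z|cell_measure. F z) = integral\<^sup>L lborel H"
    unfolding cell_measure_def H_def by (rule integral_restrict_space) (use cell_sets in simp)
  also have "\<dots> = integral\<^sup>L (density (distr (lborel \<Otimes>\<^sub>M lborel) borel lat) (\<lambda>_. ennreal (sqrt 3 / 2))) H"
    by (rule arg_cong[OF lborel_lat])
  also have "\<dots> = (LINT z|(distr (lborel \<Otimes>\<^sub>M lborel) borel lat). (sqrt 3 / 2) *\<^sub>R H z)"
    by (rule integral_density) (use Hm in auto)
  also have "\<dots> = (LINT p|(lborel \<Otimes>\<^sub>M lborel). (sqrt 3 / 2) *\<^sub>R H (lat p))"
    by (rule integral_distr[OF m]) (use Hm in auto)
  also have "(\<lambda>p. H (lat p)) = (\<lambda>p. indicator ({0..<1} \<times> {0..<1}) p *\<^sub>R F (lat p))"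
    by (auto simp: H_def cell_eq lat_def indicator_def fun_eq_iff)
  finally show ?thesis
    by (simp add: scaleR_conv_of_real)
qed

lemma measure_cell: "measure cell_measure cell = sqrt 3 / 2"
proof -
  have "emeasure (lborel \<Otimes>\<^sub>M lborel) ({0..<1::real} \<times> {0..<1::real}) = 1"
    by (subst lborel.emeasure_pair_measure_Times) auto
  then have "has_bochner_integral (lborel \<Otimes>\<^sub>M lborel)
      (\<lambda>p. indicat_real ({0..<1::real} \<times> {0..<1::real}) p *\<^sub>R (1 :: complex)) (1 *\<^sub>R 1)"
    using has_bochner_integral_indicator[of "{0..<1::real} \<times> {0..<1::real}" "lborel \<Otimes>\<^sub>M lborel" "1 :: complex"]
    by (simp add: measure_def)
  from has_bochner_integral_integral_eq[OF this]
  have "(LINT p|(lborel \<Otimes>\<^sub>M lborel). indicat_real ({0..<1::real} \<times> {0..<1::real}) p *\<^sub>R (1 :: complex)) = 1"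
    by (simp only: scaleR_one)
  then have "(LINT z|cell_measure. (1 :: complex)) = of_real (sqrt 3 / 2)"
    by (subst cell_integral) auto
  then show ?thesis
    by (simp add: scaleR_conv_of_real flip: of_real_eq_iff[where 'a = complex])
qed

lemma smooth_has_derivative:
  "smooth \<psi> \<Longrightarrow> (\<psi> has_derivative frechet_derivative \<psi> (at z)) (at z)"
  using Ck_SucD(1)[of 0 \<psi> z] by (simp add: smooth_def del: Ck.simps)

lemma frechet_decomp:
  assumes "smooth \<psi>"
  shows "frechet_derivative \<psi> (at z) v =
    of_real (Re v) * frechet_derivative \<psi> (at z) 1 + of_real (Im v) * frechet_derivative \<psi> (at z) \<i>"
proof -
  interpret bounded_linear "frechet_derivative \<psi> (at z)"
    using smooth_has_derivative[OF assms] by (rule has_derivative_bounded_linear)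
  have "v = Re v *\<^sub>R 1 + Im v *\<^sub>R \<i>" by (simp add: complex_eq_iff)
  then have "frechet_derivative \<psi> (at z) v = frechet_derivative \<psi> (at z) (Re v *\<^sub>R 1 + Im v *\<^sub>R \<i>)" by simp
  then show ?thesis by (simp only: add scaleR) (simp only: scaleR_conv_of_real)
qed

lemma frechet_continuous:
  assumes "smooth \<psi>"
  shows "continuous_on A (\<lambda>z. frechet_derivative \<psi> (at z) v)"
  unfolding frechet_decomp[OF assms, of _ v]
  by (intro continuous_intros smooth_continuous smooth_frechet[OF assms]) auto

text \<open>The fundamental theorem of calculus along a lattice vector, over one full
  period.\<close>

lemma segment_integral_zero:
  assumes \<psi>: "smooth \<psi>" "periodic \<psi>" and v: "v \<in> Lambda"
  shows "(LINT t|lborel. indicator {0..<1} t *\<^sub>R frechet_derivative \<psi> (at (a + of_real t * v)) v) = 0"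
proof -
  define g where "g = (\<lambda>t. frechet_derivative \<psi> (at (a + of_real t * v)) v)"
  have g: "continuous_on A g" for A :: "real set"
    unfolding g_def by (rule continuous_on_compose2[OF frechet_continuous[OF \<psi>(1), of UNIV]])
      (auto intro!: continuous_intros)
  have "(LINT t|lborel. indicator {0..<1} t *\<^sub>R g t) = (LINT t|lborel. indicator {0..1} t *\<^sub>R g t)"
  proof (rule integral_cong_AE)
    have [measurable]: "g \<in> borel_measurable borel" by (intro borel_measurable_continuous_onI g)
    show "(\<lambda>t. indicator {0..<1} t *\<^sub>R g t) \<in> borel_measurable lborel"
      "(\<lambda>t. indicator {0..1} t *\<^sub>R g t) \<in> borel_measurable lborel" by measurable
    show "AE t in lborel. indicator {0..<1} t *\<^sub>R g t = indicator {0..1} t *\<^sub>R g t"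
      using AE_lborel_singleton[of 1] by eventually_elim (auto simp: indicator_def)
  qed
  also have "\<dots> = \<psi> (a + of_real 1 * v) - \<psi> (a + of_real 0 * v)"
  proof (rule integral_FTC_Icc[OF _ _ g])
    fix t :: real
    have "((\<lambda>t. a + of_real t * v) has_derivative (\<lambda>h. of_real h * v)) (at t within {0..1})"
      by (auto intro!: derivative_eq_intros)
    from has_derivative_compose[OF this has_derivative_at_withinI[OF smooth_has_derivative[OF \<psi>(1)]]]
    have "((\<lambda>t. \<psi> (a + of_real t * v)) has_derivative
        (\<lambda>h. frechet_derivative \<psi> (at (a + of_real t * v)) (of_real h * v))) (at t within {0..1})"
      by simp
    moreover have "frechet_derivative \<psi> (at (a + of_real t * v)) (of_real h * v) = h *\<^sub>R g t" for h
    proof -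
      interpret bounded_linear "frechet_derivative \<psi> (at (a + of_real t * v))"
        using smooth_has_derivative[OF \<psi>(1)] by (rule has_derivative_bounded_linear)
      show ?thesis using scaleR[of h v] by (simp add: g_def scaleR_conv_of_real)
    qed
    ultimately show "((\<lambda>t. \<psi> (a + of_real t * v)) has_vector_derivative g t) (at t within {0..1})"
      by (simp add: has_vector_derivative_def)
  qed simp
  also have "\<dots> = 0" using \<psi>(2) v by (simp add: periodic_def)
  finally show ?thesis by (simp add: g_def)
qed

lemma Lambda_basis: "1 \<in> Lambda" "omega \<in> Lambda"
  unfolding Lambda_def by (force intro: exI[of _ 0] exI[of _ 1])+

text \<open>Fubini in lattice coordinates settles the directions 1 and omega, each integrated over
  full periods; the direction \<open>\<i>\<close> follows from \<i> = (2 omega + 1) / sqrt 3.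
  Applied to products, this is integration by parts on the torus.\<close>

lemma cell_integral_derivative:
  assumes \<psi>: "smooth \<psi>" "periodic \<psi>" and v: "v \<in> {1, \<i>}"
  shows "(LINT z|cell_measure. frechet_derivative \<psi> (at z) v) = 0"
proof -
  define g where "g = (\<lambda>v z. frechet_derivative \<psi> (at z) v)"
  have gc: "continuous_on A (g v)" for A v unfolding g_def by (rule frechet_continuous[OF \<psi>(1)])
  have gm [measurable]: "g v \<in> borel_measurable borel" for v by (intro borel_measurable_continuous_onI gc)
  have gp: "periodic (g v)" for v unfolding g_def by (rule periodic_frechet[OF \<psi>(2,1)])
  have m: "lat \<in> measurable (lborel \<Otimes>\<^sub>M lborel) borel"
    using lat_measurable by (simp add: lborel_prod)
  define I where "I = ({0..<1::real} \<times> {0..<1::real})"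
  have I: "I \<in> sets (lborel \<Otimes>\<^sub>M lborel)" unfolding I_def by simp
  have int: "integrable (lborel \<Otimes>\<^sub>M lborel) (\<lambda>p. indicator I p *\<^sub>R g v (lat p))" for v
  proof -
    obtain C where C: "\<And>z. cmod (g v z) \<le> C" using periodic_continuous_bounded[OF gp gc] by blast
    have "emeasure (lborel \<Otimes>\<^sub>M lborel) I < \<infinity>"
      unfolding I_def by (subst lborel.emeasure_pair_measure_Times) auto
    then have "integrable (lborel \<Otimes>\<^sub>M lborel) (\<lambda>p. indicat_real I p *\<^sub>R C)"
      using I by (intro integrable_scaleR_left) (simp add: integrable_indicator_iff)
    then show ?thesis
    proof (rule Bochner_Integration.integrable_bound)
      show "(\<lambda>p. indicator I p *\<^sub>R g v (lat p)) \<in> borel_measurable (lborel \<Otimes>\<^sub>M lborel)"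
        using I m gm by measurable
      show "AE p in lborel \<Otimes>\<^sub>M lborel. norm (indicator I p *\<^sub>R g v (lat p)) \<le> norm (indicat_real I p *\<^sub>R C)"
        using C order_trans[OF C abs_ge_self] by (auto simp: indicator_def)
    qed
  qed
  have ind: "indicator I (s, t) = indicator {0..<1} s * (indicator {0..<1} t :: real)" for s t
    by (auto simp: I_def indicator_def)
  have z1: "(LINT p|(lborel \<Otimes>\<^sub>M lborel). indicator I p *\<^sub>R g 1 (lat p)) = 0"
  proof -
    have "(LINT p|(lborel \<Otimes>\<^sub>M lborel). indicator I p *\<^sub>R g 1 (lat p)) =
        (LINT s|lborel. LINT t|lborel. indicator I (s, t) *\<^sub>R g 1 (lat (s, t)))"
      by (rule lborel_pair.integral_fst'[symmetric, OF int])
    also have "(\<lambda>s. LINT t|lborel. indicator I (s, t) *\<^sub>R g 1 (lat (s, t))) =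
        (\<lambda>s. indicator {0..<1} s *\<^sub>R (LINT t|lborel. indicator {0..<1} t *\<^sub>R g 1 (omega * of_real s + of_real t * 1)))"
      by (simp only: ind lat_def fst_conv snd_conv mult_1_right integral_scaleR_right flip: scaleR_scaleR)
    finally show ?thesis
      using segment_integral_zero[OF \<psi> Lambda_basis(1)] by (simp add: g_def)
  qed
  have z2: "(LINT p|(lborel \<Otimes>\<^sub>M lborel). indicator I p *\<^sub>R g omega (lat p)) = 0"
  proof -
    have "(LINT p|(lborel \<Otimes>\<^sub>M lborel). indicator I p *\<^sub>R g omega (lat p)) =
        (LINT t|lborel. LINT s|lborel. indicator I (s, t) *\<^sub>R g omega (lat (s, t)))"
    proof -
      have eq: "(\<lambda>(s, t). indicator I (s, t) *\<^sub>R g omega (lat (s, t))) =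
          (\<lambda>p. indicator I p *\<^sub>R g omega (lat p))" by (simp add: fun_eq_iff)
      show ?thesis
        by (rule lborel_pair.integral_snd[of "\<lambda>s t. indicator I (s, t) *\<^sub>R g omega (lat (s, t))",
              unfolded eq, OF int, symmetric])
    qed
    also have "(\<lambda>t. LINT s|lborel. indicator I (s, t) *\<^sub>R g omega (lat (s, t))) =
        (\<lambda>t. indicator {0..<1} t *\<^sub>R (LINT s|lborel. indicator {0..<1} s *\<^sub>R g omega (of_real t + of_real s * omega)))"
    proof
      fix t :: real
      have "(\<lambda>s. indicator I (s, t) *\<^sub>R g omega (lat (s, t))) =
          (\<lambda>s. indicator {0..<1} t *\<^sub>R (indicator {0..<1} s *\<^sub>R g omega (of_real t + of_real s * omega)))"
        by (simp add: ind lat_def mult.commute add.commute fun_eq_iff)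
      then show "(LINT s|lborel. indicator I (s, t) *\<^sub>R g omega (lat (s, t))) =
          indicator {0..<1} t *\<^sub>R (LINT s|lborel. indicator {0..<1} s *\<^sub>R g omega (of_real t + of_real s * omega))"
        by (simp only: integral_scaleR_right)
    qed
    finally show ?thesis
      using segment_integral_zero[OF \<psi> Lambda_basis(2)] by (simp add: g_def)
  qed
  have "g omega z = of_real (- 1 / 2) * g 1 z + of_real (sqrt 3 / 2) * g \<i> z" for z
    unfolding g_def using frechet_decomp[OF \<psi>(1), of z omega] by (simp add: omega_eq)
  then have "g \<i> z = of_real (2 / sqrt 3) * g omega z + of_real (1 / sqrt 3) * g 1 z" for z
    by (simp add: field_simps)
  then have "(LINT p|(lborel \<Otimes>\<^sub>M lborel). indicator I p *\<^sub>R g \<i> (lat p)) =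
      (LINT p|(lborel \<Otimes>\<^sub>M lborel). of_real (2 / sqrt 3) * (indicator I p *\<^sub>R g omega (lat p)) +
        of_real (1 / sqrt 3) * (indicator I p *\<^sub>R g 1 (lat p)))"
    by (simp only: scaleR_conv_of_real distrib_left mult.left_commute)
  also have "\<dots> = 0"
    by (simp only: Bochner_Integration.integral_add[OF integrable_mult_right[OF int] integrable_mult_right[OF int]]
        integral_mult_right_zero z1 z2) simp
  finally have z3: "(LINT p|(lborel \<Otimes>\<^sub>M lborel). indicator I p *\<^sub>R g \<i> (lat p)) = 0" .
  show ?thesis
    using v z1 z3 cell_integral[OF gm, of v] by (auto simp: g_def I_def)
qed

section \<open>Completeness of \<open>L\<^sup>2\<close>\<close>

lemma l2_rep_integrable: "integrable cell_measure (\<lambda>z. rep_l2 u z * cnj (rep_l2 v z))"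
  by (intro l2_prod_integrable l2_fun_cnj l2_fun_rep)

lemma inner_l2_rep: "inner u v = (LINT z|cell_measure. Re (rep_l2 u z * cnj (rep_l2 v z)))"
proof -
  have "inner (abs_l2 (rep_l2 u)) (abs_l2 (rep_l2 v)) = (LINT z|cell_measure. Re (rep_l2 u z * cnj (rep_l2 v z)))"
    by (rule inner_l2.abs_eq) (simp_all add: l2_rel_refl_iff l2_fun_rep)
  then show ?thesis by simp
qed

lemma cip_l2: "cip u v = (LINT z|cell_measure. rep_l2 u z * cnj (rep_l2 v z))"
proof -
  have eq: "inner u (\<i> *\<^sub>C v) = (LINT z|cell_measure. Im (rep_l2 u z * cnj (rep_l2 v z)))"
    unfolding inner_l2_rep
  proof (rule integral_cong_AE)
    show "AE z in cell_measure. Re (rep_l2 u z * cnj (rep_l2 (\<i> *\<^sub>C v) z)) = Im (rep_l2 u z * cnj (rep_l2 v z))"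
      using rep_scaleC_AE[of \<i> v] by eventually_elim simp
    show "(\<lambda>z. Re (rep_l2 u z * cnj (rep_l2 (\<i> *\<^sub>C v) z))) \<in> borel_measurable cell_measure"
      "(\<lambda>z. Im (rep_l2 u z * cnj (rep_l2 v z))) \<in> borel_measurable cell_measure"
      by (intro borel_measurable_integrable integrable_Re integrable_Im l2_rep_integrable)+
  qed
  show ?thesis
    by (simp only: cip_def eq inner_l2_rep[of u v] integral_Re[OF l2_rep_integrable]
        integral_Im[OF l2_rep_integrable] complex.collapse)
qed

lemma cip_abs_l2:
  assumes "l2_fun f" "l2_fun g"
  shows "cip (abs_l2 f) (abs_l2 g) = (LINT z|cell_measure. f z * cnj (g z))"
  unfolding cip_l2
proof (rule integral_cong_AE)
  show "AE z in cell_measure. rep_l2 (abs_l2 f) z * cnj (rep_l2 (abs_l2 g) z) = f z * cnj (g z)"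
    using rep_abs_l2_AE[OF assms(1)] rep_abs_l2_AE[OF assms(2)] by eventually_elim simp
qed (intro borel_measurable_integrable l2_rep_integrable l2_prod_integrable l2_fun_cnj assms)+

lemma norm_abs_l2:
  assumes "l2_fun f"
  shows "(norm (abs_l2 f))\<^sup>2 = (LINT z|cell_measure. (cmod (f z))\<^sup>2)"
proof -
  have "complex_of_real ((norm (abs_l2 f))\<^sup>2) = (LINT z|cell_measure. f z * cnj (f z))"
    by (simp only: cip_self[symmetric] cip_abs_l2[OF assms assms])
  also have "\<dots> = (LINT z|cell_measure. of_real ((cmod (f z))\<^sup>2))"
    by (simp only: complex_norm_square)
  also have "\<dots> = of_real (LINT z|cell_measure. (cmod (f z))\<^sup>2)"
    by (rule integral_complex_of_real)
  finally show ?thesis by (simp only: of_real_eq_iff)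
qed

lemma nn_integral_abs_l2:
  assumes "l2_fun f"
  shows "(\<integral>\<^sup>+z. ennreal ((cmod (f z))\<^sup>2) \<partial>cell_measure) = ennreal ((norm (abs_l2 f))\<^sup>2)"
  using assms by (simp add: norm_abs_l2 nn_integral_eq_integral l2_fun_def)

lemma abs_l2_eqI: "l2_fun f \<Longrightarrow> l2_fun g \<Longrightarrow> (AE z in cell_measure. f z = g z) \<Longrightarrow> abs_l2 f = abs_l2 g"
  by (metis l2_rel_def Quotient3_l2 Quotient3_rel)

lemma abs_l2_diff:
  assumes "l2_fun f" "l2_fun g"
  shows "abs_l2 f - abs_l2 g = abs_l2 (\<lambda>z. f z - g z)"
proof -
  have "abs_l2 f - abs_l2 g = abs_l2 f + (-1) *\<^sub>C abs_l2 g" by (simp add: scaleC_minus_one)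
  also have "(-1) *\<^sub>C abs_l2 g = abs_l2 (\<lambda>z. (-1) * g z)"
    by (rule scaleC_l2.abs_eq) (simp add: l2_rel_refl_iff assms)
  also have "abs_l2 f + abs_l2 (\<lambda>z. (-1) * g z) = abs_l2 (\<lambda>z. f z + (-1) * g z)"
    by (rule plus_l2.abs_eq) (simp_all only: l2_rel_refl_iff assms l2_fun_scale)
  finally show ?thesis by simp
qed

lemma l2_fun_sum: "finite I \<Longrightarrow> (\<And>i. i \<in> I \<Longrightarrow> l2_fun (f i)) \<Longrightarrow> l2_fun (\<lambda>z. \<Sum>i\<in>I. f i z)"
  by (induction I rule: finite_induct) (auto simp: l2_fun_zero intro: l2_fun_add)

lemma abs_l2_sum:
  "finite I \<Longrightarrow> (\<And>i. i \<in> I \<Longrightarrow> l2_fun (f i)) \<Longrightarrow> abs_l2 (\<lambda>z. \<Sum>i\<in>I. f i z) = (\<Sum>i\<in>I. abs_l2 (f i))"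
proof (induction I rule: finite_induct)
  case (insert i I)
  have "abs_l2 (f i) + abs_l2 (\<lambda>z. \<Sum>i\<in>I. f i z) = abs_l2 (\<lambda>z. f i z + (\<Sum>i\<in>I. f i z))"
    by (rule plus_l2.abs_eq) (use insert in \<open>auto simp: l2_rel_refl_iff intro: l2_fun_sum\<close>)
  then show ?case using insert by simp
qed (simp add: zero_l2_def)

text \<open>Cauchy-Schwarz against the constant 1, the cell having finite measure; |f| is again
  square integrable, with the norm of \<open>f\<close>.\<close>

lemma integral_abs_le_norm:
  assumes f: "l2_fun f"
  shows "(\<integral>\<^sup>+z. ennreal (cmod (f z)) \<partial>cell_measure) \<le> ennreal (norm (abs_l2 f) * norm (abs_l2 (\<lambda>_. 1)))"
proof -
  define g where "g = (\<lambda>z. complex_of_real (cmod (f z)))"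
  have [measurable]: "f \<in> borel_measurable borel" using f by (simp add: l2_fun_def)
  have g: "l2_fun g" using f by (auto simp: l2_fun_def g_def periodic_def)
  have one: "l2_fun (\<lambda>_. 1)" by (simp add: l2_fun_def periodic_def)
  have "(norm (abs_l2 g))\<^sup>2 = (norm (abs_l2 f))\<^sup>2"
    unfolding norm_abs_l2[OF f] norm_abs_l2[OF g] by (simp add: g_def)
  then have ng: "norm (abs_l2 g) = norm (abs_l2 f)" by (rule power2_eq_imp_eq) auto
  have gi: "integrable cell_measure (\<lambda>z. cmod (f z))"
    using l2_prod_integrable[OF f one] by simp
  have "complex_of_real (LINT z|cell_measure. cmod (f z)) = cip (abs_l2 g) (abs_l2 (\<lambda>_. 1))"
    unfolding cip_abs_l2[OF g one] by (simp add: g_def)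
  then have "cmod (cip (abs_l2 g) (abs_l2 (\<lambda>_. 1))) = cmod (complex_of_real (LINT z|cell_measure. cmod (f z)))"
    by (simp only:)
  also have "\<dots> = (LINT z|cell_measure. cmod (f z))" by (simp only: norm_of_real) simp
  finally have "(LINT z|cell_measure. cmod (f z)) = cmod (cip (abs_l2 g) (abs_l2 (\<lambda>_. 1)))" ..
  also have "\<dots> \<le> norm (abs_l2 f) * norm (abs_l2 (\<lambda>_. 1))"
    using cip_bound[of "abs_l2 g" "abs_l2 (\<lambda>_. 1)"] by (simp only: ng)
  finally show ?thesis
    by (subst nn_integral_eq_integral[OF gi]) (auto intro: ennreal_leI)
qed

text \<open>The Riesz-Fischer argument: the L^1 norms are summable, so the series converges
  absolutely almost everywhere, and Fatou's lemma shows that the pointwise limit is also the limit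
  in L^2.\<close>

lemma l2_series_converges:
  fixes F :: "nat \<Rightarrow> complex \<Rightarrow> complex"
  assumes F: "\<And>i. l2_fun (F i)" and bound: "\<And>i. norm (abs_l2 (F i)) \<le> (1 / 2) ^ i"
  obtains u where "(\<lambda>N. \<Sum>i<N. abs_l2 (F i)) \<longlonglongrightarrow> u"
proof -
  have Fm [measurable]: "F i \<in> borel_measurable borel" for i using F by (simp add: l2_fun_def)
  have Fc [measurable]: "F i \<in> borel_measurable cell_measure" for i by (intro measurable_cell Fm)
  define K where "K = norm (abs_l2 (\<lambda>_. 1))"
  have "(\<integral>\<^sup>+z. (\<Sum>i. ennreal (cmod (F i z))) \<partial>cell_measure) = (\<Sum>i. \<integral>\<^sup>+z. ennreal (cmod (F i z)) \<partial>cell_measure)"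
    by (rule nn_integral_suminf) measurable
  also have "\<dots> \<le> (\<Sum>i. ennreal ((1 / 2) ^ i * K))"
  proof (intro suminf_le allI)
    fix i
    show "(\<integral>\<^sup>+z. ennreal (cmod (F i z)) \<partial>cell_measure) \<le> ennreal ((1 / 2) ^ i * K)"
      using integral_abs_le_norm[OF F[of i]] mult_right_mono[OF bound[of i], of K]
      by (auto simp: K_def intro: order_trans ennreal_leI)
  qed auto
  also have "\<dots> = ennreal (\<Sum>i. (1 / 2) ^ i * K)"
    by (intro suminf_ennreal_eq summable_sums summable_mult2 summable_geometric) (auto simp: K_def)
  also have "\<dots> < \<infinity>" by simp
  finally have "AE z in cell_measure. (\<Sum>i. ennreal (cmod (F i z))) \<noteq> \<infinity>"
    by (intro nn_integral_PInf_AE) auto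
  then have summ: "AE z in cell_measure. summable (\<lambda>i. F i z)"
  proof eventually_elim
    case (elim z)
    then have "summable (\<lambda>i. cmod (F i z))"
      by (intro summable_suminf_not_top) auto
    then show ?case by (rule summable_norm_cancel)
  qed
  \<comment> \<open>Defined by the same formula everywhere, so that exact periodicity and Borel
    measurability, both part of \<open>l2_fun\<close>, pass from the terms to
    \<open>f\<close>.\<close>
  define f where "f = (\<lambda>z. \<Sum>i. F i z)"
  have fm [measurable]: "f \<in> borel_measurable borel" unfolding f_def by measurable
  have fc [measurable]: "f \<in> borel_measurable cell_measure" by (rule measurable_cell[OF fm])
  have per: "F i (z + \<gamma>) = F i z" if "\<gamma> \<in> Lambda" for i z \<gamma>
    using F[of i] that by (simp add: l2_fun_def periodic_def)
  have fp: "periodic f" unfolding periodic_def by (auto simp: f_def per)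
  define P where "P = (\<lambda>N z. \<Sum>i<N. F i z)"
  have P: "l2_fun (P N)" for N unfolding P_def by (intro l2_fun_sum F) auto
  have Pabs: "abs_l2 (P N) = (\<Sum>i<N. abs_l2 (F i))" for N unfolding P_def by (intro abs_l2_sum F) auto
  have Pc [measurable]: "P N \<in> borel_measurable cell_measure" for N
    using P[of N] by (rule l2_fun_measurable)
  have lim: "AE z in cell_measure. (\<lambda>M. P M z) \<longlonglongrightarrow> f z"
    using summ by eventually_elim (auto simp: P_def f_def summable_LIMSEQ)
  have diff: "norm (abs_l2 (P M) - abs_l2 (P N)) \<le> 2 * (1 / 2) ^ N" if "N \<le> M" for M N
  proof -
    have "abs_l2 (P M) - abs_l2 (P N) = (\<Sum>i\<in>{N..<M}. abs_l2 (F i))"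
      using that unfolding Pabs by (simp add: lessThan_atLeast0 sum_diff_nat_ivl)
    also have "norm \<dots> \<le> (\<Sum>i\<in>{N..<M}. (1 / 2) ^ i)"
      by (rule order_trans[OF norm_sum sum_mono]) (rule bound)
    also have "\<dots> \<le> 2 * (1 / 2) ^ N"
    proof -
      have "(\<Sum>i\<in>{N..<M}. (1 / 2 :: real) ^ i) = 2 * (1 / 2) ^ N - 2 * (1 / 2) ^ M"
        using that by (induction M rule: dec_induct) simp_all
      then show ?thesis by simp
    qed
    finally show ?thesis .
  qed
  \<comment> \<open>The partial sum \<open>P N\<close> is compared with later ones
    \<open>P M\<close>, and M tends to infinity under the integral.\<close>
  have fatou: "(\<integral>\<^sup>+z. ennreal ((cmod (f z - P N z))\<^sup>2) \<partial>cell_measure) \<le> ennreal ((2 * (1 / 2) ^ N)\<^sup>2)" for N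
  proof -
    have "(\<integral>\<^sup>+z. ennreal ((cmod (f z - P N z))\<^sup>2) \<partial>cell_measure) =
        (\<integral>\<^sup>+z. liminf (\<lambda>M. ennreal ((cmod (P M z - P N z))\<^sup>2)) \<partial>cell_measure)"
    proof (rule nn_integral_cong_AE)
      show "AE z in cell_measure. ennreal ((cmod (f z - P N z))\<^sup>2) = liminf (\<lambda>M. ennreal ((cmod (P M z - P N z))\<^sup>2))"
        using lim
      proof eventually_elim
        case (elim z)
        then have "(\<lambda>M. ennreal ((cmod (P M z - P N z))\<^sup>2)) \<longlonglongrightarrow> ennreal ((cmod (f z - P N z))\<^sup>2)"
          by (intro tendsto_ennrealI tendsto_power tendsto_norm tendsto_diff tendsto_const)
        then show ?case by (rule lim_imp_Liminf[OF sequentially_bot, symmetric])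
      qed
    qed
    also have "\<dots> \<le> liminf (\<lambda>M. \<integral>\<^sup>+z. ennreal ((cmod (P M z - P N z))\<^sup>2) \<partial>cell_measure)"
      by (rule nn_integral_liminf) measurable
    also have "\<dots> \<le> ennreal ((2 * (1 / 2) ^ N)\<^sup>2)"
    proof -
      have "(\<integral>\<^sup>+z. ennreal ((cmod (P M z - P N z))\<^sup>2) \<partial>cell_measure) \<le> ennreal ((2 * (1 / 2) ^ N)\<^sup>2)"
        if "N \<le> M" for M
      proof -
        have "l2_fun (\<lambda>z. P M z - P N z)"
          using l2_fun_add[OF P[of M] l2_fun_scale[OF P[of N], of "-1"]] by simp
        then have "(\<integral>\<^sup>+z. ennreal ((cmod (P M z - P N z))\<^sup>2) \<partial>cell_measure) =
            ennreal ((norm (abs_l2 (P M) - abs_l2 (P N)))\<^sup>2)"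
          by (simp only: nn_integral_abs_l2 abs_l2_diff[OF P P])
        also have "\<dots> \<le> ennreal ((2 * (1 / 2) ^ N)\<^sup>2)"
          by (intro ennreal_leI power_mono diff that) simp
        finally show ?thesis .
      qed
      then have "\<forall>\<^sub>F M in sequentially.
          (\<integral>\<^sup>+z. ennreal ((cmod (P M z - P N z))\<^sup>2) \<partial>cell_measure) \<le> ennreal ((2 * (1 / 2) ^ N)\<^sup>2)"
        unfolding eventually_sequentially by blast
      then show ?thesis
        by (rule order_trans[OF Liminf_mono]) (simp add: Liminf_const)
    qed
    finally show ?thesis .
  qed
  have fP: "l2_fun (\<lambda>z. f z - P N z)" for N
    unfolding l2_fun_def
  proof (intro conjI)
    have "periodic (P N)" "P N \<in> borel_measurable borel" using P[of N] by (auto simp: l2_fun_def)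
    then show "periodic (\<lambda>z. f z - P N z)" "(\<lambda>z. f z - P N z) \<in> borel_measurable borel"
      using fp fm by (auto simp: periodic_def)
    show "integrable cell_measure (\<lambda>z. (cmod (f z - P N z))\<^sup>2)"
    proof (rule integrableI_bounded)
      have "(\<integral>\<^sup>+z. ennreal ((cmod (f z - P N z))\<^sup>2) \<partial>cell_measure) < \<infinity>"
        using fatou[of N] by (rule le_less_trans) simp
      then show "(\<integral>\<^sup>+z. ennreal (norm ((cmod (f z - P N z))\<^sup>2)) \<partial>cell_measure) < \<infinity>" by simp
    qed measurable
  qed
  have f: "l2_fun f" using fP[of 0] by (simp add: P_def)
  have close: "norm (abs_l2 (P N) - abs_l2 f) \<le> 2 * (1 / 2) ^ N" for N
  proof -
    have "ennreal ((norm (abs_l2 f - abs_l2 (P N)))\<^sup>2) \<le> ennreal ((2 * (1 / 2) ^ N)\<^sup>2)"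
      using fatou[of N] nn_integral_abs_l2[OF fP] by (simp only: abs_l2_diff[OF f P])
    then have "(norm (abs_l2 f - abs_l2 (P N)))\<^sup>2 \<le> (2 * (1 / 2) ^ N)\<^sup>2"
      by (subst (asm) ennreal_le_iff) auto
    then have "norm (abs_l2 f - abs_l2 (P N)) \<le> 2 * (1 / 2) ^ N"
      by (rule power2_le_imp_le) simp
    then show ?thesis by (simp add: norm_minus_commute)
  qed
  have null: "(\<lambda>N. 2 * (1 / 2 :: real) ^ N) \<longlonglongrightarrow> 0"
    by (rule tendsto_eq_rhs[OF tendsto_mult[OF tendsto_const LIMSEQ_power_zero]]) auto
  have "(\<lambda>N. abs_l2 (P N) - abs_l2 f) \<longlonglongrightarrow> 0"
    by (rule Lim_null_comparison[OF always_eventually[OF allI[OF close]] null])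
  then have "(\<lambda>N. abs_l2 (P N)) \<longlonglongrightarrow> abs_l2 f" by (rule LIM_zero_cancel)
  then show thesis using that by (simp add: Pabs)
qed

instance l2 :: banach
proof
  fix X :: "nat \<Rightarrow> l2" assume X: "Cauchy X"
  have "\<exists>M. \<forall>m\<ge>M. \<forall>n\<ge>M. norm (X m - X n) \<le> (1 / 2) ^ k" for k
    using CauchyD[OF X, of "(1 / 2) ^ k"] by (auto intro: less_imp_le)
  then obtain M where M: "\<And>k m n. m \<ge> M k \<Longrightarrow> n \<ge> M k \<Longrightarrow> norm (X m - X n) \<le> (1 / 2) ^ k" by metis
  \<comment> \<open>The sum over all k \<le> n dominates each of these \<open>M k\<close>, and the
    added \<open>n\<close> makes the sequence strictly increasing. Increment \<open>k\<close> of the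
    subsequence then has norm at most 2^(-k).\<close>
  define r where "r = (\<lambda>n. (\<Sum>k\<le>n. M k) + n)"
  have r: "strict_mono r" unfolding strict_mono_Suc_iff r_def by auto
  have rM: "M k \<le> r k" "M k \<le> r (Suc k)" for k
    unfolding r_def using member_le_sum[of k "{..k}" M] by auto
  define F where "F = (\<lambda>i. rep_l2 (X (r (Suc i)) - X (r i)))"
  obtain u where u: "(\<lambda>N. \<Sum>i<N. abs_l2 (F i)) \<longlonglongrightarrow> u"
    by (rule l2_series_converges[of F]) (auto simp: F_def l2_fun_rep intro: M rM)
  have "(\<Sum>i<N. abs_l2 (F i)) = X (r N) - X (r 0)" for N
    unfolding F_def abs_rep_l2 by (rule sum_lessThan_telescope[of "\<lambda>n. X (r n)"])
  with u have "(\<lambda>N. X (r N) - X (r 0) + X (r 0)) \<longlonglongrightarrow> u + X (r 0)"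
    by (intro tendsto_add tendsto_const) simp
  then have "(X \<circ> r) \<longlonglongrightarrow> u + X (r 0)" by (simp add: o_def)
  then have "X \<longlonglongrightarrow> u + X (r 0)" by (rule Cauchy_converges_subseq[OF X r])
  then show "convergent X" by (rule convergentI)
qed

section \<open>Fourier series on the torus\<close>

definition wave :: "complex \<Rightarrow> complex \<Rightarrow> complex" where
  "wave p z = cis (Re (p * cnj z))"

lemma wave_add: "wave (p + q) z = wave p z * wave q z"
  by (simp add: wave_def cis_mult algebra_simps)

lemma wave_minus: "wave (- p) z = cnj (wave p z)"
  by (simp add: wave_def cis_cnj)

lemma wave_crd: "wave p z = cis (Re (p * cnj omega) * crd_s z + Re p * crd_t z)"
proof -
  have "Re (p * cnj z) = Re (p * cnj (omega * of_real (crd_s z) + of_real (crd_t z)))"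
    using crd_decomp[of z] by simp
  also have "\<dots> = Re (p * cnj omega) * crd_s z + Re p * crd_t z"
    by (simp add: algebra_simps)
  finally show ?thesis by (simp add: wave_def)
qed

lemma smooth_wave: "smooth (wave p)"
  unfolding wave_crd[abs_def] by (rule smooth_cis)

lemma frechet_wave: "frechet_derivative (wave p) (at z) v = \<i> * of_real (Re (p * cnj v)) * wave p z"
proof -
  have "bounded_linear (\<lambda>z. Re (p * cnj z))"
    by (intro bounded_linear_compose[OF bounded_linear_Re] bounded_linear_const_mult bounded_linear_cnj)
  then have "bounded_linear (\<lambda>z. \<i> * complex_of_real (Re (p * cnj z)))"
    by (intro bounded_linear_const_mult bounded_linear_compose[OF bounded_linear_of_real])
  then have "((\<lambda>z. \<i> * complex_of_real (Re (p * cnj z))) has_derivative (\<lambda>v. \<i> * of_real (Re (p * cnj v)))) (at z)"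
    by (rule bounded_linear_imp_has_derivative)
  from has_derivative_compose[OF this DERIV_exp[unfolded has_field_derivative_def]]
  have "(wave p has_derivative (\<lambda>v. wave p z * (\<i> * of_real (Re (p * cnj v))))) (at z)"
    by (simp add: wave_def[abs_def] cis_conv_exp)
  from frechet_derivative_at[OF this, symmetric] show ?thesis by (simp only: mult.commute)
qed

text \<open>These are the pairings of \<open>p\<close> with the lattice basis 1, omega. That they
  are integer multiples of 2 pi makes waves periodic, and the integers can be read off from
  them.\<close>

lemma Lambda_dual_crd:
  assumes "\<gamma> = omega * of_int m + of_int n" "p = (4 * pi * \<i> / sqrt 3) * \<gamma>"
  shows "Re p = - 2 * pi * m" "Re (p * cnj omega) = 2 * pi * n"
proof -
  have s: "sqrt 3 * sqrt 3 = (3::real)" by simp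
  have "Re \<gamma> = n - m / 2" "Im \<gamma> = sqrt 3 / 2 * m"
    unfolding assms(1) by (simp_all add: omega_eq)
  moreover define c where "c = 4 * pi / sqrt 3"
  have "p = of_real c * (\<i> * \<gamma>)" by (simp add: assms(2) c_def)
  then have "Re p = - c * Im \<gamma>" "Im p = c * Re \<gamma>" by simp_all
  ultimately have Rp: "Re p = - (4 * pi / sqrt 3) * (sqrt 3 / 2 * m)" and Ip: "Im p = (4 * pi / sqrt 3) * (n - m / 2)"
    by (simp_all only: c_def)
  show *: "Re p = - 2 * pi * m" unfolding Rp by simp
  have "Re (p * cnj omega) = Re p * (- 1 / 2) + Im p * (sqrt 3 / 2)" by (simp add: omega_eq)
  also have "\<dots> = 2 * pi * n" unfolding * Ip by (simp add: field_simps)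
  finally show "Re (p * cnj omega) = 2 * pi * n" .
qed

lemma Lambda_dualE:
  assumes "p \<in> Lambda_dual"
  obtains m n :: int where "p = (4 * pi * \<i> / sqrt 3) * (omega * of_int m + of_int n)"
    "Re p = - 2 * pi * m" "Re (p * cnj omega) = 2 * pi * n"
proof -
  obtain m n where "p = (4 * pi * \<i> / sqrt 3) * (omega * of_int m + of_int n)"
    using assms by (auto simp: Lambda_dual_def Lambda_def)
  with Lambda_dual_crd[OF refl this] that show thesis by blast
qed

lemma Lambda_dualI: "(4 * pi * \<i> / sqrt 3) * (omega * of_int m + of_int n) \<in> Lambda_dual"
  by (auto simp: Lambda_dual_def Lambda_def)

lemma Lambda_dual_add:
  assumes "p \<in> Lambda_dual" "q \<in> Lambda_dual"
  shows "p + q \<in> Lambda_dual"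
proof -
  obtain m n where p: "p = (4 * pi * \<i> / sqrt 3) * (omega * of_int m + of_int n)" using Lambda_dualE[OF assms(1)] by metis
  obtain m' n' where q: "q = (4 * pi * \<i> / sqrt 3) * (omega * of_int m' + of_int n')" using Lambda_dualE[OF assms(2)] by metis
  have "p + q = (4 * pi * \<i> / sqrt 3) * (omega * of_int (m + m') + of_int (n + n'))"
    unfolding p q of_int_add by (simp only: distrib_left add_ac)
  then show ?thesis by (simp only: Lambda_dualI)
qed

lemma Lambda_dual_minus:
  assumes "p \<in> Lambda_dual"
  shows "- p \<in> Lambda_dual"
proof -
  obtain m n where p: "p = (4 * pi * \<i> / sqrt 3) * (omega * of_int m + of_int n)" using Lambda_dualE[OF assms] by metis
  have "- p = (4 * pi * \<i> / sqrt 3) * (omega * of_int (- m) + of_int (- n))"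
    unfolding p of_int_minus by (simp only: mult_minus_right minus_add_distrib distrib_left)
  then show ?thesis by (simp only: Lambda_dualI)
qed

lemma Lambda_dual_zero: "0 \<in> Lambda_dual"
  using Lambda_dualI[of 0 0] by simp

lemma periodic_wave:
  assumes "p \<in> Lambda_dual"
  shows "periodic (wave p)"
  unfolding periodic_def
proof (intro allI ballI)
  fix z \<gamma> assume "\<gamma> \<in> Lambda"
  then obtain k l :: int where kl: "crd_s \<gamma> = of_int k" "crd_t \<gamma> = of_int l" by (rule crd_Lambda)
  obtain m n :: int where mn: "Re p = - 2 * pi * m" "Re (p * cnj omega) = 2 * pi * n"
    using Lambda_dualE[OF assms] by metis
  have "wave p \<gamma> = cis (2 * pi * of_int (n * k - m * l))"
    unfolding wave_crd kl mn by (simp add: algebra_simps)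
  also have "\<dots> = 1" by (rule cis_multiple_2pi) simp
  finally show "wave p (z + \<gamma>) = wave p z"
    by (simp add: wave_def distrib_left flip: cis_mult)
qed

lemma l2_fun_wave: "p \<in> Lambda_dual \<Longrightarrow> l2_fun (wave p)"
  by (intro l2_fun_smooth periodic_wave smooth_wave)

text \<open>For p \<noteq> 0 some partial derivative of the wave is a nonzero multiple of the wave
  itself, and derivatives integrate to 0.\<close>

lemma integral_wave:
  assumes "p \<in> Lambda_dual"
  shows "(LINT z|cell_measure. wave p z) = (if p = 0 then of_real (sqrt 3 / 2) else 0)"
proof (cases "p = 0")
  case True
  then show ?thesis by (simp add: wave_def measure_cell scaleR_conv_of_real)
next
  case False
  have "Re (p * cnj 1) \<noteq> 0 \<or> Re (p * cnj \<i>) \<noteq> 0" using False by (simp add: complex_eq_iff)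
  then obtain v where v: "v \<in> {1, \<i>}" "Re (p * cnj v) \<noteq> 0" by blast
  have "(LINT z|cell_measure. \<i> * of_real (Re (p * cnj v)) * wave p z) = 0"
    using cell_integral_derivative[OF smooth_wave periodic_wave[OF assms] v(1)] unfolding frechet_wave .
  then have "\<i> * of_real (Re (p * cnj v)) * (LINT z|cell_measure. wave p z) = 0"
    by (simp only: integral_mult_right_zero)
  then show ?thesis using v(2) False by (simp only: mult_eq_0_iff of_real_eq_0_iff complex_i_not_zero) simp
qed

lemma countable_Lambda_dual: "countable Lambda_dual"
proof -
  have "Lambda_dual \<subseteq> (\<lambda>(m, n). (4 * pi * \<i> / sqrt 3) * (omega * of_int m + of_int n)) ` (UNIV :: (int \<times> int) set)"
    by (auto simp: Lambda_dual_def Lambda_def)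
  then show ?thesis by (rule countable_subset) simp
qed

lemma infinite_Lambda_dual: "infinite Lambda_dual"
proof
  assume fin: "finite Lambda_dual"
  have "inj (\<lambda>m :: int. (4 * pi * \<i> / sqrt 3) * (omega * of_int m + of_int 0))"
    by (rule injI) (simp add: omega_eq complex_eq_iff)
  then have "infinite (range (\<lambda>m :: int. (4 * pi * \<i> / sqrt 3) * (omega * of_int m + of_int 0)))"
    using finite_imageD infinite_UNIV_int by blast
  moreover have "range (\<lambda>m :: int. (4 * pi * \<i> / sqrt 3) * (omega * of_int m + of_int 0)) \<subseteq> Lambda_dual"
    using Lambda_dualI by blast
  ultimately show False using fin finite_subset by blast
qed

lemma finite_Lambda_dual_bounded: "finite {p \<in> Lambda_dual. cmod p \<le> R}"
proof -
  have fin: "finite {m :: int. \<bar>of_int m\<bar> \<le> R}"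
    by (rule finite_subset[of _ "{- \<lceil>R\<rceil>..\<lceil>R\<rceil>}"]) (auto simp: abs_le_iff le_ceiling_iff ceiling_le_iff, linarith+)
  have "{p \<in> Lambda_dual. cmod p \<le> R} \<subseteq> (\<lambda>(m, n). (4 * pi * \<i> / sqrt 3) * (omega * of_int m + of_int n)) `
      ({m :: int. \<bar>of_int m\<bar> \<le> R} \<times> {m :: int. \<bar>of_int m\<bar> \<le> R})"
  proof
    fix p assume p: "p \<in> {p \<in> Lambda_dual. cmod p \<le> R}"
    then obtain m n :: int where mn: "p = (4 * pi * \<i> / sqrt 3) * (omega * of_int m + of_int n)"
      "Re p = - 2 * pi * m" "Re (p * cnj omega) = 2 * pi * n" using Lambda_dualE by blast
    have pi: "1 \<le> 2 * pi" using pi_ge_two by linarith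
    have "cmod omega = 1" by (simp add: omega_eq cmod_def power2_eq_square)
    then have "\<bar>Re (p * cnj omega)\<bar> \<le> cmod p" using abs_Re_le_cmod[of "p * cnj omega"] by (simp add: norm_mult)
    moreover have "\<bar>Re p\<bar> \<le> cmod p" by (rule abs_Re_le_cmod)
    moreover have "\<bar>of_int k\<bar> \<le> \<bar>2 * pi * of_int k\<bar>" for k :: int
      using mult_right_mono[OF pi, of "\<bar>of_int k\<bar>"] by (simp add: abs_mult)
    ultimately have "\<bar>of_int m\<bar> \<le> cmod p" "\<bar>of_int n\<bar> \<le> cmod p"
      unfolding mn(2,3) by (metis abs_minus_cancel mult_minus_left order_trans)+
    then show "p \<in> (\<lambda>(m, n). (4 * pi * \<i> / sqrt 3) * (omega * of_int m + of_int n)) `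
      ({m :: int. \<bar>of_int m\<bar> \<le> R} \<times> {m :: int. \<bar>of_int m\<bar> \<le> R})"
      using p mn(1) by force
  qed
  then show ?thesis by (rule finite_subset) (intro finite_imageI finite_cartesian_product fin)
qed

text \<open>The enumeration is not arranged by modulus; decay along the index is later derived from
  the finiteness of bounded parts of the dual lattice.\<close>

definition dual_enum :: "nat \<Rightarrow> complex" where
  "dual_enum = from_nat_into Lambda_dual"

lemma dual_enum: "bij_betw dual_enum UNIV Lambda_dual"
  unfolding dual_enum_def by (intro bij_betw_from_nat_into countable_Lambda_dual infinite_Lambda_dual)

lemma dual_enum_in: "dual_enum i \<in> Lambda_dual"
  using dual_enum by (auto simp: bij_betw_def)

lemma dual_enum_inj: "dual_enum i = dual_enum j \<longleftrightarrow> i = j"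
  using dual_enum by (auto simp: bij_betw_def inj_eq)

lemma dual_enum_surj: "p \<in> Lambda_dual \<Longrightarrow> \<exists>i. p = dual_enum i"
  using dual_enum by (auto simp: bij_betw_def)

text \<open>Normalised so that \<open>cip (fourier i) (fourier i) = 1\<close>; the cell has area \<open>sqrt 3 / 2\<close>.\<close>

definition fourier_const :: real where
  "fourier_const = 1 / sqrt (sqrt 3 / 2)"

definition fourier :: "nat \<Rightarrow> l2" where
  "fourier i = abs_l2 (\<lambda>z. of_real fourier_const * wave (dual_enum i) z)"

lemma l2_fun_fourier: "l2_fun (\<lambda>z. of_real fourier_const * wave (dual_enum i) z)"
  by (intro l2_fun_scale l2_fun_wave dual_enum_in)

lemma fourier_const: "fourier_const * fourier_const * (sqrt 3 / 2) = 1" "fourier_const \<noteq> 0"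
  by (simp_all add: fourier_const_def)

lemma cip_fourier_fun:
  assumes "l2_fun f"
  shows "cip (abs_l2 f) (fourier i) = of_real fourier_const * (LINT z|cell_measure. f z * wave (- dual_enum i) z)"
proof -
  have "cip (abs_l2 f) (fourier i) = (LINT z|cell_measure. f z * cnj (of_real fourier_const * wave (dual_enum i) z))"
    unfolding fourier_def by (rule cip_abs_l2[OF assms l2_fun_fourier])
  also have "(\<lambda>z. f z * cnj (of_real fourier_const * wave (dual_enum i) z)) =
      (\<lambda>z. of_real fourier_const * (f z * wave (- dual_enum i) z))"
    by (simp add: wave_minus fun_eq_iff)
  finally show ?thesis by (simp only: integral_mult_right_zero)
qed

lemma cip_fourier: "cip u (fourier i) = of_real fourier_const * (LINT z|cell_measure. rep_l2 u z * wave (- dual_enum i) z)"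
  using cip_fourier_fun[OF l2_fun_rep, of u i] by simp

lemma fourier_orth: "cip (fourier i) (fourier j) = (if i = j then 1 else 0)"
proof -
  have mem: "dual_enum i - dual_enum j \<in> Lambda_dual"
    using Lambda_dual_add[OF dual_enum_in[of i] Lambda_dual_minus[OF dual_enum_in[of j]]] by simp
  have "cip (fourier i) (fourier j) = of_real fourier_const *
      (LINT z|cell_measure. of_real fourier_const * wave (dual_enum i) z * wave (- dual_enum j) z)"
    unfolding fourier_def[of i] by (rule cip_fourier_fun[OF l2_fun_fourier])
  also have "(\<lambda>z. of_real fourier_const * wave (dual_enum i) z * wave (- dual_enum j) z) =
      (\<lambda>z. of_real fourier_const * wave (dual_enum i - dual_enum j) z)"
    using wave_add[of "dual_enum i" "- dual_enum j"] by (simp add: fun_eq_iff mult.assoc)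
  also have "of_real fourier_const * (LINT z|cell_measure. of_real fourier_const * wave (dual_enum i - dual_enum j) z) =
      of_real fourier_const * (of_real fourier_const * (if i = j then of_real (sqrt 3 / 2) else 0))"
    by (simp only: integral_mult_right_zero integral_wave[OF mem] right_minus_eq dual_enum_inj)
  also have "\<dots> = (if i = j then of_real (fourier_const * fourier_const * (sqrt 3 / 2)) else 0)"
    by simp
  finally show ?thesis by (simp only: fourier_const of_real_1)
qed

subsection \<open>Totality\<close>

inductive trig :: "(complex \<Rightarrow> complex) \<Rightarrow> bool" where
  monomial: "p \<in> Lambda_dual \<Longrightarrow> trig (\<lambda>z. c * wave p z)"
| add: "trig f \<Longrightarrow> trig g \<Longrightarrow> trig (\<lambda>z. f z + g z)"

lemma trig_mult:
  assumes "trig f" "trig g"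
  shows "trig (\<lambda>z. f z * g z)"
  using assms(1)
proof induction
  case (monomial p c)
  show ?case using assms(2)
  proof induction
    case (monomial q d)
    have "trig (\<lambda>z. (c * d) * wave (p + q) z)"
      using \<open>p \<in> Lambda_dual\<close> monomial by (intro trig.monomial Lambda_dual_add)
    then show ?case by (simp add: wave_add mult_ac)
  next
    case (add f g)
    from trig.add[OF add.IH] show ?case by (simp add: distrib_left)
  qed
next
  case (add f h)
  from trig.add[OF add.IH] show ?case by (simp add: distrib_right)
qed

lemma trig_const: "trig (\<lambda>z. c)"
  using trig.monomial[OF Lambda_dual_zero, of c] by (simp add: wave_def)

lemma trig_torus_coordinates:
  "trig (\<lambda>z. cis (2 * pi * crd_s z))" "trig (\<lambda>z. cis (- (2 * pi * crd_s z)))"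
  "trig (\<lambda>z. cis (2 * pi * crd_t z))" "trig (\<lambda>z. cis (- (2 * pi * crd_t z)))"
proof -
  have *: "trig (\<lambda>z. cis (2 * pi * of_int n * crd_s z - 2 * pi * of_int m * crd_t z))" for m n :: int
    using trig.monomial[OF Lambda_dualI[of m n], of 1] Lambda_dual_crd[OF refl refl, of m n]
    by (simp only: wave_crd mult_1) simp
  show "trig (\<lambda>z. cis (2 * pi * crd_s z))" "trig (\<lambda>z. cis (- (2 * pi * crd_s z)))"
    "trig (\<lambda>z. cis (2 * pi * crd_t z))" "trig (\<lambda>z. cis (- (2 * pi * crd_t z)))"
    using *[of 1 0] *[of "-1" 0] *[of 0 1] *[of 0 "-1"] by simp_all
qed

lemma trig_polynomial:
  assumes "real_polynomial_function g"
  shows "trig (\<lambda>z. of_real (g (torus_emb z)))"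
  using assms
proof induction
  case (linear f)
  interpret bounded_linear f by fact
  have dec: "f (a, b) = Re a * f (1, 0) + Im a * f (\<i>, 0) + Re b * f (0, 1) + Im b * f (0, \<i>)" for a b
  proof -
    have "(a, b) = Re a *\<^sub>R (1, 0) + Im a *\<^sub>R (\<i>, 0) + Re b *\<^sub>R (0, 1) + Im b *\<^sub>R (0, \<i>)"
      by (simp add: complex_eq_iff)
    then have "f (a, b) = f (Re a *\<^sub>R (1, 0) + Im a *\<^sub>R (\<i>, 0) + Re b *\<^sub>R (0, 1) + Im b *\<^sub>R (0, \<i>))" by simp
    then show ?thesis by (simp only: add scaleR real_scaleR_def)
  qed
  have cs: "complex_of_real (cos x) = 1 / 2 * (cis x + cis (- x))"
    "complex_of_real (sin x) = (- \<i> / 2) * (cis x + (- 1) * cis (- x))" for x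
    by (simp_all add: complex_eq_iff)
  have "complex_of_real (f (torus_emb z)) =
      of_real (f (1, 0)) * (1 / 2 * (cis (2 * pi * crd_s z) + cis (- (2 * pi * crd_s z))))
    + of_real (f (\<i>, 0)) * ((- \<i> / 2) * (cis (2 * pi * crd_s z) + (- 1) * cis (- (2 * pi * crd_s z))))
    + of_real (f (0, 1)) * (1 / 2 * (cis (2 * pi * crd_t z) + cis (- (2 * pi * crd_t z))))
    + of_real (f (0, \<i>)) * ((- \<i> / 2) * (cis (2 * pi * crd_t z) + (- 1) * cis (- (2 * pi * crd_t z))))" for z
    unfolding torus_emb_def cs[symmetric]
    using dec[of "cis (2 * pi * crd_s z)" "cis (2 * pi * crd_t z)"] by (simp add: mult_ac)
  then show ?case
    by (simp only:) (intro trig.add trig_mult trig_const trig_torus_coordinates)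
next
  case (const c)
  show ?case by (rule trig_const)
next
  case (add f g)
  then show ?case using trig.add by simp
next
  case (mult f g)
  then show ?case using trig_mult by simp
qed

lemma range_torus_emb: "range torus_emb = torus_emb ` {z. crd_s z \<in> {0..1} \<and> crd_t z \<in> {0..1}}"
proof (intro equalityI subsetI)
  fix x assume "x \<in> range torus_emb"
  then obtain z where x: "x = torus_emb z" by blast
  obtain \<gamma> where \<gamma>: "\<gamma> \<in> Lambda" "z + \<gamma> \<in> cell" using cell_reduce by blast
  then have "x = torus_emb (z + \<gamma>)" using periodic_torus_emb x by (simp add: periodic_def)
  moreover have "z + \<gamma> \<in> {z. crd_s z \<in> {0..1} \<and> crd_t z \<in> {0..1}}" using \<gamma>(2) by (auto simp: cell_eq)
  ultimately show "x \<in> torus_emb ` {z. crd_s z \<in> {0..1} \<and> crd_t z \<in> {0..1}}" by blast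
qed auto

lemma compact_range_torus_emb: "compact (range torus_emb)"
  unfolding range_torus_emb by (intro compact_continuous_image continuous_torus_emb cell_closed_compact)

text \<open>A closed lattice cell is compact and maps onto the torus, so the preimage of a closed
  set under the induced function is the image of a compact set. This gives continuity
  downstairs.\<close>

lemma periodic_factor:
  fixes h :: "complex \<Rightarrow> real"
  assumes "periodic h" "continuous_on UNIV h"
  obtains H where "continuous_on (range torus_emb) H" "\<And>z. H (torus_emb z) = h z"
proof -
  have eq: "h z = h w" if zw: "torus_emb z = torus_emb w" for z w
  proof -
    obtain \<gamma> where \<gamma>: "\<gamma> \<in> Lambda" "z + \<gamma> \<in> cell" using cell_reduce by blast
    obtain \<delta> where \<delta>: "\<delta> \<in> Lambda" "w + \<delta> \<in> cell" using cell_reduce by blast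
    have "torus_emb (z + \<gamma>) = torus_emb (w + \<delta>)"
      using periodic_torus_emb zw \<gamma>(1) \<delta>(1) by (simp add: periodic_def)
    then have "z + \<gamma> = w + \<delta>" using torus_emb_inj \<gamma>(2) \<delta>(2) by (auto dest: inj_onD)
    moreover have "h (z + \<gamma>) = h z" "h (w + \<delta>) = h w" using assms(1) \<gamma>(1) \<delta>(1) by (simp_all add: periodic_def)
    ultimately show ?thesis by simp
  qed
  define H where "H = (\<lambda>x. h (SOME z. torus_emb z = x))"
  have H: "H (torus_emb z) = h z" for z
    unfolding H_def by (rule eq) (rule someI[of "\<lambda>w. torus_emb w = torus_emb z"], rule refl)
  define K where "K = {z. crd_s z \<in> {0..1} \<and> crd_t z \<in> {0..1}}"
  have K: "compact K" unfolding K_def by (rule cell_closed_compact)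
  have "continuous_on (range torus_emb) H"
    unfolding continuous_on_closed_vimage[OF compact_imp_closed[OF compact_range_torus_emb]]
  proof (intro allI impI)
    fix B :: "real set" assume B: "closed B"
    have "H -` B \<inter> range torus_emb = torus_emb ` (K \<inter> h -` B)"
      unfolding range_torus_emb K_def by (auto simp: H)
    moreover have "compact (K \<inter> h -` B)"
      by (intro compact_Int_closed K continuous_closed_vimage B)
        (use assms(2) in \<open>simp add: continuous_on_eq_continuous_at\<close>)
    ultimately show "closed (H -` B \<inter> range torus_emb)"
      by (simp add: compact_imp_closed compact_continuous_image continuous_torus_emb)
  qed
  then show thesis using that H by blast
qed

lemma trig_dense_real:
  fixes h :: "complex \<Rightarrow> real"
  assumes "periodic h" "continuous_on UNIV h" "\<epsilon> > 0"
  obtains \<tau> where "trig \<tau>" "\<And>z. cmod (of_real (h z) - \<tau> z) < \<epsilon>"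
proof -
  obtain H where H: "continuous_on (range torus_emb) H" "\<And>z. H (torus_emb z) = h z"
    using periodic_factor[OF assms(1,2)] by blast
  obtain g where g: "real_polynomial_function g" "\<And>x. x \<in> range torus_emb \<Longrightarrow> \<bar>H x - g x\<bar> < \<epsilon>"
    using Stone_Weierstrass_real_polynomial_function[OF compact_range_torus_emb H(1) assms(3)] by auto
  have "cmod (of_real (h z) - of_real (g (torus_emb z))) < \<epsilon>" for z
    using g(2)[of "torus_emb z"] by (simp add: H(2) flip: of_real_diff)
  then show thesis using that[OF trig_polynomial[OF g(1)]] by blast
qed

lemma trig_dense:
  assumes \<phi>: "periodic \<phi>" "continuous_on UNIV \<phi>" "\<epsilon> > 0"
  obtains \<tau> where "trig \<tau>" "\<And>z. cmod (\<phi> z - \<tau> z) \<le> \<epsilon>"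
proof -
  have p: "periodic (\<lambda>z. Re (\<phi> z))" "periodic (\<lambda>z. Im (\<phi> z))" using \<phi>(1) by (auto simp: periodic_def)
  have c: "continuous_on UNIV (\<lambda>z. Re (\<phi> z))" "continuous_on UNIV (\<lambda>z. Im (\<phi> z))"
    by (intro continuous_intros \<phi>)+
  have e: "\<epsilon> / 2 > 0" using \<phi>(3) by simp
  obtain \<tau>1 where \<tau>1: "trig \<tau>1" "\<And>z. cmod (of_real (Re (\<phi> z)) - \<tau>1 z) < \<epsilon> / 2"
    using trig_dense_real[OF p(1) c(1) e] by blast
  obtain \<tau>2 where \<tau>2: "trig \<tau>2" "\<And>z. cmod (of_real (Im (\<phi> z)) - \<tau>2 z) < \<epsilon> / 2"
    using trig_dense_real[OF p(2) c(2) e] by blast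
  have "cmod (\<phi> z - (\<tau>1 z + \<i> * \<tau>2 z)) \<le> \<epsilon>" for z
  proof -
    have "\<phi> z - (\<tau>1 z + \<i> * \<tau>2 z) = (of_real (Re (\<phi> z)) - \<tau>1 z) + \<i> * (of_real (Im (\<phi> z)) - \<tau>2 z)"
      using complex_eq[of "\<phi> z"] by (simp add: algebra_simps)
    then have "cmod (\<phi> z - (\<tau>1 z + \<i> * \<tau>2 z)) \<le> cmod (of_real (Re (\<phi> z)) - \<tau>1 z) + cmod (\<i> * (of_real (Im (\<phi> z)) - \<tau>2 z))"
      by (simp only: norm_triangle_ineq)
    also have "cmod (\<i> * (of_real (Im (\<phi> z)) - \<tau>2 z)) = cmod (of_real (Im (\<phi> z)) - \<tau>2 z)"
      by (simp only: norm_mult norm_ii mult_1)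
    finally show ?thesis using \<tau>1(2)[of z] \<tau>2(2)[of z] by linarith
  qed
  then show thesis by (rule that[OF trig.add[OF \<tau>1(1) trig_mult[OF trig_const \<tau>2(1)]]])
qed

lemma le_all_multiples_zero: "(\<And>\<epsilon>. \<epsilon> > 0 \<Longrightarrow> x \<le> \<epsilon> * J) \<Longrightarrow> 0 \<le> J \<Longrightarrow> x \<le> (0::real)"
proof (rule field_le_epsilon)
  fix \<epsilon> :: real assume le: "\<And>\<epsilon>. \<epsilon> > 0 \<Longrightarrow> x \<le> \<epsilon> * J" and J: "0 \<le> J" and e: "\<epsilon> > 0"
  have "x \<le> \<epsilon> / (J + 1) * J" using e J by (intro le) simp
  also have "\<dots> \<le> \<epsilon>" using J e by (simp add: field_simps)
  finally show "x \<le> 0 + \<epsilon>" by simp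
qed

text \<open>Vanishing coefficients kill the pairing with every trigonometric polynomial, and these
  approximate a test function uniformly, at the cost of \<epsilon> times the L^1 norm of
  \<open>u\<close>.\<close>

lemma fourier_total:
  assumes u: "\<And>i. cip u (fourier i) = 0"
  shows "u = 0"
proof (rule pair_zero_imp_zero)
  define w where "w = rep_l2 u"
  have w: "l2_fun w" by (simp add: w_def l2_fun_rep)
  have wint: "integrable cell_measure w"
    using l2_prod_integrable[OF w l2_fun_smooth[of "\<lambda>_. 1"]] by (simp add: periodic_def smooth_const)
  have wave0: "(LINT z|cell_measure. w z * wave p z) = 0" if p: "p \<in> Lambda_dual" for p
  proof -
    obtain i where i: "- p = dual_enum i" using dual_enum_surj[OF Lambda_dual_minus[OF p]] by blast
    have "p = - dual_enum i" by (simp flip: i)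
    then show ?thesis using u[of i] fourier_const(2) unfolding cip_fourier w_def by simp
  qed
  have trig0: "(LINT z|cell_measure. w z * \<tau> z) = 0 \<and> integrable cell_measure (\<lambda>z. w z * \<tau> z)" if "trig \<tau>" for \<tau>
    using that
  proof induction
    case (monomial p c)
    have "(LINT z|cell_measure. c * (w z * wave p z)) = 0"
      by (simp only: integral_mult_right_zero wave0[OF monomial] mult_zero_right)
    moreover have "integrable cell_measure (\<lambda>z. c * (w z * wave p z))"
      by (intro integrable_mult_right l2_prod_integrable w l2_fun_wave monomial)
    ultimately show ?case by (simp add: mult.left_commute)
  next
    case (add f g)
    then show ?case by (simp add: distrib_left)
  qed
  fix \<phi> :: "complex \<Rightarrow> complex" assume \<phi>: "smooth \<phi>" "periodic \<phi>"
  define I where "I = (LINT z|cell_measure. w z * \<phi> z)"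
  define J where "J = (LINT z|cell_measure. cmod (w z))"
  have int: "integrable cell_measure (\<lambda>z. w z * \<phi> z)" by (intro l2_prod_integrable w l2_fun_smooth \<phi>)
  have "cmod I \<le> \<epsilon> * J" if e: "\<epsilon> > 0" for \<epsilon>
  proof -
    obtain \<tau> where \<tau>: "trig \<tau>" "\<And>z. cmod (\<phi> z - \<tau> z) \<le> \<epsilon>"
      using trig_dense[OF \<phi>(2) smooth_continuous[OF \<phi>(1)] e] by blast
    note t0 = trig0[OF \<tau>(1)]
    have "I = (LINT z|cell_measure. w z * \<phi> z - w z * \<tau> z)"
      unfolding I_def using t0 by (subst Bochner_Integration.integral_diff[OF int]) auto
    also have "cmod \<dots> \<le> (LINT z|cell_measure. \<epsilon> * cmod (w z))"
    proof (rule Bochner_Integration.integral_norm_bound_integral)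
      show "integrable cell_measure (\<lambda>z. w z * \<phi> z - w z * \<tau> z)" using int t0 by auto
      show "integrable cell_measure (\<lambda>z. \<epsilon> * cmod (w z))" using wint by auto
      show "cmod (w z * \<phi> z - w z * \<tau> z) \<le> \<epsilon> * cmod (w z)" for z
      proof -
        have "w z * \<phi> z - w z * \<tau> z = (\<phi> z - \<tau> z) * w z" by (simp add: algebra_simps)
        then show ?thesis
          using mult_right_mono[OF \<tau>(2)[of z] norm_ge_zero[of "w z"]] by (simp only: norm_mult)
      qed
    qed
    also have "\<dots> = \<epsilon> * J" by (simp add: J_def)
    finally show ?thesis .
  qed
  moreover have "0 \<le> J" unfolding J_def by (rule integral_nonneg_AE) simp
  ultimately have "cmod I \<le> 0" by (rule le_all_multiples_zero)
  then show "(LINT z|cell_measure. rep_l2 u z * \<phi> z) = 0" by (simp add: w_def I_def)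
qed

interpretation fourier: orthonormal_basis fourier
  by unfold_locales (rule fourier_orth, rule fourier_total)

subsection \<open>Weak derivatives and Fourier coefficients\<close>

text \<open>Waves are themselves test functions, and the one with the opposite frequency reads off a
  single coefficient.\<close>

lemma weak_derivD:
  assumes "v \<in> {1, \<i>}" "weak_deriv v u w"
  shows "cip w (fourier i) = \<i> * of_real (Re (dual_enum i * cnj v)) * cip u (fourier i)"
proof -
  define p where "p = dual_enum i"
  have p: "- p \<in> Lambda_dual" unfolding p_def by (intro Lambda_dual_minus dual_enum_in)
  have "(LINT z|cell_measure. rep_l2 u z * frechet_derivative (wave (- p)) (at z) v) =
      - (LINT z|cell_measure. rep_l2 w z * wave (- p) z)"
    using assms(2) smooth_wave periodic_wave[OF p] unfolding weak_deriv_def by blast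
  also have "(\<lambda>z. rep_l2 u z * frechet_derivative (wave (- p)) (at z) v) =
      (\<lambda>z. (\<i> * of_real (Re (- p * cnj v))) * (rep_l2 u z * wave (- p) z))"
    by (simp only: frechet_wave mult_ac)
  finally have "(LINT z|cell_measure. rep_l2 w z * wave (- p) z) =
      - ((\<i> * of_real (Re (- p * cnj v))) * (LINT z|cell_measure. rep_l2 u z * wave (- p) z))"
    by (simp only: integral_mult_right_zero minus_minus)
  then show ?thesis
    unfolding cip_fourier p_def[symmetric] by (simp add: algebra_simps)
qed

text \<open>Parseval reduces the pairing with an arbitrary test function to Fourier coefficients;
  the coefficients of its derivative come from integrating the derivative of \<open>\<phi>\<close>
  times a wave over the cell.\<close>

lemma weak_derivI:
  assumes v: "v \<in> {1, \<i>}"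
    and coeff: "\<And>i. cip w (fourier i) = \<i> * of_real (Re (dual_enum i * cnj v)) * cip u (fourier i)"
  shows "weak_deriv v u w"
  unfolding weak_deriv_def
proof (intro allI impI)
  fix \<phi> assume "smooth \<phi> \<and> periodic \<phi>"
  then have \<phi>: "smooth \<phi>" "periodic \<phi>" by auto
  define \<phi>' where "\<phi>' = (\<lambda>z. frechet_derivative \<phi> (at z) v)"
  have \<phi>': "smooth \<phi>'" "periodic \<phi>'"
    unfolding \<phi>'_def by (rule smooth_frechet[OF \<phi>(1) v], rule periodic_frechet[OF \<phi>(2,1)])
  have l2: "l2_fun (\<lambda>z. cnj (\<phi> z))" "l2_fun (\<lambda>z. cnj (\<phi>' z))"
    using l2_fun_cnj[OF l2_fun_smooth[OF \<phi>(2,1)]] l2_fun_cnj[OF l2_fun_smooth[OF \<phi>'(2,1)]] by simp_all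
  have pair: "(LINT z|cell_measure. rep_l2 x z * f z) = cip x (abs_l2 (\<lambda>z. cnj (f z)))" if "l2_fun (\<lambda>z. cnj (f z))" for x f
    using cip_abs_l2[OF l2_fun_rep that, of x] by simp
  have co: "cip (abs_l2 (\<lambda>z. cnj (f z))) (fourier i) =
      of_real fourier_const * cnj (LINT z|cell_measure. f z * wave (dual_enum i) z)" if "l2_fun (\<lambda>z. cnj (f z))" for f i
  proof -
    have "(LINT z|cell_measure. cnj (f z) * wave (- dual_enum i) z) =
        (LINT z|cell_measure. cnj (f z * wave (dual_enum i) z))" by (simp add: wave_minus)
    also have "\<dots> = cnj (LINT z|cell_measure. f z * wave (dual_enum i) z)" by (rule Bochner_Integration.integral_cnj)
    finally show ?thesis by (simp only: cip_fourier_fun[OF that])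
  qed
  have parts: "(LINT z|cell_measure. \<phi>' z * wave (dual_enum i) z) =
      - (\<i> * of_real (Re (dual_enum i * cnj v)) * (LINT z|cell_measure. \<phi> z * wave (dual_enum i) z))" for i
  proof -
    define p where "p = dual_enum i"
    have p: "p \<in> Lambda_dual" by (simp add: p_def dual_enum_in)
    have sm: "smooth (\<lambda>z. \<phi> z * wave p z)" by (intro smooth_mult \<phi> smooth_wave)
    have pe: "periodic (\<lambda>z. \<phi> z * wave p z)" using \<phi>(2) periodic_wave[OF p] by (simp add: periodic_def)
    have "frechet_derivative (\<lambda>z. \<phi> z * wave p z) (at z) v =
        (\<i> * of_real (Re (p * cnj v))) * (\<phi> z * wave p z) + \<phi>' z * wave p z" for z
    proof -
      have "((\<lambda>z. \<phi> z * wave p z) has_derivative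
          (\<lambda>v. \<phi> z * frechet_derivative (wave p) (at z) v + frechet_derivative \<phi> (at z) v * wave p z)) (at z)"
        by (rule has_derivative_mult[OF smooth_has_derivative[OF \<phi>(1)] smooth_has_derivative[OF smooth_wave]])
      from frechet_derivative_at[OF this, symmetric] show ?thesis
        by (simp only: frechet_wave \<phi>'_def) (simp only: mult_ac)
    qed
    then have "0 = (LINT z|cell_measure. (\<i> * of_real (Re (p * cnj v))) * (\<phi> z * wave p z) + \<phi>' z * wave p z)"
      using cell_integral_derivative[OF sm pe v] by simp
    also have "\<dots> = (\<i> * of_real (Re (p * cnj v))) * (LINT z|cell_measure. \<phi> z * wave p z) +
        (LINT z|cell_measure. \<phi>' z * wave p z)"
      by (subst Bochner_Integration.integral_add, intro integrable_mult_right l2_prod_integrable l2_fun_smooth \<phi> l2_fun_wave p,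
          intro l2_prod_integrable l2_fun_smooth \<phi>' l2_fun_wave p, simp only: integral_mult_right_zero)
    finally show ?thesis unfolding p_def by (simp add: add_eq_0_iff2)
  qed
  define \<psi> where "\<psi> = abs_l2 (\<lambda>z. cnj (\<phi> z))"
  define \<psi>' where "\<psi>' = abs_l2 (\<lambda>z. cnj (\<phi>' z))"
  have "cip u (fourier i) * cnj (cip \<psi>' (fourier i)) = - (cip w (fourier i) * cnj (cip \<psi> (fourier i)))" for i
    unfolding \<psi>_def \<psi>'_def co[OF l2(1)] co[OF l2(2)] parts coeff by simp
  then have "(\<lambda>i. - (cip w (fourier i) * cnj (cip \<psi> (fourier i)))) sums cip u \<psi>'"
    using fourier.cip_sums[of u \<psi>'] by simp
  moreover have "(\<lambda>i. - (cip w (fourier i) * cnj (cip \<psi> (fourier i)))) sums (- cip w \<psi>)"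
    by (intro sums_minus fourier.cip_sums)
  ultimately have "cip u \<psi>' = - cip w \<psi>" by (rule sums_unique2)
  then show "(LINT z|cell_measure. rep_l2 u z * frechet_derivative \<phi> (at z) v) =
      - (LINT z|cell_measure. rep_l2 w z * \<phi> z)"
    using pair[OF l2(1), of w] pair[OF l2(2), of u] by (simp add: \<psi>_def \<psi>'_def \<phi>'_def)
qed

text \<open>The directions 1 and \<open>\<i>\<close> contribute \<i> Re p and \<i> Im p, and (1 /
  \<i>) (\<i> Re p + \<i> \<i> Im p) = p.\<close>

lemma coeff_two_Dbar:
  assumes "u \<in> sobolev (Suc n)"
  shows "cip (two_Dbar u) (fourier i) = dual_enum i * cip u (fourier i)"
proof -
  have d: "cip (wderiv v u) (fourier i) = \<i> * of_real (Re (dual_enum i * cnj v)) * cip u (fourier i)"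
    if "v \<in> {1, \<i>}" for v
    by (rule weak_derivD[OF that sobolev_wderiv(1)[OF assms that]])
  have "cip (two_Dbar u) (fourier i) = (of_real (Re (dual_enum i)) + \<i> * of_real (Im (dual_enum i))) * cip u (fourier i)"
    unfolding two_Dbar_def cip_scaleC_left cip_add_left
    by (subst d, simp, subst d, simp) (simp add: algebra_simps)
  also have "of_real (Re (dual_enum i)) + \<i> * of_real (Im (dual_enum i)) = dual_enum i"
    by (simp add: complex_eq_iff)
  finally show ?thesis .
qed

lemma two_Dbar_sobolev:
  assumes "u \<in> sobolev (Suc n)"
  shows "two_Dbar u \<in> sobolev n"
  unfolding two_Dbar_def
  by (intro sobolev_scaleC sobolev_add sobolev_wderiv(2)[OF assms]) auto

lemma coeff_Q_map:
  "cip (Q_map V \<alpha> k u) (fourier i) =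
    (dual_enum i + k)\<^sup>2 * cip (Rep_h2 u) (fourier i) - \<alpha>\<^sup>2 * cip (l2_mult V (Rep_h2 u)) (fourier i)"
proof -
  have u: "Rep_h2 u \<in> sobolev (Suc (Suc 0))" using Rep_h2[of u] by (simp only: numeral_2_eq_2)
  then have "two_Dbar (Rep_h2 u) + k *\<^sub>C Rep_h2 u \<in> sobolev (Suc 0)"
    by (intro sobolev_add two_Dbar_sobolev sobolev_scaleC) (use sobolev_Suc_subset in blast)+
  from coeff_two_Dbar[OF this] coeff_two_Dbar[OF u] show ?thesis
    by (simp add: Q_map_def Let_def cip_add_left cip_diff_left cip_scaleC_left power2_eq_square algebra_simps)
qed

subsection \<open>An isomorphism from \<open>H\<^sup>2\<close> to \<open>L\<^sup>2\<close>\<close>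

lemma Lambda_dual_norm:
  assumes "p \<in> Lambda_dual" "p \<noteq> 0"
  shows "1 \<le> cmod p"
proof -
  obtain m n :: int where mn: "p = (4 * pi * \<i> / sqrt 3) * (omega * of_int m + of_int n)"
    "Re p = - 2 * pi * m" "Re (p * cnj omega) = 2 * pi * n" using Lambda_dualE[OF assms(1)] by blast
  have pi: "1 \<le> 2 * pi" using pi_ge_two by linarith
  have big: "1 \<le> \<bar>2 * pi * of_int k\<bar>" if "k \<noteq> 0" for k :: int
  proof -
    have "1 \<le> \<bar>k\<bar>" using that by linarith
    then have k: "1 \<le> \<bar>real_of_int k\<bar>" by linarith
    show ?thesis using mult_mono[OF pi k] by (simp add: abs_mult)
  qed
  have "cmod omega = 1" by (simp add: omega_eq cmod_def power2_eq_square)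
  then have *: "\<bar>Re (p * cnj omega)\<bar> \<le> cmod p" "\<bar>Re p\<bar> \<le> cmod p"
    using abs_Re_le_cmod[of "p * cnj omega"] abs_Re_le_cmod[of p] by (simp_all add: norm_mult)
  have "m \<noteq> 0 \<or> n \<noteq> 0" using assms(2) mn(1) by auto
  then show ?thesis
  proof
    assume "m \<noteq> 0"
    then have "1 \<le> \<bar>Re p\<bar>" unfolding mn(2) using big[of m] by simp
    then show ?thesis using *(2) by linarith
  next
    assume "n \<noteq> 0"
    then have "1 \<le> \<bar>Re (p * cnj omega)\<bar>" unfolding mn(3) by (rule big)
    then show ?thesis using *(1) by linarith
  qed
qed

text \<open>The symbol of the squared operator \<open>two_Dbar\<close>, with its zero at p = 0
  replaced by 1 to make it invertible.\<close>

definition lsym :: "nat \<Rightarrow> complex" where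
  "lsym i = (if dual_enum i = 0 then 1 else (dual_enum i)\<^sup>2)"

lemma lsym_nonzero: "lsym i \<noteq> 0"
  by (simp add: lsym_def)

lemma lsym_bounds:
  "1 \<le> cmod (lsym i)" "cmod (dual_enum i) \<le> cmod (lsym i)" "(cmod (dual_enum i))\<^sup>2 \<le> cmod (lsym i)"
proof -
  have "1 \<le> cmod (dual_enum i)" if "dual_enum i \<noteq> 0" using Lambda_dual_norm[OF dual_enum_in that] .
  then show "1 \<le> cmod (lsym i)" "cmod (dual_enum i) \<le> cmod (lsym i)" "(cmod (dual_enum i))\<^sup>2 \<le> cmod (lsym i)"
    by (auto simp: lsym_def norm_power self_le_power one_le_power)
qed

text \<open>The inverse of \<open>LO\<close> below, seen as an operator on L^2; \<open>LI\<close> is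
  the same map with values in H^2.\<close>

definition Ld :: "l2 \<Rightarrow>\<^sub>L l2" where
  "Ld = fourier.multiplier (\<lambda>i. 1 / lsym i)"

lemma Ld_bound: "cmod (1 / lsym i) \<le> 1"
  using lsym_bounds(1)[of i] by (simp add: norm_divide divide_le_eq)

lemma coeff_Ld: "cip (Ld g) (fourier i) = cip g (fourier i) / lsym i"
  unfolding Ld_def by (subst fourier.coeff_multiplier[OF Ld_bound]) simp

lemma clin_Ld: "clin Ld" unfolding Ld_def by (rule fourier.clin_multiplier[OF Ld_bound])

text \<open>\<open>Ld1\<close> and \<open>Ld2\<close> are \<open>Ld\<close> followed by one or two
  derivatives: symbols of order at most 2 over one of order 2, hence bounded.\<close>

definition Ld1 :: "complex \<Rightarrow> l2 \<Rightarrow>\<^sub>L l2" where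
  "Ld1 v = fourier.multiplier (\<lambda>i. \<i> * of_real (Re (dual_enum i * cnj v)) / lsym i)"

definition Ld2 :: "complex \<Rightarrow> complex \<Rightarrow> l2 \<Rightarrow>\<^sub>L l2" where
  "Ld2 v' v = fourier.multiplier (\<lambda>i. \<i> * of_real (Re (dual_enum i * cnj v')) * (\<i> * of_real (Re (dual_enum i * cnj v))) / lsym i)"

lemma direction_bound: "v \<in> {1, \<i>} \<Longrightarrow> \<bar>Re (p * cnj v)\<bar> \<le> cmod p"
  using abs_Re_le_cmod[of "p * cnj v"] by (auto simp: norm_mult)

lemma
  assumes v: "v \<in> {1, \<i>}" "v' \<in> {1, \<i>}"
  shows coeff_Ld1: "cip (Ld1 v g) (fourier i) = \<i> * of_real (Re (dual_enum i * cnj v)) / lsym i * cip g (fourier i)"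
    and coeff_Ld2: "cip (Ld2 v' v g) (fourier i) =
      \<i> * of_real (Re (dual_enum i * cnj v')) * (\<i> * of_real (Re (dual_enum i * cnj v))) / lsym i * cip g (fourier i)"
    and norm_Ld1: "norm (Ld1 v) \<le> 1" and norm_Ld2: "norm (Ld2 v' v) \<le> 1"
proof -
  have b1: "cmod (\<i> * of_real (Re (dual_enum i * cnj v)) / lsym i) \<le> 1" for i
  proof -
    have "\<bar>Re (dual_enum i * cnj v)\<bar> \<le> cmod (lsym i)"
      using direction_bound[OF v(1), of "dual_enum i"] lsym_bounds(2)[of i] by linarith
    then show ?thesis by (simp only: norm_divide norm_mult norm_of_real norm_ii mult_1) (simp add: lsym_nonzero)
  qed
  have b2: "cmod (\<i> * of_real (Re (dual_enum i * cnj v')) * (\<i> * of_real (Re (dual_enum i * cnj v))) / lsym i) \<le> 1" for i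
  proof -
    have "\<bar>Re (dual_enum i * cnj v')\<bar> * \<bar>Re (dual_enum i * cnj v)\<bar> \<le> cmod (dual_enum i) * cmod (dual_enum i)"
      by (intro mult_mono direction_bound v) auto
    also have "\<dots> \<le> cmod (lsym i)" using lsym_bounds(3)[of i] by (simp only: power2_eq_square)
    finally show ?thesis by (simp only: norm_divide norm_mult norm_of_real norm_ii mult_1) (simp add: lsym_nonzero)
  qed
  show "cip (Ld1 v g) (fourier i) = \<i> * of_real (Re (dual_enum i * cnj v)) / lsym i * cip g (fourier i)"
    unfolding Ld1_def by (rule fourier.coeff_multiplier[OF b1])
  show "cip (Ld2 v' v g) (fourier i) =
      \<i> * of_real (Re (dual_enum i * cnj v')) * (\<i> * of_real (Re (dual_enum i * cnj v))) / lsym i * cip g (fourier i)"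
    unfolding Ld2_def by (rule fourier.coeff_multiplier[OF b2])
  show "norm (Ld1 v) \<le> 1" unfolding Ld1_def by (rule fourier.norm_multiplier[OF b1])
  show "norm (Ld2 v' v) \<le> 1" unfolding Ld2_def by (rule fourier.norm_multiplier[OF b2])
qed

lemma weak_deriv_Ld:
  assumes "v \<in> {1, \<i>}" "v' \<in> {1, \<i>}"
  shows "weak_deriv v (Ld g) (Ld1 v g)" "weak_deriv v' (Ld1 v g) (Ld2 v' v g)"
  by (rule weak_derivI[OF assms(1)], simp only: coeff_Ld1[OF assms] coeff_Ld, simp)
    (rule weak_derivI[OF assms(2)], simp only: coeff_Ld1[OF assms] coeff_Ld2[OF assms], simp)

lemma Ld_sobolev: "Ld g \<in> sobolev 2"
proof -
  have "Ld1 v g \<in> sobolev (Suc 0)" if "v \<in> {1, \<i>}" for v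
    using weak_deriv_Ld(2)[OF that] by auto
  then have "Ld g \<in> sobolev (Suc (Suc 0))"
    unfolding sobolev.simps(2)[of "Suc 0"] using weak_deriv_Ld(1) by blast
  then show ?thesis by (simp only: numeral_2_eq_2)
qed

definition LI :: "l2 \<Rightarrow>\<^sub>L h2" where
  "LI = Blinfun (\<lambda>g. Abs_h2 (Ld g))"

lemma Rep_LI: "Rep_h2 (LI g) = Ld g"
proof -
  define L where "L = (\<lambda>g. Abs_h2 (Ld g))"
  have L: "Rep_h2 (L g) = Ld g" for g unfolding L_def by (rule Abs_h2_inverse[OF Ld_sobolev])
  \<comment> \<open>The squared H^2 norm has seven terms: the function, two first and four second
    derivatives. Each is at most the squared norm of \<open>g\<close>, whence the constant
    \<open>sqrt 7\<close>.\<close>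
  have "bounded_linear L"
  proof (rule bounded_linear_intro[where K = "sqrt 7"])
    show "L (x + y) = L x + L y" for x y
      by (simp add: Rep_h2_inject[symmetric] L plus_h2.rep_eq blinfun.add_right)
    show "L (r *\<^sub>R x) = r *\<^sub>R L x" for r x
      by (simp add: Rep_h2_inject[symmetric] L scaleR_h2.rep_eq blinfun.scaleR_right)
    show "norm (L g) \<le> norm g * sqrt 7" for g
    proof -
      have sq: "inner x x \<le> inner g g" if "norm x \<le> norm g" for x :: l2
        using power_mono[OF that, of 2] by (simp add: power2_norm_eq_inner)
      have le: "norm (B g) \<le> norm g" if "norm B \<le> 1" for B :: "l2 \<Rightarrow>\<^sub>L l2"
        using order_trans[OF norm_blinfun mult_right_mono[OF that norm_ge_zero]] by simp
      have w1: "wderiv v (Ld g) = Ld1 v g" if "v \<in> {1, \<i>}" for v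
        by (rule wderiv_eq[OF that weak_deriv_Ld(1)[OF that that]])
      have w2: "wderiv v' (Ld1 v g) = Ld2 v' v g" if "v \<in> {1, \<i>}" "v' \<in> {1, \<i>}" for v v'
        by (rule wderiv_eq[OF that(2) weak_deriv_Ld(2)[OF that]])
      have "norm Ld \<le> 1" unfolding Ld_def by (rule fourier.norm_multiplier[OF Ld_bound])
      note n0 = sq[OF le[OF this]]
      have n1: "inner (Ld1 v g) (Ld1 v g) \<le> inner g g" if "v \<in> {1, \<i>}" for v
        by (rule sq[OF le[OF norm_Ld1[OF that that]]])
      have n2: "inner (Ld2 v' v g) (Ld2 v' v g) \<le> inner g g" if "v \<in> {1, \<i>}" "v' \<in> {1, \<i>}" for v v'
        by (rule sq[OF le[OF norm_Ld2[OF that]]])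
      have "inner (L g) (L g) \<le> 7 * inner g g"
        unfolding inner_h2.rep_eq sum_directions L w1[OF directions(1)] w1[OF directions(2)]
          w2[OF directions(1) directions(1)] w2[OF directions(1) directions(2)]
          w2[OF directions(2) directions(1)] w2[OF directions(2) directions(2)]
        using n0 n1[OF directions(1)] n1[OF directions(2)] n2[OF directions(1) directions(1)]
          n2[OF directions(1) directions(2)] n2[OF directions(2) directions(1)] n2[OF directions(2) directions(2)]
        by linarith
      then have "norm (L g) \<le> sqrt (7 * inner g g)" by (simp add: norm_eq_sqrt_inner)
      then show ?thesis by (simp add: real_sqrt_mult norm_eq_sqrt_inner mult.commute)
    qed
  qed
  then have "blinfun_apply LI = L" unfolding LI_def L_def by (rule bounded_linear_Blinfun_apply)
  then show ?thesis by (simp add: L)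
qed

lemma clin_LI: "clin LI"
  by (simp add: clin_def Rep_h2_inject[symmetric] Rep_LI scaleC_h2.rep_eq clinD[OF clin_Ld])

definition zero_index :: nat where
  "zero_index = (SOME i. dual_enum i = 0)"

lemma zero_index: "dual_enum i = 0 \<longleftrightarrow> i = zero_index"
proof -
  have "\<exists>i. dual_enum i = 0" using dual_enum_surj[OF Lambda_dual_zero] by metis
  then have "dual_enum zero_index = 0" unfolding zero_index_def by (rule someI_ex)
  then show ?thesis using dual_enum_inj by metis
qed

text \<open>The square of \<open>two_Dbar\<close> plus the projection to the constants, an
  isomorphism from H^2 to L^2. Writing the square as \<open>Q_map\<close> with zero potential and
  zero parameters provides boundedness.\<close>

definition LO :: "h2 \<Rightarrow>\<^sub>L l2" where
  "LO = Blinfun (\<lambda>u. Q_map (\<lambda>_. 0) 0 0 u + cip (Rep_h2 u) (fourier zero_index) *\<^sub>C fourier zero_index)"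

lemma coeff_LO: "cip (LO u) (fourier i) = lsym i * cip (Rep_h2 u) (fourier i)"
proof -
  have "bounded_linear (\<lambda>u. Q_map (\<lambda>_. 0) 0 0 u + cip (Rep_h2 u) (fourier zero_index) *\<^sub>C fourier zero_index)"
    by (intro bounded_linear_add bounded_linear_Q_map
        bounded_linear_compose[OF bounded_bilinear.bounded_linear_left[OF bounded_bilinear_scaleC]]
        bounded_linear_compose[OF bounded_linear_cip_left bounded_linear_h2(1)[of 1 1]])
      (auto simp: periodic_def smooth_const)
  then have "LO u = Q_map (\<lambda>_. 0) 0 0 u + cip (Rep_h2 u) (fourier zero_index) *\<^sub>C fourier zero_index"
    unfolding LO_def by (simp add: bounded_linear_Blinfun_apply)
  then show ?thesis
    by (simp add: cip_add_left cip_scaleC_left coeff_Q_map fourier.orth lsym_def zero_index)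
qed

lemma clin_LO: "clin LO"
  unfolding clin_def by (intro allI fourier.coeff_eqI)
    (simp add: coeff_LO cip_scaleC_left scaleC_h2.rep_eq)

lemma LO_LI: "LO (LI g) = g"
  by (rule fourier.coeff_eqI) (simp add: coeff_LO Rep_LI coeff_Ld lsym_nonzero)

lemma Ld_LO: "Ld (LO u) = Rep_h2 u"
  by (rule fourier.coeff_eqI) (simp add: coeff_LO coeff_Ld lsym_nonzero)

lemma LI_LO: "LI (LO u) = u"
  by (simp add: Rep_h2_inject[symmetric] Rep_LI Ld_LO)

subsection \<open>Reduction to a quadratic family\<close>

text \<open>All but finitely many dual lattice points are large, so a symbol of size C / |p| is
  eventually small along the enumeration.\<close>

lemma dual_symbol_tail:
  assumes bd: "\<And>i. cmod (\<sigma> i) \<le> K" and dec: "\<And>i. dual_enum i \<noteq> 0 \<Longrightarrow> cmod (\<sigma> i) \<le> C / cmod (dual_enum i)"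
  shows "(\<lambda>n. norm (fourier.multiplier \<sigma> o\<^sub>L (id_blinfun - fourier.proj n))) \<longlonglongrightarrow> 0"
proof (rule LIMSEQ_I)
  fix \<epsilon> :: real assume e: "\<epsilon> > 0"
  \<comment> \<open>Beyond modulus \<open>D\<close> the bound C / |p| is at most \<epsilon> / 2; the
    maximum with 1 excludes p = 0.\<close>
  define D where "D = max 1 (2 * \<bar>C\<bar> / \<epsilon>)"
  have D: "1 \<le> D" "2 * \<bar>C\<bar> / \<epsilon> \<le> D" by (auto simp: D_def)
  have "finite (dual_enum -` {p \<in> Lambda_dual. cmod p \<le> D})"
    by (intro finite_vimageI finite_Lambda_dual_bounded) (simp add: inj_on_def dual_enum_inj)
  then obtain N where N: "dual_enum -` {p \<in> Lambda_dual. cmod p \<le> D} \<subseteq> {..<N}"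
    using finite_nat_iff_bounded by blast
  have small: "cmod (\<sigma> i) \<le> \<epsilon> / 2" if "i \<ge> N" for i
  proof -
    have big: "D < cmod (dual_enum i)" using N that dual_enum_in[of i] by force
    then have nz: "dual_enum i \<noteq> 0" using D(1) by auto
    have "cmod (\<sigma> i) \<le> \<bar>C\<bar> / cmod (dual_enum i)"
      using order_trans[OF dec[OF nz] divide_right_mono[OF abs_ge_self]] by simp
    also have "\<dots> \<le> \<epsilon> / 2"
    proof -
      have "2 * \<bar>C\<bar> \<le> \<epsilon> * D" using D(2) e by (simp add: field_simps)
      also have "\<dots> \<le> \<epsilon> * cmod (dual_enum i)" using big e by (intro mult_left_mono) auto
      finally show ?thesis using nz by (simp add: field_simps)
    qed
    finally show ?thesis .
  qed
  have "norm (fourier.multiplier \<sigma> o\<^sub>L (id_blinfun - fourier.proj n)) < \<epsilon>" if "n \<ge> N" for n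
  proof -
    have "norm (fourier.multiplier \<sigma> o\<^sub>L (id_blinfun - fourier.proj n)) \<le> \<epsilon> / 2"
      by (rule fourier.norm_multiplier_tail[OF bd]) (use small that e in auto)
    then show ?thesis using e by linarith
  qed
  then show "\<exists>N. \<forall>n\<ge>N. norm (norm (fourier.multiplier \<sigma> o\<^sub>L (id_blinfun - fourier.proj n)) - 0) < \<epsilon>"
    by auto
qed

text \<open>\<open>sym0\<close>, \<open>sym1\<close> and 1 / \<open>lsym\<close> are the
  coefficients of 1, k and k^2 in (p + k)^2 / lsym - 1. At p = 0, where \<open>lsym\<close> is 1,
  this expression is k^2 - 1, whence the value -1.\<close>

definition sym0 :: "nat \<Rightarrow> complex" where "sym0 i = (if dual_enum i = 0 then - 1 else 0)"
definition sym1 :: "nat \<Rightarrow> complex" where "sym1 i = (if dual_enum i = 0 then 0 else 2 / dual_enum i)"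

lemma sym_bounds:
  "cmod (sym0 i) \<le> 1" "cmod (sym1 i) \<le> 2"
  "dual_enum i \<noteq> 0 \<Longrightarrow> cmod (sym0 i) \<le> 0 / cmod (dual_enum i)"
  "dual_enum i \<noteq> 0 \<Longrightarrow> cmod (sym1 i) \<le> 2 / cmod (dual_enum i)"
  "dual_enum i \<noteq> 0 \<Longrightarrow> cmod (1 / lsym i) \<le> 1 / cmod (dual_enum i)"
proof -
  have "1 \<le> cmod (dual_enum i)" if "dual_enum i \<noteq> 0" using Lambda_dual_norm[OF dual_enum_in that] .
  then show "cmod (sym1 i) \<le> 2" by (auto simp: sym1_def norm_divide divide_le_eq)
  show "dual_enum i \<noteq> 0 \<Longrightarrow> cmod (1 / lsym i) \<le> 1 / cmod (dual_enum i)"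
    using lsym_bounds(2)[of i] by (auto simp: norm_divide intro!: frac_le)
qed (auto simp: sym0_def sym1_def norm_divide)

section \<open>The operators of a periodic potential\<close>

locale potential =
  fixes V :: "complex \<Rightarrow> complex"
  assumes smooth_V: "smooth V" and periodic_V: "periodic V"
begin

definition MV :: "l2 \<Rightarrow>\<^sub>L l2" where
  "MV = Blinfun (l2_mult V)"

lemma MV_apply: "MV u = l2_mult V u"
  unfolding MV_def by (simp add: bounded_linear_Blinfun_apply bounded_linear_l2_mult[OF periodic_V smooth_V])

lemma clin_MV: "clin MV"
  unfolding clin_def MV_apply
proof (intro allI l2_eqI)
  fix c u
  show "AE z in cell_measure. rep_l2 (l2_mult V (c *\<^sub>C u)) z = rep_l2 (c *\<^sub>C l2_mult V u) z"
    using rep_l2_mult_AE[OF periodic_V smooth_V, of "c *\<^sub>C u"] rep_l2_mult_AE[OF periodic_V smooth_V, of u]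
      rep_scaleC_AE[of c u] rep_scaleC_AE[of c "l2_mult V u"]
    by eventually_elim simp
qed

text \<open>Multiplication by V is bounded and \<open>Ld\<close> has small tails, so their product
  has small tails too; the other coefficients are multipliers with decaying symbols.\<close>

sublocale quadratic_family fourier "fourier.multiplier sym0" "fourier.multiplier sym1" Ld "MV o\<^sub>L Ld"
proof
  show "clin (fourier.multiplier sym0)" "clin (fourier.multiplier sym1)" "clin Ld" "clin (MV o\<^sub>L Ld)"
    by (rule fourier.clin_multiplier[OF sym_bounds(1)], rule fourier.clin_multiplier[OF sym_bounds(2)],
        intro clin_Ld, intro clin_Ld clin_compose clin_MV)
  show "(\<lambda>n. norm (fourier.multiplier sym0 o\<^sub>L (id_blinfun - fourier.proj n))) \<longlonglongrightarrow> 0"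
    "(\<lambda>n. norm (fourier.multiplier sym1 o\<^sub>L (id_blinfun - fourier.proj n))) \<longlonglongrightarrow> 0"
    by (rule dual_symbol_tail, rule sym_bounds, erule sym_bounds)+
  show *: "(\<lambda>n. norm (Ld o\<^sub>L (id_blinfun - fourier.proj n))) \<longlonglongrightarrow> 0"
    unfolding Ld_def by (rule dual_symbol_tail[OF Ld_bound sym_bounds(5)])
  have lim: "(\<lambda>n. norm MV * norm (Ld o\<^sub>L (id_blinfun - fourier.proj n))) \<longlonglongrightarrow> 0"
    using tendsto_mult[OF tendsto_const *, of "norm MV"] by simp
  show "(\<lambda>n. norm (MV o\<^sub>L Ld o\<^sub>L (id_blinfun - fourier.proj n))) \<longlonglongrightarrow> 0"
    by (rule Lim_null_comparison[OF always_eventually lim])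
      (simp add: blinfun_compose_assoc norm_blinfun_compose)
qed

lemma coeff_T:
  "cip (T \<alpha> k g) (fourier i) = (dual_enum i + k)\<^sup>2 / lsym i * cip g (fourier i) - \<alpha>\<^sup>2 * cip (MV (Ld g)) (fourier i)"
proof -
  have "cip (T \<alpha> k g) (fourier i) = (1 + sym0 i + k * sym1 i + k\<^sup>2 / lsym i) * cip g (fourier i)
      - \<alpha>\<^sup>2 * cip (MV (Ld g)) (fourier i)"
    by (simp add: T_def blinfun.bilinear_simps scaleC_blinfun.rep_eq cip_add_left cip_diff_left cip_scaleC_left
        fourier.coeff_multiplier[OF sym_bounds(1)] fourier.coeff_multiplier[OF sym_bounds(2)] coeff_Ld
        distrib_right)
  also have "1 + sym0 i + k * sym1 i + k\<^sup>2 / lsym i = (dual_enum i + k)\<^sup>2 / lsym i"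
    by (simp add: sym0_def sym1_def lsym_def field_simps power2_eq_square)
  finally show ?thesis .
qed

lemma Q_op_eq: "Q_op V \<alpha> k = T \<alpha> k o\<^sub>L LO"
proof (rule blinfun_eqI, rule fourier.coeff_eqI)
  fix u i
  show "cip (blinfun_apply (Q_op V \<alpha> k) u) (fourier i) = cip (blinfun_apply (T \<alpha> k o\<^sub>L LO) u) (fourier i)"
    by (simp add: Q_op_apply[OF periodic_V smooth_V] coeff_Q_map coeff_T coeff_LO Ld_LO MV_apply lsym_nonzero)
qed

lemma op_ker_Q: "op_ker (Q_op V \<alpha> k) \<noteq> {0} \<longleftrightarrow> (\<exists>x. x \<noteq> 0 \<and> T \<alpha> k x = 0)"
proof
  assume "op_ker (Q_op V \<alpha> k) \<noteq> {0}"
  moreover have "0 \<in> op_ker (Q_op V \<alpha> k)" by (simp add: op_ker_def)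
  ultimately obtain u where u: "u \<in> op_ker (Q_op V \<alpha> k)" "u \<noteq> 0" by blast
  then have "T \<alpha> k (LO u) = 0" by (simp add: op_ker_def Q_op_eq)
  moreover have "LO u \<noteq> 0" using u(2) LI_LO[of u] by auto
  ultimately show "\<exists>x. x \<noteq> 0 \<and> T \<alpha> k x = 0" by blast
next
  assume "\<exists>x. x \<noteq> 0 \<and> T \<alpha> k x = 0"
  then obtain x where x: "x \<noteq> 0" "T \<alpha> k x = 0" by blast
  then have "LI x \<in> op_ker (Q_op V \<alpha> k)" by (simp add: op_ker_def Q_op_eq LO_LI)
  moreover have "LI x \<noteq> 0" using x(1) LO_LI[of x] by auto
  ultimately show "op_ker (Q_op V \<alpha> k) \<noteq> {0}" by blast
qed

lemma Q_op_deriv: "complex_deriv (Q_op V \<alpha>) k = T' k o\<^sub>L LO"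
proof (rule complex_deriv_eq)
  have "has_cderiv (\<lambda>k. T \<alpha> k o\<^sub>L LO) ((T \<alpha> k o\<^sub>L 0) + (T' k o\<^sub>L LO)) k"
    by (rule has_cderiv_compose[OF T_deriv has_cderiv_const open_UNIV UNIV_I clin_T])
  moreover have "T \<alpha> k o\<^sub>L 0 = (0 :: h2 \<Rightarrow>\<^sub>L l2)" by (rule blinfun_eqI) simp
  ultimately show "has_cderiv (Q_op V \<alpha>) (T' k o\<^sub>L LO) k" by (simp add: Q_op_eq[abs_def])
qed

lemma
  assumes "B o\<^sub>L T \<alpha> k = id_blinfun" "T \<alpha> k o\<^sub>L B = id_blinfun"
  shows Q_op_invertible: "op_invertible (Q_op V \<alpha> k)"
    and Q_op_inverse: "op_inverse (Q_op V \<alpha> k) = LI o\<^sub>L B"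
proof -
  have BT: "B (T \<alpha> k x) = x" "T \<alpha> k (B x) = x" for x
    using assms by (metis blinfun_apply_blinfun_compose blinfun_apply_id_blinfun)+
  have "(LI o\<^sub>L B) o\<^sub>L Q_op V \<alpha> k = id_blinfun" "Q_op V \<alpha> k o\<^sub>L (LI o\<^sub>L B) = id_blinfun"
    by (rule blinfun_eqI, simp add: Q_op_eq BT LI_LO LO_LI)+
  then show "op_invertible (Q_op V \<alpha> k)" "op_inverse (Q_op V \<alpha> k) = LI o\<^sub>L B"
    using op_inverse_eq by (auto simp: op_invertible_def)
qed

end

section \<open>Symmetries of the kernel\<close>

context orthonormal_basis
begin

text \<open>Relabelled square sums are subsums of the original one, so Bessel's inequality bounds
  them. This realises the pull-back along a rotation on the level of coefficients.\<close>

lemma permutation_operator: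
  assumes \<pi>: "inj \<pi>"
  obtains U :: "'a \<Rightarrow>\<^sub>L 'a" where "\<And>x i. cip (U x) (e i) = cip x (e (\<pi> i))" "clin U"
proof -
  have part: "(\<Sum>i<n. (cmod (cip x (e (\<pi> i))))\<^sup>2) \<le> (norm x)\<^sup>2" for n x
  proof -
    obtain N where N: "\<pi> ` {..<n} \<subseteq> {..<N}"
      using finite_nat_iff_bounded[of "\<pi> ` {..<n}"] by auto
    have "(\<Sum>i<n. (cmod (cip x (e (\<pi> i))))\<^sup>2) = (\<Sum>j\<in>\<pi> ` {..<n}. (cmod (cip x (e j)))\<^sup>2)"
      using \<pi> by (subst sum.reindex) (auto intro: inj_on_subset)
    also have "\<dots> \<le> (\<Sum>j<N. (cmod (cip x (e j)))\<^sup>2)" by (rule sum_mono2) (use N in auto)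
    also have "\<dots> \<le> (norm x)\<^sup>2" by (rule bessel)
    finally show ?thesis .
  qed
  have summ: "summable (\<lambda>i. (cmod (cip x (e (\<pi> i))))\<^sup>2)" for x
  proof (rule bounded_imp_summable)
    show "(\<Sum>i\<le>n. (cmod (cip x (e (\<pi> i))))\<^sup>2) \<le> (norm x)\<^sup>2" for n
      using part[of x "Suc n"] by (simp only: lessThan_Suc_atMost)
  qed simp
  define u where "u = (\<lambda>x. \<Sum>i. cip x (e (\<pi> i)) *\<^sub>C e i)"
  have u: "cip (u x) (e i) = cip x (e (\<pi> i))" for x i
    unfolding u_def by (rule coeff_suminf[OF summ])
  have "bounded_linear u"
  proof (rule bounded_linear_intro[where K = 1])
    show "u (x + y) = u x + u y" for x y by (rule coeff_eqI) (simp add: u cip_add_left)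
    show "u (r *\<^sub>R x) = r *\<^sub>R u x" for r x by (rule coeff_eqI) (simp add: u scaleR_scaleC cip_scaleC_left)
    show "norm (u x) \<le> norm x * 1" for x
    proof -
      have "(norm (u x))\<^sup>2 \<le> (norm x)\<^sup>2"
        by (rule LIMSEQ_le_const2[OF parseval[of "u x", unfolded sums_def]]) (use part in \<open>auto simp: u\<close>)
      then show ?thesis using power2_le_imp_le by fastforce
    qed
  qed
  then have U: "blinfun_apply (Blinfun u) = u" by (rule bounded_linear_Blinfun_apply)
  show thesis
  proof (rule that[of "Blinfun u"])
    show "clin (Blinfun u)" unfolding clin_def U by (intro allI coeff_eqI) (simp add: u cip_scaleC_left)
  qed (simp add: U u)
qed

lemma eq_on_basis:
  assumes "clin A" "clin B" "\<And>j. blinfun_apply A (e j) = blinfun_apply B (e j)"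
  shows "blinfun_apply A x = blinfun_apply B x"
proof -
  have "(\<lambda>i. A (cip x (e i) *\<^sub>C e i)) sums A x" "(\<lambda>i. B (cip x (e i) *\<^sub>C e i)) sums B x"
    by (intro bounded_linear.sums[OF blinfun.bounded_linear_right] expansion)+
  then show ?thesis using assms by (simp add: clinD) (rule sums_unique2)
qed

end

lemma omega_cube: "omega * omega = - 1 - omega" "omega * omega * omega = 1" "cnj omega = omega * omega"
  "cmod omega = 1" "omega * cnj omega = 1"
  by (simp_all add: omega_eq complex_eq_iff cmod_def power2_eq_square)

lemma Lambda_dual_omega:
  assumes "p \<in> Lambda_dual"
  shows "omega * p \<in> Lambda_dual"
proof -
  obtain m n where p: "p = (4 * pi * \<i> / sqrt 3) * (omega * of_int m + of_int n)" using Lambda_dualE[OF assms] by metis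
  have "omega * (omega * of_int m + of_int n) = (omega * omega) * of_int m + omega * of_int n"
    by (simp add: algebra_simps)
  also have "\<dots> = omega * of_int (n - m) + of_int (- m)"
    unfolding omega_cube by (simp add: algebra_simps)
  finally have eq: "omega * (omega * of_int m + of_int n) = omega * of_int (n - m) + of_int (- m)" .
  have "omega * p = (4 * pi * \<i> / sqrt 3) * (omega * (omega * of_int m + of_int n))"
    unfolding p by (rule mult.left_commute)
  then show ?thesis by (simp only: eq Lambda_dualI)
qed

lemma Lambda_omega: "\<gamma> \<in> Lambda \<Longrightarrow> omega * \<gamma> \<in> Lambda"
proof -
  assume "\<gamma> \<in> Lambda"
  then obtain m n where g: "\<gamma> = omega * of_int m + of_int n" by (auto simp: Lambda_def)
  have "omega * \<gamma> = (omega * omega) * of_int m + omega * of_int n"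
    by (simp add: g algebra_simps)
  also have "\<dots> = omega * of_int (n - m) + of_int (- m)"
    unfolding omega_cube by (simp add: algebra_simps)
  finally show ?thesis unfolding Lambda_def by blast
qed

lemma wave_omega: "wave (omega * p) (omega * z) = wave p z"
proof -
  have "omega * p * cnj (omega * z) = (omega * cnj omega) * (p * cnj z)"
    by (simp only: complex_cnj_mult mult_ac)
  then show ?thesis by (simp only: wave_def omega_cube(5) mult_1)
qed

lemma integrable_continuous_periodic:
  assumes "periodic F" "continuous_on UNIV (F :: complex \<Rightarrow> complex)"
  shows "integrable cell_measure F"
proof -
  obtain C where "\<And>z. cmod (F z) \<le> C" using periodic_continuous_bounded[OF assms] by blast
  moreover have "F \<in> borel_measurable cell_measure"
    by (intro measurable_cell borel_measurable_continuous_onI assms)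
  ultimately show ?thesis by (intro cell.integrable_const_bound[where B = C]) auto
qed

lemma trig_periodic_continuous: "trig \<tau> \<Longrightarrow> periodic \<tau> \<and> continuous_on UNIV \<tau>"
proof (induction rule: trig.induct)
  case (monomial p c)
  then show ?case using periodic_wave[of p] smooth_continuous[OF smooth_wave[of p], of UNIV]
    by (auto simp: periodic_def intro: continuous_intros)
qed (auto simp: periodic_def intro: continuous_intros)

lemma periodic_rotate: "periodic F \<Longrightarrow> periodic (\<lambda>z. F (omega * z))"
  by (auto simp: periodic_def distrib_left Lambda_omega)

lemma continuous_rotate: "continuous_on UNIV F \<Longrightarrow> continuous_on UNIV (\<lambda>z. F (omega * z))"
  by (rule continuous_on_compose2[of UNIV F]) (auto intro!: continuous_intros)

text \<open>Both sides are integrated exactly for trigonometric polynomials, which are uniformly dense.\<close>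

lemma integral_rotate:
  assumes F: "periodic F" "continuous_on UNIV (F :: complex \<Rightarrow> complex)"
  shows "(LINT z|cell_measure. F (omega * z)) = (LINT z|cell_measure. F z)"
proof -
  have trig: "(LINT z|cell_measure. \<tau> (omega * z)) = (LINT z|cell_measure. \<tau> z)" if "trig \<tau>" for \<tau>
    using that
  proof induction
    case (monomial p c)
    define q where "q = omega * omega * p"
    have q: "q \<in> Lambda_dual"
      unfolding q_def mult.assoc by (intro Lambda_dual_omega monomial)
    have "omega * q = (omega * omega * omega) * p" by (simp only: q_def mult.assoc)
    then have pq: "p = omega * q" by (simp only: omega_cube(2) mult_1)
    have "(\<lambda>z. c * wave p (omega * z)) = (\<lambda>z. c * wave q z)"
      unfolding pq wave_omega ..
    moreover have "p = 0 \<longleftrightarrow> q = 0" using pq omega_cube(4) by auto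
    ultimately show ?case
      by (simp only: integral_mult_right_zero integral_wave[OF monomial] integral_wave[OF q])
  next
    case (add f g)
    note fg = trig_periodic_continuous[OF add.hyps(1)] trig_periodic_continuous[OF add.hyps(2)]
    have i: "integrable cell_measure f" "integrable cell_measure g"
      "integrable cell_measure (\<lambda>z. f (omega * z))" "integrable cell_measure (\<lambda>z. g (omega * z))"
      using fg by (simp_all add: integrable_continuous_periodic periodic_rotate continuous_rotate)
    show ?case
      by (simp only: Bochner_Integration.integral_add[OF i(1,2)] Bochner_Integration.integral_add[OF i(3,4)] add.IH)
  qed
  define J where "J = measure cell_measure cell"
  have "cmod ((LINT z|cell_measure. F (omega * z)) - (LINT z|cell_measure. F z)) \<le> \<epsilon> * (2 * J)" if e: "\<epsilon> > 0" for \<epsilon>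
  proof -
    obtain \<tau> where \<tau>: "trig \<tau>" "\<And>z. cmod (F z - \<tau> z) \<le> \<epsilon>" using trig_dense[OF F e] by blast
    note pc = trig_periodic_continuous[OF \<tau>(1)]
    have i: "integrable cell_measure F" "integrable cell_measure \<tau>"
      "integrable cell_measure (\<lambda>z. F (omega * z))" "integrable cell_measure (\<lambda>z. \<tau> (omega * z))"
      using pc F by (simp_all add: integrable_continuous_periodic periodic_rotate continuous_rotate)
    have bd: "cmod (LINT z|cell_measure. f z) \<le> \<epsilon> * J" if "integrable cell_measure f" "\<And>z. cmod (f z) \<le> \<epsilon>" for f :: "complex \<Rightarrow> complex"
    proof -
      have "cmod (LINT z|cell_measure. f z) \<le> (LINT z|cell_measure. \<epsilon>)"
        by (rule Bochner_Integration.integral_norm_bound_integral) (use that in auto)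
      then show ?thesis by (simp add: J_def mult.commute)
    qed
    have "(LINT z|cell_measure. F (omega * z)) - (LINT z|cell_measure. F z) =
        (LINT z|cell_measure. F (omega * z) - \<tau> (omega * z)) - (LINT z|cell_measure. F z - \<tau> z)"
      by (simp only: Bochner_Integration.integral_diff[OF i(3,4)] Bochner_Integration.integral_diff[OF i(1,2)] trig[OF \<tau>(1)]) simp
    also have "cmod \<dots> \<le> \<epsilon> * J + \<epsilon> * J"
      by (rule order_trans[OF norm_triangle_ineq4 add_mono]) (intro bd Bochner_Integration.integrable_diff i \<tau>(2))+
    finally show ?thesis by (simp only: mult_2 distrib_left)
  qed
  moreover have "0 \<le> 2 * J" unfolding J_def using measure_nonneg[of cell_measure cell] by linarith
  ultimately have "cmod ((LINT z|cell_measure. F (omega * z)) - (LINT z|cell_measure. F z)) \<le> 0"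
    by (rule le_all_multiples_zero)
  then show ?thesis by simp
qed

lemma lsym_max: "cmod (lsym i) = (max 1 (cmod (dual_enum i)))\<^sup>2"
  using Lambda_dual_norm[OF dual_enum_in[of i]] by (auto simp: lsym_def norm_power max_def)

section \<open>Transport of kernels under translation and rotation\<close>

context potential
begin

text \<open>The symmetry \<open>U\<close> acts on functions in the domain of Q, while kernel vectors
  of \<open>T\<close> are their images under \<open>LO\<close>. A kernel vector is therefore moved
  by LO U LO^(-1), and \<open>\<mu>\<close> is the weight that this conjugation leaves behind. The
  factor \<open>c\<close> acquired by the potential has to match the one acquired by the
  symbol.\<close>

lemma kernel_transfer:
  assumes U: "\<And>x i. cip (blinfun_apply U x) (fourier i) = cip x (fourier (\<pi> i))"
    and surj: "surj \<pi>"
    and comm: "\<And>x. MV (blinfun_apply U x) = c *\<^sub>C blinfun_apply U (MV x)"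
    and ratio: "\<And>i. cmod (lsym i) \<le> K * cmod (lsym (\<pi> i))"
    and sym: "\<And>i. (dual_enum i + k')\<^sup>2 = c * (dual_enum (\<pi> i) + k)\<^sup>2"
    and x: "x \<noteq> 0" "T \<alpha> k x = 0"
  shows "\<exists>y. y \<noteq> 0 \<and> T \<alpha> k' y = 0"
proof -
  define \<mu> where "\<mu> = (\<lambda>i. lsym i / lsym (\<pi> i))"
  have \<mu>: "cmod (\<mu> i) \<le> K" for i
    using ratio[of i] by (simp add: \<mu>_def norm_divide divide_le_eq lsym_nonzero)
  define y where "y = fourier.multiplier \<mu> (U x)"
  have y: "cip y (fourier i) = \<mu> i * cip x (fourier (\<pi> i))" for i
    unfolding y_def by (subst fourier.coeff_multiplier[OF \<mu>]) (simp add: U)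
  have Ly: "Ld y = U (Ld x)"
    by (rule fourier.coeff_eqI) (simp add: coeff_Ld y U \<mu>_def lsym_nonzero)
  have "cip (T \<alpha> k' y) (fourier i) = c * cip (T \<alpha> k x) (fourier (\<pi> i))" for i
  proof -
    have eq: "(dual_enum i + k')\<^sup>2 / lsym i * (\<mu> i * X) = c * ((dual_enum (\<pi> i) + k)\<^sup>2 / lsym (\<pi> i) * X)" for X
      unfolding sym \<mu>_def by (simp add: lsym_nonzero)
    show ?thesis
      by (simp only: coeff_T Ly comm cip_scaleC_left U y eq right_diff_distrib) (simp only: mult.left_commute)
  qed
  then have "T \<alpha> k' y = 0" using x(2) by (intro fourier.coeff_eqI) simp
  moreover have "y \<noteq> 0"
  proof
    assume "y = 0"
    then have z: "cip x (fourier (\<pi> i)) = 0" for i using y[of i] by (simp add: \<mu>_def lsym_nonzero)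
    have "cip x (fourier j) = 0" for j
    proof -
      obtain i where "j = \<pi> i" using surj by blast
      then show ?thesis by (simp only: z)
    qed
    then have "x = 0" by (rule fourier_total)
    then show False using x(1) by contradiction
  qed
  ultimately show ?thesis by blast
qed

text \<open>Multiplication by a wave commutes with the potential and shifts all frequencies by
  \<open>q\<close>, which amounts to a shift of \<open>k\<close>.\<close>

lemma kernel_translate:
  assumes q: "q \<in> Lambda_dual" and x: "x \<noteq> 0" "T \<alpha> k x = 0"
  shows "\<exists>y. y \<noteq> 0 \<and> T \<alpha> (k - q) y = 0"
proof -
  have bl: "bounded_linear (l2_mult (wave q))" by (rule bounded_linear_l2_mult[OF periodic_wave[OF q] smooth_wave])
  define U where "U = Blinfun (l2_mult (wave q))"
  have U: "blinfun_apply U = l2_mult (wave q)" unfolding U_def by (rule bounded_linear_Blinfun_apply[OF bl])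
  define \<pi> where "\<pi> = (\<lambda>i. SOME j. dual_enum j = dual_enum i - q)"
  have ex: "\<exists>j. dual_enum j = dual_enum i - q" for i
    using dual_enum_surj[OF Lambda_dual_add[OF dual_enum_in[of i] Lambda_dual_minus[OF q]]] by (metis diff_conv_add_uminus)
  have \<pi>: "dual_enum (\<pi> i) = dual_enum i - q" for i unfolding \<pi>_def by (rule someI_ex[OF ex])
  show ?thesis
  proof (rule kernel_transfer[OF _ _ _ _ _ x, where U = U and \<pi> = \<pi> and c = 1 and K = "(1 + cmod q)\<^sup>2"])
    show "cip (U u) (fourier i) = cip u (fourier (\<pi> i))" for u i
    proof -
      have "cip (U u) (fourier i) = of_real fourier_const * (LINT z|cell_measure. wave q z * rep_l2 u z * wave (- dual_enum i) z)"
        unfolding U l2_mult_def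
        by (rule cip_fourier_fun[OF l2_fun_mult_smooth[OF l2_fun_rep periodic_wave[OF q] smooth_wave]])
      also have "(\<lambda>z. wave q z * rep_l2 u z * wave (- dual_enum i) z) = (\<lambda>z. rep_l2 u z * wave (- dual_enum (\<pi> i)) z)"
        using wave_add[of q "- dual_enum i"] by (simp add: \<pi> fun_eq_iff mult_ac)
      finally show ?thesis by (simp only: cip_fourier)
    qed
    show "surj \<pi>"
      unfolding surj_def
    proof
      fix j
      obtain i where "dual_enum j + q = dual_enum i" using dual_enum_surj[OF Lambda_dual_add[OF dual_enum_in[of j] q]] by blast
      then have "dual_enum j = dual_enum (\<pi> i)" by (simp add: \<pi> algebra_simps)
      then show "\<exists>i. j = \<pi> i" using dual_enum_inj by blast
    qed
    show "MV (U u) = 1 *\<^sub>C U (MV u)" for u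
      unfolding U MV_apply scaleC_one
    proof (rule l2_eqI)
      note m = rep_l2_mult_AE[OF periodic_V smooth_V] rep_l2_mult_AE[OF periodic_wave[OF q] smooth_wave]
      show "AE z in cell_measure. rep_l2 (l2_mult V (l2_mult (wave q) u)) z = rep_l2 (l2_mult (wave q) (l2_mult V u)) z"
        using m(1)[of "l2_mult (wave q) u"] m(2)[of u] m(2)[of "l2_mult V u"] m(1)[of u]
        by eventually_elim simp
    qed
    \<comment> \<open>From max(1, |p + q|) \<le> (1 + |q|) max(1, |p|), squared.\<close>
    show "cmod (lsym i) \<le> (1 + cmod q)\<^sup>2 * cmod (lsym (\<pi> i))" for i
    proof -
      define a where "a = cmod (dual_enum (\<pi> i))"
      have "cmod (dual_enum i) \<le> a + cmod q"
        using norm_triangle_ineq[of "dual_enum (\<pi> i)" q] by (simp add: a_def \<pi>)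
      moreover have "a + cmod q \<le> (1 + cmod q) * max 1 a" "1 \<le> (1 + cmod q) * max 1 a"
        using mult_mono[of 1 "1 + cmod q" 1 "max 1 a"] mult_left_mono[of 1 "max 1 a" "cmod q"]
        by (auto simp: distrib_right)
      ultimately have "max 1 (cmod (dual_enum i)) \<le> (1 + cmod q) * max 1 a" by simp
      then have "(max 1 (cmod (dual_enum i)))\<^sup>2 \<le> ((1 + cmod q) * max 1 a)\<^sup>2" by (rule power_mono) simp
      then show ?thesis by (simp only: lsym_max a_def power_mult_distrib)
    qed
    show "(dual_enum i + (k - q))\<^sup>2 = 1 * (dual_enum (\<pi> i) + k)\<^sup>2" for i
      by (simp add: \<pi> algebra_simps)
  qed
qed

text \<open>\<open>U\<close> is the pull-back along z \<mapsto> omega z, given on coefficients by p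
  \<mapsto> omega p. Moving the potential past \<open>U\<close> costs the factor omega, and the
  symbol pays the same: (p + cnj omega k)^2 = omega (omega p + k)^2, because omega^3 = 1.\<close>

lemma kernel_rotate:
  assumes Vrot: "\<And>z. V (omega * z) = cnj omega * V z" and x: "x \<noteq> 0" "T \<alpha> k x = 0"
  shows "\<exists>y. y \<noteq> 0 \<and> T \<alpha> (cnj omega * k) y = 0"
proof -
  define \<pi> where "\<pi> = (\<lambda>i. SOME j. dual_enum j = omega * dual_enum i)"
  have ex: "\<exists>j. dual_enum j = omega * dual_enum i" for i
    using dual_enum_surj[OF Lambda_dual_omega[OF dual_enum_in[of i]]] by metis
  have \<pi>: "dual_enum (\<pi> i) = omega * dual_enum i" for i unfolding \<pi>_def by (rule someI_ex[OF ex])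
  have om: "omega \<noteq> 0" using omega_cube(4) by auto
  have inj: "inj \<pi>"
  proof (rule injI)
    fix i j assume "\<pi> i = \<pi> j"
    then have "omega * dual_enum i = omega * dual_enum j" using \<pi> by metis
    then show "i = j" using om by (simp add: dual_enum_inj)
  qed
  have surj: "surj \<pi>"
    unfolding surj_def
  proof
    fix j
    obtain i where "omega * (omega * dual_enum j) = dual_enum i"
      using dual_enum_surj[OF Lambda_dual_omega[OF Lambda_dual_omega[OF dual_enum_in[of j]]]] by blast
    then have "dual_enum (\<pi> i) = (omega * omega * omega) * dual_enum j" by (simp add: \<pi> mult_ac)
    then have "dual_enum j = dual_enum (\<pi> i)" by (simp only: omega_cube(2) mult_1)
    then show "\<exists>i. j = \<pi> i" using dual_enum_inj by blast
  qed
  obtain U where U: "\<And>x i. cip (blinfun_apply U x) (fourier i) = cip x (fourier (\<pi> i))" "clin U"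
    using fourier.permutation_operator[OF inj] by blast
  have coV: "cip (MV (fourier j)) (fourier i) = of_real fourier_const * (of_real fourier_const *
      (LINT z|cell_measure. V z * wave (dual_enum j - dual_enum i) z))" for i j
  proof -
    have l2: "l2_fun (\<lambda>z. V z * (of_real fourier_const * wave (dual_enum j) z))"
      by (rule l2_fun_mult_smooth[OF l2_fun_fourier periodic_V smooth_V])
    have "MV (fourier j) = abs_l2 (\<lambda>z. V z * (of_real fourier_const * wave (dual_enum j) z))"
      unfolding MV_apply l2_mult_def
    proof (rule abs_l2_eqI[OF l2_fun_mult_smooth[OF l2_fun_rep periodic_V smooth_V] l2])
      show "AE z in cell_measure. V z * rep_l2 (fourier j) z = V z * (of_real fourier_const * wave (dual_enum j) z)"
        using rep_abs_l2_AE[OF l2_fun_fourier[of j]] by eventually_elim (simp add: fourier_def)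
    qed
    then have "cip (MV (fourier j)) (fourier i) = of_real fourier_const *
        (LINT z|cell_measure. V z * (of_real fourier_const * wave (dual_enum j) z) * wave (- dual_enum i) z)"
      by (simp only: cip_fourier_fun[OF l2])
    also have "(\<lambda>z. V z * (of_real fourier_const * wave (dual_enum j) z) * wave (- dual_enum i) z) =
        (\<lambda>z. of_real fourier_const * (V z * wave (dual_enum j - dual_enum i) z))"
      using wave_add[of "dual_enum j" "- dual_enum i"] by (simp add: fun_eq_iff mult_ac)
    finally show ?thesis by (simp only: integral_mult_right_zero)
  qed
  \<comment> \<open>The rotation law of V in terms of its Fourier integrals, by substituting omega z
    for z.\<close>
  have Vint: "(LINT z|cell_measure. V z * wave q z) = omega * (LINT z|cell_measure. V z * wave (omega * q) z)"
    if q: "q \<in> Lambda_dual" for q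
  proof -
    have "(LINT z|cell_measure. V z * wave (omega * q) z) = (LINT z|cell_measure. V (omega * z) * wave (omega * q) (omega * z))"
    proof (rule integral_rotate[symmetric])
      show "periodic (\<lambda>z. V z * wave (omega * q) z)"
        using periodic_V periodic_wave[OF Lambda_dual_omega[OF q]] by (simp add: periodic_def)
      show "continuous_on UNIV (\<lambda>z. V z * wave (omega * q) z)"
        by (intro continuous_on_mult smooth_continuous smooth_V smooth_wave)
    qed
    also have "\<dots> = (LINT z|cell_measure. cnj omega * (V z * wave q z))"
      by (simp only: Vrot wave_omega mult.assoc)
    also have "\<dots> = cnj omega * (LINT z|cell_measure. V z * wave q z)" by (rule integral_mult_right_zero)
    finally show ?thesis using omega_cube(2,3) by (simp add: mult.assoc[symmetric])
  qed
  have comm: "MV (U u) = omega *\<^sub>C U (MV u)" for u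
  proof -
    \<comment> \<open>Both sides are bounded and complex linear, so the commutation rule need only
      be checked on matrix entries.\<close>
    have cl: "clin (MV o\<^sub>L U)" "clin (omega *\<^sub>C (U o\<^sub>L MV))" by (intro clin_compose clin_scaleC clin_MV U)+
    have "(MV o\<^sub>L U) (fourier j) = (omega *\<^sub>C (U o\<^sub>L MV)) (fourier j)" for j
    proof -
      obtain j' where j: "j = \<pi> j'" using surj by blast
      have Uj: "U (fourier j) = fourier j'"
        by (rule fourier.coeff_eqI) (auto simp: U j fourier.orth inj_eq[OF inj])
      show ?thesis
      proof (rule fourier.coeff_eqI)
        fix i
        have q: "dual_enum j' - dual_enum i \<in> Lambda_dual"
          using Lambda_dual_add[OF dual_enum_in[of j'] Lambda_dual_minus[OF dual_enum_in[of i]]] by simp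
        have eq: "dual_enum (\<pi> j') - dual_enum (\<pi> i) = omega * (dual_enum j' - dual_enum i)"
          by (simp only: \<pi> right_diff_distrib)
        have "cip ((MV o\<^sub>L U) (fourier j)) (fourier i) = cip (MV (fourier j')) (fourier i)"
          by (simp only: blinfun_apply_blinfun_compose Uj)
        also have "\<dots> = omega * cip (MV (fourier (\<pi> j'))) (fourier (\<pi> i))"
          by (simp only: coV eq Vint[OF q]) (simp only: mult_ac)
        also have "\<dots> = cip ((omega *\<^sub>C (U o\<^sub>L MV)) (fourier j)) (fourier i)"
          by (simp add: scaleC_blinfun.rep_eq cip_scaleC_left U j)
        finally show "cip ((MV o\<^sub>L U) (fourier j)) (fourier i) = cip ((omega *\<^sub>C (U o\<^sub>L MV)) (fourier j)) (fourier i)" .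
      qed
    qed
    from fourier.eq_on_basis[OF cl this, of u] show ?thesis by (simp add: scaleC_blinfun.rep_eq)
  qed
  show ?thesis
  proof (rule kernel_transfer[OF U(1) surj comm _ _ x, where K = 1])
    show "cmod (lsym i) \<le> 1 * cmod (lsym (\<pi> i))" for i
      by (simp add: lsym_max \<pi> norm_mult omega_cube)
    show "(dual_enum i + cnj omega * k)\<^sup>2 = omega * (dual_enum (\<pi> i) + k)\<^sup>2" for i
    proof -
      let ?p = "dual_enum i"
      have "(?p + omega * omega * k)\<^sup>2 = ?p\<^sup>2 + 2 * (omega * omega) * ?p * k + (omega * omega * omega) * (omega * k\<^sup>2)"
        by (simp add: power2_eq_square algebra_simps)
      moreover have "omega * (omega * ?p + k)\<^sup>2 = (omega * omega * omega) * ?p\<^sup>2 + 2 * (omega * omega) * ?p * k + omega * k\<^sup>2"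
        by (simp add: power2_eq_square algebra_simps)
      ultimately show ?thesis by (simp only: \<pi> omega_cube(2,3) mult_1)
    qed
  qed
qed

end

section \<open>Persistence of the double zero\<close>

definition zero_count :: "(complex \<Rightarrow> complex) \<Rightarrow> complex \<Rightarrow> real \<Rightarrow> int" where
  "zero_count h c r = (\<Sum>p\<in>{p \<in> ball c r. h p = 0}. zorder h p)"

lemma winding_circlepath_ball:
  assumes "0 < r" "p \<notin> sphere c r"
  shows "winding_number (circlepath c r) p = (if p \<in> ball c r then 1 else 0)"
proof (cases "p \<in> ball c r")
  case True
  then show ?thesis by (simp add: winding_number_circlepath dist_norm norm_minus_commute)
next
  case False
  then have "p \<notin> cball c r" using assms by auto
  have "winding_number (circlepath c r) p = 0"
    by (rule winding_number_zero_outside[of _ "cball c r"]) (use assms \<open>p \<notin> cball c r\<close> in auto)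
  then show ?thesis using False by simp
qed

text \<open>Zeros outside the circle have winding number 0, so the weighted sum of the general
  theorems reduces to a count inside the disc.\<close>

lemma zero_count_winding:
  assumes r: "0 < r" "r < r'" and nz: "\<And>z. z \<in> sphere c r \<Longrightarrow> h z \<noteq> 0"
    and fin: "finite {p \<in> ball c r'. h p = 0}"
  shows "(\<Sum>p\<in>{p \<in> ball c r'. h p = 0}. winding_number (circlepath c r) p * zorder h p) = of_int (zero_count h c r)"
proof -
  have w: "winding_number (circlepath c r) p = (if p \<in> ball c r then 1 else 0)" if "h p = 0" for p
    using winding_circlepath_ball[OF r(1), of p c] nz that by blast
  have "(\<Sum>p\<in>{p \<in> ball c r'. h p = 0}. winding_number (circlepath c r) p * zorder h p) =
      (\<Sum>p\<in>{p \<in> ball c r. h p = 0}. winding_number (circlepath c r) p * zorder h p)"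
    by (rule sum.mono_neutral_right[OF fin]) (use r w in auto)
  also have "\<dots> = (\<Sum>p\<in>{p \<in> ball c r. h p = 0}. of_int (zorder h p))"
    by (rule sum.cong) (auto simp: w)
  finally show ?thesis by (simp add: zero_count_def)
qed

lemma zero_count_rouche:
  assumes r: "0 < r" "r < r'" and hol: "g holomorphic_on ball c r'" "h holomorphic_on ball c r'"
    and fin: "finite {p \<in> ball c r'. g p = 0}" "finite {p \<in> ball c r'. h p = 0}"
    and less: "\<And>z. z \<in> sphere c r \<Longrightarrow> cmod (h z - g z) < cmod (g z)"
  shows "zero_count h c r = zero_count g c r"
proof -
  have im: "path_image (circlepath c r) = sphere c r" using r by simp
  have sub: "sphere c r \<subseteq> ball c r'" using r by auto
  have nzg: "g z \<noteq> 0" if "z \<in> sphere c r" for z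
  proof
    assume "g z = 0"
    then show False using less[OF that] by simp
  qed
  have nzh: "h z \<noteq> 0" if "z \<in> sphere c r" for z
  proof
    assume "h z = 0"
    then show False using less[OF that] by simp
  qed
  have eq: "(\<lambda>p. g p + (h p - g p)) = h" by simp
  have "(\<Sum>p\<in>{p \<in> ball c r'. g p + (h p - g p) = 0}. winding_number (circlepath c r) p * zorder (\<lambda>p. g p + (h p - g p)) p)
      = (\<Sum>p\<in>{p \<in> ball c r'. g p = 0}. winding_number (circlepath c r) p * zorder g p)"
  proof (rule Rouche_theorem)
    show "finite {p \<in> ball c r'. g p + (h p - g p) = 0}" using fin(2) by simp
    show "(\<lambda>p. h p - g p) holomorphic_on ball c r'" by (intro holomorphic_intros hol)
    show "\<forall>z\<in>path_image (circlepath c r). cmod (h z - g z) < cmod (g z)" unfolding im using less by blast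
    show "path_image (circlepath c r) \<subseteq> ball c r'" unfolding im by (rule sub)
    show "\<forall>z. z \<notin> ball c r' \<longrightarrow> winding_number (circlepath c r) z = 0"
      using winding_circlepath_ball[OF r(1)] r by auto
  qed (use hol fin in auto)
  then have "of_int (zero_count h c r) = (of_int (zero_count g c r) :: complex)"
    unfolding eq using zero_count_winding[OF r nzg fin(1)] zero_count_winding[OF r nzh fin(2)] by simp
  then show ?thesis by simp
qed

lemma zero_order_pos:
  assumes "h holomorphic_on S" "open S" "connected S" "z \<in> S" "\<exists>w\<in>S. h w \<noteq> 0" "h z = 0"
  shows "0 < zorder h z"
  using zorder_exist_zero[OF assms(1-5)] assms(6) by simp

lemma argument_principle_disc:
  assumes h: "h holomorphic_on ball 0 R" and disc: "cball c r \<subseteq> ball 0 R" "k \<in> ball c r"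
    and nz: "\<And>z. z \<in> cball c r - {k} \<Longrightarrow> h z \<noteq> 0"
  shows "contour_integral (circlepath c r) (\<lambda>z. deriv h z / h z) =
    2 * pi * \<i> * of_int (if h k = 0 then zorder h k else 0)"
proof -
  have r: "0 < r" using disc(2) by (metis ball_eq_empty empty_iff not_less)
  have im: "path_image (circlepath c r) = sphere c r" using r by simp
  define V where "V = (ball 0 R \<inter> h -` (- {0})) \<union> ball c r"
  have "open V"
    unfolding V_def using holomorphic_on_imp_continuous_on[OF h]
    by (intro open_Un continuous_open_preimage) auto
  moreover have "cball c r \<subseteq> V" using nz disc by (force simp: V_def)
  ultimately obtain r' where r': "r < r'" "ball c r' \<subseteq> V" using cball_subset_open r by blast
  have nz': "h z \<noteq> 0" if "z \<in> ball c r' - {k}" for z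
    using that r'(2) nz by (force simp: V_def)
  have "ball c r \<subseteq> ball 0 R" using disc(1) ball_subset_cball by blast
  then have "V \<subseteq> ball 0 R" unfolding V_def by blast
  then have sub: "ball c r' \<subseteq> ball 0 R" using r'(2) by (rule subset_trans[rotated])
  have sph: "sphere c r \<subseteq> cball c r - {k}" using disc(2) by auto
  define Z where "Z = {w \<in> ball c r'. h w = 0 \<or> w \<in> {}}"
  have kin: "k \<in> ball c r'" using disc(2) r' by auto
  have Z: "Z = (if h k = 0 then {k} else {})" using nz' kin by (auto simp: Z_def)
  have "contour_integral (circlepath c r) (\<lambda>x. deriv h x * 1 / h x) =
      2 * pi * \<i> * (\<Sum>p\<in>Z. winding_number (circlepath c r) p * 1 * zorder h p)"
    unfolding Z_def
  proof (rule argument_principle)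
    show "h holomorphic_on ball c r' - {}" using holomorphic_on_subset[OF h sub] by simp
    show "path_image (circlepath c r) \<subseteq> ball c r' - {w \<in> ball c r'. h w = 0 \<or> w \<in> {}}"
    proof -
      have "sphere c r \<subseteq> ball c r'" using r'(1) by auto
      moreover have "h z \<noteq> 0" if "z \<in> sphere c r" for z by (rule nz) (use sph that in blast)
      ultimately show ?thesis unfolding im by blast
    qed
    show "\<forall>z. z \<notin> ball c r' \<longrightarrow> winding_number (circlepath c r) z = 0"
      using winding_circlepath_ball[OF r] r' by auto
    show "finite {w \<in> ball c r'. h w = 0 \<or> w \<in> {}}" using Z unfolding Z_def by (simp split: if_splits)
  qed auto
  moreover have "winding_number (circlepath c r) k = 1"
    using winding_circlepath_ball[OF r, of k c] disc(2) by auto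
  ultimately show ?thesis by (simp add: Z)
qed

text \<open>A point of the cell has modulus at most 2, as |omega| = 1, and the dual lattice is the
  lattice turned by a right angle and scaled by 4 pi / sqrt 3.\<close>

lemma Lambda_dual_reduce:
  obtains q where "q \<in> Lambda_dual" "cmod (k + q) \<le> 8 * pi / sqrt 3"
proof -
  define a where "a = (4 * pi * \<i> / sqrt 3 :: complex)"
  have a: "a \<noteq> 0" "cmod a = 4 * pi / sqrt 3" by (simp_all add: a_def norm_mult norm_divide)
  obtain \<gamma> where g: "\<gamma> \<in> Lambda" "k / a + \<gamma> \<in> cell" using cell_reduce by blast
  obtain s t where st: "k / a + \<gamma> = omega * of_real s + of_real t" "s \<in> {0..<1}" "t \<in> {0..<1}"
    using g(2) by (auto simp: cell_def)
  have "cmod (k / a + \<gamma>) \<le> cmod (omega * of_real s) + cmod (of_real t)"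
    unfolding st(1) by (rule norm_triangle_ineq)
  also have "\<dots> \<le> 2" using st(2,3) by (simp add: norm_mult omega_cube)
  finally have le: "cmod (k / a + \<gamma>) \<le> 2" .
  have "k + a * \<gamma> = a * (k / a + \<gamma>)" using a(1) by (simp add: distrib_left)
  then have "cmod (k + a * \<gamma>) = (4 * pi / sqrt 3) * cmod (k / a + \<gamma>)" by (simp only: norm_mult a)
  also have "\<dots> \<le> (4 * pi / sqrt 3) * 2" by (intro mult_left_mono le) auto
  finally have "cmod (k + a * \<gamma>) \<le> 8 * pi / sqrt 3" by simp
  moreover have "a * \<gamma> \<in> Lambda_dual" using g(1) by (auto simp: Lambda_dual_def a_def)
  ultimately show thesis using that by blast
qed

lemma Lambda_dual_diff: "p \<in> Lambda_dual \<Longrightarrow> q \<in> Lambda_dual \<Longrightarrow> p - q \<in> Lambda_dual"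
  using Lambda_dual_add[OF _ Lambda_dual_minus] by (metis diff_conv_add_uminus)

lemma Lambda_dual_separated: "p \<in> Lambda_dual \<Longrightarrow> q \<in> Lambda_dual \<Longrightarrow> dist p q < 1 \<Longrightarrow> p = q"
  using Lambda_dual_norm[OF Lambda_dual_diff, of p q] by (auto simp: dist_norm)

section \<open>Zeros of a family with lattice symmetries\<close>

text \<open>\<open>f\<close> is the local determinant and \<open>Ker\<close> the existence of a
  kernel. The symmetries are stated for \<open>Ker\<close> because translations leave the ball on
  which \<open>f\<close> is controlled. The lower bound on \<open>R\<close> places a representative
  of every class modulo the dual lattice inside that ball; \<open>B\<close> is to be the ball
  without the exceptional parameters.\<close>

locale zero_family =
  fixes f :: "complex \<Rightarrow> complex \<Rightarrow> complex" and Ker :: "complex \<Rightarrow> complex \<Rightarrow> bool" and R :: real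
    and B :: "complex set"
  assumes cont: "continuous_on (ball 0 R \<times> ball 0 R) (\<lambda>x. f (fst x) (snd x))"
    and hol: "\<And>\<alpha>. \<alpha> \<in> ball 0 R \<Longrightarrow> f \<alpha> holomorphic_on ball 0 R"
    and zero: "\<And>\<alpha> k. \<alpha> \<in> ball 0 R \<Longrightarrow> k \<in> ball 0 R \<Longrightarrow> f \<alpha> k = 0 \<longleftrightarrow> Ker \<alpha> k"
    and translate: "\<And>\<alpha> k q. q \<in> Lambda_dual \<Longrightarrow> Ker \<alpha> k \<Longrightarrow> Ker \<alpha> (k - q)"
    and rotate: "\<And>\<alpha> k. Ker \<alpha> k \<Longrightarrow> Ker \<alpha> (cnj omega * k)"
    and B: "connected B" "B \<subseteq> ball 0 R" "0 \<in> B"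
    and nontrivial: "\<And>\<alpha>. \<alpha> \<in> B \<Longrightarrow> \<exists>k\<in>ball 0 R. f \<alpha> k \<noteq> 0"
    and R: "8 * pi / sqrt 3 < R"
begin

text \<open>Uniform continuity on a compact product, with the minimum of |f \<alpha>0| over
  \<open>K\<close> as tolerance: this is the hypothesis of Rouche's theorem for all nearby
  parameters at once.\<close>

lemma uniformly_close:
  assumes K: "compact K" "K \<subseteq> ball 0 R" and \<alpha>: "\<alpha>0 \<in> ball 0 R" and nz: "\<And>k. k \<in> K \<Longrightarrow> f \<alpha>0 k \<noteq> 0"
  obtains \<delta> where "\<delta> > 0" "\<And>\<alpha> k. \<alpha> \<in> ball 0 R \<Longrightarrow> dist \<alpha> \<alpha>0 < \<delta> \<Longrightarrow> k \<in> K \<Longrightarrow> cmod (f \<alpha> k - f \<alpha>0 k) < cmod (f \<alpha>0 k)"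
proof (cases "K = {}")
  case True
  then show thesis using that[of 1] by simp
next
  case False
  have cK: "continuous_on K (\<lambda>k. cmod (f \<alpha>0 k))"
    using holomorphic_on_imp_continuous_on[OF hol[OF \<alpha>]] K(2)
    by (intro continuous_on_norm) (rule continuous_on_subset)
  obtain k0 where k0: "k0 \<in> K" "\<And>k. k \<in> K \<Longrightarrow> cmod (f \<alpha>0 k0) \<le> cmod (f \<alpha>0 k)"
    using continuous_attains_inf[OF K(1) False cK] by blast
  define m where "m = cmod (f \<alpha>0 k0)"
  have m: "m > 0" "\<And>k. k \<in> K \<Longrightarrow> m \<le> cmod (f \<alpha>0 k)" using nz[OF k0(1)] k0 by (auto simp: m_def)
  obtain d where d: "d > 0" "cball \<alpha>0 d \<subseteq> ball 0 R" using open_contains_cball[of "ball 0 R"] open_ball \<alpha> by blast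
  have "compact (cball \<alpha>0 d \<times> K)" by (intro compact_Times K) simp
  moreover have "continuous_on (cball \<alpha>0 d \<times> K) (\<lambda>x. f (fst x) (snd x))"
    by (rule continuous_on_subset[OF cont]) (use d K in auto)
  ultimately have "uniformly_continuous_on (cball \<alpha>0 d \<times> K) (\<lambda>x. f (fst x) (snd x))"
    by (rule compact_uniformly_continuous[rotated])
  then obtain \<delta> where \<delta>: "\<delta> > 0" "\<And>x y. x \<in> cball \<alpha>0 d \<times> K \<Longrightarrow> y \<in> cball \<alpha>0 d \<times> K \<Longrightarrow> dist y x < \<delta> \<Longrightarrow>
      dist (f (fst y) (snd y)) (f (fst x) (snd x)) < m"
    unfolding uniformly_continuous_on_def using m(1) by metis
  show thesis
  proof (rule that[of "min \<delta> d"])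
    fix \<alpha> k assume *: "dist \<alpha> \<alpha>0 < min \<delta> d" "k \<in> K"
    have "dist (f (fst (\<alpha>, k)) (snd (\<alpha>, k))) (f (fst (\<alpha>0, k)) (snd (\<alpha>0, k))) < m"
      by (rule \<delta>(2)) (use * d(1) in \<open>auto simp: dist_commute dist_Pair_Pair\<close>)
    then show "cmod (f \<alpha> k - f \<alpha>0 k) < cmod (f \<alpha>0 k)" using m(2)[OF *(2)] by (simp add: dist_norm)
  qed (use \<delta> d in auto)
qed

lemma finite_zeros:
  assumes "\<alpha> \<in> B" "cball c r \<subseteq> ball 0 R"
  shows "finite {p \<in> ball c r. f \<alpha> p = 0}"
proof (cases "\<exists>z\<in>ball 0 R. f \<alpha> z = 0")
  case True
  have \<alpha>: "\<alpha> \<in> ball 0 R" using assms(1) B by auto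
  have "\<not> f \<alpha> constant_on ball 0 R"
    using nontrivial[OF assms(1)] True by (metis constant_on_def)
  then have "finite {z \<in> cball c r. f \<alpha> z = 0}"
    by (intro holomorphic_compact_finite_zeros[OF hol[OF \<alpha>]]) (use assms(2) in auto)
  then show ?thesis by (rule rev_finite_subset) auto
next
  case False
  then have "{p \<in> ball c r. f \<alpha> p = 0} = {}" using assms(2) by force
  then show ?thesis by (simp only: finite.emptyI)
qed

lemma zorder_pos:
  assumes "\<alpha> \<in> B" "z \<in> ball 0 R" "f \<alpha> z = 0"
  shows "0 < zorder (f \<alpha>) z"
  by (rule zero_order_pos[OF hol open_ball connected_ball assms(2) nontrivial[OF assms(1)] assms(3)])
    (use assms(1) B in auto)

text \<open>On a small circle around \<open>c\<close> enclosing no other zero, Rouche's theorem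
  freezes the number of zeros while the parameter moves slightly.\<close>

lemma local_count:
  assumes \<alpha>: "\<alpha>0 \<in> B" and c: "c \<in> ball 0 R" and e: "\<epsilon> > 0"
  obtains r \<delta> where "0 < r" "r < \<epsilon>" "cball c r \<subseteq> ball 0 R" "\<delta> > 0"
    "\<And>\<alpha>. \<alpha> \<in> B \<Longrightarrow> dist \<alpha> \<alpha>0 < \<delta> \<Longrightarrow> zero_count (f \<alpha>) c r = (if f \<alpha>0 c = 0 then zorder (f \<alpha>0) c else 0)"
proof -
  have \<alpha>R: "\<alpha>0 \<in> ball 0 R" using \<alpha> B by auto
  obtain w where w: "w \<in> ball 0 R" "f \<alpha>0 w \<noteq> 0" using nontrivial[OF \<alpha>] by blast
  have "\<forall>\<^sub>F k in at c. f \<alpha>0 k \<noteq> 0 \<and> k \<in> ball 0 R"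
    by (rule non_zero_neighbour_alt[OF hol[OF \<alpha>R] open_ball connected_ball c w])
  then obtain d1 where d1: "d1 > 0" "\<And>k. k \<noteq> c \<Longrightarrow> dist k c < d1 \<Longrightarrow> f \<alpha>0 k \<noteq> 0"
    unfolding eventually_at by blast
  obtain d2 where d2: "d2 > 0" "cball c d2 \<subseteq> ball 0 R" using open_contains_cball[of "ball 0 R"] open_ball c by blast
  define r where "r = min (\<epsilon> / 2) (min (d1 / 2) (d2 / 2))"
  have r: "0 < r" "r < \<epsilon>" "r < d1" "r < d2" using e d1(1) d2(1) by (auto simp: r_def)
  have sub: "cball c r \<subseteq> ball 0 R" using d2(2) r(4) by (meson less_imp_le order_trans subset_cball)
  have nz: "f \<alpha>0 k \<noteq> 0" if "k \<in> cball c r" "k \<noteq> c" for k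
    using d1(2)[OF that(2)] that(1) r(3) by (auto simp: dist_commute)
  have sph: "sphere c r \<subseteq> cball c r - {c}" using r(1) by auto
  obtain \<delta> where \<delta>: "\<delta> > 0" "\<And>\<alpha> k. \<alpha> \<in> ball 0 R \<Longrightarrow> dist \<alpha> \<alpha>0 < \<delta> \<Longrightarrow> k \<in> sphere c r \<Longrightarrow>
      cmod (f \<alpha> k - f \<alpha>0 k) < cmod (f \<alpha>0 k)"
  proof (rule uniformly_close[OF _ _ \<alpha>R])
    show "compact (sphere c r)" by simp
    show "sphere c r \<subseteq> ball 0 R" using sph sub by blast
    show "f \<alpha>0 k \<noteq> 0" if "k \<in> sphere c r" for k using nz sph that by blast
  qed blast
  have "zero_count (f \<alpha>0) c r = (if f \<alpha>0 c = 0 then zorder (f \<alpha>0) c else 0)"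
  proof -
    have "{p \<in> ball c r. f \<alpha>0 p = 0} = (if f \<alpha>0 c = 0 then {c} else {})"
    proof -
      have "p = c" if "p \<in> ball c r" "f \<alpha>0 p = 0" for p
        using nz[of p] that ball_subset_cball by blast
      moreover have "c \<in> ball c r" using r(1) by simp
      ultimately show ?thesis by auto
    qed
    then show ?thesis by (simp add: zero_count_def)
  qed
  moreover have "zero_count (f \<alpha>) c r = zero_count (f \<alpha>0) c r" if "\<alpha> \<in> B" "dist \<alpha> \<alpha>0 < \<delta>" for \<alpha>
  proof (rule zero_count_rouche[OF r(1,4)])
    have aR: "\<alpha> \<in> ball 0 R" using that B by auto
    have s: "ball c d2 \<subseteq> ball 0 R" using d2(2) ball_subset_cball by blast
    show "f \<alpha>0 holomorphic_on ball c d2" "f \<alpha> holomorphic_on ball c d2"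
      using holomorphic_on_subset[OF hol s] \<alpha>R aR by blast+
    show "finite {p \<in> ball c d2. f \<alpha>0 p = 0}" "finite {p \<in> ball c d2. f \<alpha> p = 0}"
      using finite_zeros[OF _ d2(2)] \<alpha> that by blast+
    show "cmod (f \<alpha> z - f \<alpha>0 z) < cmod (f \<alpha>0 z)" if "z \<in> sphere c r" for z
      by (rule \<delta>(2)[OF aR \<open>dist \<alpha> \<alpha>0 < \<delta>\<close> that])
  qed
  ultimately show thesis using that[OF r(1,2) sub \<delta>(1)] by simp
qed

text \<open>A zero near \<open>p\<close> other than \<open>p\<close> comes with its two rotations about \<open>p\<close>, which is too many.\<close>

lemma zeros_near_dual:
  assumes \<alpha>: "\<alpha> \<in> B" and p: "p \<in> Lambda_dual" and r: "cball p r \<subseteq> ball 0 R"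
    and count: "zero_count (f \<alpha>) p r = 2"
  shows "{z \<in> ball p r. f \<alpha> z = 0} = {p}" "zorder (f \<alpha>) p = 2"
proof -
  have \<alpha>R: "\<alpha> \<in> ball 0 R" using \<alpha> B by auto
  define Z where "Z = {z \<in> ball p r. f \<alpha> z = 0}"
  have Z: "finite Z" unfolding Z_def by (rule finite_zeros[OF \<alpha> r])
  have sub: "ball p r \<subseteq> ball 0 R" using r ball_subset_cball by blast
  have pos: "1 \<le> zorder (f \<alpha>) z" if "z \<in> Z" for z
    using zorder_pos[OF \<alpha>, of z] that sub by (auto simp: Z_def)
  have sum: "(\<Sum>z\<in>Z. zorder (f \<alpha>) z) = 2" using count by (simp add: zero_count_def Z_def)
  have "card Z \<le> 2"
  proof -
    have "int (card Z) = (\<Sum>z\<in>Z. 1)" by simp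
    also have "\<dots> \<le> (\<Sum>z\<in>Z. zorder (f \<alpha>) z)" by (intro sum_mono pos)
    finally show ?thesis using sum by simp
  qed
  have rot: "p + cnj omega * (z - p) \<in> Z" if "z \<in> Z" for z
  proof -
    have z: "z \<in> ball p r" "f \<alpha> z = 0" using that by (auto simp: Z_def)
    then have "Ker \<alpha> z" using zero[OF \<alpha>R, of z] sub by auto
    then have "Ker \<alpha> (cnj omega * (z - p) - (- p))" by (intro translate rotate p Lambda_dual_minus)
    then have K: "Ker \<alpha> (p + cnj omega * (z - p))" by (simp add: add.commute)
    have "p + cnj omega * (z - p) \<in> ball p r"
      using z(1) by (simp add: dist_norm norm_mult omega_cube(4) norm_minus_commute)
    then show ?thesis using K zero[OF \<alpha>R] sub by (auto simp: Z_def)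
  qed
  have only: "z = p" if z: "z \<in> Z" for z
  proof (rule ccontr)
    assume ne: "z \<noteq> p"
    define u where "u = z - p"
    define w where "w = cnj omega"
    have u: "u \<noteq> 0" using ne by (simp add: u_def)
    have w: "w \<noteq> 1" "w * w \<noteq> 1" "w * w \<noteq> w"
      by (simp_all add: w_def omega_eq complex_eq_iff)
    have in_Z: "p + u \<in> Z" "p + w * u \<in> Z" "p + w * (w * u) \<in> Z"
      using z rot[OF z] rot[OF rot[OF z]] by (simp_all add: u_def w_def)
    have "card {p + u, p + w * u, p + w * (w * u)} = 3"
    proof -
      have "u \<noteq> w * u" "u \<noteq> w * (w * u)" "w * u \<noteq> w * (w * u)"
        using u w by (simp_all add: mult.assoc[symmetric])
      then show ?thesis by simp
    qed
    moreover have "card {p + u, p + w * u, p + w * (w * u)} \<le> card Z"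
      by (rule card_mono[OF Z]) (use in_Z in blast)
    ultimately show False using \<open>card Z \<le> 2\<close> by simp
  qed
  have "Z \<noteq> {}" using sum by auto
  then show Zp: "{z \<in> ball p r. f \<alpha> z = 0} = {p}" using only unfolding Z_def by blast
  show "zorder (f \<alpha>) p = 2" using sum Zp by (simp add: Z_def)
qed

text \<open>The good parameters form a nonempty subset of the connected set \<open>B\<close> that is
  open and closed in it. Open: zeros stay near the dual lattice, translate to a neighbourhood of
  \<open>p\<close>, and the rotation argument puts them on \<open>p\<close>. Closed: a zero off the
  dual lattice would force zeros off it at nearby good parameters.\<close>

theorem double_zero_persists:
  assumes p: "p \<in> Lambda_dual" "cmod p < R"
    and zero0: "\<And>k. Ker 0 k \<longleftrightarrow> k \<in> Lambda_dual" and order0: "zorder (f 0) p = 2"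
    and \<alpha>: "\<alpha> \<in> B"
  shows "\<And>k. Ker \<alpha> k \<longleftrightarrow> k \<in> Lambda_dual" "zorder (f \<alpha>) p = 2"
proof -
  have pR: "p \<in> ball 0 R" using p by simp
  have one: "(1 :: real) > 0" by simp
  define A where "A = {\<alpha> \<in> B. (\<forall>k. Ker \<alpha> k \<longrightarrow> k \<in> Lambda_dual) \<and> Ker \<alpha> p \<and> zorder (f \<alpha>) p = 2}"
  have zB: "f \<alpha> k = 0 \<longleftrightarrow> Ker \<alpha> k" if "\<alpha> \<in> B" "k \<in> ball 0 R" for \<alpha> k
    using zero that B by blast
  have open_A: "\<exists>\<delta>>0. \<forall>\<alpha>\<in>B. dist \<alpha> \<alpha>0 < \<delta> \<longrightarrow> \<alpha> \<in> A" if "\<alpha>0 \<in> A" for \<alpha>0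
  proof -
    have \<alpha>0: "\<alpha>0 \<in> B" "\<And>k. Ker \<alpha>0 k \<Longrightarrow> k \<in> Lambda_dual" "Ker \<alpha>0 p" "zorder (f \<alpha>0) p = 2"
      using that by (auto simp: A_def)
    obtain r \<delta>1 where r: "0 < r" "r < 1" "cball p r \<subseteq> ball 0 R" "\<delta>1 > 0"
      "\<And>\<alpha>. \<alpha> \<in> B \<Longrightarrow> dist \<alpha> \<alpha>0 < \<delta>1 \<Longrightarrow> zero_count (f \<alpha>) p r = (if f \<alpha>0 p = 0 then zorder (f \<alpha>0) p else 0)"
      using local_count[OF \<alpha>0(1) pR, of 1] one by blast
    \<comment> \<open>A compact set without zeros at \<open>\<alpha>0\<close>, hence without zeros
      at nearby parameters. The rest of the closed disc, which meets every class modulo the dual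
      lattice, lies within \<open>r\<close> of a dual lattice point.\<close>
    define K where "K = cball 0 (8 * pi / sqrt 3) - (\<Union>q\<in>Lambda_dual. ball q r)"
    have K: "compact K" unfolding K_def by (intro compact_diff open_UN) auto
    have KR: "K \<subseteq> ball 0 R" unfolding K_def using R by auto
    have nzK: "f \<alpha>0 k \<noteq> 0" if "k \<in> K" for k
    proof
      assume "f \<alpha>0 k = 0"
      then have "k \<in> Lambda_dual" using zB[OF \<alpha>0(1)] KR that \<alpha>0(2) by blast
      then show False using that r(1) by (auto simp: K_def)
    qed
    obtain \<delta>2 where \<delta>2: "\<delta>2 > 0" "\<And>\<alpha> k. \<alpha> \<in> ball 0 R \<Longrightarrow> dist \<alpha> \<alpha>0 < \<delta>2 \<Longrightarrow> k \<in> K \<Longrightarrow>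
        cmod (f \<alpha> k - f \<alpha>0 k) < cmod (f \<alpha>0 k)"
      using uniformly_close[OF K KR _ nzK] \<alpha>0(1) B by blast
    have "\<alpha> \<in> A" if \<alpha>: "\<alpha> \<in> B" "dist \<alpha> \<alpha>0 < min \<delta>1 \<delta>2" for \<alpha>
    proof -
      have "zero_count (f \<alpha>) p r = 2" using r(5)[OF \<alpha>(1)] \<alpha>(2) \<alpha>0(3,4) zB[OF \<alpha>0(1) pR] by simp
      note Z = zeros_near_dual[OF \<alpha>(1) p(1) r(3) this]
      have sub: "ball p r \<subseteq> ball 0 R" using r(3) ball_subset_cball by blast
      have "k \<in> Lambda_dual" if k: "Ker \<alpha> k" for k
      proof -
        obtain q where q: "q \<in> Lambda_dual" "cmod (k + q) \<le> 8 * pi / sqrt 3" by (rule Lambda_dual_reduce)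
        have Kq: "Ker \<alpha> (k + q)" using translate[OF Lambda_dual_minus[OF q(1)] k] by simp
        have "k + q \<notin> K"
        proof
          assume kK: "k + q \<in> K"
          then have "f \<alpha> (k + q) = 0" using zB[OF \<alpha>(1)] KR Kq by blast
          moreover have "cmod (f \<alpha> (k + q) - f \<alpha>0 (k + q)) < cmod (f \<alpha>0 (k + q))"
            by (rule \<delta>2(2)[OF _ _ kK]) (use \<alpha> B in auto)
          ultimately show False by simp
        qed
        then obtain q' where q': "q' \<in> Lambda_dual" "k + q \<in> ball q' r" using q(2) by (auto simp: K_def)
        \<comment> \<open>The zero is moved from the neighbourhood of q' to that of
          \<open>p\<close>, where \<open>p\<close> is known to be the only zero.\<close>
        have "Ker \<alpha> (k + q - (q' - p))" by (intro translate Kq Lambda_dual_diff q' p)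
        then have "Ker \<alpha> (p + (k + q - q'))" by (simp add: algebra_simps)
        moreover have "p + (k + q - q') \<in> ball p r"
        proof -
          have "p - (p + (k + q - q')) = q' - (k + q)" by simp
          then show ?thesis using q'(2) by (simp only: mem_ball dist_norm)
        qed
        ultimately have "p + (k + q - q') \<in> {z \<in> ball p r. f \<alpha> z = 0}" using zB[OF \<alpha>(1)] sub by blast
        then have "k = q' - q" unfolding Z(1) by (simp add: algebra_simps)
        then show ?thesis using Lambda_dual_diff[OF q'(1) q(1)] by simp
      qed
      moreover have "Ker \<alpha> p" using Z(1) zB[OF \<alpha>(1) pR] by blast
      ultimately show ?thesis using Z(2) \<alpha>(1) by (simp add: A_def)
    qed
    then show ?thesis using r(4) \<delta>2(1) by (intro exI[of _ "min \<delta>1 \<delta>2"]) auto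
  qed
  have closed_A: "\<alpha>0 \<in> A" if \<alpha>0: "\<alpha>0 \<in> B" and lim: "\<And>\<delta>. \<delta> > 0 \<Longrightarrow> \<exists>\<alpha>\<in>A. dist \<alpha> \<alpha>0 < \<delta>" for \<alpha>0
  proof -
    have "k \<in> Lambda_dual" if k: "Ker \<alpha>0 k" for k
    proof (rule ccontr)
      assume nk: "k \<notin> Lambda_dual"
      obtain q where q: "q \<in> Lambda_dual" "cmod (k + q) \<le> 8 * pi / sqrt 3" by (rule Lambda_dual_reduce)
      define c where "c = k + q"
      have cR: "c \<in> ball 0 R" using q(2) R by (simp add: c_def)
      have "Ker \<alpha>0 c" using translate[OF Lambda_dual_minus[OF q(1)] k] by (simp add: c_def)
      then have fc: "f \<alpha>0 c = 0" using zB[OF \<alpha>0 cR] by simp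
      have nc: "c \<notin> Lambda_dual" using Lambda_dual_diff[OF _ q(1), of c] nk by (auto simp: c_def)
      obtain d where d: "d > 0" "\<And>x. x \<in> {x \<in> Lambda_dual. cmod x \<le> cmod c + 1} \<Longrightarrow> x \<noteq> c \<Longrightarrow> d \<le> dist c x"
        using finite_set_avoid[OF finite_Lambda_dual_bounded[of "cmod c + 1"], of c] by blast
      \<comment> \<open>The disc avoids the dual lattice, which carries all zeros for parameters in
        \<open>A\<close>. The count near \<open>c\<close> is then 0, against the positive order of
        the limiting zero \<open>c\<close>.\<close>
      have far: "x \<notin> Lambda_dual" if "x \<in> ball c (min d 1)" for x
      proof
        assume x: "x \<in> Lambda_dual"
        have "cmod x \<le> cmod c + dist c x" using norm_triangle_sub[of x c] by (simp add: dist_norm norm_minus_commute)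
        then have "d \<le> dist c x" using d(2)[of x] x nc that by auto
        then show False using that by simp
      qed
      obtain r \<delta> where r: "0 < r" "r < min d 1" "cball c r \<subseteq> ball 0 R" "\<delta> > 0"
        "\<And>\<alpha>. \<alpha> \<in> B \<Longrightarrow> dist \<alpha> \<alpha>0 < \<delta> \<Longrightarrow> zero_count (f \<alpha>) c r = (if f \<alpha>0 c = 0 then zorder (f \<alpha>0) c else 0)"
        using local_count[OF \<alpha>0 cR, of "min d 1"] d(1) by auto
      obtain \<alpha> where \<alpha>: "\<alpha> \<in> A" "dist \<alpha> \<alpha>0 < \<delta>" using lim[OF r(4)] by blast
      have aB: "\<alpha> \<in> B" using \<alpha>(1) by (simp add: A_def)
      have "{z \<in> ball c r. f \<alpha> z = 0} = {}"
      proof -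
        have "f \<alpha> z \<noteq> 0" if z: "z \<in> ball c r" for z
        proof
          assume "f \<alpha> z = 0"
          moreover have "z \<in> ball 0 R" using z r(3) ball_subset_cball by blast
          ultimately have "Ker \<alpha> z" using zB[OF aB, of z] by blast
          then have "z \<in> Lambda_dual" using \<alpha>(1) by (simp add: A_def)
          moreover have "z \<in> ball c (min d 1)" using z r(2) by auto
          ultimately show False using far by blast
        qed
        then show ?thesis by blast
      qed
      then have "zero_count (f \<alpha>) c r = 0" by (simp only: zero_count_def sum.empty)
      then show False using r(5)[OF aB \<alpha>(2)] fc zorder_pos[OF \<alpha>0 cR fc] by simp
    qed
    moreover have "f \<alpha>0 p = 0 \<and> zorder (f \<alpha>0) p = 2"
    proof -
      obtain r \<delta> where r: "0 < r" "r < 1" "cball p r \<subseteq> ball 0 R" "\<delta> > 0"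
        "\<And>\<alpha>. \<alpha> \<in> B \<Longrightarrow> dist \<alpha> \<alpha>0 < \<delta> \<Longrightarrow> zero_count (f \<alpha>) p r = (if f \<alpha>0 p = 0 then zorder (f \<alpha>0) p else 0)"
        using local_count[OF \<alpha>0 pR, of 1] one by blast
      obtain \<alpha> where \<alpha>: "\<alpha> \<in> A" "dist \<alpha> \<alpha>0 < \<delta>" using lim[OF r(4)] by blast
      then have aA: "\<alpha> \<in> B" "\<And>k. Ker \<alpha> k \<Longrightarrow> k \<in> Lambda_dual" "Ker \<alpha> p" "zorder (f \<alpha>) p = 2" by (auto simp: A_def)
      \<comment> \<open>Distinct dual lattice points are at distance at least 1, and
        \<open>r < 1\<close>.\<close>
      have "z = p" if z: "z \<in> ball p r" "f \<alpha> z = 0" for z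
      proof -
        have "z \<in> ball 0 R" using z(1) r(3) ball_subset_cball by blast
        then have "Ker \<alpha> z" using zB[OF aA(1), of z] z(2) by blast
        then have "z \<in> Lambda_dual" by (rule aA(2))
        moreover have "dist z p < 1" using z(1) r(2) by (simp add: dist_commute)
        ultimately show ?thesis using Lambda_dual_separated p(1) by blast
      qed
      then have "{z \<in> ball p r. f \<alpha> z = 0} = {p}" using zB[OF aA(1) pR] aA(3) r(1) by auto
      then have "zero_count (f \<alpha>) p r = 2" using aA(4) by (simp add: zero_count_def)
      then show ?thesis using r(5)[OF aA(1) \<alpha>(2)] by (auto split: if_splits)
    qed
    ultimately show ?thesis using \<alpha>0 zB[OF \<alpha>0 pR] by (simp add: A_def)
  qed
  have "openin (top_of_set B) A"
    unfolding openin_euclidean_subtopology_iff using open_A by (auto simp: A_def)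
  moreover have "closedin (top_of_set B) A"
  proof -
    have "openin (top_of_set B) (B - A)"
      unfolding openin_euclidean_subtopology_iff
    proof (intro conjI ballI)
      fix \<alpha>0 assume "\<alpha>0 \<in> B - A"
      then obtain \<delta> where "\<delta> > 0" "\<forall>\<alpha>\<in>A. \<not> dist \<alpha> \<alpha>0 < \<delta>" using closed_A by blast
      then show "\<exists>\<delta>>0. \<forall>\<alpha>\<in>B. dist \<alpha> \<alpha>0 < \<delta> \<longrightarrow> \<alpha> \<in> B - A" by blast
    qed blast
    then show ?thesis by (simp add: closedin_def A_def)
  qed
  moreover have "0 \<in> A" using B(3) zero0 order0 p(1) by (simp add: A_def)
  ultimately have "A = B" using B(1) unfolding connected_clopen by blast
  then have A: "\<And>k. Ker \<alpha> k \<Longrightarrow> k \<in> Lambda_dual" "Ker \<alpha> p" "zorder (f \<alpha>) p = 2" using \<alpha> by (auto simp: A_def)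
  show "zorder (f \<alpha>) p = 2" by (rule A(3))
  have "Ker \<alpha> k" if k: "k \<in> Lambda_dual" for k
    using translate[OF Lambda_dual_diff[OF p(1) k] A(2)] by simp
  then show "Ker \<alpha> k \<longleftrightarrow> k \<in> Lambda_dual" for k using A(1) by blast
qed

end

section \<open>The multiplicity\<close>

text \<open>Nonzero dual lattice points have modulus at least 1, so 1/2 serves as a point where the
  operator at \<alpha> = 0 is invertible.\<close>

lemma half_not_dual: "1 / 2 \<notin> Lambda_dual"
  using Lambda_dual_norm[of "1 / 2"] by auto

lemma dual_isolated:
  obtains d where "d > 0" "\<And>x. x \<in> Lambda_dual \<Longrightarrow> x \<noteq> k \<Longrightarrow> d \<le> dist k x"
proof -
  obtain d where d: "d > 0" "\<And>x. x \<in> {x \<in> Lambda_dual. cmod x \<le> cmod k + 1} \<Longrightarrow> x \<noteq> k \<Longrightarrow> d \<le> dist k x"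
    using finite_set_avoid[OF finite_Lambda_dual_bounded[of "cmod k + 1"], of k] by blast
  have "min d 1 \<le> dist k x" if x: "x \<in> Lambda_dual" "x \<noteq> k" for x
  proof (rule ccontr)
    assume *: "\<not> min d 1 \<le> dist k x"
    have "cmod x \<le> cmod k + dist k x" using norm_triangle_sub[of x k] by (simp add: dist_norm norm_minus_commute)
    then have "d \<le> dist k x" using * by (intro d(2)) (use x in auto)
    then show False using * by simp
  qed
  then show thesis using that[of "min d 1"] d(1) by simp
qed

section \<open>Exceptional parameters and the value of the multiplicity\<close>

locale rotation_potential = potential +
  assumes rotation: "\<And>z. V (omega * z) = cnj omega * V z"
begin

definition degenerate :: "complex \<Rightarrow> complex \<Rightarrow> bool" where
  "degenerate \<alpha> k \<longleftrightarrow> (\<exists>x. x \<noteq> 0 \<and> T \<alpha> k x = 0)"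

definition magic :: "complex set" where
  "magic = {\<alpha>. \<forall>k. degenerate \<alpha> k}"

lemma T_zero_fourier: "T 0 k (fourier j) = ((dual_enum j + k)\<^sup>2 / lsym j) *\<^sub>C fourier j"
  by (rule fourier.coeff_eqI) (auto simp: coeff_T cip_scaleC_left fourier.orth)

context
  fixes R :: real and n :: nat
  assumes rank: "schur_bound n R"
begin

lemma char_det_zero_iff:
  assumes "\<alpha> \<in> ball 0 R" "k \<in> ball 0 R"
  shows "char_det n \<alpha> k = 0 \<longleftrightarrow> degenerate \<alpha> k"
proof
  assume "char_det n \<alpha> k = 0"
  then obtain x where "x \<noteq> 0" "T \<alpha> k x = 0" by (rule char_det_zero[OF rank assms])
  then show "degenerate \<alpha> k" unfolding degenerate_def by blast
next
  assume "degenerate \<alpha> k"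
  then obtain x where x: "x \<noteq> 0" "T \<alpha> k x = 0" by (auto simp: degenerate_def)
  show "char_det n \<alpha> k = 0"
  proof (rule ccontr)
    assume "char_det n \<alpha> k \<noteq> 0"
    then have "op_inverse (T \<alpha> k) o\<^sub>L T \<alpha> k = id_blinfun" by (rule char_det_nonzero(1)[OF rank assms])
    then have "(op_inverse (T \<alpha> k) o\<^sub>L T \<alpha> k) x = x" by (simp only: blinfun_apply_id_blinfun)
    then show False using x by simp
  qed
qed

lemma char_det_at_zero:
  assumes "0 < R" "k \<in> ball 0 R"
  shows "char_det n 0 k = (\<Prod>j<n. (dual_enum j + k)\<^sup>2 / lsym j)"
proof (rule char_det_diagonal[OF rank])
  show "0 \<in> ball 0 R" using assms(1) by simp
  show "k \<in> ball 0 R" by (rule assms(2))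
qed (rule T_zero_fourier)

end

lemma degenerate_zero: "degenerate 0 k \<longleftrightarrow> k \<in> Lambda_dual"
proof
  define R where "R = cmod k + 1"
  have R: "0 < R" "(0 :: complex) \<in> ball 0 R" "k \<in> ball 0 R" by (auto simp: R_def add_nonneg_pos)
  obtain n where rank: "schur_bound n R"
    by (rule schur_bound_exists)
  assume "degenerate 0 k"
  then have "char_det n 0 k = 0" using char_det_zero_iff[OF rank R(2,3)] by blast
  then have "(\<Prod>j<n. (dual_enum j + k)\<^sup>2 / lsym j) = 0" unfolding char_det_at_zero[OF rank R(1,3)] .
  then obtain j where "dual_enum j + k = 0" by (auto simp: lsym_nonzero)
  then have "k = - dual_enum j" by (simp add: add_eq_0_iff2)
  then show "k \<in> Lambda_dual" using Lambda_dual_minus[OF dual_enum_in] by simp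
next
  assume "k \<in> Lambda_dual"
  then obtain j where j: "- k = dual_enum j" using dual_enum_surj[OF Lambda_dual_minus] by blast
  have "dual_enum j + k = 0" unfolding j[symmetric] by simp
  then have "T 0 k (fourier j) = 0" by (simp add: T_zero_fourier)
  moreover have "fourier j \<noteq> 0" using fourier.orth[of j j] by auto
  ultimately show "degenerate 0 k" unfolding degenerate_def by blast
qed

lemma magic_isolated: "\<forall>\<^sub>F \<alpha> in at \<alpha>0. \<alpha> \<notin> magic"
proof -
  \<comment> \<open>A radius that admits \<open>\<alpha>0\<close>, 0 and 1/2 at once, so that the
    nonzero value at \<alpha> = 0 makes the zeros of \<alpha> \<mapsto>
    \<open>char_det n \<alpha> (1 / 2)\<close> isolated up to \<open>\<alpha>0\<close>.\<close>
  define R where "R = cmod \<alpha>0 + 1"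
  have "1 / 2 < cmod \<alpha>0 + 1" using norm_ge_zero[of \<alpha>0] by linarith
  then have R: "\<alpha>0 \<in> ball 0 R" "(0 :: complex) \<in> ball 0 R" "(1 / 2 :: complex) \<in> ball 0 R"
    by (auto simp: R_def add_nonneg_pos dist_norm norm_divide)
  obtain n where rank: "schur_bound n R"
    by (rule schur_bound_exists)
  have nz: "char_det n 0 (1 / 2) \<noteq> 0"
    using char_det_zero_iff[OF rank R(2,3)] degenerate_zero half_not_dual by blast
  have "\<forall>\<^sub>F \<alpha> in at \<alpha>0. char_det n \<alpha> (1 / 2) \<noteq> 0 \<and> \<alpha> \<in> ball 0 R"
    by (rule non_zero_neighbour_alt[OF char_det_holomorphic_param[OF rank R(3)] open_ball connected_ball R(1,2) nz])
  then show ?thesis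
  proof (rule eventually_mono)
    fix \<alpha> assume "char_det n \<alpha> (1 / 2) \<noteq> 0 \<and> \<alpha> \<in> ball 0 R"
    then have "\<not> degenerate \<alpha> (1 / 2)" using char_det_zero_iff[OF rank _ R(3)] by blast
    then show "\<alpha> \<notin> magic" by (auto simp: magic_def)
  qed
qed

lemma not_islimpt_magic: "\<not> \<alpha> islimpt magic"
  unfolding islimpt_iff_eventually using magic_isolated by blast

lemma discrete_magic: "discrete magic"
  unfolding discrete_def isolated_in_islimpt_iff using not_islimpt_magic by blast

lemma closed_magic: "closed magic"
  unfolding closed_limpt using not_islimpt_magic by blast

lemma zero_not_magic: "0 \<notin> magic"
  using degenerate_zero half_not_dual by (auto simp: magic_def)

lemma degenerate_translate: "q \<in> Lambda_dual \<Longrightarrow> degenerate \<alpha> k \<Longrightarrow> degenerate \<alpha> (k - q)"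
  unfolding degenerate_def using kernel_translate by blast

lemma degenerate_rotate: "degenerate \<alpha> k \<Longrightarrow> degenerate \<alpha> (cnj omega * k)"
  unfolding degenerate_def using kernel_rotate[OF rotation] by blast

lemma zero_family_char_det:
  assumes rank: "schur_bound n R"
    and R: "8 * pi / sqrt 3 < R"
  shows "zero_family (char_det n) degenerate R (ball 0 R - magic)"
proof
  have "0 < 8 * pi / sqrt 3" by simp
  then have "0 < R" using R by (rule less_trans)
  then show "0 \<in> ball 0 R - magic" using zero_not_magic by simp
  \<comment> \<open>Removing a set without limit points does not disconnect an open connected subset
    of the plane.\<close>
  show "connected (ball 0 R - magic)"
    by (rule sparse_imp_connected) (use not_islimpt_magic in \<open>auto simp: sparse_in_def\<close>)
  show "continuous_on (ball 0 R \<times> ball 0 R) (\<lambda>x. char_det n (fst x) (snd x))"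
    by (rule char_det_continuous[OF rank])
  fix \<alpha>
  show "char_det n \<alpha> holomorphic_on ball 0 R" if "\<alpha> \<in> ball 0 R"
    by (rule char_det_holomorphic[OF rank that])
  show "char_det n \<alpha> k = 0 \<longleftrightarrow> degenerate \<alpha> k" if "\<alpha> \<in> ball 0 R" "k \<in> ball 0 R" for k
    by (rule char_det_zero_iff[OF rank that])
  show "\<exists>k\<in>ball 0 R. char_det n \<alpha> k \<noteq> 0" if \<alpha>: "\<alpha> \<in> ball 0 R - magic"
  proof -
    obtain k where k: "\<not> degenerate \<alpha> k" using \<alpha> by (auto simp: magic_def)
    obtain q where q: "q \<in> Lambda_dual" "cmod (k + q) \<le> 8 * pi / sqrt 3" by (rule Lambda_dual_reduce)
    have "\<not> degenerate \<alpha> (k + q)" using degenerate_translate[OF q(1), of \<alpha> "k + q"] k by auto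
    moreover have kq: "k + q \<in> ball 0 R" using q(2) R by simp
    ultimately have "char_det n \<alpha> (k + q) \<noteq> 0" using char_det_zero_iff[OF rank _ kq] \<alpha> by blast
    then show ?thesis using kq by blast
  qed
qed (use R degenerate_translate degenerate_rotate in auto)

text \<open>Exactly one frequency equals -p, so exactly one factor of the diagonal product vanishes
  at \<open>p\<close>, to second order.\<close>

lemma zorder_char_det_zero:
  assumes rank: "schur_bound n R"
    and p: "p \<in> Lambda_dual" "cmod p < R"
  shows "zorder (char_det n 0) p = 2"
proof -
  have R: "0 < R" "p \<in> ball 0 R" using p(2) norm_ge_zero[of p] by (linarith, simp)
  have "(0 :: complex) \<in> ball 0 R" using R(1) by simp
  then have "char_det n 0 p = 0" using char_det_zero_iff[OF rank _ R(2)] degenerate_zero p(1) by blast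
  then have "(\<Prod>j<n. (dual_enum j + p)\<^sup>2 / lsym j) = 0" unfolding char_det_at_zero[OF rank R] .
  \<comment> \<open>The vanishing of the determinant itself guarantees that the index of -p is below
    \<open>n\<close>.\<close>
  then obtain i where i: "i < n" "dual_enum i + p = 0" by (auto simp: lsym_nonzero)
  then have di: "dual_enum i = - p" by (simp add: add_eq_0_iff2)
  define g where "g = (\<lambda>k. (\<Prod>j\<in>{..<n} - {i}. (dual_enum j + k)\<^sup>2 / lsym j) / lsym i)"
  show ?thesis
  proof (rule zorder_eqI[OF open_ball R(2)])
    show "g holomorphic_on ball 0 R" unfolding g_def by (intro holomorphic_intros) (auto simp: lsym_nonzero)
    have "dual_enum j + p \<noteq> 0" if "j \<noteq> i" for j
      using that di dual_enum_inj[of j i] by (auto simp: add_eq_0_iff2)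
    then show "g p \<noteq> 0" by (auto simp: g_def lsym_nonzero)
    fix w assume "w \<in> ball 0 R" "w \<noteq> p"
    then have "char_det n 0 w = (\<Prod>j<n. (dual_enum j + w)\<^sup>2 / lsym j)" by (intro char_det_at_zero[OF rank R(1)])
    also have "\<dots> = (dual_enum i + w)\<^sup>2 / lsym i * (\<Prod>j\<in>{..<n} - {i}. (dual_enum j + w)\<^sup>2 / lsym j)"
      by (rule prod.remove) (use i in auto)
    also have "\<dots> = g w * (w - p) powi 2" by (simp add: g_def di power_int_numeral)
    finally show "char_det n 0 w = g w * (w - p) powi 2" .
  qed
qed

lemma
  assumes rank: "schur_bound n R"
    and R: "8 * pi / sqrt 3 < R" and \<alpha>: "\<alpha> \<in> ball 0 R" "\<alpha> \<notin> magic"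
  shows degenerate_iff_aux: "degenerate \<alpha> k \<longleftrightarrow> k \<in> Lambda_dual"
    and zorder_char_det: "p \<in> Lambda_dual \<Longrightarrow> cmod p < R \<Longrightarrow> zorder (char_det n \<alpha>) p = 2"
proof -
  interpret zero_family "char_det n" degenerate R "ball 0 R - magic" by (rule zero_family_char_det[OF rank R])
  have aB: "\<alpha> \<in> ball 0 R - magic" using \<alpha> by blast
  note * = double_zero_persists[OF _ _ degenerate_zero zorder_char_det_zero[OF rank] aB]
  show "p \<in> Lambda_dual \<Longrightarrow> cmod p < R \<Longrightarrow> zorder (char_det n \<alpha>) p = 2" using * by blast
  have "0 < 8 * pi / sqrt 3" by simp
  then have "cmod 0 < R" unfolding norm_zero using R by (rule less_trans)
  then show "degenerate \<alpha> k \<longleftrightarrow> k \<in> Lambda_dual" using *(1)[OF Lambda_dual_zero] Lambda_dual_zero by blast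
qed

lemma degenerate_iff:
  assumes "\<alpha> \<notin> magic"
  shows "degenerate \<alpha> k \<longleftrightarrow> k \<in> Lambda_dual"
proof -
  define R where "R = 8 * pi / sqrt 3 + cmod \<alpha> + 1"
  have R: "8 * pi / sqrt 3 < R" "\<alpha> \<in> ball 0 R" by (auto simp: R_def add_nonneg_pos add_pos_pos)
  obtain n where rank: "schur_bound n R"
    by (rule schur_bound_exists)
  show ?thesis by (rule degenerate_iff_aux[OF rank R assms])
qed

lemma op_ker_iff: "op_ker (Q_op V \<alpha> k) = {0} \<longleftrightarrow> \<not> degenerate \<alpha> k"
  unfolding degenerate_def op_ker_Q[symmetric] by (rule not_not[symmetric])

lemma T_inverse:
  assumes "\<not> degenerate \<alpha> k"
  shows "op_inverse (T \<alpha> k) o\<^sub>L T \<alpha> k = id_blinfun" "T \<alpha> k o\<^sub>L op_inverse (T \<alpha> k) = id_blinfun"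
proof -
  define R where "R = cmod k + cmod \<alpha> + 1"
  have R: "k \<in> ball 0 R" "\<alpha> \<in> ball 0 R" by (auto simp: R_def add_nonneg_pos)
  obtain n where rank: "schur_bound n R"
    by (rule schur_bound_exists)
  have nz: "char_det n \<alpha> k \<noteq> 0" using char_det_zero_iff[OF rank R(2,1)] assms by blast
  show "op_inverse (T \<alpha> k) o\<^sub>L T \<alpha> k = id_blinfun" "T \<alpha> k o\<^sub>L op_inverse (T \<alpha> k) = id_blinfun"
    by (rule char_det_nonzero[OF rank R(2,1) nz])+
qed

lemma op_invertible_iff: "op_invertible (Q_op V \<alpha> k) \<longleftrightarrow> \<not> degenerate \<alpha> k"
proof
  assume "op_invertible (Q_op V \<alpha> k)"
  then obtain B where B: "B o\<^sub>L Q_op V \<alpha> k = id_blinfun" unfolding op_invertible_def by blast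
  have "u = 0" if "Q_op V \<alpha> k u = 0" for u
  proof -
    have "u = (B o\<^sub>L Q_op V \<alpha> k) u" unfolding B by simp
    then show ?thesis using that by simp
  qed
  then have "op_ker (Q_op V \<alpha> k) = {0}" by (auto simp: op_ker_def)
  then show "\<not> degenerate \<alpha> k" by (rule op_ker_iff[THEN iffD1])
next
  assume "\<not> degenerate \<alpha> k"
  from T_inverse[OF this] show "op_invertible (Q_op V \<alpha> k)" by (rule Q_op_invertible)
qed

text \<open>\<open>op_multiplicity\<close> fixes its disc by choice, so the computation runs for an
  unknown admissible disc and \<open>R\<close> is adapted to it afterwards. The isomorphism
  \<open>LO\<close> reduces the trace to \<open>T\<close>, and the argument principle turns it into
  the order of the determinant at \<open>k\<close>.\<close>

theorem multiplicity:
  assumes \<alpha>: "\<alpha> \<notin> magic"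
  shows "op_multiplicity (Q_op V \<alpha>) k = Fin (2 * indicator Lambda_dual k)"
proof -
  note deg = degenerate_iff[OF \<alpha>]
  have regular: "\<exists>k0. op_ker (Q_op V \<alpha> k0) = {0}"
    unfolding op_ker_iff deg using half_not_dual by blast
  obtain d where d: "d > 0" "\<And>x. x \<in> Lambda_dual \<Longrightarrow> x \<noteq> k \<Longrightarrow> d \<le> dist k x" by (rule dual_isolated[of k]) blast
  have "admissible_disc (Q_op V \<alpha>) k k (d / 2)"
    unfolding admissible_disc_def op_invertible_iff deg
  proof (intro conjI ballI notI)
    fix \<zeta> assume "\<zeta> \<in> cball k (d / 2) - {k}" "\<zeta> \<in> Lambda_dual"
    then show False using d(2)[of \<zeta>] d(1) by auto
  qed (use d(1) in simp)
  then have ex: "case (k, d / 2) of (c, r) \<Rightarrow> admissible_disc (Q_op V \<alpha>) k c r" by simp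
  obtain c r where some: "(SOME (c, r). admissible_disc (Q_op V \<alpha>) k c r) = (c, r)" by fastforce
  have adm: "admissible_disc (Q_op V \<alpha>) k c r" using someI[of "\<lambda>(c, r). admissible_disc (Q_op V \<alpha>) k c r", OF ex] by (simp add: some)
  then have kc: "k \<in> ball c r" and nd: "\<And>\<zeta>. \<zeta> \<in> cball c r - {k} \<Longrightarrow> \<not> degenerate \<alpha> \<zeta>"
    by (auto simp: admissible_disc_def op_invertible_iff)
  have r: "0 < r" using kc by (metis ball_eq_empty empty_iff not_less)
  \<comment> \<open>Large enough for the chosen disc, for \<alpha>, and for the bound under which
    the double zeros are known to persist.\<close>
  define R where "R = 8 * pi / sqrt 3 + cmod \<alpha> + cmod c + r + 1"
  have R: "8 * pi / sqrt 3 < R" "\<alpha> \<in> ball 0 R" and cR: "cmod c + r < R"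
    using r by (auto simp: R_def add_nonneg_pos add_pos_pos)
  have sub: "cball c r \<subseteq> ball 0 R"
  proof
    fix z assume "z \<in> cball c r"
    then show "z \<in> ball 0 R" using cR norm_triangle_sub[of z c] by (simp add: dist_norm norm_minus_commute)
  qed
  have kR: "k \<in> ball 0 R" using kc sub ball_subset_cball by blast
  obtain n where rank: "schur_bound n R"
    by (rule schur_bound_exists)
  have nz: "char_det n \<alpha> \<zeta> \<noteq> 0" if "\<zeta> \<in> cball c r - {k}" for \<zeta>
    using char_det_zero_iff[OF rank R(2), of \<zeta>] nd[OF that] that sub by blast
  have tr: "continuous_on (sphere c r) (\<lambda>\<zeta>. op_inverse (T \<alpha> \<zeta>) o\<^sub>L T' \<zeta>)"
    "op_trace (LI o\<^sub>L circle_integral (\<lambda>\<zeta>. op_inverse (T \<alpha> \<zeta>) o\<^sub>L T' \<zeta>) c r o\<^sub>L LO) =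
      contour_integral (circlepath c r) (\<lambda>\<zeta>. deriv (char_det n \<alpha>) \<zeta> / char_det n \<alpha> \<zeta>)"
    by (rule char_det_trace[OF rank R(2) sub kc _ clin_LI clin_LO LO_LI], erule nz)+
  have count: "contour_integral (circlepath c r) (\<lambda>\<zeta>. deriv (char_det n \<alpha>) \<zeta> / char_det n \<alpha> \<zeta>) =
      2 * pi * \<i> * of_int (if char_det n \<alpha> k = 0 then zorder (char_det n \<alpha>) k else 0)"
    by (rule argument_principle_disc[OF char_det_holomorphic[OF rank R(2)] sub kc], erule nz)
  have "circle_integral (\<lambda>\<zeta>. op_inverse (Q_op V \<alpha> \<zeta>) o\<^sub>L complex_deriv (Q_op V \<alpha>) \<zeta>) c r =
      LI o\<^sub>L circle_integral (\<lambda>\<zeta>. op_inverse (T \<alpha> \<zeta>) o\<^sub>L T' \<zeta>) c r o\<^sub>L LO"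
  proof (rule circle_integral_compose[OF tr(1) _ clin_LI])
    fix \<zeta> assume "\<zeta> \<in> sphere c r"
    then have "\<zeta> \<in> cball c r - {k}" using kc by auto
    from Q_op_inverse[OF T_inverse[OF nd[OF this]]]
    show "op_inverse (Q_op V \<alpha> \<zeta>) o\<^sub>L complex_deriv (Q_op V \<alpha>) \<zeta> = LI o\<^sub>L (op_inverse (T \<alpha> \<zeta>) o\<^sub>L T' \<zeta>) o\<^sub>L LO"
      by (simp only: Q_op_deriv blinfun_compose_assoc)
  qed (use r in simp)
  then have "op_multiplicity (Q_op V \<alpha>) k = Fin (1 / (2 * pi * \<i>) *
      contour_integral (circlepath c r) (\<lambda>\<zeta>. deriv (char_det n \<alpha>) \<zeta> / char_det n \<alpha> \<zeta>))"
    unfolding op_multiplicity_def some using regular tr(2) by simp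
  also have "\<dots> = Fin (of_int (if char_det n \<alpha> k = 0 then zorder (char_det n \<alpha>) k else 0))"
    unfolding count by simp
  also have "\<dots> = Fin (2 * indicator Lambda_dual k)"
    using char_det_zero_iff[OF rank R(2) kR] deg[of k] zorder_char_det[OF rank R \<alpha>, of k] kR
    by (auto simp: indicator_def)
  finally show ?thesis .
qed

end

theorem theorem2:
  fixes V :: "complex \<Rightarrow> complex"
  assumes "smooth V"
    and "\<forall>z. \<forall>\<gamma>\<in>Lambda. V (z + \<gamma>) = V z"
    and "\<forall>z. V (omega * z) = cnj omega * V z"
  shows "\<exists>A :: complex set. discrete A \<and> closed A \<and>
    (\<forall>\<alpha>\<in>A. \<forall>k. op_ker (Q_op V \<alpha> k) \<noteq> {0}) \<and>
    (\<forall>\<alpha>\<in>- A. \<forall>k. op_multiplicity (Q_op V \<alpha>) k = Fin (2 * indicator Lambda_dual k))"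
proof -
  interpret rotation_potential V
    by standard (use assms in \<open>auto simp: periodic_def\<close>)
  show ?thesis
  proof (intro exI[of _ magic] conjI ballI allI)
    fix \<alpha> k
    show "op_ker (Q_op V \<alpha> k) \<noteq> {0}" if "\<alpha> \<in> magic"
      using that unfolding op_ker_iff magic_def by simp
    show "op_multiplicity (Q_op V \<alpha>) k = Fin (2 * indicator Lambda_dual k)" if "\<alpha> \<in> - magic"
      by (rule multiplicity) (use that in simp)
  qed (rule discrete_magic closed_magic)+
qed

end
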